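(* Let $(k,n)=(3,9)$ or $(k,n)=(4,8)$. For every real root $\alpha$ of degree $2$ for $J_{k,n}$ there are two non-isomorphic rigid indecomposable rank $2$ modules $M$ in $\mathrm{CM}(B_{k,n})$ with $\varphi(M)=\alpha$. Moreover, if $M$ is such a rigid indecomposable rank $2$ module (i.e. $\varphi(M)$ is a real root of degree $2$) and its filtration by rank $1$ modules (its profile) is $L_I\mid L_J$, then the rank $2$ module with filtration $L_J\mid L_I$ is also rigid indecomposable; that is, there exists a rigid indecomposable rank $2$ module with profile $J\mid I$.
   Context: The algebra $B=B_{k,n}$: take the quiver with vertex set $\mathbb{Z}_n$ and, for each $i\in\mathbb{Z}_n$, arrows $x_i\colon i-1\to i$ and $y_i\colon i\to i-1$. $B$ is the completed path algebra over $\mathbb{C}$ (completion with respect to the ideal generated by arrows) modulo the closure of the ideal generated by the relations $xy=yx$ and $x^k=y^{n-k}$ at every vertex (subscripts determined by the starting vertex). Its center is $Z=\mathbb{C}[[t]]$, $t=\sum_i x_iy_i$. Modules are left modules, i.e. representations of the quiver with relations. $\mathrm{CM}(B)$ is the category of $B$-modules that are finitely generated free over $Z$; the rank of $M$ is the $Z$-rank of $e_iM$ (the same for all $i$). A module $M$ is rigid if $\mathrm{Ext}^1_B(M,M)=0$. For a $k$-subset $I$ of $\mathbb{Z}_n$, $L_I$ is the rank 1 module with $\mathbb{C}[[t]]$ at each vertex, $x_i$ acting by $1$ if $i\in I$ and by $t$ if $i\notin I$, and $y_i$ acting by $t$ if $i\in I$ and by $1$ if $i\notin I$. Profile: let $K=\mathbb{C}((t))$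 and $\varepsilon_i=0$ if $i\in\{1,\dots,k\}$, $\varepsilon_i=1$ if $i\in\{k+1,\dots,n\}$. Every $M\in\mathrm{CM}(B)$ of rank $d$ is isomorphic to a collection of $\mathbb{C}[[t]]$-lattices $M_i\subset K^d$ ($i\in\mathbb{Z}_n$) with $x_i$, $y_i$ acting as multiplication by $t^{\varepsilon_i}$, $t^{1-\varepsilon_i}$. If this can be done with $M_i=\prod_m t^mW_{i,m}$ for subspaces $W_{i,m}\subset W_{i,m+1}\subset\mathbb{C}^d$ (equal to $0$ for $m\ll0$ and $\mathbb{C}^d$ for $m\gg0$), which is always possible, uniquely up to shift, for rigid indecomposable $M$, put $p_c(i)=\min\{m:\dim W_{i,m}\ge c\}$ for $c=1,\dots,d$; the lattices $t^{p_c(i)}\mathbb{C}[[t]]\subset K$ form a rank 1 module isomorphic to $L_{I_c}$ for a unique $k$-subset $I_c$. The profile of $M$ is $I_1\mid I_2\mid\dots\mid I_d$ (also written $L_{I_1}\mid\dots\mid L_{I_d}$), and $M$ has a filtration with factors $L_{I_1},\dots,L_{I_d}$ from top to bottom. A rigid indecomposable module is determined up to isomorphism by its profile. Roots: $J_{k,n}$ is the tree obtained from the Dynkin diagram of type $A_{n-1}$ with nodes $1,\dots,n-1$ by adding a node $n$ joined by an edge to node $k$; simple roots of the associated Kac--Moody algebra are $\alpha_1,\dots,\alpha_{n-1}$ (nodes $1,\dots,n-1$) and $\beta$ (node $n$). The degree of a root is its coefficient at $\beta$. For $M\in\mathrm{CM}(B)$ with a filtration by $L_{I_1},\dots,L_{I_d}$,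 $\underline a(M)=(a_1,\dots,a_n)$ where $a_i$ is the number of $c$ with $i\in I_c$. The root lattice is identified with $\mathbb{Z}^n(k)=\{a\in\mathbb{Z}^n: k\mid\sum a_i\}$ via $\alpha_i\leftrightarrow -e_i+e_{i+1}$, $\beta\leftrightarrow e_1+\dots+e_k$, and $\varphi(M)$ is the element of the root lattice corresponding to $\underline a(M)$; its degree is the rank of $M$. With $q(a)=\sum_i a_i^2+\frac{2-k}{k^2}\left(\sum_i a_i\right)^2$, real roots correspond to vectors with $q(a)=2$. *)

theory Defs
  imports
    Complex_Main
    "HOL-Library.Function_Algebras"
    "HOL-Library.Product_Plus"
    "HOL-Computational_Algebra.Formal_Laurent_Series"
begin

section \<open>Representations of the circular quiver\<close>

text \<open>
  The vertex set \<open>\<int>\<^sub>n\<close> is represented by \<open>{1..n}\<close>; the arrows are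
  \<open>x\<^sub>i: i - 1 \<rightarrow> i\<close> and \<open>y\<^sub>i: i \<rightarrow> i - 1\<close>, with indices read modulo \<open>n\<close>.
\<close>

definition nxt :: "nat \<Rightarrow> nat \<Rightarrow> nat" where
  "nxt n i = (if i = n then 1 else i + 1)"

definition prv :: "nat \<Rightarrow> nat \<Rightarrow> nat" where
  "prv n i = (if i = 1 then n else i - 1)"

text \<open>
  The algebra \<open>B\<close> is generated over its center \<open>\<complex>[[t]]\<close> by the idempotents \<open>e\<^sub>i\<close> and the
  arrows, with relations \<open>xy = yx = t\<close> and \<open>x^k = y^(n-k)\<close>.  A \<open>B\<close>-module \<open>M\<close> is therefore a
  family of \<open>\<complex>[[t]]\<close>-modules \<open>e\<^sub>i M\<close> (\<open>vsp M i\<close>, given as submodules of an ambient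
  \<open>\<complex>[[t]]\<close>-module with scalar multiplication \<open>zscale M\<close>) together with
  \<open>\<complex>[[t]]\<close>-linear maps for the arrows satisfying these relations.  Only values of
  \<open>xmap\<close> and \<open>ymap\<close> at indices in \<open>{1..n}\<close> and on the carriers matter.
\<close>

record 'v brep =
  zscale :: "complex fps \<Rightarrow> 'v \<Rightarrow> 'v"
  vsp :: "nat \<Rightarrow> 'v set"
  xmap :: "nat \<Rightarrow> 'v \<Rightarrow> 'v"
  ymap :: "nat \<Rightarrow> 'v \<Rightarrow> 'v"

definition zlinear_on ::
  "(complex fps \<Rightarrow> 'v \<Rightarrow> 'v) \<Rightarrow> 'v::ab_group_add set \<Rightarrow>
   (complex fps \<Rightarrow> 'w \<Rightarrow> 'w) \<Rightarrow> 'w::ab_group_add set \<Rightarrow> ('v \<Rightarrow> 'w) \<Rightarrow> bool" where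
  "zlinear_on s A s' A' f \<longleftrightarrow>
     (\<forall>u\<in>A. f u \<in> A') \<and>
     (\<forall>u\<in>A. \<forall>v\<in>A. f (u + v) = f u + f v) \<and>
     (\<forall>c. \<forall>u\<in>A. f (s c u) = s' c (f u))"

text \<open>The action of the paths \<open>x^m\<close> and \<open>y^m\<close> starting at the vertex \<open>i\<close>.\<close>

primrec xpow :: "nat \<Rightarrow> 'v brep \<Rightarrow> nat \<Rightarrow> nat \<Rightarrow> 'v \<Rightarrow> 'v" where
  "xpow n M 0 i v = v"
| "xpow n M (Suc m) i v = xpow n M m (nxt n i) (xmap M (nxt n i) v)"

primrec ypow :: "nat \<Rightarrow> 'v brep \<Rightarrow> nat \<Rightarrow> nat \<Rightarrow> 'v \<Rightarrow> 'v" where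
  "ypow n M 0 i v = v"
| "ypow n M (Suc m) i v = ypow n M m (prv n i) (ymap M i v)"

definition B_module :: "nat \<Rightarrow> nat \<Rightarrow> 'v::ab_group_add brep \<Rightarrow> bool" where
  "B_module k n M \<longleftrightarrow>
     module (zscale M) \<and>
     (\<forall>i\<in>{1..n}.
        module.subspace (zscale M) (vsp M i) \<and>
        zlinear_on (zscale M) (vsp M (prv n i)) (zscale M) (vsp M i) (xmap M i) \<and>
        zlinear_on (zscale M) (vsp M i) (zscale M) (vsp M (prv n i)) (ymap M i) \<and>
        (\<forall>v\<in>vsp M i.
           xmap M i (ymap M i v) = zscale M fps_X v \<and>
           ymap M (nxt n i) (xmap M (nxt n i) v) = zscale M fps_X v \<and>
           xpow n M k i v = ypow n M (n - k) i v))"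

definition free_of_rank ::
  "(complex fps \<Rightarrow> 'v \<Rightarrow> 'v) \<Rightarrow> 'v::ab_group_add set \<Rightarrow> nat \<Rightarrow> bool" where
  "free_of_rank s V d \<longleftrightarrow>
     (\<exists>X. finite X \<and> card X = d \<and> \<not> module.dependent s X \<and> module.span s X = V)"

definition CM :: "nat \<Rightarrow> nat \<Rightarrow> 'v::ab_group_add brep \<Rightarrow> bool" where
  "CM k n M \<longleftrightarrow> B_module k n M \<and> (\<forall>i\<in>{1..n}. \<exists>d. free_of_rank (zscale M) (vsp M i) d)"

definition has_rank :: "nat \<Rightarrow> 'v::ab_group_add brep \<Rightarrow> nat \<Rightarrow> bool" where
  "has_rank n M d \<longleftrightarrow> (\<forall>i\<in>{1..n}. free_of_rank (zscale M) (vsp M i) d)"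

section \<open>Homomorphisms, indecomposability, extensions\<close>

definition brep_hom ::
  "nat \<Rightarrow> 'v::ab_group_add brep \<Rightarrow> 'w::ab_group_add brep \<Rightarrow> (nat \<Rightarrow> 'v \<Rightarrow> 'w) \<Rightarrow> bool" where
  "brep_hom n M N f \<longleftrightarrow>
     (\<forall>i\<in>{1..n}.
        zlinear_on (zscale M) (vsp M i) (zscale N) (vsp N i) (f i) \<and>
        (\<forall>v\<in>vsp M (prv n i). f i (xmap M i v) = xmap N i (f (prv n i) v)) \<and>
        (\<forall>v\<in>vsp M i. f (prv n i) (ymap M i v) = ymap N i (f i v)))"

definition brep_iso ::
  "nat \<Rightarrow> 'v::ab_group_add brep \<Rightarrow> 'w::ab_group_add brep \<Rightarrow> (nat \<Rightarrow> 'v \<Rightarrow> 'w) \<Rightarrow> bool" where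
  "brep_iso n M N f \<longleftrightarrow>
     brep_hom n M N f \<and> (\<forall>i\<in>{1..n}. bij_betw (f i) (vsp M i) (vsp N i))"

definition brep_isomorphic ::
  "nat \<Rightarrow> 'v::ab_group_add brep \<Rightarrow> 'w::ab_group_add brep \<Rightarrow> bool" where
  "brep_isomorphic n M N \<longleftrightarrow> (\<exists>f. brep_iso n M N f)"

definition B_submodule :: "nat \<Rightarrow> 'v::ab_group_add brep \<Rightarrow> (nat \<Rightarrow> 'v set) \<Rightarrow> bool" where
  "B_submodule n M S \<longleftrightarrow>
     (\<forall>i\<in>{1..n}.
        S i \<subseteq> vsp M i \<and> module.subspace (zscale M) (S i) \<and>
        xmap M i ` S (prv n i) \<subseteq> S i \<and> ymap M i ` S i \<subseteq> S (prv n i))"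

definition indecomposable_brep :: "nat \<Rightarrow> 'v::ab_group_add brep \<Rightarrow> bool" where
  "indecomposable_brep n M \<longleftrightarrow>
     (\<exists>i\<in>{1..n}. vsp M i \<noteq> {0}) \<and>
     (\<forall>S T. B_submodule n M S \<and> B_submodule n M T \<and>
        (\<forall>i\<in>{1..n}. vsp M i = {a + b |a b. a \<in> S i \<and> b \<in> T i} \<and> S i \<inter> T i = {0}) \<longrightarrow>
        (\<forall>i\<in>{1..n}. S i = {0}) \<or> (\<forall>i\<in>{1..n}. T i = {0}))"

text \<open>
  \<open>Ext\<^sup>1\<close> in Yoneda's description: equivalence classes of short exact sequences
  \<open>0 \<rightarrow> M \<rightarrow> E \<rightarrow> N \<rightarrow> 0\<close> of \<open>B\<close>-modules, the zero element being the class of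
  \<open>M \<oplus> N\<close>.  If \<open>M\<close> and \<open>N\<close> are free over \<open>\<complex>[[t]]\<close>, then \<open>e\<^sub>i E \<cong> e\<^sub>i M \<oplus> e\<^sub>i N\<close>
  over \<open>\<complex>[[t]]\<close>, so that up to equivalence the carriers of \<open>E\<close> can be taken in the
  product type.
\<close>

definition extensions ::
  "nat \<Rightarrow> nat \<Rightarrow> 'w::ab_group_add brep \<Rightarrow> 'v::ab_group_add brep \<Rightarrow>
   (('v \<times> 'w) brep \<times> (nat \<Rightarrow> 'v \<Rightarrow> 'v \<times> 'w) \<times> (nat \<Rightarrow> 'v \<times> 'w \<Rightarrow> 'w)) set" where
  "extensions k n N M = {(E, f, g).
     B_module k n E \<and> brep_hom n M E f \<and> brep_hom n E N g \<and>
     (\<forall>i\<in>{1..n}. inj_on (f i) (vsp M i) \<and> g i ` vsp E i = vsp N i \<and>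
        f i ` vsp M i = {e \<in> vsp E i. g i e = 0})}"

definition ext_rel ::
  "nat \<Rightarrow> nat \<Rightarrow> 'w::ab_group_add brep \<Rightarrow> 'v::ab_group_add brep \<Rightarrow>
   (('v \<times> 'w) brep \<times> (nat \<Rightarrow> 'v \<Rightarrow> 'v \<times> 'w) \<times> (nat \<Rightarrow> 'v \<times> 'w \<Rightarrow> 'w)) rel" where
  "ext_rel k n N M = {((E, f, g), (E', f', g')).
     (E, f, g) \<in> extensions k n N M \<and> (E', f', g') \<in> extensions k n N M \<and>
     (\<exists>h. brep_iso n E E' h \<and>
        (\<forall>i\<in>{1..n}. (\<forall>v\<in>vsp M i. h i (f i v) = f' i v) \<and>
                     (\<forall>e\<in>vsp E i. g' i (h i e) = g i e)))}"

definition Ext1 where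
  "Ext1 k n N M = extensions k n N M // ext_rel k n N M"

definition direct_sum ::
  "'v::ab_group_add brep \<Rightarrow> 'w::ab_group_add brep \<Rightarrow> ('v \<times> 'w) brep" where
  "direct_sum M N =
     \<lparr> zscale = (\<lambda>c. map_prod (zscale M c) (zscale N c)),
       vsp = (\<lambda>i. vsp M i \<times> vsp N i),
       xmap = (\<lambda>i. map_prod (xmap M i) (xmap N i)),
       ymap = (\<lambda>i. map_prod (ymap M i) (ymap N i)) \<rparr>"

definition Ext1_zero where
  "Ext1_zero k n N M = ext_rel k n N M `` {(direct_sum M N, \<lambda>i v. (v, 0), \<lambda>i. snd)}"

definition rigid :: "nat \<Rightarrow> nat \<Rightarrow> 'v::ab_group_add brep \<Rightarrow> bool" where
  "rigid k n M \<longleftrightarrow> Ext1 k n M M = {Ext1_zero k n M M}"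

section \<open>Rank 1 modules, filtrations, profiles\<close>

definition k_subset :: "nat \<Rightarrow> nat \<Rightarrow> nat set \<Rightarrow> bool" where
  "k_subset k n I \<longleftrightarrow> I \<subseteq> {1..n} \<and> card I = k"

definition L_module :: "nat set \<Rightarrow> complex fps brep" where
  "L_module I =
     \<lparr> zscale = (*), vsp = (\<lambda>i. UNIV),
       xmap = (\<lambda>i v. if i \<in> I then v else fps_X * v),
       ymap = (\<lambda>i v. if i \<in> I then fps_X * v else v) \<rparr>"

definition kernel_brep ::
  "'v brep \<Rightarrow> (nat \<Rightarrow> 'v \<Rightarrow> 'w::zero) \<Rightarrow> 'v brep" where
  "kernel_brep M f = M\<lparr>vsp := \<lambda>i. {v \<in> vsp M i. f i v = 0}\<rparr>"

text \<open>Filtrations with rank 1 factors, listed from top to bottom.\<close>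

fun has_filtration :: "nat \<Rightarrow> nat \<Rightarrow> 'v::ab_group_add brep \<Rightarrow> nat set list \<Rightarrow> bool" where
  "has_filtration k n M [] \<longleftrightarrow> (\<forall>i\<in>{1..n}. vsp M i = {0})"
| "has_filtration k n M (I # Is) \<longleftrightarrow>
     k_subset k n I \<and>
     (\<exists>f. brep_hom n M (L_module I) f \<and>
        (\<forall>i\<in>{1..n}. f i ` vsp M i = vsp (L_module I) i) \<and>
        has_filtration k n (kernel_brep M f) Is)"

text \<open>
  \<open>K^d\<close> and \<open>\<complex>^d\<close>, for \<open>K = \<complex>((t))\<close>, are the functions on \<open>nat\<close> vanishing at all
  \<open>c \<ge> d\<close>.  The collection of lattices \<open>Ms i\<close> in \<open>K^d\<close> carries the action of
  \<open>x\<^sub>i\<close>, \<open>y\<^sub>i\<close> by \<open>t^\<epsilon>\<^sub>i\<close>, \<open>t^(1-\<epsilon>\<^sub>i)\<close> with \<open>\<epsilon>\<^sub>i = 0\<close> iff \<open>i \<le> k\<close>.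
\<close>

definition lattice_brep :: "nat \<Rightarrow> (nat \<Rightarrow> (nat \<Rightarrow> complex fls) set) \<Rightarrow> (nat \<Rightarrow> complex fls) brep"
  where
  "lattice_brep k Ms =
     \<lparr> zscale = (\<lambda>a v c. fps_to_fls a * v c), vsp = Ms,
       xmap = (\<lambda>i v c. if i \<le> k then v c else fls_X * v c),
       ymap = (\<lambda>i v c. if i \<le> k then fls_X * v c else v c) \<rparr>"

definition coord_space :: "nat \<Rightarrow> (nat \<Rightarrow> complex) set" where
  "coord_space d = {w. \<forall>c\<ge>d. w c = 0}"

definition cscale :: "complex \<Rightarrow> (nat \<Rightarrow> complex) \<Rightarrow> nat \<Rightarrow> complex" where
  "cscale a w = (\<lambda>c. a * w c)"

text \<open>The lattice \<open>\<Prod>\<^sub>m t^m W\<^sub>m\<close> in \<open>K^d\<close>.\<close>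

definition graded_lattice ::
  "nat \<Rightarrow> (int \<Rightarrow> (nat \<Rightarrow> complex) set) \<Rightarrow> (nat \<Rightarrow> complex fls) set" where
  "graded_lattice d W =
     {v. (\<forall>c\<ge>d. v c = 0) \<and> (\<forall>m. (\<lambda>c. fls_nth (v c) m) \<in> W m)}"

definition graded_data :: "nat \<Rightarrow> (int \<Rightarrow> (nat \<Rightarrow> complex) set) \<Rightarrow> bool" where
  "graded_data d W \<longleftrightarrow>
     (\<forall>m. module.subspace cscale (W m) \<and> W m \<subseteq> W (m + 1) \<and> W m \<subseteq> coord_space d) \<and>
     (\<exists>m0. \<forall>m\<le>m0. W m = {0}) \<and> (\<exists>m1. \<forall>m\<ge>m1. W m = coord_space d)"

definition profile_exponent :: "(int \<Rightarrow> (nat \<Rightarrow> complex) set) \<Rightarrow> nat \<Rightarrow> int" where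
  "profile_exponent W c = (LEAST m. vector_space.dim cscale (W m) \<ge> c)"

text \<open>The lattice \<open>t^p \<complex>[[t]]\<close> in \<open>K = K^1\<close>.\<close>

definition line_lattice :: "int \<Rightarrow> (nat \<Rightarrow> complex fls) set" where
  "line_lattice p = {v. (\<forall>c\<ge>1. v c = 0) \<and> (\<forall>m<p. fls_nth (v 0) m = 0)}"

definition has_profile ::
  "nat \<Rightarrow> nat \<Rightarrow> 'v::ab_group_add brep \<Rightarrow> nat set list \<Rightarrow> bool" where
  "has_profile k n M Is \<longleftrightarrow>
     (\<exists>W. (\<forall>i\<in>{1..n}. graded_data (length Is) (W i)) \<and>
        B_module k n (lattice_brep k (\<lambda>i. graded_lattice (length Is) (W i))) \<and>
        brep_isomorphic n M (lattice_brep k (\<lambda>i. graded_lattice (length Is) (W i))) \<and>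
        (\<forall>c\<in>{1..length Is}. k_subset k n (Is ! (c - 1)) \<and>
           brep_isomorphic n
             (lattice_brep k (\<lambda>i. line_lattice (profile_exponent (W i) c)))
             (L_module (Is ! (c - 1)))))"

section \<open>Roots\<close>

text \<open>
  Elements of the root lattice of \<open>J\<^sub>k\<^sub>,\<^sub>n\<close> are given by their coefficients at the simple
  roots; node \<open>n\<close>, with simple root \<open>\<beta>\<close>, is the one attached to node \<open>k\<close> of the
  \<open>A\<^sub>n\<^sub>-\<^sub>1\<close>-diagram.
\<close>

definition J_adjacent :: "nat \<Rightarrow> nat \<Rightarrow> nat \<Rightarrow> nat \<Rightarrow> bool" where
  "J_adjacent k n i j \<longleftrightarrow>
     (i \<in> {1..n-1} \<and> j \<in> {1..n-1} \<and> (j = i + 1 \<or> i = j + 1)) \<or>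
     (i = k \<and> j = n) \<or> (i = n \<and> j = k)"

definition J_cartan :: "nat \<Rightarrow> nat \<Rightarrow> nat \<Rightarrow> nat \<Rightarrow> int" where
  "J_cartan k n i j = (if i = j then 2 else if J_adjacent k n i j then -1 else 0)"

definition simple_root :: "nat \<Rightarrow> nat \<Rightarrow> int" where
  "simple_root i = (\<lambda>j. if j = i then 1 else 0)"

definition simple_reflection :: "nat \<Rightarrow> nat \<Rightarrow> nat \<Rightarrow> (nat \<Rightarrow> int) \<Rightarrow> nat \<Rightarrow> int" where
  "simple_reflection k n i r =
     (\<lambda>j. r j - (\<Sum>l\<in>{1..n}. J_cartan k n i l * r l) * simple_root i j)"

text \<open>Real roots are the Weyl group conjugates of the simple roots.\<close>

inductive real_root :: "nat \<Rightarrow> nat \<Rightarrow> (nat \<Rightarrow> int) \<Rightarrow> bool" for k n where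
  simple: "i \<in> {1..n} \<Longrightarrow> real_root k n (simple_root i)"
| reflect: "real_root k n r \<Longrightarrow> i \<in> {1..n} \<Longrightarrow> real_root k n (simple_reflection k n i r)"

definition root_degree :: "nat \<Rightarrow> (nat \<Rightarrow> int) \<Rightarrow> int" where
  "root_degree n r = r n"

text \<open>The identification \<open>\<alpha>\<^sub>i \<mapsto> - e\<^sub>i + e\<^sub>i\<^sub>+\<^sub>1\<close>, \<open>\<beta> \<mapsto> e\<^sub>1 + \<dots> + e\<^sub>k\<close>.\<close>

definition root_vector :: "nat \<Rightarrow> nat \<Rightarrow> (nat \<Rightarrow> int) \<Rightarrow> nat \<Rightarrow> int" where
  "root_vector k n r j =
     (\<Sum>i\<in>{1..n-1}. r i * (simple_root (i + 1) j - simple_root i j)) +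
     r n * (\<Sum>i\<in>{1..k}. simple_root i j)"

text \<open>
  \<open>\<phi>(M) = r\<close>.  The vector read off from a filtration does not depend on the filtration,
  and it determines the element \<open>r\<close> of the root lattice.
\<close>

definition phi_eq :: "nat \<Rightarrow> nat \<Rightarrow> 'v::ab_group_add brep \<Rightarrow> (nat \<Rightarrow> int) \<Rightarrow> bool" where
  "phi_eq k n M r \<longleftrightarrow>
     (\<forall>j. j \<notin> {1..n} \<longrightarrow> r j = 0) \<and>
     (\<exists>Is. has_filtration k n M Is \<and>
        (\<forall>j\<in>{1..n}. root_vector k n r j = int (length (filter (\<lambda>I. j \<in> I) Is))))"

definition rigid_indecomposable ::
  "nat \<Rightarrow> nat \<Rightarrow> nat \<Rightarrow> 'v::ab_group_add brep \<Rightarrow> bool" where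
  "rigid_indecomposable k n d M \<longleftrightarrow>
     CM k n M \<and> has_rank n M d \<and> rigid k n M \<and> indecomposable_brep n M"

end

theory Submission
  imports Defs
begin

text \<open>
  A rank 2 module embeds into the constant representation \<open>K\<^sup>2\<close> and becomes a family of lattices
  whose homothety classes move in the Bruhat--Tits tree of \<open>PGL\<^sub>2(K)\<close>: they stay put at the
  arrows with \<open>a\<^sub>i = 0\<close> or \<open>a\<^sub>i = 2\<close> and make one step at each of the arrows with \<open>a\<^sub>i = 1\<close>.
  For a real root of degree 2 there are exactly six of the latter, so the module is a closed walk
  of length six.  Such a walk either lies in an apartment, and the module splits, or it runs three
  times from a centre to a neighbour and back, with three distinct neighbours (a tripod).  All
  tripods are conjugate under \<open>GL\<^sub>2(K)\<close>, so that only the parity of the positions at which the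
  walk visits the centre remains: this gives the two modules.  They are rigid because the three
  nilpotent matrices attached to three distinct lines in \<open>\<complex>\<^sup>2\<close> are linearly independent, and
  the other choice of the parity interchanges the two parts of the profile.
\<close>

unbundle fps_syntax

section \<open>The plane over the field of Laurent series\<close>

text \<open>Both parameter pairs behave alike because \<open>\<Sum>a\<^sub>i = 2 * k\<close> and
  \<open>\<Sum>a\<^sub>i\<^sup>2 = 4 * k - 6\<close> force six entries 1: (3,9) leaves three zeros,
  (4,8) one 0 and one 2. The tree is never formed. Multiplying the lattice at vertex i by t^(- wt i)
  removes the arrows with entry 0 or 2 and leaves an increasing chain of lattices indexed by the
  integers, each of colength 1 in the next, which is multiplied by t^(-3) after six steps. A closed
  walk crosses each of its edges at least twice, so length six leaves room for three edges: a path
  or a star, and only a star with three distinct ends lies in no apartment. Two obstacles shape the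
  rest. The profile is defined through some graded realisation of the module, so every graded
  realisation of a tripod must be shown to have its centre at a multiple of
  \<open>std_lattice\<close>; only then are the exponents determined up to a common shift. And the
  middle term of an extension is an arbitrary B-module, so it is first embedded into a product of
  two planes over K, where splitting becomes a statement about a chain of modules of pairs.\<close>

datatype plane = Vec (vx: "complex fls") (vy: "complex fls")

instantiation plane :: ab_group_add
begin

definition "0 = Vec 0 0"
definition "u + v = Vec (vx u + vx v) (vy u + vy v)"
definition "- u = Vec (- vx u) (- vy u)"
definition "u - v = Vec (vx u - vx v) (vy u - vy v)"

instance
  by standard (auto simp: zero_plane_def plus_plane_def uminus_plane_def minus_plane_def)

end

lemma plane_sel [simp]:
  "vx 0 = 0" "vy 0 = 0" "vx (u + v) = vx u + vx v" "vy (u + v) = vy u + vy v"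
  "vx (- u) = - vx u" "vy (- u) = - vy u" "vx (u - v) = vx u - vx v" "vy (u - v) = vy u - vy v"
  by (simp_all add: zero_plane_def plus_plane_def uminus_plane_def minus_plane_def)

lemma plane_eqI: "vx u = vx v \<Longrightarrow> vy u = vy v \<Longrightarrow> u = v"
  by (rule plane.expand) simp

definition kscale :: "complex fls \<Rightarrow> plane \<Rightarrow> plane" where
  "kscale c v = Vec (c * vx v) (c * vy v)"

definition oscale :: "complex fps \<Rightarrow> plane \<Rightarrow> plane" where
  "oscale c v = kscale (fps_to_fls c) v"

definition tmul :: "int \<Rightarrow> plane \<Rightarrow> plane" where
  "tmul m v = kscale (fls_X_intpow m) v"

definition klinear :: "(plane \<Rightarrow> plane) \<Rightarrow> bool" where
  "klinear H \<longleftrightarrow> (\<forall>u v. H (u + v) = H u + H v) \<and> (\<forall>c v. H (kscale c v) = kscale c (H v))"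

definition o_submodule :: "plane set \<Rightarrow> bool" where
  "o_submodule S \<longleftrightarrow> 0 \<in> S \<and> (\<forall>u\<in>S. \<forall>v\<in>S. u + v \<in> S) \<and> (\<forall>c. \<forall>v\<in>S. oscale c v \<in> S)"

definition det2 :: "plane \<Rightarrow> plane \<Rightarrow> complex fls" where
  "det2 g h = vx g * vy h - vy g * vx h"

definition span2 :: "plane \<Rightarrow> plane \<Rightarrow> plane set" where
  "span2 g h = {oscale a g + oscale b h |a b. True}"

definition lattice2 :: "plane set \<Rightarrow> bool" where
  "lattice2 S \<longleftrightarrow> (\<exists>g h. det2 g h \<noteq> 0 \<and> S = span2 g h)"

text \<open>\<open>A\<close> has colength 1 in \<open>B\<close>; for lattices this is an oriented edge of the
  Bruhat--Tits tree of \<open>PGL\<^sub>2(K)\<close>.\<close>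

definition neighbour :: "plane set \<Rightarrow> plane set \<Rightarrow> bool" where
  "neighbour A B \<longleftrightarrow> o_submodule A \<and> tmul 1 ` B \<subset> A \<and> A \<subset> B"

global_interpretation kscale: vector_space kscale
  by unfold_locales (auto simp: kscale_def algebra_simps intro!: plane_eqI)

global_interpretation oscale: module oscale
  by unfold_locales
    (auto simp: oscale_def kscale_def algebra_simps fls_times_fps_to_fls intro!: plane_eqI)

lemma kscale_simps [simp]: "vx (kscale c v) = c * vx v" "vy (kscale c v) = c * vy v"
  by (auto simp: kscale_def)

lemma tmul_sel: "vx (tmul m v) = fls_shift (-m) (vx v)" "vy (tmul m v) = fls_shift (-m) (vy v)"
  by (auto simp: tmul_def kscale_def fls_X_intpow_times_conv_shift)

lemma tmul_tmul [simp]: "tmul m (tmul l v) = tmul (m + l) v"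
  by (rule plane_eqI) (auto simp: tmul_sel add.commute)

lemma tmul_0 [simp]: "tmul 0 v = v"
  by (rule plane_eqI) (auto simp: tmul_sel)

lemma tmul_zero [simp]: "tmul m 0 = 0"
  by (simp add: tmul_def)

lemma tmul_add: "tmul m (u + v) = tmul m u + tmul m v"
  by (simp add: tmul_def kscale.scale_right_distrib)

lemma tmul_diff: "tmul m (u - v) = tmul m u - tmul m v"
  by (simp add: tmul_def kscale.scale_right_diff_distrib)

lemma tmul_kscale: "tmul m (kscale c v) = kscale c (tmul m v)"
  by (simp add: tmul_def kscale.scale_left_commute)

lemma tmul_oscale: "tmul m (oscale c v) = oscale c (tmul m v)"
  by (simp add: oscale_def tmul_kscale)

lemma tmul_image_tmul [simp]: "tmul m ` tmul l ` S = tmul (m + l) ` S"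
  by (simp add: image_image)

lemma tmul_image_0 [simp]: "tmul 0 ` S = S"
  by (simp add: image_def)

lemma tmul_eq_iff [simp]: "tmul m u = tmul m v \<longleftrightarrow> u = v"
  by (metis add.left_inverse tmul_tmul tmul_0)

lemma tmul_eq_0_iff [simp]: "tmul m u = 0 \<longleftrightarrow> u = 0"
  by (metis tmul_eq_iff tmul_zero)

lemma inj_tmul: "inj (tmul m)"
  by (auto simp: inj_def)

lemma mem_tmul_image: "v \<in> tmul m ` S \<longleftrightarrow> tmul (-m) v \<in> S"
proof
  assume "tmul (-m) v \<in> S"
  then have "tmul m (tmul (-m) v) \<in> tmul m ` S" by blast
  then show "v \<in> tmul m ` S" by simp
qed auto

lemma tmul_image_subset_iff [simp]: "tmul m ` A \<subseteq> tmul m ` B \<longleftrightarrow> A \<subseteq> B"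
  by (simp add: inj_image_subset_iff[OF inj_tmul])

lemma tmul_image_eq_iff [simp]: "tmul m ` A = tmul m ` B \<longleftrightarrow> A = B"
  by (simp add: inj_image_eq_iff[OF inj_tmul])

lemma tmul_image_psubset_iff [simp]: "tmul m ` A \<subset> tmul m ` B \<longleftrightarrow> A \<subset> B"
  by (simp add: psubset_eq)

lemma oscale_X: "oscale fps_X v = tmul 1 v"
  by (simp add: oscale_def tmul_def fls_X_conv_shift_1)

lemma o_submoduleD:
  assumes "o_submodule S"
  shows "0 \<in> S" "\<And>u v. u \<in> S \<Longrightarrow> v \<in> S \<Longrightarrow> u + v \<in> S" "\<And>c v. v \<in> S \<Longrightarrow> oscale c v \<in> S"
    "\<And>u v. u \<in> S \<Longrightarrow> v \<in> S \<Longrightarrow> u - v \<in> S" "\<And>v. v \<in> S \<Longrightarrow> - v \<in> S"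
proof -
  show *: "0 \<in> S" "\<And>u v. u \<in> S \<Longrightarrow> v \<in> S \<Longrightarrow> u + v \<in> S" "\<And>c v. v \<in> S \<Longrightarrow> oscale c v \<in> S"
    using assms by (auto simp: o_submodule_def)
  show neg: "\<And>v. v \<in> S \<Longrightarrow> - v \<in> S" using *(3)[of _ "-1"] by simp
  show "\<And>u v. u \<in> S \<Longrightarrow> v \<in> S \<Longrightarrow> u - v \<in> S" using *(2)[OF _ neg] by fastforce
qed

lemma o_submodule_tmul_nonneg:
  assumes "o_submodule S" "v \<in> S" "0 \<le> m"
  shows "tmul m v \<in> S"
proof -
  have "tmul m v = oscale (fps_X ^ nat m) v"
    using assms(3) by (simp add: oscale_def tmul_def fps_to_fls_power fls_X_power_conv_shift_1)
  then show ?thesis using assms by (simp add: o_submoduleD)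
qed

lemma o_submodule_tmul_image: "o_submodule S \<Longrightarrow> o_submodule (tmul m ` S)"
  unfolding o_submodule_def
  by (auto simp: tmul_add[symmetric] tmul_oscale[symmetric] simp del: tmul_tmul)

lemma neighbour_tmul [simp]: "neighbour (tmul m ` A) (tmul m ` B) \<longleftrightarrow> neighbour A B"
proof -
  have "o_submodule (tmul m ` A) \<longleftrightarrow> o_submodule A"
    using o_submodule_tmul_image[of A m] o_submodule_tmul_image[of "tmul m ` A" "-m"] by auto
  moreover have "tmul 1 ` tmul m ` B \<subset> tmul m ` A \<longleftrightarrow> tmul 1 ` B \<subset> A"
    using tmul_image_psubset_iff[of m "tmul 1 ` B" A] by (simp add: add.commute)
  ultimately show ?thesis by (simp add: neighbour_def)
qed

section \<open>Spans of two vectors over C[[t]] and determinants\<close>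

lemma span2I: "oscale a g + oscale b h \<in> span2 g h"
  unfolding span2_def by blast

lemma span2E:
  assumes "v \<in> span2 g h" obtains a b where "v = oscale a g + oscale b h"
  using assms unfolding span2_def by blast

lemma o_submodule_span2: "o_submodule (span2 g h)"
proof -
  have "0 \<in> span2 g h"
    using span2I[of 0 g 0 h] by simp
  moreover have "u + v \<in> span2 g h" if uv: "u \<in> span2 g h" "v \<in> span2 g h" for u v
  proof -
    obtain a b where u: "u = oscale a g + oscale b h" using uv(1) by (rule span2E)
    obtain c d where v: "v = oscale c g + oscale d h" using uv(2) by (rule span2E)
    have "u + v = oscale (a + c) g + oscale (b + d) h"
      unfolding u v by (simp add: oscale.scale_left_distrib)
    then show ?thesis by (simp only: span2I)
  qed
  moreover have "oscale e u \<in> span2 g h" if u: "u \<in> span2 g h" for u e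
  proof -
    obtain a b where "u = oscale a g + oscale b h"
      using u by (rule span2E)
    then have "oscale e u = oscale (e * a) g + oscale (e * b) h"
      by (simp add: oscale.scale_right_distrib)
    then show ?thesis by (simp only: span2I)
  qed
  ultimately show ?thesis by (auto simp: o_submodule_def)
qed

lemma span2_base: "g \<in> span2 g h" "h \<in> span2 g h"
proof -
  have "oscale 1 g + oscale 0 h \<in> span2 g h" "oscale 0 g + oscale 1 h \<in> span2 g h"
    by (rule span2I)+
  then show "g \<in> span2 g h" "h \<in> span2 g h" by simp_all
qed

lemma span2_commute: "span2 g h = span2 h g"
  unfolding span2_def by (metis add.commute)

lemma span2_least:
  assumes "o_submodule S" "g \<in> S" "h \<in> S" shows "span2 g h \<subseteq> S"
proof
  fix v assume "v \<in> span2 g h"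
  then obtain a b where "v = oscale a g + oscale b h" by (rule span2E)
  then show "v \<in> S" using assms by (simp add: o_submoduleD)
qed

lemma lattice2_o_submodule: "lattice2 S \<Longrightarrow> o_submodule S"
  by (auto simp: lattice2_def o_submodule_span2)

lemma tmul_span2: "tmul m ` span2 g h = span2 (tmul m g) (tmul m h)"
proof -
  have "tmul m (oscale a g + oscale b h) = oscale a (tmul m g) + oscale b (tmul m h)" for a b
    by (simp add: tmul_add tmul_oscale)
  then show ?thesis unfolding span2_def by (auto 0 0 simp: image_Collect) metis+
qed

lemma det2_scale [simp]: "det2 (kscale c g) h = c * det2 g h" "det2 g (kscale c h) = c * det2 g h"
  by (auto simp: det2_def algebra_simps)

lemma det2_tmul_eq_0_iff [simp]: "det2 (tmul m g) h = 0 \<longleftrightarrow> det2 g h = 0"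
    "det2 g (tmul m h) = 0 \<longleftrightarrow> det2 g h = 0"
  by (auto simp: tmul_def)

lemma det2_commute_eq_0: "det2 g h = 0 \<longleftrightarrow> det2 h g = 0"
  by (auto simp: det2_def algebra_simps)

lemma det2_add: "det2 (u + v) h = det2 u h + det2 v h" "det2 h (u + v) = det2 h u + det2 h v"
  by (auto simp: det2_def algebra_simps)

lemma det2_self [simp]: "det2 g g = 0"
  by (simp add: det2_def algebra_simps)

lemma cramer:
  assumes "det2 g h \<noteq> 0"
  shows "v = kscale (det2 v h / det2 g h) g + kscale (det2 g v / det2 g h) h"
proof -
  have "det2 g h * vx v = det2 v h * vx g + det2 g v * vx h"
    "det2 g h * vy v = det2 v h * vy g + det2 g v * vy h"
    by (auto simp: det2_def algebra_simps)
  then have "vx v = (det2 v h * vx g + det2 g v * vx h) / det2 g h"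
    "vy v = (det2 v h * vy g + det2 g v * vy h) / det2 g h"
    using assms by (auto simp: field_simps)
  then show ?thesis by (intro plane_eqI) (auto simp: add_divide_distrib)
qed

lemma det2_independent:
  assumes "det2 g h \<noteq> 0" "kscale a g + kscale b h = kscale c g + kscale d h"
  shows "a = c \<and> b = d"
proof -
  have "det2 (kscale a g + kscale b h) h = det2 (kscale c g + kscale d h) h"
    "det2 g (kscale a g + kscale b h) = det2 g (kscale c g + kscale d h)"
    using assms(2) by simp_all
  then show ?thesis using assms(1) by (simp add: det2_add)
qed

lemma det2_independent_o:
  assumes "det2 g h \<noteq> 0" "oscale a g + oscale b h = oscale c g + oscale d h"
  shows "a = c \<and> b = d"
  using det2_independent[OF assms(1) assms(2)[unfolded oscale_def]] by simp

lemma lattice2_tmul: "lattice2 S \<Longrightarrow> lattice2 (tmul m ` S)"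
  unfolding lattice2_def
proof (elim exE conjE)
  fix g h assume "det2 g h \<noteq> 0" "S = span2 g h"
  then show "\<exists>g h. det2 g h \<noteq> 0 \<and> tmul m ` S = span2 g h"
    by (intro exI[of _ "tmul m g"] exI[of _ "tmul m h"]) (simp add: tmul_span2)
qed

section \<open>Primitive vectors and bases adapted to an edge\<close>

lemma fps_X_dvd_of_nth_0: "(a::complex fps) $ 0 = 0 \<Longrightarrow> \<exists>b. a = fps_X * b"
  by (intro exI[of _ "fps_shift 1 a"] fps_ext) (auto simp: fps_X_mult_nth)

lemma oscale_X_mult: "oscale (fps_X * a) v = oscale a (tmul 1 v)"
  by (simp add: oscale_X[symmetric] mult.commute)

lemma oscale_unit_mem:
  assumes "o_submodule S" "oscale a v \<in> S" "a $ 0 \<noteq> 0" shows "v \<in> S"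
proof -
  have "oscale (inverse a) (oscale a v) \<in> S" using assms(1,2) by (rule o_submoduleD)
  then show ?thesis using assms(3) by (simp add: inverse_mult_eq_1)
qed

text \<open>Steinitz exchange modulo t: since a is nonzero in the plane B / tB, one of its
  coordinates in a basis of B has a nonzero constant term, i.e. is a unit, and the corresponding
  basis vector can be replaced by a.\<close>

lemma primitive_extend:
  assumes "lattice2 B" "a \<in> B" "a \<notin> tmul 1 ` B"
  shows "\<exists>h. det2 a h \<noteq> 0 \<and> B = span2 a h"
proof -
  have *: "\<exists>h. det2 a h \<noteq> 0 \<and> B = span2 a h"
    if gh: "det2 g h \<noteq> 0" "B = span2 g h" "a = oscale \<alpha> g + oscale \<beta> h" "\<beta> $ 0 \<noteq> 0" for g h \<alpha> \<beta>
  proof (intro exI[of _ g] conjI)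
    have "\<beta> \<noteq> 0" using gh(4) by auto
    then show "det2 a g \<noteq> 0"
      using gh(1) det2_commute_eq_0[of h g] unfolding gh(3) by (simp add: oscale_def det2_add)
    have "span2 a g \<subseteq> B" using assms(2) gh(2) span2_base(1)[of g h]
      by (intro span2_least lattice2_o_submodule assms(1)) auto
    moreover have "span2 g h \<subseteq> span2 a g"
    proof (rule span2_least[OF o_submodule_span2])
      have "oscale \<beta> h = a - oscale \<alpha> g" using gh(3) by simp
      also have "\<dots> \<in> span2 a g"
        by (intro o_submoduleD[OF o_submodule_span2] span2_base)
      finally show "h \<in> span2 a g"
        using oscale_unit_mem[OF o_submodule_span2] gh(4) by blast
    qed (rule span2_base)
    ultimately show "B = span2 a g" using gh(2) by simp
  qed
  obtain g h where gh: "det2 g h \<noteq> 0" "B = span2 g h" using assms(1) by (auto simp: lattice2_def)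
  then obtain \<alpha> \<beta> where ab: "a = oscale \<alpha> g + oscale \<beta> h" using assms(2) by (auto elim: span2E)
  consider "\<beta> $ 0 \<noteq> 0" | "\<alpha> $ 0 \<noteq> 0" | "\<alpha> $ 0 = 0" "\<beta> $ 0 = 0" by blast
  then show ?thesis
  proof cases
    case 1 then show ?thesis using * gh ab by blast
  next
    case 2 then show ?thesis
      using *[of h g \<beta> \<alpha>] gh ab span2_commute[of h g] det2_commute_eq_0[of h g]
      by (simp add: add.commute)
  next
    case 3
    then obtain \<alpha>' \<beta>' where "\<alpha> = fps_X * \<alpha>'" "\<beta> = fps_X * \<beta>'"
      using fps_X_dvd_of_nth_0 by metis
    then have "a = oscale \<alpha>' (tmul 1 g) + oscale \<beta>' (tmul 1 h)" using ab by (simp add: oscale_X_mult)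
    then have "a \<in> tmul 1 ` B" unfolding gh(2) tmul_span2 by (simp only: span2I)
    then show ?thesis using assms(3) by simp
  qed
qed

text \<open>Modulo tB the module A is the line spanned by g: an element of A with a unit as
  coordinate at h would bring h, and with it all of B, into A.\<close>

lemma neighbour_basis_given:
  assumes "neighbour A B" "B = span2 g h" "g \<in> A"
  shows "A = span2 g (tmul 1 h)"
proof
  have A: "o_submodule A" "tmul 1 ` B \<subseteq> A" "A \<subset> B" using assms(1) by (auto simp: neighbour_def)
  show "span2 g (tmul 1 h) \<subseteq> A"
    using A assms(2,3) span2_base(2)[of h g] by (intro span2_least) auto
  show "A \<subseteq> span2 g (tmul 1 h)"
  proof
    fix a assume "a \<in> A"
    then obtain \<alpha> \<beta> where ab: "a = oscale \<alpha> g + oscale \<beta> h" using A(3) assms(2) by (blast elim: span2E)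
    have "\<beta> $ 0 = 0"
    proof (rule ccontr)
      assume "\<beta> $ 0 \<noteq> 0"
      moreover have "oscale \<beta> h \<in> A"
        using o_submoduleD(4)[OF A(1) \<open>a \<in> A\<close> o_submoduleD(3)[OF A(1) assms(3), of \<alpha>]] ab by simp
      ultimately have "h \<in> A" using oscale_unit_mem A(1) by blast
      then have "B \<subseteq> A" using span2_least A(1) assms(2,3) by blast
      then show False using A(3) by blast
    qed
    then obtain \<beta>' where "\<beta> = fps_X * \<beta>'" using fps_X_dvd_of_nth_0 by blast
    then show "a \<in> span2 g (tmul 1 h)" using ab by (simp add: oscale_X_mult span2I)
  qed
qed

lemma neighbour_basis:
  assumes "lattice2 B" "neighbour A B"
  obtains g h where "det2 g h \<noteq> 0" "B = span2 g h" "A = span2 g (tmul 1 h)"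
proof -
  obtain g where g: "g \<in> A" "g \<notin> tmul 1 ` B" "g \<in> B" using assms(2) by (auto simp: neighbour_def)
  obtain h where "det2 g h \<noteq> 0" "B = span2 g h" using primitive_extend[OF assms(1) g(3,2)] by auto
  then show ?thesis using that neighbour_basis_given[OF assms(2) _ g(1)] by blast
qed

lemma neighbour_lattice_down:
  assumes "lattice2 B" "neighbour A B" shows "lattice2 A"
proof -
  obtain g h where "det2 g h \<noteq> 0" "B = span2 g h" "A = span2 g (tmul 1 h)"
    using neighbour_basis[OF assms] .
  then show ?thesis unfolding lattice2_def by (intro exI[of _ g] exI[of _ "tmul 1 h"]) auto
qed

text \<open>B / A has length one. In the adapted basis an element of D outside A has a unit as
  coordinate at h, so D contains h.\<close>

lemma neighbour_maximal:
  assumes "lattice2 B" "neighbour A B" "o_submodule D" "A \<subset> D" "D \<subseteq> B"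
  shows "D = B"
proof -
  obtain g h where gh: "det2 g h \<noteq> 0" "B = span2 g h" "A = span2 g (tmul 1 h)"
    using neighbour_basis[OF assms(1,2)] .
  obtain d where d: "d \<in> D" "d \<notin> A" using assms(4) by blast
  then obtain \<alpha> \<beta> where ab: "d = oscale \<alpha> g + oscale \<beta> h" using assms(5) gh(2) by (blast elim: span2E)
  have g: "g \<in> D" using assms(4) gh(3) span2_base by blast
  have "\<beta> $ 0 \<noteq> 0"
  proof
    assume "\<beta> $ 0 = 0"
    then obtain \<beta>' where "\<beta> = fps_X * \<beta>'" using fps_X_dvd_of_nth_0 by blast
    then show False using ab d(2) gh(3) by (simp add: oscale_X_mult span2I)
  qed
  moreover have "oscale \<beta> h \<in> D"
    using o_submoduleD(4)[OF assms(3) d(1) o_submoduleD(3)[OF assms(3) g, of \<alpha>]] ab by simp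
  ultimately have "h \<in> D" using oscale_unit_mem assms(3) by blast
  then have "B \<subseteq> D" using span2_least assms(3) g gh(2) by blast
  then show ?thesis using assms(5) by blast
qed

section \<open>Closed walks of length six in the tree of lattices\<close>

definition std_lattice :: "plane set" where
  "std_lattice = {v. \<forall>j<0. vx v $$ j = 0 \<and> vy v $$ j = 0}"

text \<open>The points e1, e2 and e1 + e2 of the projective line over C, as lines in
  \<open>std_lattice\<close> modulo t. They are indexed by the odd residues 1, 3, 5 modulo 6, the
  positions of the walk at which they are visited; the last branch stands for 5.\<close>

definition leg :: "int \<Rightarrow> plane set" where
  "leg l = {v \<in> std_lattice. if l = 1 then vy v $$ 0 = 0 else if l = 3 then vx v $$ 0 = 0
     else vx v $$ 0 = vy v $$ 0}"

text \<open>The chain lifting the walk centre, e1, centre, e2, centre, e1 + e2, with the centre at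
  the even positions. The exponents make every term of colength 1 in the next one and give the
  factor t^(-3) per period.\<close>

definition tripod :: "int \<Rightarrow> plane set" where
  "tripod m = (if even m then tmul (- (m div 2)) ` std_lattice
     else tmul (- ((m + 1) div 2)) ` leg (m mod 6))"

abbreviation "unit1 \<equiv> Vec 1 0"
abbreviation "unit2 \<equiv> Vec 0 1"

lemma integral_fls_iff: "(\<forall>j<0. x $$ j = 0) \<longleftrightarrow> (\<exists>c. x = fps_to_fls (c :: complex fps))"
proof
  assume x: "\<forall>j<0. x $$ j = 0"
  have "x = fps_to_fls (fls_regpart x)"
    by (rule fls_eqI) (use x in \<open>auto simp: fps_to_fls_nth\<close>)
  then show "\<exists>c. x = fps_to_fls c" by blast
qed auto

lemma oscale_sel [simp]: "vx (oscale c v) = fps_to_fls c * vx v" "vy (oscale c v) = fps_to_fls c * vy v"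
  by (auto simp: oscale_def)

lemma fps_to_fls_mult_nth_nonpos:
  assumes "\<forall>j<0. x $$ j = 0" "i \<le> 0"
  shows "(fps_to_fls c * x) $$ i = (if i = 0 then c $ 0 * x $$ 0 else (0::complex))"
proof -
  obtain d where d: "x = fps_to_fls d" using assms(1) integral_fls_iff by blast
  show ?thesis using assms(2) unfolding d by (auto simp: fls_times_fps_to_fls[symmetric])
qed

lemma std_lattice_eq_span2: "std_lattice = span2 unit1 unit2"
proof
  show "std_lattice \<subseteq> span2 unit1 unit2"
  proof
    fix v assume "v \<in> std_lattice"
    then have "(\<forall>j<0. vx v $$ j = 0)" "(\<forall>j<0. vy v $$ j = 0)" by (auto simp: std_lattice_def)
    then obtain a b where "vx v = fps_to_fls a" "vy v = fps_to_fls b"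
      unfolding integral_fls_iff by blast
    then have "v = oscale a unit1 + oscale b unit2"
      by (intro plane_eqI) auto
    then show "v \<in> span2 unit1 unit2" by (simp only: span2I)
  qed
  show "span2 unit1 unit2 \<subseteq> std_lattice"
    by (rule subsetI, erule span2E) (auto simp: std_lattice_def)
qed

lemma o_submodule_std_lattice: "o_submodule std_lattice"
  unfolding std_lattice_eq_span2 by (rule o_submodule_span2)

lemma o_submodule_leg: "o_submodule (leg l)"
  using o_submodule_std_lattice
  by (auto simp: o_submodule_def leg_def std_lattice_def fps_to_fls_mult_nth_nonpos)

lemma std_lattice_tmul1: "tmul 1 ` std_lattice = {v \<in> std_lattice. vx v $$ 0 = 0 \<and> vy v $$ 0 = 0}"
proof -
  have "(\<forall>j<0. f (j - (-1::int)) = 0) \<longleftrightarrow> (\<forall>j<0. f j = 0) \<and> f 0 = (0::complex)" for f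
  proof safe
    fix j :: int assume *: "\<forall>j<0. f (j - -1) = 0"
    show "f 0 = 0" using *[rule_format, of "-1"] by simp
    show "f j = 0" if "j < 0" using *[rule_format, of "j - 1"] that by simp
  next
    fix j :: int assume "\<forall>j<0. f j = 0" "f 0 = 0" "j < 0"
    then show "f (j - -1) = 0" by (cases "j = -1") auto
  qed
  note shift = this
  show ?thesis
  proof (rule set_eqI)
    fix v
    have "v \<in> tmul 1 ` std_lattice \<longleftrightarrow>
        (\<forall>j<0. vx v $$ (j - - 1) = 0) \<and> (\<forall>j<0. vy v $$ (j - - 1) = 0)"
      by (auto simp: mem_tmul_image std_lattice_def tmul_sel)
    also have "\<dots> \<longleftrightarrow> v \<in> {v \<in> std_lattice. vx v $$ 0 = 0 \<and> vy v $$ 0 = 0}"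
      unfolding shift std_lattice_def by blast
    finally show "v \<in> tmul 1 ` std_lattice \<longleftrightarrow> v \<in> {v \<in> std_lattice. vx v $$ 0 = 0 \<and> vy v $$ 0 = 0}" .
  qed
qed

lemma leg_between: "leg l \<subset> std_lattice" "tmul 1 ` std_lattice \<subset> leg l"
proof -
  have "unit1 \<in> std_lattice" "unit2 \<in> std_lattice"
    by (auto simp: std_lattice_def)
  have "\<exists>v\<in>std_lattice. v \<notin> leg l"
  proof (cases "l = 1")
    case True then show ?thesis using \<open>unit2 \<in> std_lattice\<close> by (intro bexI[of _ unit2]) (auto simp: leg_def)
  next
    case False then show ?thesis using \<open>unit1 \<in> std_lattice\<close> by (intro bexI[of _ unit1]) (auto simp: leg_def)
  qed
  moreover have "leg l \<subseteq> std_lattice" by (auto simp: leg_def)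
  moreover have "tmul 1 ` std_lattice \<subseteq> leg l" unfolding std_lattice_tmul1 leg_def by auto
  moreover have "\<exists>v\<in>leg l. v \<notin> tmul 1 ` std_lattice"
  proof -
    let ?v = "if l = 1 then unit1 else if l = 3 then unit2 else unit1 + unit2"
    have "?v \<in> leg l" "?v \<notin> tmul 1 ` std_lattice"
      unfolding std_lattice_tmul1 by (auto simp: leg_def std_lattice_def)
    then show ?thesis by blast
  qed
  ultimately show "leg l \<subset> std_lattice" "tmul 1 ` std_lattice \<subset> leg l" by blast+
qed

lemma neighbour_leg: "neighbour (leg l) std_lattice"
  using leg_between by (auto simp: neighbour_def o_submodule_leg)

lemma leg_eq_span2:
  "leg 1 = span2 unit1 (tmul 1 unit2)" "leg 3 = span2 unit2 (tmul 1 unit1)"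
  "leg 5 = span2 (unit1 + unit2) (tmul 1 unit2)"
proof -
  show "leg 1 = span2 unit1 (tmul 1 unit2)"
    by (rule neighbour_basis_given[OF neighbour_leg std_lattice_eq_span2])
      (auto simp: leg_def std_lattice_def)
  show "leg 3 = span2 unit2 (tmul 1 unit1)"
    by (rule neighbour_basis_given[OF neighbour_leg])
      (auto simp: leg_def std_lattice_def span2_commute[of unit2] std_lattice_eq_span2[symmetric])
  have "std_lattice = span2 (unit1 + unit2) unit2"
  proof
    have "unit1 = unit1 + unit2 - unit2" by simp
    also have "\<dots> \<in> span2 (unit1 + unit2) unit2"
      by (intro o_submoduleD(4) o_submodule_span2 span2_base)
    finally show "std_lattice \<subseteq> span2 (unit1 + unit2) unit2"
      unfolding std_lattice_eq_span2 by (intro span2_least o_submodule_span2 span2_base)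
    show "span2 (unit1 + unit2) unit2 \<subseteq> std_lattice"
      by (intro span2_least o_submodule_std_lattice) (auto simp: std_lattice_def)
  qed
  then show "leg 5 = span2 (unit1 + unit2) (tmul 1 unit2)"
    by (rule neighbour_basis_given[OF neighbour_leg])
      (auto simp: leg_def std_lattice_def)
qed

lemma tripod_period: "tripod (m + 6) = tmul (-3) ` tripod m"
proof -
  have "(m + 6) div 2 = m div 2 + 3" "(m + 6 + 1) div 2 = (m + 1) div 2 + 3" "(m + 6) mod 6 = m mod 6"
    by presburger+
  then show ?thesis by (auto simp: tripod_def add.commute)
qed

lemma tripod_period_mult: "tripod (m + 6 * q) = tmul (- 3 * q) ` tripod m"
proof (induction q rule: int_induct[where k = 0])
  case (step1 q)
  then show ?case using tripod_period[of "m + 6 * q"] by (simp add: algebra_simps)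
next
  case (step2 q)
  have "tripod (m + 6 * q) = tmul (-3) ` tripod (m + 6 * (q - 1))"
    using tripod_period[of "m + 6 * (q - 1)"] by (simp add: algebra_simps)
  then have "tripod (m + 6 * (q - 1)) = tmul 3 ` tripod (m + 6 * q)" by simp
  then show ?case using step2 by (simp add: algebra_simps)
qed simp

section \<open>Apartments and the neighbours of one vertex\<close>

text \<open>Membership in the apartment of the frame Kb, Kc. A module whose lattices all lie in one
  apartment is the direct sum of its intersections with the two lines.\<close>

definition adapted :: "plane \<Rightarrow> plane \<Rightarrow> plane set \<Rightarrow> bool" where
  "adapted b c S \<longleftrightarrow> (\<exists>p q. S = span2 (tmul p b) (tmul q c))"

lemma adapted_tmul: "adapted b c S \<Longrightarrow> adapted b c (tmul m ` S)"
  unfolding adapted_def by (auto simp: tmul_span2 simp del: tmul_tmul) (metis tmul_tmul)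

text \<open>The neighbours below C are the lines of C / tC, and a vector of C outside tC lies on
  only one of them.\<close>

lemma neighbour_eq_if_common_primitive:
  assumes "lattice2 C" "neighbour N C" "neighbour N' C" "v \<in> N" "v \<in> N'" "v \<notin> tmul 1 ` C"
  shows "N = N'"
proof -
  have "v \<in> C" using assms by (auto simp: neighbour_def)
  then obtain h where C: "C = span2 v h" using primitive_extend[OF assms(1) _ assms(6)] by blast
  show ?thesis
    using neighbour_basis_given[OF assms(2) C assms(4)] neighbour_basis_given[OF assms(3) C assms(5)] by simp
qed

text \<open>Vectors spanning two different lines of C / tC form a basis of C: relative to a basis g,
  k of C the coefficient of h at k is a unit, because otherwise h would lie in N.\<close>

lemma two_neighbours_span:
  assumes "lattice2 C" "neighbour N C" "neighbour N' C" "N \<noteq> N'"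
    and g: "g \<in> N" "g \<notin> tmul 1 ` C" and h: "h \<in> N'" "h \<notin> tmul 1 ` C"
  shows "det2 g h \<noteq> 0" "C = span2 g h"
proof -
  have gC: "g \<in> C" and hC: "h \<in> C" using assms by (auto simp: neighbour_def)
  have hN: "h \<notin> N" using neighbour_eq_if_common_primitive[OF assms(1,2,3)] h assms(4) by blast
  obtain k where k: "det2 g k \<noteq> 0" "C = span2 g k" using primitive_extend[OF assms(1) gC g(2)] by blast
  have N: "N = span2 g (tmul 1 k)" by (rule neighbour_basis_given[OF assms(2) k(2) g(1)])
  obtain a b where ab: "h = oscale a g + oscale b k" using hC unfolding k(2) by (rule span2E)
  have b: "b $ 0 \<noteq> 0"
  proof
    assume "b $ 0 = 0"
    then obtain c where "b = fps_X * c" using fps_X_dvd_of_nth_0 by blast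
    then show False using hN N ab by (simp add: oscale_X_mult span2I)
  qed
  then have "b \<noteq> 0" by auto
  then show "det2 g h \<noteq> 0" using k(1) unfolding ab by (simp add: oscale_def det2_add)
  have "oscale b k = h - oscale a g" using ab by simp
  also have "\<dots> \<in> span2 g h" by (intro o_submoduleD o_submodule_span2 span2_base)
  finally have "k \<in> span2 g h" using oscale_unit_mem[OF o_submodule_span2] b by blast
  then have "C \<subseteq> span2 g h" unfolding k(2) by (intro span2_least o_submodule_span2 span2_base)
  moreover have "span2 g h \<subseteq> C" using gC hC by (intro span2_least lattice2_o_submodule assms(1)) auto
  ultimately show "C = span2 g h" by blast
qed

lemma two_neighbours_basis:
  assumes "lattice2 C" "neighbour N C" "neighbour N' C" "N \<noteq> N'"
  obtains g h where "det2 g h \<noteq> 0" "C = span2 g h" "N = span2 g (tmul 1 h)" "N' = span2 h (tmul 1 g)"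
proof -
  obtain g where g: "g \<in> N" "g \<notin> tmul 1 ` C" using assms(2) by (auto simp: neighbour_def)
  obtain h where h: "h \<in> N'" "h \<notin> tmul 1 ` C" using assms(3) by (auto simp: neighbour_def)
  note C = two_neighbours_span[OF assms g h]
  show ?thesis
  proof (rule that[OF C])
    show "N = span2 g (tmul 1 h)" by (rule neighbour_basis_given[OF assms(2) C(2) g(1)])
    show "N' = span2 h (tmul 1 g)"
      by (rule neighbour_basis_given[OF assms(3) _ h(1)]) (simp add: C(2) span2_commute)
  qed
qed

text \<open>Three distinct points of a projective line can be moved to three standard ones: a vector
  on the third line has unit coordinates a, b in a basis adapted to the first two, and these units
  are absorbed into the basis.\<close>

lemma three_neighbours_basis:
  assumes "lattice2 C" "neighbour N C" "neighbour N' C" "neighbour N'' C" "N \<noteq> N'" "N \<noteq> N''" "N' \<noteq> N''"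
  obtains g h where "det2 g h \<noteq> 0" "C = span2 g h" "N = span2 g (tmul 1 h)" "N' = span2 h (tmul 1 g)"
    "N'' = span2 (g + h) (tmul 1 h)"
proof -
  obtain g h where gh: "det2 g h \<noteq> 0" "C = span2 g h" "N = span2 g (tmul 1 h)" "N' = span2 h (tmul 1 g)"
    using two_neighbours_basis[OF assms(1,2,3,5)] .
  obtain v where v: "v \<in> N''" "v \<notin> tmul 1 ` C" "v \<in> C" using assms(4) by (auto simp: neighbour_def)
  have vN: "v \<notin> N" "v \<notin> N'"
    using neighbour_eq_if_common_primitive[OF assms(1,2,4)] neighbour_eq_if_common_primitive[OF assms(1,3,4)]
      v assms(6,7) by blast+
  obtain a b where ab: "v = oscale a g + oscale b h" using v(3) unfolding gh(2) by (rule span2E)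
  have b: "b $ 0 \<noteq> 0"
  proof
    assume "b $ 0 = 0"
    then obtain c where "b = fps_X * c" using fps_X_dvd_of_nth_0 by blast
    then show False using vN gh(3) ab by (simp add: oscale_X_mult span2I)
  qed
  have a: "a $ 0 \<noteq> 0"
  proof
    assume "a $ 0 = 0"
    then obtain c where "a = fps_X * c" using fps_X_dvd_of_nth_0 by blast
    then show False using vN gh(4) ab by (simp add: oscale_X_mult span2I add.commute)
  qed
  let ?g = "oscale a g" and ?h = "oscale b h"
  have "a \<noteq> 0" "b \<noteq> 0" using a b by auto
  then have d: "det2 ?g ?h \<noteq> 0" using gh(1) by (simp add: oscale_def)
  have C: "C = span2 ?g ?h"
  proof
    have "g \<in> span2 ?g ?h" "h \<in> span2 ?g ?h"
      using oscale_unit_mem[OF o_submodule_span2] a b span2_base by blast+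
    then show "C \<subseteq> span2 ?g ?h" unfolding gh(2) by (intro span2_least o_submodule_span2)
    show "span2 ?g ?h \<subseteq> C" unfolding gh(2)
      by (intro span2_least o_submodule_span2 o_submoduleD span2_base)
  qed
  have C': "C = span2 (?g + ?h) ?h"
  proof
    have "?g = ?g + ?h - ?h" by simp
    also have "\<dots> \<in> span2 (?g + ?h) ?h"
      by (intro o_submoduleD(4) o_submodule_span2 span2_base)
    finally show "C \<subseteq> span2 (?g + ?h) ?h"
      unfolding C by (intro span2_least o_submodule_span2 span2_base)
    show "span2 (?g + ?h) ?h \<subseteq> C" unfolding C
      by (intro span2_least o_submodule_span2 o_submoduleD span2_base)
  qed
  show ?thesis
  proof (rule that[OF d C])
    show "N = span2 ?g (tmul 1 ?h)"
      by (rule neighbour_basis_given[OF assms(2) C]) (simp add: gh(3) o_submoduleD o_submodule_span2 span2_base)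
    show "N' = span2 ?h (tmul 1 ?g)"
      by (rule neighbour_basis_given[OF assms(3)])
        (simp_all add: gh(4) o_submoduleD o_submodule_span2 span2_base span2_commute C)
    show "N'' = span2 (?g + ?h) (tmul 1 ?h)"
      by (rule neighbour_basis_given[OF assms(4) C']) (use ab v in simp)
  qed
qed

lemma klinear_span2:
  assumes "klinear H" shows "H ` span2 g h = span2 (H g) (H h)"
proof -
  have "H (oscale a g + oscale b h) = oscale a (H g) + oscale b (H h)" for a b
    using assms by (simp add: klinear_def oscale_def)
  then show ?thesis unfolding span2_def by (auto simp: image_Collect) metis+
qed

lemma klinear_tmul: "klinear H \<Longrightarrow> H (tmul m v) = tmul m (H v)"
  by (simp add: klinear_def tmul_def)

lemma klinear_tmul_image: "klinear H \<Longrightarrow> H ` tmul m ` S = tmul m ` H ` S"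
  by (simp add: image_image klinear_tmul)

lemma coordinate_map:
  assumes "det2 g h \<noteq> 0"
  obtains H where "klinear H" "bij H" "H g = unit1" "H h = unit2"
proof -
  define H where "H v = Vec (det2 v h / det2 g h) (det2 g v / det2 g h)" for v
  define G where "G v = kscale (vx v) g + kscale (vy v) h" for v
  have GH: "G (H v) = v" for v using cramer[OF assms, of v] by (simp add: G_def H_def)
  have HG: "H (G v) = v" for v
    using assms by (intro plane_eqI) (simp_all add: G_def H_def det2_add)
  have "klinear H"
    by (auto simp: klinear_def H_def det2_add add_divide_distrib intro!: plane_eqI)
  moreover have "bij H" by (rule o_bij[of G]) (auto simp: fun_eq_iff GH HG)
  ultimately show ?thesis using that assms by (auto simp: H_def)
qed

section \<open>Backtracking of closed walks\<close>

text \<open>The walk leaves position m through the edge by which it came. Along a chain both L (m -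
  1) and tL (m + 1) have colength 1 in L m, so they are equal as soon as they are homothetic; hence
  the exact factor t.\<close>

definition backtrack :: "(int \<Rightarrow> plane set) \<Rightarrow> int \<Rightarrow> bool" where
  "backtrack L m \<longleftrightarrow> L (m - 1) = tmul 1 ` L (m + 1)"

text \<open>Lift of a closed walk of length six to a chain: six steps change the colength by 6, as
  does the factor t^(-3) in a plane.\<close>

locale lattice_walk =
  fixes L :: "int \<Rightarrow> plane set"
  assumes lattice: "lattice2 (L m)"
    and step: "neighbour (L m) (L (m + 1))"
    and period: "L (m + 6) = tmul (-3) ` L m"
begin

lemma period': "L m = tmul 3 ` L (m + 6)"
  by (simp add: period)

lemma period_mult: "L (m + 6 * q) = tmul (- 3 * q) ` L m"
proof (induction q rule: int_induct[where k = 0])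
  case base then show ?case by simp
next
  case (step1 i)
  have "L (m + 6 * (i + 1)) = tmul (-3) ` L (m + 6 * i)"
    using period[of "m + 6 * i"] by (simp add: algebra_simps)
  then show ?case using step1 by (simp add: algebra_simps)
next
  case (step2 i)
  have "L (m + 6 * (i - 1)) = tmul 3 ` L (m + 6 * i)"
    using period'[of "m + 6 * (i - 1)"] by (simp add: algebra_simps)
  then show ?case using step2 by (simp add: algebra_simps)
qed

lemma all_from_six:
  assumes "\<And>S r. P S \<Longrightarrow> P (tmul r ` S)"
    and "P (L j)" "P (L (j + 1))" "P (L (j + 2))" "P (L (j + 3))" "P (L (j + 4))" "P (L (j + 5))"
  shows "P (L m)"
proof -
  define r where "r = (m - j) mod 6"
  have m: "m = (j + r) + 6 * ((m - j) div 6)" unfolding r_def by presburger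
  have "r \<in> {0, 1, 2, 3, 4, 5}" unfolding r_def by simp presburger
  then have "P (L (j + r))" using assms(2-) by auto
  then show ?thesis by (subst m, subst period_mult) (rule assms(1))
qed

lemma step_subset: "L m \<subset> L (m + 1)" "tmul 1 ` L (m + 1) \<subset> L m" "o_submodule (L m)"
  using step[of m] by (auto simp: neighbour_def)

lemma step_down: "neighbour (tmul 1 ` L (m + 1)) (L m)"
  using step_subset[of m] by (auto simp: neighbour_def o_submodule_tmul_image step_subset(3))

text \<open>A walk without backtracking in a tree is a geodesic; here this is expressed by L (m - 1)
  containing a vector that is primitive in L (m + r). Otherwise the module D below lies strictly
  inside L m and contains both L (m - 1) and tL (m + 1). These have colength 1 in L m, so both equal
  D, and the walk turns at m.\<close>

lemma no_backtrack:
  assumes "\<And>i. m \<le> i \<Longrightarrow> i < m + int r \<Longrightarrow> \<not> backtrack L i"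
  shows "\<not> L (m - 1) \<subseteq> tmul 1 ` L (m + int r)"
  using assms
proof (induction r arbitrary: m)
  case 0
  then show ?case using step_subset(2)[of "m - 1"] by auto
next
  case (Suc r)
  show ?case
  proof
    assume *: "L (m - 1) \<subseteq> tmul 1 ` L (m + int (Suc r))"
    have "\<not> L (m + 1 - 1) \<subseteq> tmul 1 ` L (m + 1 + int r)"
      by (rule Suc.IH) (use Suc.prems in auto)
    then have not_sub: "\<not> L m \<subseteq> tmul 1 ` L (m + int (Suc r))" by (simp add: add_ac)
    define D where "D = L m \<inter> tmul 1 ` L (m + int (Suc r))"
    have D: "o_submodule D"
      using step_subset(3)[of m] o_submodule_tmul_image[OF step_subset(3), of 1 "m + int (Suc r)"]
      by (auto simp: D_def o_submodule_def)
    have "L (m - 1) \<subseteq> D" using * step_subset(1)[of "m - 1"] by (auto simp: D_def)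
    moreover have "D \<noteq> L m" using not_sub by (auto simp: D_def)
    ultimately have D1: "D = L (m - 1)"
      using neighbour_maximal[OF lattice step[of "m - 1"] D] by (auto simp: D_def)
    have mono: "L (m + 1) \<subseteq> L (m + 1 + int s)" for s
    proof (induction s)
      case (Suc s) then show ?case using step_subset(1)[of "m + 1 + int s"] by (auto simp: add_ac)
    qed simp
    have "tmul 1 ` L (m + 1) \<subseteq> L m" using step_subset(2)[of m] by auto
    moreover have "tmul 1 ` L (m + 1) \<subseteq> tmul 1 ` L (m + int (Suc r))" using mono[of r] by (auto simp: add_ac)
    ultimately have "tmul 1 ` L (m + 1) \<subseteq> D" by (auto simp: D_def)
    then have "tmul 1 ` L (m + 1) = D"
      using neighbour_maximal[OF lattice step_down D] \<open>D \<noteq> L m\<close> D_def by blast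
    then have "backtrack L m" using D1 by (simp add: backtrack_def)
    then show False using Suc.prems[of m] by auto
  qed
qed

lemma backtrack_exists:
  assumes "L (m - 1) \<subseteq> tmul 1 ` L (m + int r)"
  shows "\<exists>i. m \<le> i \<and> i < m + int r \<and> backtrack L i"
  using no_backtrack[of m r] assms by blast

text \<open>Removing the spur at j leaves a closed walk of length four from j + 1 to j + 5. Two
  overlapping pieces of it each contain a backtrack: one at j + 2 or j + 3, the other at j + 3 or j
  + 4.\<close>

lemma backtrack_rotate:
  assumes "backtrack L j"
  shows "backtrack L (j + 3) \<or> (backtrack L (j + 2) \<and> backtrack L (j + 4))"
proof -
  have "L (j + 5) = tmul (-3) ` L (j - 1)" using period[of "j - 1"] by (simp add: algebra_simps)
  also have "L (j - 1) = tmul 1 ` L (j + 1)" using assms by (simp add: backtrack_def)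
  finally have *: "L (j + 1) = tmul 2 ` L (j + 5)" by simp
  have "tmul 1 ` L (j + 5) \<subseteq> L (j + 4)" using step_subset(2)[of "j + 4"] by (simp add: algebra_simps psubset_eq)
  then have "tmul 1 ` tmul 1 ` L (j + 5) \<subseteq> tmul 1 ` L (j + 4)" by (simp only: tmul_image_subset_iff)
  then have "L (j + 1) \<subseteq> tmul 1 ` L (j + 4)" using * by simp
  then obtain i where i: "j + 2 \<le> i" "i < j + 4" "backtrack L i"
    using backtrack_exists[of "j + 2" 2] by (auto simp: add_ac)
  have "tmul 1 ` L (j + 2) \<subseteq> L (j + 1)" using step_subset(2)[of "j + 1"] by (simp add: algebra_simps psubset_eq)
  then have "tmul (-1) ` tmul 1 ` L (j + 2) \<subseteq> tmul (-1) ` tmul 2 ` L (j + 5)"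
    unfolding * by (simp only: tmul_image_subset_iff)
  then have "L (j + 2) \<subseteq> tmul 1 ` L (j + 5)" by simp
  then obtain i' where i': "j + 3 \<le> i'" "i' < j + 5" "backtrack L i'"
    using backtrack_exists[of "j + 3" 2] by (auto simp: add_ac)
  have "i = j + 2 \<or> i = j + 3" "i' = j + 3 \<or> i' = j + 4" using i i' by auto
  then show ?thesis using i i' by auto
qed

lemma backtrack_period: "backtrack L (m + 6) \<longleftrightarrow> backtrack L m"
  using period[of "m - 1"] period[of "m + 1"]
    tmul_image_eq_iff[of "-3" "L (m - 1)" "tmul 1 ` L (m + 1)"]
  by (simp add: backtrack_def algebra_simps)

text \<open>Cyclically, backtracks at three alternate positions form a star, two opposite ones with
  nothing between them on one side form a path. A further backtrack next to an opposite pair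
  produces a star: at j + 1 it forces one at j + 5, at j + 2 it forces one at j + 4.\<close>

lemma star_or_path:
  obtains (star) j where "backtrack L j" "backtrack L (j + 2)" "backtrack L (j + 4)"
  | (path) j where "backtrack L j" "backtrack L (j + 3)" "\<not> backtrack L (j + 1)" "\<not> backtrack L (j + 2)"
proof -
  \<comment> \<open>Periodicity gives L 0 \<subseteq> t^(-2) L 0 = tL 6, so the positions 1 to 5
    cannot all be passed without turning.\<close>
  have "L 6 = tmul (-3) ` L 0" using period[of 0] by simp
  moreover have "tmul 2 ` L 0 \<subseteq> L 0"
    using o_submodule_tmul_nonneg[OF step_subset(3)] by auto
  then have "tmul (-2) ` tmul 2 ` L 0 \<subseteq> tmul (-2) ` L 0" by (simp only: tmul_image_subset_iff)
  ultimately have "L (1 - 1) \<subseteq> tmul 1 ` L (1 + int 5)" by simp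
  then obtain j where j: "backtrack L j" using backtrack_exists[of 1 5] by blast
  consider "backtrack L (j + 3)" | "backtrack L (j + 2)" "backtrack L (j + 4)"
    using backtrack_rotate[OF j] by blast
  then show ?thesis
  proof cases
    case 2 then show ?thesis using j star by blast
  next
    case 1
    have a: "L (j - 1) = tmul 1 ` L (j + 1)" "L (j + 2) = tmul 1 ` L (j + 4)"
      using j 1 by (auto simp: backtrack_def algebra_simps)
    have b: "L (j + 5) = tmul (-2) ` L (j + 1)" using period[of "j - 1"] a by (simp add: algebra_simps)
    consider "backtrack L (j + 1)" | "backtrack L (j + 2)" | "\<not> backtrack L (j + 1)" "\<not> backtrack L (j + 2)"
      by blast
    then show ?thesis
    proof cases
      case 11: 1
      have "L j = tmul 1 ` L (j + 2)" using 11 by (simp add: backtrack_def algebra_simps)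
      then have "backtrack L (j + 5)" using a period[of j] by (simp add: backtrack_def algebra_simps)
      then show ?thesis using star[of "j + 1"] 1 11 by (simp add: algebra_simps)
    next
      case 12: 2
      have "L (j + 1) = tmul 1 ` L (j + 3)" using 12 by (simp add: backtrack_def algebra_simps)
      then have "backtrack L (j + 4)" using b by (simp add: backtrack_def algebra_simps)
      then show ?thesis using star[of j] j 12 by simp
    next
      case 3 then show ?thesis using path j 1 by blast
    qed
  qed
qed

text \<open>From j to j + 3 the walk is a geodesic, so some vector b of L j is still primitive in L
  (j + 3). Completing b to a basis with c puts these four lattices into one apartment, and the way
  back runs through the same vertices.\<close>

lemma path_adapted:
  assumes "backtrack L j" "backtrack L (j + 3)" "\<not> backtrack L (j + 1)" "\<not> backtrack L (j + 2)"
  obtains b c where "det2 b c \<noteq> 0" "\<And>m. adapted b c (L m)"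
proof -
  have "\<not> L j \<subseteq> tmul 1 ` L (j + 3)"
  proof -
    have "\<not> L (j + 1 - 1) \<subseteq> tmul 1 ` L (j + 1 + int 2)"
    proof (rule no_backtrack)
      fix i assume "j + 1 \<le> i" "i < j + 1 + int 2"
      then have "i = j + 1 \<or> i = j + 2" by auto
      then show "\<not> backtrack L i" using assms by auto
    qed
    then show ?thesis by (simp add: algebra_simps)
  qed
  then obtain b where b: "b \<in> L j" "b \<notin> tmul 1 ` L (j + 3)" by blast
  have sub: "L j \<subset> L (j + 1)" "L (j + 1) \<subset> L (j + 2)" "L (j + 2) \<subset> L (j + 3)"
    using step_subset(1)[of j] step_subset(1)[of "j + 1"] step_subset(1)[of "j + 2"]
    by (simp_all add: algebra_simps)
  then obtain c where c: "det2 b c \<noteq> 0" "L (j + 3) = span2 b c"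
    using primitive_extend[OF lattice _ b(2)] b(1) by blast
  have l2: "L (j + 2) = span2 b (tmul 1 c)"
    by (rule neighbour_basis_given[OF _ c(2)]) (use step[of "j + 2"] b sub in \<open>auto simp: algebra_simps\<close>)
  have l1: "L (j + 1) = span2 b (tmul 2 c)"
    using neighbour_basis_given[OF _ l2, of "L (j + 1)"] step[of "j + 1"] b sub by (auto simp: algebra_simps)
  have l0: "L j = span2 b (tmul 3 c)"
    using neighbour_basis_given[OF _ l1, of "L j"] step[of "j"] b sub by (auto simp: algebra_simps)
  \<comment> \<open>The turn at j + 3 identifies the vertex at j + 4 with the one at j + 2; the turn
    at j, one period later, identifies j + 5 with j + 1.\<close>
  have l4: "L (j + 4) = tmul (-1) ` L (j + 2)"
    using assms(2) by (auto simp: backtrack_def algebra_simps)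
  have l5: "L (j + 5) = tmul (-2) ` L (j + 1)"
    using assms(1) period[of "j - 1"] by (simp add: backtrack_def algebra_simps)
  have ad: "adapted b c (span2 b (tmul q c))" for q
    unfolding adapted_def by (intro exI[of _ 0] exI[of _ q]) simp
  have ad3: "adapted b c (L (j + 3))" using ad[of 0] c by simp
  have "adapted b c (L m)" for m
  proof (rule all_from_six)
    show "adapted b c (L j)" "adapted b c (L (j + 1))" "adapted b c (L (j + 2))"
      unfolding l0 l1 l2 by (rule ad)+
    then show "adapted b c (L (j + 4))" "adapted b c (L (j + 5))"
      unfolding l4 l5 by (blast intro: adapted_tmul)+
  qed (rule adapted_tmul ad3, assumption?)+
  then show ?thesis using that c by blast
qed

lemma star_backtrack:
  assumes "backtrack L j" "backtrack L (j + 2)" "backtrack L (j + 4)" "even (m - j)"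
  shows "backtrack L m"
proof -
  have *: "backtrack L (i + 6 * q) \<longleftrightarrow> backtrack L i" for i q
  proof (induction q rule: int_induct[where k = 0])
    case (step1 q) then show ?case using backtrack_period[of "i + 6 * q"] by (simp add: algebra_simps)
  next
    case (step2 q) then show ?case using backtrack_period[of "i + 6 * (q - 1)"] by (simp add: algebra_simps)
  qed simp
  define r where "r = (m - j) mod 6"
  have m: "m = (j + r) + 6 * ((m - j) div 6)" unfolding r_def by presburger
  have "r = 0 \<or> r = 2 \<or> r = 4" unfolding r_def using assms(4) by presburger
  then show ?thesis using assms by (subst m, subst *) auto
qed

text \<open>A star at \<open>j\<close> of either parity can be moved to \<open>1 - e\<close>, which puts its centre at the
  even positions of the walk shifted by \<open>e\<close>.\<close>

lemma star_tripod_or_adapted: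
  assumes "backtrack L (1 - e)" "backtrack L (3 - e)" "backtrack L (5 - e)"
  shows "(\<exists>b c. det2 b c \<noteq> 0 \<and> (\<forall>m. adapted b c (L m))) \<or>
    (\<exists>H. klinear H \<and> bij H \<and> (\<forall>m. H ` L m = tripod (m + e)))"
proof -
  \<comment> \<open>The centre and the three legs are brought to one scale: \<open>N1\<close>,
    \<open>N3\<close>, \<open>N5\<close> are neighbours of C itself and can be compared as lines of
    C / tC.\<close>
  define C where "C = L (2 - e)"
  define N1 where "N1 = L (1 - e)"
  define N3 where "N3 = tmul 1 ` L (3 - e)"
  define N5 where "N5 = tmul 2 ` L (5 - e)"
  have l0: "L (- e) = tmul 1 ` C" and l4: "L (4 - e) = tmul (-1) ` C"
    and l1: "L (1 - e) = N1" and l2: "L (2 - e) = C"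
    and l3: "L (3 - e) = tmul (-1) ` N3" and l5: "L (5 - e) = tmul (-2) ` N5"
    using assms by (auto simp: backtrack_def C_def N1_def N3_def N5_def algebra_simps)
  have C: "lattice2 C" unfolding C_def by (rule lattice)
  have n1: "neighbour N1 C" using step[of "1 - e"] by (simp add: C_def N1_def algebra_simps)
  have n3: "neighbour N3 C"
    using step[of "3 - e"] l4 l3 neighbour_tmul[of "-1" N3 C] by (simp add: algebra_simps)
  have n5: "neighbour N5 C"
  proof -
    have "L (6 - e) = tmul (-2) ` C" using period[of "-e"] l0 by (simp add: algebra_simps)
    then show ?thesis
      using step[of "5 - e"] l5 neighbour_tmul[of "-2" N5 C] by (simp add: algebra_simps)
  qed
  have six: "P (L m)" if "\<And>S r. P S \<Longrightarrow> P (tmul r ` S)" "P C" "P N1" "P N3" "P N5" for P m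
    by (rule all_from_six[where j = "-e"])
      (use that l0 l1 l2 l3 l4 l5 in \<open>simp_all add: algebra_simps\<close>)
  show ?thesis
  proof (cases "N1 \<noteq> N3 \<and> N1 \<noteq> N5 \<and> N3 \<noteq> N5")
    case True
    then obtain g h where gh: "det2 g h \<noteq> 0" "C = span2 g h" "N1 = span2 g (tmul 1 h)"
      "N3 = span2 h (tmul 1 g)" "N5 = span2 (g + h) (tmul 1 h)"
      using three_neighbours_basis[OF C n1 n3 n5] by blast
    obtain G where G: "klinear G" "bij G" "G g = unit1" "G h = unit2"
      using coordinate_map[OF gh(1)] .
    have "G (g + h) = unit1 + unit2" using G by (simp add: klinear_def)
    then have im: "G ` C = std_lattice" "G ` N1 = leg 1" "G ` N3 = leg 3" "G ` N5 = leg 5"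
      unfolding gh std_lattice_eq_span2 leg_eq_span2
      by (simp_all add: klinear_span2 klinear_tmul G)
    \<comment> \<open>The extra factor is needed because \<open>tripod\<close> has t^(-1)
      \<open>std_lattice\<close> at position 2, where the walk shifted by e has C.\<close>
    define H where "H = tmul (-1) \<circ> G"
    have H: "klinear H" using G(1) by (auto simp: klinear_def H_def tmul_add tmul_kscale)
    have bH: "bij H"
    proof -
      have "bij (tmul (-1))" by (rule o_bij[of "tmul 1"]) (auto simp: fun_eq_iff)
      then show ?thesis unfolding H_def using G(2) by (rule bij_comp[rotated])
    qed
    have HS: "H ` tmul r ` S = tmul (r - 1) ` G ` S" for r S
      unfolding H_def image_comp[symmetric] klinear_tmul_image[OF G(1)] by simp
    have HS0: "H ` S = tmul (- 1) ` G ` S" for S using HS[of 0] by simp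
    have base: "H ` L (r - e) = tripod r" if "r \<in> {0, 1, 2, 3, 4, 5}" for r
      using that
    proof (elim insertE)
      assume "r = 0" then show ?thesis using l0 im by (simp add: HS tripod_def)
    next
      assume "r = 1" then show ?thesis using l1 im by (simp add: HS0 tripod_def)
    next
      assume "r = 2" then show ?thesis using l2 im by (simp add: HS0 tripod_def)
    next
      assume "r = 3" then show ?thesis using l3 im by (simp add: HS tripod_def)
    next
      assume "r = 4" then show ?thesis using l4 im by (simp add: HS tripod_def)
    next
      assume "r = 5" then show ?thesis using l5 im by (simp add: HS tripod_def)
    qed simp
    have "H ` L m = tripod (m + e)" for m
    proof -
      define r where "r = (m + e) mod 6"
      define q where "q = (m + e) div 6"
      have m: "m = (r - e) + 6 * q" unfolding r_def q_def by presburger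
      have "r \<in> {0, 1, 2, 3, 4, 5}" unfolding r_def by simp presburger
      then have "H ` L (r - e) = tripod r" by (rule base)
      then have "H ` L ((r - e) + 6 * q) = tripod (r + 6 * q)"
        unfolding period_mult tripod_period_mult klinear_tmul_image[OF H] by simp
      moreover have "m + e = r + 6 * q" using m by simp
      ultimately show ?thesis using m by simp
    qed
    then show ?thesis using H bH by blast
  next
    \<comment> \<open>With two equal legs at most two neighbours of C are visited, and a basis
      adapted to both of them is a frame for the whole walk.\<close>
    case False
    have "\<exists>b c. det2 b c \<noteq> 0 \<and> C = span2 b c \<and>
      (\<forall>N\<in>{N1, N3, N5}. N = span2 b (tmul 1 c) \<or> N = span2 c (tmul 1 b))"
    proof -
      have pair: ?thesis if p: "\<And>N. N \<in> {N1, N3, N5} \<Longrightarrow> N = A \<or> N = A'" "neighbour A C" "neighbour A' C" for A A'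
      proof (cases "A = A'")
        case True
        obtain b c where "det2 b c \<noteq> 0" "C = span2 b c" "A = span2 b (tmul 1 c)"
          using neighbour_basis[OF C p(2)] .
        then show ?thesis using p True by blast
      next
        case False
        obtain b c where "det2 b c \<noteq> 0" "C = span2 b c" "A = span2 b (tmul 1 c)" "A' = span2 c (tmul 1 b)"
          using two_neighbours_basis[OF C p(2,3) False] .
        then show ?thesis using p by blast
      qed
      show ?thesis using False pair[of N1 N3] pair[of N1 N5] n1 n3 n5 by blast
    qed
    then obtain b c where bc: "det2 b c \<noteq> 0" "C = span2 b c"
      "\<And>N. N \<in> {N1, N3, N5} \<Longrightarrow> N = span2 b (tmul 1 c) \<or> N = span2 c (tmul 1 b)" by blast
    have ad: "adapted b c (span2 b c)" "adapted b c (span2 b (tmul 1 c))" "adapted b c (span2 c (tmul 1 b))"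
      using tmul_0 unfolding adapted_def by (metis span2_commute)+
    have "adapted b c C" "adapted b c N1" "adapted b c N3" "adapted b c N5"
      using bc(2) bc(3)[of N1] bc(3)[of N3] bc(3)[of N5] ad by auto
    then have "adapted b c (L m)" for m
      using six[of "adapted b c"] adapted_tmul by blast
    then show ?thesis using bc by blast
  qed
qed

theorem adapted_or_tripod:
  "(\<exists>b c. det2 b c \<noteq> 0 \<and> (\<forall>m. adapted b c (L m))) \<or>
   (\<exists>e\<in>{0, 1}. \<exists>H. klinear H \<and> bij H \<and> (\<forall>m. H ` L m = tripod (m + e)))"
proof (cases rule: star_or_path)
  case (star j)
  \<comment> \<open>The parity for which 1 - e, 3 - e and 5 - e are congruent to j modulo 2.\<close>
  define e where "e = (1 + j) mod 2"
  have e: "e \<in> {0, 1}" unfolding e_def by simp presburger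
  have "even (1 - e - j)" "even (3 - e - j)" "even (5 - e - j)" unfolding e_def by presburger+
  then have "backtrack L (1 - e)" "backtrack L (3 - e)" "backtrack L (5 - e)"
    using star_backtrack[OF star] by blast+
  then show ?thesis using star_tripod_or_adapted e by blast
next
  case (path j)
  then show ?thesis using path_adapted by metis
qed

end

section \<open>Embedding modules into the constant representation\<close>

lemma prv_in: "i \<in> {1..n} \<Longrightarrow> prv n i \<in> {1..n}"
  by (auto simp: prv_def)

lemma nxt_in: "i \<in> {1..n} \<Longrightarrow> nxt n i \<in> {1..n}"
  by (auto simp: nxt_def)

lemma nxt_prv: "i \<in> {1..n} \<Longrightarrow> nxt n (prv n i) = i"
  by (auto simp: nxt_def prv_def)

lemma prv_nxt: "i \<in> {1..n} \<Longrightarrow> prv n (nxt n i) = i"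
  by (auto simp: nxt_def prv_def)

lemma cyclic_induct:
  assumes "k \<in> {1..n}" "P k" "\<And>i. i \<in> {1..n} \<Longrightarrow> P (prv n i) \<Longrightarrow> P i" "i \<in> {1..n}"
  shows "P i"
proof -
  have up: "P j" if "P i" "i \<le> j" "j \<le> n" "1 \<le> i" for i j
    using that(2,1,3,4)
  proof (induction j rule: dec_induct)
    case (step j)
    then show ?case using assms(3)[of "Suc j"] by (auto simp: prv_def)
  qed
  have "P n" using up[OF assms(2)] assms(1) by auto
  then have "P 1" using assms(3)[of 1] assms(1) by (auto simp: prv_def)
  then show ?thesis using up[of 1 i] assms(4) by auto
qed

definition eps :: "nat \<Rightarrow> nat \<Rightarrow> int" where
  "eps k i = (if i \<le> k then 0 else 1)"

text \<open>What a module of rank 2 becomes, in suitable coordinates, after inverting t: all arrows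
  are invertible there.\<close>

definition const_rep :: "nat \<Rightarrow> plane brep" where
  "const_rep k = \<lparr> zscale = oscale, vsp = (\<lambda>i. UNIV),
     xmap = (\<lambda>i. tmul (eps k i)), ymap = (\<lambda>i. tmul (1 - eps k i)) \<rparr>"

lemma const_rep_simps [simp]:
  "zscale (const_rep k) = oscale" "vsp (const_rep k) i = UNIV"
  "xmap (const_rep k) i = tmul (eps k i)" "ymap (const_rep k) i = tmul (1 - eps k i)"
  by (auto simp: const_rep_def)

locale B_mod =
  fixes k n :: nat and M :: "'v::ab_group_add brep"
  assumes B: "B_module k n M" and k: "1 \<le> k" "k < n"
begin

sublocale Z: module "zscale M"
  using B by (auto simp: B_module_def)

lemma subspace: "i \<in> {1..n} \<Longrightarrow> Z.subspace (vsp M i)"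
  using B by (auto simp: B_module_def)

lemmas zero_in = Z.subspace_0[OF subspace]
lemmas add_in = Z.subspace_add[OF subspace]
lemmas diff_in = Z.subspace_diff[OF subspace]
lemmas scale_in = Z.subspace_scale[OF subspace]

lemma
  assumes "i \<in> {1..n}"
  shows x_in: "v \<in> vsp M (prv n i) \<Longrightarrow> xmap M i v \<in> vsp M i"
    and x_add: "u \<in> vsp M (prv n i) \<Longrightarrow> v \<in> vsp M (prv n i) \<Longrightarrow> xmap M i (u + v) = xmap M i u + xmap M i v"
    and x_scale: "v \<in> vsp M (prv n i) \<Longrightarrow> xmap M i (zscale M c v) = zscale M c (xmap M i v)"
    and y_in: "v \<in> vsp M i \<Longrightarrow> ymap M i v \<in> vsp M (prv n i)"
    and y_add: "u \<in> vsp M i \<Longrightarrow> v \<in> vsp M i \<Longrightarrow> ymap M i (u + v) = ymap M i u + ymap M i v"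
    and y_scale: "v \<in> vsp M i \<Longrightarrow> ymap M i (zscale M c v) = zscale M c (ymap M i v)"
    and xy: "v \<in> vsp M i \<Longrightarrow> xmap M i (ymap M i v) = zscale M fps_X v"
    and path: "v \<in> vsp M i \<Longrightarrow> xpow n M k i v = ypow n M (n - k) i v"
  using B assms by (simp_all add: B_module_def zlinear_on_def)

lemma yx:
  assumes "i \<in> {1..n}" "v \<in> vsp M (prv n i)"
  shows "ymap M i (xmap M i v) = zscale M fps_X v"
proof -
  have "ymap M (nxt n (prv n i)) (xmap M (nxt n (prv n i)) v) = zscale M fps_X v"
    using B assms prv_in[OF assms(1)] by (simp add: B_module_def)
  then show ?thesis using nxt_prv[OF assms(1)] by simp
qed

lemma xpow_linear:
  assumes "1 \<le> i" "i + m \<le> n"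
  shows "zlinear_on (zscale M) (vsp M i) (zscale M) (vsp M (i + m)) (xpow n M m i)"
  using assms
proof (induction m arbitrary: i)
  case 0 then show ?case by (simp add: zlinear_on_def)
next
  case (Suc m)
  have i: "Suc i \<in> {1..n}" "nxt n i = Suc i" "prv n (Suc i) = i"
    using Suc.prems by (auto simp: nxt_def prv_def)
  have IH: "zlinear_on (zscale M) (vsp M (Suc i)) (zscale M) (vsp M (Suc i + m)) (xpow n M m (Suc i))"
    using Suc.IH[of "Suc i"] Suc.prems by simp
  show ?case
    using IH x_in[OF i(1)] x_add[OF i(1)] x_scale[OF i(1)] by (simp add: zlinear_on_def i)
qed

lemma ypow_linear:
  assumes "m < i" "i \<le> n"
  shows "zlinear_on (zscale M) (vsp M i) (zscale M) (vsp M (i - m)) (ypow n M m i)"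
  using assms
proof (induction m arbitrary: i)
  case 0 then show ?case by (simp add: zlinear_on_def)
next
  case (Suc m)
  have i: "i \<in> {1..n}" "prv n i = i - 1"
    using Suc.prems by (auto simp: prv_def)
  have IH: "zlinear_on (zscale M) (vsp M (i - 1)) (zscale M) (vsp M (i - 1 - m)) (ypow n M m (i - 1))"
    using Suc.IH[of "i - 1"] Suc.prems by simp
  show ?case
    using IH y_in[OF i(1)] y_add[OF i(1)] y_scale[OF i(1)] by (simp add: zlinear_on_def i)
qed

text \<open>The constant representation sees \<open>x\<^sub>1, \<dots>, x\<^sub>k\<close> and \<open>y\<^sub>n, \<dots>, y\<^sub>k\<^sub>+\<^sub>1\<close> as identities, so a map
  at vertex \<open>k\<close> is pulled back along these two paths; they agree at vertex \<open>n\<close> because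
  \<open>x^k = y^(n - k)\<close>.\<close>

lemma extend_from_vertex:
  assumes "zlinear_on (zscale M) (vsp M k) oscale UNIV \<psi>"
  obtains \<Psi> where "brep_hom n M (const_rep k) \<Psi>" "\<And>v. v \<in> vsp M k \<Longrightarrow> \<Psi> k v = \<psi> v"
proof -
  define \<Psi> where "\<Psi> i v = (if i \<le> k then \<psi> (xpow n M (k - i) i v) else \<psi> (ypow n M (i - k) i v))" for i v
  have lin: "zlinear_on (zscale M) (vsp M i) oscale UNIV (\<Psi> i)" if i: "i \<in> {1..n}" for i
  proof (cases "i \<le> k")
    case True
    then have "zlinear_on (zscale M) (vsp M i) (zscale M) (vsp M k) (xpow n M (k - i) i)"
      using xpow_linear[of i "k - i"] i k by auto
    then show ?thesis using assms True by (simp add: \<Psi>_def zlinear_on_def)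
  next
    case False
    then have "zlinear_on (zscale M) (vsp M i) (zscale M) (vsp M k) (ypow n M (i - k) i)"
      using ypow_linear[of "i - k" i] i k by auto
    then show ?thesis using assms False by (simp add: \<Psi>_def zlinear_on_def)
  qed
  have X: "\<Psi> i (zscale M fps_X v) = tmul 1 (\<Psi> i v)" if "i \<in> {1..n}" "v \<in> vsp M i" for i v
    using lin[OF that(1)] that(2) by (simp add: zlinear_on_def oscale_X)
  have x: "\<Psi> i (xmap M i v) = tmul (eps k i) (\<Psi> (prv n i) v)"
    if i: "i \<in> {1..n}" and v: "v \<in> vsp M (prv n i)" for i v
  proof -
    consider "i = 1" | "1 < i" "i \<le> k" | "k < i" using i by fastforce
    then show ?thesis
    proof cases
      case 1
      have p: "prv n 1 = n" "nxt n n = 1" by (auto simp: prv_def nxt_def)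
      have "\<Psi> (prv n i) v = \<psi> (ypow n M (n - k) n v)" unfolding 1 p(1) using k by (simp add: \<Psi>_def)
      also have "\<dots> = \<psi> (xpow n M k n v)" using path[of n v] k v p 1 by simp
      also have "xpow n M k n v = xpow n M (k - 1) 1 (xmap M 1 v)"
        using k p by (cases k) auto
      finally show ?thesis using k 1 by (simp add: \<Psi>_def eps_def)
    next
      case 2
      then have p: "prv n i = i - 1" "nxt n (i - 1) = i" "k - (i - 1) = Suc (k - i)" 
        using i by (auto simp: prv_def nxt_def)
      have "\<Psi> (i - 1) v = \<psi> (xpow n M (k - (i - 1)) (i - 1) v)"
        using 2 by (auto simp: \<Psi>_def)
      also have "\<dots> = \<psi> (xpow n M (k - i) i (xmap M i v))" unfolding p(3) by (simp only: xpow.simps p(2))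
      finally show ?thesis using 2 unfolding p(1) by (simp add: \<Psi>_def eps_def)
    next
      case 3
      then have p: "prv n i = i - 1" "i - k = Suc (i - 1 - k)" "i \<noteq> 1" using k by (auto simp: prv_def)
      have "\<Psi> i (xmap M i v) = \<psi> (ypow n M (i - 1 - k) (i - 1) (ymap M i (xmap M i v)))"
        using 3 unfolding \<Psi>_def p(2) by (simp add: p(1))
      also have "ymap M i (xmap M i v) = zscale M fps_X v" using yx[OF i v] .
      also have "\<psi> (ypow n M (i - 1 - k) (i - 1) (zscale M fps_X v)) = \<Psi> (i - 1) (zscale M fps_X v)"
        using 3 by (cases "i - 1 = k") (auto simp: \<Psi>_def)
      also have "\<dots> = tmul 1 (\<Psi> (i - 1) v)" using X[of "i - 1"] prv_in[OF i] v p by simp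
      finally show ?thesis using 3 by (simp add: eps_def p)
    qed
  qed
  \<comment> \<open>The relation xy = t turns the formula for x into the one for y, after cancelling
    a power of t, which is invertible on the plane over K.\<close>
  have y: "\<Psi> (prv n i) (ymap M i v) = tmul (1 - eps k i) (\<Psi> i v)" if i: "i \<in> {1..n}" and v: "v \<in> vsp M i" for i v
  proof -
    have "tmul 1 (\<Psi> i v) = tmul (eps k i) (\<Psi> (prv n i) (ymap M i v))"
      using x[OF i y_in[OF i v]] xy[OF i v] X[OF i v] by simp
    then have "tmul (- eps k i) (tmul 1 (\<Psi> i v)) =
        tmul (- eps k i) (tmul (eps k i) (\<Psi> (prv n i) (ymap M i v)))" by simp
    then show ?thesis by simp
  qed
  have "brep_hom n M (const_rep k) \<Psi>"
    using lin x y by (simp add: brep_hom_def)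
  moreover have "\<Psi> k v = \<psi> v" if "v \<in> vsp M k" for v by (simp add: \<Psi>_def)
  ultimately show ?thesis using that by blast
qed

end

lemma plane_homD:
  assumes "brep_hom n M (const_rep k) \<Phi>" "i \<in> {1..n}"
  shows "u \<in> vsp M i \<Longrightarrow> v \<in> vsp M i \<Longrightarrow> \<Phi> i (u + v) = \<Phi> i u + \<Phi> i v"
    "v \<in> vsp M i \<Longrightarrow> \<Phi> i (zscale M c v) = oscale c (\<Phi> i v)"
    "v \<in> vsp M (prv n i) \<Longrightarrow> \<Phi> i (xmap M i v) = tmul (eps k i) (\<Phi> (prv n i) v)"
    "v \<in> vsp M i \<Longrightarrow> \<Phi> (prv n i) (ymap M i v) = tmul (1 - eps k i) (\<Phi> i v)"
  using assms by (auto simp: brep_hom_def zlinear_on_def)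

lemma plane_hom_klinear:
  assumes "klinear H" "brep_hom n M (const_rep k) \<Phi>"
  shows "brep_hom n M (const_rep k) (\<lambda>i v. H (\<Phi> i v))"
  using assms(2) assms(1)[unfolded klinear_def]
  by (auto simp: brep_hom_def zlinear_on_def klinear_tmul[OF assms(1)] oscale_def)

lemma eventually_in_std_lattice: "\<exists>m0. \<forall>m\<ge>m0. tmul m v \<in> std_lattice"
proof (intro exI allI impI)
  fix m assume m: "m \<ge> max (- fls_subdegree (vx v)) (- fls_subdegree (vy v))"
  have "vx v $$ (j - m) = 0" "vy v $$ (j - m) = 0" if "j < 0" for j
    using m that by (intro fls_eq0_below_subdegree; simp)+
  then show "tmul m v \<in> std_lattice" by (auto simp: std_lattice_def tmul_sel)
qed

locale plane_embedding = B_mod +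
  fixes \<Phi> :: "nat \<Rightarrow> 'a \<Rightarrow> plane"
  assumes hom: "brep_hom n M (const_rep k) \<Phi>"
    and kernel: "\<And>i v. i \<in> {1..n} \<Longrightarrow> v \<in> vsp M i \<Longrightarrow> \<Phi> i v = 0 \<Longrightarrow> v = 0"
begin

lemmas \<Phi>_add = plane_homD(1)[OF hom]
lemmas \<Phi>_scale = plane_homD(2)[OF hom]
lemmas \<Phi>_x = plane_homD(3)[OF hom]
lemmas \<Phi>_y = plane_homD(4)[OF hom]

lemma \<Phi>_diff: "i \<in> {1..n} \<Longrightarrow> u \<in> vsp M i \<Longrightarrow> v \<in> vsp M i \<Longrightarrow> \<Phi> i (u - v) = \<Phi> i u - \<Phi> i v"
  using \<Phi>_add[of i "u - v" v] diff_in[of i u v] by (simp add: eq_diff_eq)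

lemma \<Phi>_inj: "i \<in> {1..n} \<Longrightarrow> u \<in> vsp M i \<Longrightarrow> v \<in> vsp M i \<Longrightarrow> \<Phi> i u = \<Phi> i v \<Longrightarrow> u = v"
  using \<Phi>_diff[of i u v] kernel[of i "u - v"] diff_in[of i u v] by simp

definition image :: "nat \<Rightarrow> plane set" where
  "image i = \<Phi> i ` vsp M i"

lemma image_o_submodule: assumes "i \<in> {1..n}" shows "o_submodule (image i)"
proof -
  have "\<Phi> i 0 = 0" using \<Phi>_scale[OF assms zero_in[OF assms], of 0] by simp
  then have "0 \<in> image i" unfolding image_def using zero_in[OF assms] by force
  moreover have "\<Phi> i u + \<Phi> i v \<in> image i" if "u \<in> vsp M i" "v \<in> vsp M i" for u v
    using \<Phi>_add[OF assms that] add_in[OF assms that] by (metis image_def image_eqI)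
  moreover have "oscale c (\<Phi> i v) \<in> image i" if "v \<in> vsp M i" for c v
    using \<Phi>_scale[OF assms that] scale_in[OF assms that] by (metis image_def image_eqI)
  ultimately show ?thesis by (auto simp: o_submodule_def image_def)
qed

lemma image_step: "i \<in> {1..n} \<Longrightarrow> tmul (eps k i) ` image (prv n i) \<subseteq> image i"
  using \<Phi>_x x_in by (force simp: image_def)

lemma image_step': "i \<in> {1..n} \<Longrightarrow> tmul (1 - eps k i) ` image i \<subseteq> image (prv n i)"
  using \<Phi>_y y_in by (force simp: image_def)

text \<open>Every y acts invertibly on the plane over K, so a homomorphism into it is known at i as
  soon as it is known at the preceding vertex, and hence everywhere from vertex k.\<close>

lemma homs_agree:
  assumes "brep_hom n M (const_rep k) \<Psi>" "brep_hom n M (const_rep k) \<Psi>'"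
    and "\<And>v. v \<in> vsp M k \<Longrightarrow> \<Psi> k v = \<Psi>' k v" "i \<in> {1..n}" "v \<in> vsp M i"
  shows "\<Psi> i v = \<Psi>' i v"
proof -
  have "\<forall>v\<in>vsp M i. \<Psi> i v = \<Psi>' i v"
  proof (rule cyclic_induct[where k = k and P = "\<lambda>i. \<forall>v\<in>vsp M i. \<Psi> i v = \<Psi>' i v"])
    fix i assume i: "i \<in> {1..n}" and IH: "\<forall>v\<in>vsp M (prv n i). \<Psi> (prv n i) v = \<Psi>' (prv n i) v"
    show "\<forall>v\<in>vsp M i. \<Psi> i v = \<Psi>' i v"
    proof
      fix v assume v: "v \<in> vsp M i"
      then have "tmul (1 - eps k i) (\<Psi> i v) = tmul (1 - eps k i) (\<Psi>' i v)"
        using IH y_in[OF i v] plane_homD(4)[OF assms(1) i v] plane_homD(4)[OF assms(2) i v] by simp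
      then show "\<Psi> i v = \<Psi>' i v" by simp
    qed
  qed (use k assms in auto)
  then show ?thesis using assms by blast
qed

text \<open>The image at vertex k contains t^N e1 and t^N e2, a K-basis of the plane. H is the
  K-linear map prescribed on these two vectors by \<Psi>, and agreement at vertex k spreads around
  the cycle.\<close>

lemma hom_factors:
  assumes full: "\<And>v. v \<in> std_lattice \<Longrightarrow> tmul N v \<in> image k"
    and \<Psi>: "brep_hom n M (const_rep k) \<Psi>"
  obtains H where "klinear H" "\<And>i v. i \<in> {1..n} \<Longrightarrow> v \<in> vsp M i \<Longrightarrow> \<Psi> i v = H (\<Phi> i v)"
proof -
  have kk: "k \<in> {1..n}" using k by auto
  have "unit1 \<in> std_lattice" "unit2 \<in> std_lattice" by (auto simp: std_lattice_def)
  then obtain a b where ab: "a \<in> vsp M k" "b \<in> vsp M k" "\<Phi> k a = tmul N unit1" "\<Phi> k b = tmul N unit2"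
    using full unfolding image_def by (metis imageE)
  define H where "H v = kscale (vx v) (tmul (- N) (\<Psi> k a)) + kscale (vy v) (tmul (- N) (\<Psi> k b))" for v
  have H: "klinear H"
    by (auto simp: klinear_def H_def kscale.scale_left_distrib kscale.scale_right_distrib)
  have "\<Psi> k v = H (\<Phi> k v)" if v: "v \<in> vsp M k" for v
  proof -
    obtain m0 where m0: "\<forall>m\<ge>m0. tmul m (\<Phi> k v) \<in> std_lattice"
      using eventually_in_std_lattice by blast
    \<comment> \<open>Large enough for two purposes: t^m \<Phi> v becomes integral, and t^(m + N)
      has a nonnegative exponent, hence acts on the module itself.\<close>
    define m where "m = max m0 (- N)"
    have "tmul m (\<Phi> k v) \<in> std_lattice" using m0 by (simp add: m_def)
    then obtain c d where cd: "tmul m (\<Phi> k v) = oscale c unit1 + oscale d unit2"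
      unfolding std_lattice_eq_span2 by (rule span2E)
    define p where "p = nat (m + N)"
    have "int p = m + N" by (simp add: p_def m_def)
    then have p: "oscale (fps_X ^ p) w = tmul (m + N) w" for w
      by (simp add: oscale_def tmul_def fps_to_fls_power fls_X_power_conv_shift_1)
    have in1: "zscale M c a \<in> vsp M k" "zscale M d b \<in> vsp M k" "zscale M (fps_X ^ p) v \<in> vsp M k"
      using ab v kk by (auto intro: scale_in)
    have "\<Phi> k (zscale M (fps_X ^ p) v) = tmul N (tmul m (\<Phi> k v))"
      using \<Phi>_scale[OF kk v] by (simp add: p add.commute)
    also have "\<dots> = \<Phi> k (zscale M c a + zscale M d b)"
      unfolding cd using \<Phi>_add[OF kk in1(1,2)] \<Phi>_scale[OF kk] ab by (simp add: tmul_add tmul_oscale)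
    finally have eq: "zscale M (fps_X ^ p) v = zscale M c a + zscale M d b"
      by (rule \<Phi>_inj[OF kk in1(3) add_in[OF kk in1(1,2)]])
    have "tmul (m + N) (\<Psi> k v) = \<Psi> k (zscale M (fps_X ^ p) v)"
      using plane_homD(2)[OF \<Psi> kk v] by (simp add: p)
    also have "\<dots> = oscale c (\<Psi> k a) + oscale d (\<Psi> k b)"
      unfolding eq using plane_homD(1)[OF \<Psi> kk in1(1,2)] plane_homD(2)[OF \<Psi> kk] ab by simp
    also have "\<dots> = tmul N (H (oscale c unit1 + oscale d unit2))"
      by (simp add: H_def tmul_add oscale_def tmul_kscale)
    also have "\<dots> = tmul (m + N) (H (\<Phi> k v))"
      unfolding cd[symmetric] by (simp add: klinear_tmul[OF H] add.commute)
    finally show ?thesis by simp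
  qed
  then have "\<Psi> i v = H (\<Phi> i v)" if "i \<in> {1..n}" "v \<in> vsp M i" for i v
    using homs_agree[OF \<Psi> plane_hom_klinear[OF H hom]] that by blast
  then show ?thesis using that H by blast
qed

text \<open>Intersecting with the lines Kb and Kc gives two submodules; the basis t^p b, t^q c of
  each lattice shows that they are complementary and both nonzero.\<close>

lemma adapted_not_indecomposable:
  assumes "det2 b c \<noteq> 0" "\<And>i. i \<in> {1..n} \<Longrightarrow> adapted b c (image i)"
  shows "\<not> indecomposable_brep n M"
proof
  assume ind: "indecomposable_brep n M"
  define line where "line d i = {v \<in> vsp M i. \<exists>r. \<Phi> i v = kscale r d}" for d i
  have sub: "B_submodule n M (line d)" for d
    unfolding B_submodule_def
  proof (intro ballI conjI)
    fix i assume i: "i \<in> {1..n}"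
    have i': "prv n i \<in> {1..n}" by (rule prv_in[OF i])
    show "line d i \<subseteq> vsp M i" by (auto simp: line_def)
    show "Z.subspace (line d i)"
    proof (rule Z.subspaceI)
      have "\<Phi> i 0 = kscale 0 d" using \<Phi>_scale[OF i zero_in[OF i], of 0] by simp
      then show "0 \<in> line d i" using zero_in[OF i] unfolding line_def by blast
    next
      fix u v assume "u \<in> line d i" "v \<in> line d i"
      then obtain r s where "u \<in> vsp M i" "v \<in> vsp M i" "\<Phi> i u = kscale r d" "\<Phi> i v = kscale s d"
        by (auto simp: line_def)
      then have "u + v \<in> vsp M i" "\<Phi> i (u + v) = kscale (r + s) d"
        using \<Phi>_add[OF i] add_in[OF i] by (simp_all add: kscale.scale_left_distrib)
      then show "u + v \<in> line d i" unfolding line_def by blast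
    next
      fix e v assume "v \<in> line d i"
      then obtain s where "v \<in> vsp M i" "\<Phi> i v = kscale s d"
        by (auto simp: line_def)
      then have "zscale M e v \<in> vsp M i" "\<Phi> i (zscale M e v) = kscale (fps_to_fls e * s) d"
        using \<Phi>_scale[OF i] scale_in[OF i] by (simp_all add: oscale_def)
      then show "zscale M e v \<in> line d i" unfolding line_def by blast
    qed
    show "xmap M i ` line d (prv n i) \<subseteq> line d i"
    proof (intro image_subsetI)
      fix v assume "v \<in> line d (prv n i)"
      then obtain s where v: "v \<in> vsp M (prv n i)" "\<Phi> (prv n i) v = kscale s d"
        by (auto simp: line_def)
      then have "\<Phi> i (xmap M i v) = kscale (fls_X_intpow (eps k i) * s) d"
        using \<Phi>_x[OF i v(1)] by (simp add: tmul_def)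
      then show "xmap M i v \<in> line d i" using x_in[OF i v(1)] unfolding line_def by blast
    qed
    show "ymap M i ` line d i \<subseteq> line d (prv n i)"
    proof (intro image_subsetI)
      fix v assume "v \<in> line d i"
      then obtain s where v: "v \<in> vsp M i" "\<Phi> i v = kscale s d"
        by (auto simp: line_def)
      then have "\<Phi> (prv n i) (ymap M i v) = kscale (fls_X_intpow (1 - eps k i) * s) d"
        using \<Phi>_y[OF i v(1)] by (simp add: tmul_def)
      then show "ymap M i v \<in> line d (prv n i)" using y_in[OF i v(1)] unfolding line_def by blast
    qed
  qed
  have basis: "\<exists>u v. u \<in> line b i \<and> v \<in> line c i \<and> u \<noteq> 0 \<and> v \<noteq> 0 \<and>
      vsp M i = {s + t |s t. s \<in> line b i \<and> t \<in> line c i} \<and> line b i \<inter> line c i = {0}"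
    if i: "i \<in> {1..n}" for i
  proof -
    obtain p q where pq: "image i = span2 (tmul p b) (tmul q c)" using assms(2)[OF i] by (auto simp: adapted_def)
    then obtain u v where uv: "u \<in> vsp M i" "v \<in> vsp M i" "\<Phi> i u = tmul p b" "\<Phi> i v = tmul q c"
      using span2_base[of "tmul p b" "tmul q c"] unfolding image_def by (metis imageE span2_base(2))
    have u: "u \<in> line b i" and v: "v \<in> line c i" using uv by (auto simp: line_def tmul_def)
    have nz: "u \<noteq> 0" "v \<noteq> 0"
    proof -
      have "b \<noteq> 0" "c \<noteq> 0" using assms(1) by (auto simp: det2_def)
      moreover have "\<Phi> i 0 = 0" using \<Phi>_scale[OF i zero_in[OF i], of 0] by simp
      ultimately show "u \<noteq> 0" "v \<noteq> 0" using uv by (metis tmul_eq_0_iff)+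
    qed
    have "\<exists>s t. w = s + t \<and> s \<in> line b i \<and> t \<in> line c i" if w: "w \<in> vsp M i" for w
    proof -
      have "\<Phi> i w \<in> span2 (tmul p b) (tmul q c)" using w pq unfolding image_def by blast
      then obtain \<alpha> \<beta> where ab: "\<Phi> i w = oscale \<alpha> (tmul p b) + oscale \<beta> (tmul q c)" by (rule span2E)
      have in1: "zscale M \<alpha> u \<in> vsp M i" "zscale M \<beta> v \<in> vsp M i" using uv scale_in[OF i] by auto
      have "\<Phi> i (zscale M \<alpha> u + zscale M \<beta> v) = \<Phi> i w"
        using ab \<Phi>_add[OF i in1] \<Phi>_scale[OF i] uv by simp
      then have "w = zscale M \<alpha> u + zscale M \<beta> v"
        using \<Phi>_inj[OF i add_in[OF i in1] w] by simp
      moreover have "zscale M \<alpha> u \<in> line b i" "zscale M \<beta> v \<in> line c i"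
        using sub u v i by (auto simp: B_submodule_def intro: Z.subspace_scale)
      ultimately show ?thesis by blast
    qed
    moreover have "s + t \<in> vsp M i" if "s \<in> line b i" "t \<in> line c i" for s t
      using that add_in[OF i] by (auto simp: line_def)
    ultimately have "vsp M i = {s + t |s t. s \<in> line b i \<and> t \<in> line c i}" by blast
    moreover have "line b i \<inter> line c i = {0}"
    proof -
      have "w = 0" if "w \<in> line b i" "w \<in> line c i" for w
      proof -
        have "w \<in> vsp M i" "\<exists>r. \<Phi> i w = kscale r b" "\<exists>s. \<Phi> i w = kscale s c"
          using that by (simp_all add: line_def)
        then obtain r s where rs: "w \<in> vsp M i" "\<Phi> i w = kscale r b" "\<Phi> i w = kscale s c"
          by blast
        then have "kscale r b + kscale 0 c = kscale 0 b + kscale s c" by simp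
        then have "r = 0" using det2_independent[OF assms(1)] by blast
        then show ?thesis using kernel[OF i rs(1)] rs(2) by simp
      qed
      moreover have "0 \<in> line b i" "0 \<in> line c i"
        using sub i by (auto simp: B_submodule_def intro: Z.subspace_0)
      ultimately show ?thesis by blast
    qed
    ultimately show ?thesis using u v nz by blast
  qed
  have "(\<forall>i\<in>{1..n}. line b i = {0}) \<or> (\<forall>i\<in>{1..n}. line c i = {0})"
    using ind sub basis unfolding indecomposable_brep_def by blast
  moreover have "\<not> (\<forall>i\<in>{1..n}. line b i = {0})" "\<not> (\<forall>i\<in>{1..n}. line c i = {0})"
    using basis[of 1] k by auto
  ultimately show False by blast
qed

end

lemma plane_embedding_isomorphic:
  assumes "plane_embedding k n M \<Phi>" "plane_embedding k n M' \<Phi>'"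
    and "\<And>i. i \<in> {1..n} \<Longrightarrow> \<Phi> i ` vsp M i = \<Phi>' i ` vsp M' i"
  shows "brep_isomorphic n M M'"
proof -
  interpret M: plane_embedding k n M \<Phi> by fact
  interpret M': plane_embedding k n M' \<Phi>' by fact
  define f where "f i v = (SOME w. w \<in> vsp M' i \<and> \<Phi>' i w = \<Phi> i v)" for i v
  have f: "f i v \<in> vsp M' i" "\<Phi>' i (f i v) = \<Phi> i v" if "i \<in> {1..n}" "v \<in> vsp M i" for i v
  proof -
    have "\<Phi> i v \<in> \<Phi>' i ` vsp M' i" using assms(3)[OF that(1)] that(2) by blast
    then have "\<exists>w. w \<in> vsp M' i \<and> \<Phi>' i w = \<Phi> i v" by force
    then have "f i v \<in> vsp M' i \<and> \<Phi>' i (f i v) = \<Phi> i v" unfolding f_def by (rule someI_ex)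
    then show "f i v \<in> vsp M' i" "\<Phi>' i (f i v) = \<Phi> i v" by auto
  qed
  have "brep_hom n M M' f"
    unfolding brep_hom_def zlinear_on_def
  proof (intro ballI conjI allI)
    fix i assume i: "i \<in> {1..n}"
    have i': "prv n i \<in> {1..n}" by (rule prv_in[OF i])
    show "f i u \<in> vsp M' i" if "u \<in> vsp M i" for u using f i that by blast
    show "f i (u + v) = f i u + f i v" if uv: "u \<in> vsp M i" "v \<in> vsp M i" for u v
      by (rule M'.\<Phi>_inj[OF i])
        (use uv i f M.add_in[OF i uv] M.\<Phi>_add[OF i uv] M'.\<Phi>_add[OF i] M'.add_in[OF i] in auto)
    show "f i (zscale M c u) = zscale M' c (f i u)" if u: "u \<in> vsp M i" for c u
      by (rule M'.\<Phi>_inj[OF i])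
        (use u i f M.scale_in[OF i u] M.\<Phi>_scale[OF i u] M'.\<Phi>_scale[OF i] M'.scale_in[OF i] in auto)
    show "f i (xmap M i v) = xmap M' i (f (prv n i) v)" if v: "v \<in> vsp M (prv n i)" for v
      by (rule M'.\<Phi>_inj[OF i])
        (use v i i' f M.x_in[OF i v] M.\<Phi>_x[OF i v] M'.\<Phi>_x[OF i] M'.x_in[OF i] in auto)
    show "f (prv n i) (ymap M i v) = ymap M' i (f i v)" if v: "v \<in> vsp M i" for v
      by (rule M'.\<Phi>_inj[OF i'])
        (use v i i' f M.y_in[OF i v] M.\<Phi>_y[OF i v] M'.\<Phi>_y[OF i] M'.y_in[OF i] in auto)
  qed
  moreover have "bij_betw (f i) (vsp M i) (vsp M' i)" if i: "i \<in> {1..n}" for i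
    unfolding bij_betw_def
  proof
    show "inj_on (f i) (vsp M i)"
      by (rule inj_onI) (metis M.\<Phi>_inj f(2) i)
    show "f i ` vsp M i = vsp M' i"
    proof
      show "f i ` vsp M i \<subseteq> vsp M' i" using f i by blast
      show "vsp M' i \<subseteq> f i ` vsp M i"
      proof
        fix w assume w: "w \<in> vsp M' i"
        then obtain v where v: "v \<in> vsp M i" "\<Phi>' i w = \<Phi> i v"
          using assms(3)[OF i] by (metis imageE imageI)
        then have "w = f i v" using M'.\<Phi>_inj[OF i w] f[OF i v(1)] by simp
        then show "w \<in> f i ` vsp M i" using v by blast
      qed
    qed
  qed
  ultimately show ?thesis by (auto simp: brep_isomorphic_def brep_iso_def)
qed

section \<open>Free modules of rank two\<close>

lemma free_of_rank_2D:
  assumes "module s" "free_of_rank s V 2"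
  obtains b c where "b \<in> V" "c \<in> V" "V = {s \<alpha> b + s \<beta> c |\<alpha> \<beta>. True}"
    "\<forall>\<alpha> \<beta>. s \<alpha> b + s \<beta> c = 0 \<longrightarrow> \<alpha> = 0 \<and> \<beta> = 0"
proof -
  interpret module s by fact
  obtain X where X: "finite X" "card X = 2" "\<not> dependent X" "span X = V"
    using assms(2) by (auto simp: free_of_rank_def)
  obtain b c where bc: "X = {b, c}" "b \<noteq> c" using X(2) by (auto simp: card_2_iff)
  have "V = {s \<alpha> b + s \<beta> c |\<alpha> \<beta>. True}"
  proof
    show "V \<subseteq> {s \<alpha> b + s \<beta> c |\<alpha> \<beta>. True}"
      using X(1,4) bc by (auto simp: span_finite)
    show "{s \<alpha> b + s \<beta> c |\<alpha> \<beta>. True} \<subseteq> V"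
      unfolding X(4)[symmetric] bc(1) by (auto intro: span_add span_scale span_base)
  qed
  moreover have "\<alpha> = 0 \<and> \<beta> = 0" if "s \<alpha> b + s \<beta> c = 0" for \<alpha> \<beta>
  proof -
    define u where "u v = (if v = b then \<alpha> else \<beta>)" for v
    have u: "(\<Sum>v\<in>X. s (u v) v) = 0" using that bc by (simp add: u_def)
    have "\<not> (\<exists>v\<in>X. u v \<noteq> 0)"
    proof
      assume "\<exists>v\<in>X. u v \<noteq> 0"
      then have "dependent X" unfolding dependent_finite[OF X(1)] using u by (intro exI[of _ u] conjI)
      then show False using X(3) by contradiction
    qed
    then show ?thesis using bc by (auto simp: u_def)
  qed
  moreover have "b \<in> V" "c \<in> V" using bc X(4) span_base by auto
  ultimately show ?thesis using that by blast
qed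

lemma free_of_rank_2I:
  assumes "module s" "V = {s \<alpha> b + s \<beta> c |\<alpha> \<beta>. True}"
    "\<And>\<alpha> \<beta>. s \<alpha> b + s \<beta> c = 0 \<Longrightarrow> \<alpha> = 0 \<and> \<beta> = (0::complex fps)"
  shows "free_of_rank s V 2"
proof -
  interpret module s by fact
  have bc: "b \<noteq> c" using assms(3)[of 1 "-1"] by auto
  have "\<not> dependent {b, c}"
  proof
    assume "dependent {b, c}"
    then obtain u where u: "\<exists>v\<in>{b, c}. u v \<noteq> 0" "(\<Sum>v\<in>{b, c}. s (u v) v) = 0"
      by (auto simp: dependent_finite)
    then have "s (u b) b + s (u c) c = 0" using bc by simp
    then show False using assms(3) u(1) by blast
  qed
  moreover have "span {b, c} = V"
  proof
    show "span {b, c} \<subseteq> V" using bc by (auto simp: span_finite assms(2))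
    show "V \<subseteq> span {b, c}"
      unfolding assms(2) by (auto intro: span_add span_scale span_base)
  qed
  ultimately show ?thesis using bc by (auto simp: free_of_rank_def intro!: exI[of _ "{b, c}"])
qed

text \<open>A basis at vertex k is sent to e1, e2 and the map is extended to the other vertices.
  Injectivity travels around the cycle: if \<Phi> v = 0, then y v lies in the kernel one step back
  and vanishes, so t v = x y v = 0, and v = 0 because the module is free.\<close>

lemma (in B_mod) rank_2_embedding:
  assumes "has_rank n M 2"
  obtains \<Phi> where "plane_embedding k n M \<Phi>" "\<Phi> k ` vsp M k = std_lattice"
proof -
  have free: "free_of_rank (zscale M) (vsp M i) 2" if "i \<in> {1..n}" for i
    using assms that by (auto simp: has_rank_def)
  have kk: "k \<in> {1..n}" using k by auto
  obtain b c where bc: "b \<in> vsp M k" "c \<in> vsp M k" "vsp M k = {zscale M \<alpha> b + zscale M \<beta> c |\<alpha> \<beta>. True}"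
    and ind: "\<forall>\<alpha> \<beta>. zscale M \<alpha> b + zscale M \<beta> c = 0 \<longrightarrow> \<alpha> = 0 \<and> \<beta> = 0"
    using free_of_rank_2D[OF Z.module_axioms free[OF kk]] .
  have uniq: "\<alpha> = \<gamma> \<and> \<beta> = \<delta>" if "zscale M \<alpha> b + zscale M \<beta> c = zscale M \<gamma> b + zscale M \<delta> c" for \<alpha> \<beta> \<gamma> \<delta>
    using ind[rule_format, of "\<alpha> - \<gamma>" "\<beta> - \<delta>"] that by (simp add: Z.scale_left_diff_distrib algebra_simps)
  define \<psi> where "\<psi> v = (SOME w. \<exists>\<alpha> \<beta>. v = zscale M \<alpha> b + zscale M \<beta> c \<and>
      w = oscale \<alpha> unit1 + oscale \<beta> unit2)" for v
  have \<psi>: "\<psi> (zscale M \<alpha> b + zscale M \<beta> c) = oscale \<alpha> unit1 + oscale \<beta> unit2" for \<alpha> \<beta>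
    unfolding \<psi>_def by (rule some_equality) (use uniq in blast)+
  have lin: "zlinear_on (zscale M) (vsp M k) oscale UNIV \<psi>"
    unfolding zlinear_on_def
  proof (intro conjI ballI allI)
    fix u v assume "u \<in> vsp M k" "v \<in> vsp M k"
    then obtain \<alpha> \<beta> \<gamma> \<delta> where uv: "u = zscale M \<alpha> b + zscale M \<beta> c" "v = zscale M \<gamma> b + zscale M \<delta> c"
      using bc(3) by auto
    then have "u + v = zscale M (\<alpha> + \<gamma>) b + zscale M (\<beta> + \<delta>) c"
      by (simp add: Z.scale_left_distrib)
    then show "\<psi> (u + v) = \<psi> u + \<psi> v" unfolding uv by (simp add: \<psi> oscale.scale_left_distrib)
  next
    fix e u assume "u \<in> vsp M k"
    then obtain \<alpha> \<beta> where u: "u = zscale M \<alpha> b + zscale M \<beta> c" using bc(3) by auto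
    then have "zscale M e u = zscale M (e * \<alpha>) b + zscale M (e * \<beta>) c"
      by (simp add: Z.scale_right_distrib)
    then show "\<psi> (zscale M e u) = oscale e (\<psi> u)" unfolding u by (simp add: \<psi> oscale.scale_right_distrib)
  qed auto
  obtain \<Phi> where \<Phi>: "brep_hom n M (const_rep k) \<Phi>" "\<And>v. v \<in> vsp M k \<Longrightarrow> \<Phi> k v = \<psi> v"
    using extend_from_vertex[OF lin] by blast
  have torsion: "v = 0" if i: "i \<in> {1..n}" and v: "v \<in> vsp M i" "zscale M fps_X v = 0" for i v
  proof -
    obtain g h where "g \<in> vsp M i" "h \<in> vsp M i" and gh: "vsp M i = {zscale M \<alpha> g + zscale M \<beta> h |\<alpha> \<beta>. True}"
      and ind: "\<forall>\<alpha> \<beta>. zscale M \<alpha> g + zscale M \<beta> h = 0 \<longrightarrow> \<alpha> = 0 \<and> \<beta> = 0"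
      using free_of_rank_2D[OF Z.module_axioms free[OF i]] .
    obtain \<alpha> \<beta> where u: "v = zscale M \<alpha> g + zscale M \<beta> h" using gh v by auto
    then have "zscale M (fps_X * \<alpha>) g + zscale M (fps_X * \<beta>) h = 0"
      using v(2) by (simp add: Z.scale_right_distrib)
    then have "fps_X * \<alpha> = 0 \<and> fps_X * \<beta> = 0" by (rule ind[rule_format])
    then show ?thesis using u by simp
  qed
  have ker: "\<forall>v\<in>vsp M i. \<Phi> i v = 0 \<longrightarrow> v = 0" if "i \<in> {1..n}" for i
  proof (rule cyclic_induct[where k = k and P = "\<lambda>i. \<forall>v\<in>vsp M i. \<Phi> i v = 0 \<longrightarrow> v = 0"])
    show "\<forall>v\<in>vsp M k. \<Phi> k v = 0 \<longrightarrow> v = 0"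
    proof (intro ballI impI)
      fix v assume v: "v \<in> vsp M k" "\<Phi> k v = 0"
      then obtain \<alpha> \<beta> where u: "v = zscale M \<alpha> b + zscale M \<beta> c" using bc(3) by auto
      then have "oscale \<alpha> unit1 + oscale \<beta> unit2 = 0" using v \<Phi>(2)[OF v(1)] \<psi> by simp
      then have "vx (oscale \<alpha> unit1 + oscale \<beta> unit2) = 0" "vy (oscale \<alpha> unit1 + oscale \<beta> unit2) = 0"
        by simp_all
      then show "v = 0" using u by simp
    qed
    fix i assume i: "i \<in> {1..n}" and IH: "\<forall>v\<in>vsp M (prv n i). \<Phi> (prv n i) v = 0 \<longrightarrow> v = 0"
    show "\<forall>v\<in>vsp M i. \<Phi> i v = 0 \<longrightarrow> v = 0"
    proof (intro ballI impI)
      fix v assume v: "v \<in> vsp M i" "\<Phi> i v = 0"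
      then have "\<Phi> (prv n i) (ymap M i v) = 0" using plane_homD(4)[OF \<Phi>(1) i v(1)] by simp
      then have "ymap M i v = 0" using IH y_in[OF i v(1)] by blast
      moreover have "xmap M i 0 = 0"
        using x_scale[OF i zero_in[OF prv_in[OF i]], of 0] by simp
      ultimately have "zscale M fps_X v = 0" using xy[OF i v(1)] by simp
      then show "v = 0" using torsion[OF i v(1)] by blast
    qed
  qed (use kk that in auto)
  have "plane_embedding k n M \<Phi>"
    using \<Phi>(1) ker by unfold_locales auto
  moreover have "\<Phi> k ` vsp M k = std_lattice"
  proof -
    have "\<Phi> k ` vsp M k = \<psi> ` vsp M k" using \<Phi>(2) by (rule image_cong[OF refl])
    also have "\<dots> = span2 unit1 unit2"
    proof (intro equalityI subsetI)
      fix w assume "w \<in> \<psi> ` vsp M k"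
      then obtain v where "w = \<psi> v" "v \<in> vsp M k" by blast
      moreover from this obtain \<alpha> \<beta> where "v = zscale M \<alpha> b + zscale M \<beta> c" using bc(3) by auto
      ultimately show "w \<in> span2 unit1 unit2" using \<psi> by (simp add: span2I)
    next
      fix w assume "w \<in> span2 unit1 unit2"
      then obtain \<alpha> \<beta> where "w = oscale \<alpha> unit1 + oscale \<beta> unit2" by (rule span2E)
      then have "w = \<psi> (zscale M \<alpha> b + zscale M \<beta> c)" using \<psi> by simp
      moreover have "zscale M \<alpha> b + zscale M \<beta> c \<in> vsp M k" using bc(3) by blast
      ultimately show "w \<in> \<psi> ` vsp M k" by blast
    qed
    finally show ?thesis by (simp add: std_lattice_eq_span2)
  qed
  ultimately show ?thesis using that by blast
qed

section \<open>Root vectors of degree two and the tripod modules\<close>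

text \<open>Combinatorial form of the vector of a real root of degree 2. The remaining k - 3 entries
  are 2, that is none for (3,9) and one for (4,8).\<close>

locale root_vec =
  fixes k n :: nat and a :: "nat \<Rightarrow> int"
  assumes kn: "(k, n) = (3, 9) \<or> (k, n) = (4, 8)"
    and a: "\<And>i. i \<in> {1..n} \<Longrightarrow> a i \<in> {0, 1, 2}"
    and ones: "card {i \<in> {1..n}. a i = 1} = 6"
    and zeros: "card {i \<in> {1..n}. a i = 0} = n - k - 3"
begin

section \<open>Bookkeeping around the cycle\<close>

lemma k_bounds: "1 \<le> k" "k < n" "k + 3 \<le> n" "3 \<le> k"
  using kn by auto

text \<open>Position of the walk after the arrows 1, ..., i: one step for each entry 1.\<close>

definition cnt :: "nat \<Rightarrow> nat" where "cnt i = card {j \<in> {1..i}. a j = 1}"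

definition zer :: "nat \<Rightarrow> nat" where "zer i = card {j \<in> {1..i}. a j = 0}"

text \<open>Exponent by which the lattice at vertex i is scaled against the walk. The truncated
  difference i - k is the sum of the \<open>eps\<close> up to i, each entry 0 lowers the exponent by
  one, and a full turn raises it by (n - k) - (n - k - 3) = 3. The initial value n keeps the
  lattices of the tripod modules inside the plane over C[[t]].\<close>

definition wt :: "nat \<Rightarrow> int" where "wt i = int n + int (i - k) - int (zer i)"

lemma card_filter_Suc:
  "card {j \<in> {1..Suc i}. P j} = card {j \<in> {1..i}. P j} + (if P (Suc i) then 1 else 0)"
proof -
  have "{j \<in> {1..Suc i}. P j} = (if P (Suc i) then insert (Suc i) {j \<in> {1..i}. P j} else {j \<in> {1..i}. P j})"
    by (auto simp: le_Suc_eq)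
  then show ?thesis by simp
qed

lemma cnt_0 [simp]: "cnt 0 = 0" and cnt_n [simp]: "cnt n = 6"
  using ones by (auto simp: cnt_def)

lemma cnt_Suc: "cnt (Suc i) = cnt i + (if a (Suc i) = 1 then 1 else 0)"
  unfolding cnt_def by (rule card_filter_Suc)

lemma cnt_step: "i \<in> {1..n} \<Longrightarrow> cnt i = cnt (i - 1) + (if a i = 1 then 1 else 0)"
  using cnt_Suc[of "i - 1"] by simp

lemma cnt_mono: "i \<le> j \<Longrightarrow> cnt i \<le> cnt j"
  by (induction j rule: dec_induct) (auto simp: cnt_Suc)

lemma cnt_le: "i \<le> n \<Longrightarrow> cnt i \<le> 6"
  using cnt_mono[of i n] by simp

lemma cnt_surj:
  assumes "1 \<le> m" "m \<le> 6" obtains i where "i \<in> {1..n}" "cnt i = m"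
proof -
  define i where "i = (LEAST i. m \<le> cnt i)"
  have i: "m \<le> cnt i" "i \<le> n" unfolding i_def
    using assms LeastI[of "\<lambda>i. m \<le> cnt i" n] Least_le[of "\<lambda>i. m \<le> cnt i" n] by auto
  have "i \<noteq> 0" using i assms by (metis cnt_0 not_one_le_zero order_trans)
  moreover have "\<not> m \<le> cnt (i - 1)"
    using not_less_Least[of "i - 1" "\<lambda>i. m \<le> cnt i"] \<open>i \<noteq> 0\<close> by (simp add: i_def)
  ultimately have "cnt i = m" using i cnt_step[of i] by (auto split: if_splits)
  then show ?thesis using that[of i] i \<open>i \<noteq> 0\<close> by simp
qed

lemma wt_0 [simp]: "wt 0 = int n" and wt_n [simp]: "wt n = int n + 3"
  using zeros k_bounds by (auto simp: wt_def zer_def)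

lemma wt_step: "i \<in> {1..n} \<Longrightarrow> wt i = wt (i - 1) + eps k i - (if a i = 0 then 1 else 0)"
  using card_filter_Suc[of "i - 1" "\<lambda>j. a j = 0"] by (auto simp: wt_def zer_def eps_def)

lemma wt_ge: assumes "i \<le> n" shows "6 \<le> wt i"
proof -
  have "zer i \<le> card {i \<in> {1..n}. a i = 0}" unfolding zer_def
    using assms by (intro card_mono) auto
  then show ?thesis using zeros k_bounds by (simp add: wt_def)
qed

lemma constant_between:
  assumes "\<And>i. i \<in> {1..n} \<Longrightarrow> a i \<noteq> 1 \<Longrightarrow> Z i = Z (i - 1)" "i \<le> j" "j \<le> n" "cnt i = cnt j"
  shows "Z i = Z j"
  using assms(2-)
proof (induction j rule: dec_induct)
  case (step j)
  then have "cnt j = cnt i" using cnt_mono[of i j] cnt_mono[of j "Suc j"] by simp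
  moreover from this have "a (Suc j) \<noteq> 1" using step cnt_Suc[of j] by auto
  ultimately show ?case using step assms(1)[of "Suc j"] by simp
qed simp

text \<open>A family over the vertices that changes only at the six arrows with \<open>a\<^sub>i = 1\<close>, and is
  multiplied by \<open>T 1\<close> by a full turn, is read off from a sequence with period six up to \<open>T\<close>.\<close>

lemma periodic_sequence:
  fixes Z :: "nat \<Rightarrow> 'b" and T :: "int \<Rightarrow> 'b \<Rightarrow> 'b"
  assumes T: "\<And>p q x. T (p + q) x = T p (T q x)" "\<And>x. T 0 x = x"
    and R: "\<And>q x y. R x y \<Longrightarrow> R (T q x) (T q y)"
    and const: "\<And>i. i \<in> {1..n} \<Longrightarrow> a i \<noteq> 1 \<Longrightarrow> Z i = Z (i - 1)"
    and step: "\<And>i. i \<in> {1..n} \<Longrightarrow> a i = 1 \<Longrightarrow> R (Z (i - 1)) (Z i)"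
    and turn: "Z n = T 1 (Z 0)"
  obtains L where "\<And>i. i \<le> n \<Longrightarrow> Z i = L (int (cnt i))" "\<And>m. L (m + 6) = T 1 (L m)"
    "\<And>m. R (L m) (L (m + 1))"
proof -
  define v where "v m = (SOME i. i \<le> n \<and> cnt i = m)" for m
  have v: "v m \<le> n \<and> cnt (v m) = m" if m: "m \<le> 6" for m
  proof -
    have "\<exists>i. i \<le> n \<and> cnt i = m"
    proof (cases "m = 0")
      case True then show ?thesis by (intro exI[of _ 0]) simp
    next
      case False
      then obtain i where "i \<in> {1..n}" "cnt i = m" using cnt_surj[of m] m by auto
      then show ?thesis by auto
    qed
    then show ?thesis unfolding v_def by (rule someI_ex)
  qed
  have same: "Z i = Z j" if "i \<le> n" "j \<le> n" "cnt i = cnt j" for i j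
    using constant_between[of Z i j] constant_between[of Z j i] const that by (metis nat_le_linear)
  define L0 where "L0 m = Z (v m)" for m
  have L0: "Z i = L0 (cnt i)" if "i \<le> n" for i
    unfolding L0_def using v[of "cnt i"] cnt_le[OF that] that by (intro same) auto
  have L06: "L0 6 = T 1 (L0 0)" using L0[of n] L0[of 0] turn by simp
  have stepL0: "R (L0 m) (L0 (Suc m))" if "m < 6" for m
  proof -
    \<comment> \<open>The arrow at which the count passes from m to m + 1; its entry is 1 because
      the count grows there.\<close>
    define i where "i = (LEAST i. Suc m \<le> cnt i)"
    have i: "Suc m \<le> cnt i" "i \<le> n" unfolding i_def
      using that LeastI[of "\<lambda>i. Suc m \<le> cnt i" n] Least_le[of "\<lambda>i. Suc m \<le> cnt i" n] by auto
    have "i \<noteq> 0" using i by (metis cnt_0 not_less_eq_eq zero_le)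
    moreover have "\<not> Suc m \<le> cnt (i - 1)"
      using not_less_Least[of "i - 1" "\<lambda>i. Suc m \<le> cnt i"] \<open>i \<noteq> 0\<close> by (simp add: i_def)
    ultimately have "cnt i = Suc m" "cnt (i - 1) = m" "a i = 1" "i \<in> {1..n}"
      using i cnt_step[of i] by (auto split: if_splits)
    then show ?thesis using step[of i] L0[of i] L0[of "i - 1"] by auto
  qed
  define L where "L m = T (m div 6) (L0 (nat (m mod 6)))" for m
  have "Z i = L (int (cnt i))" if "i \<le> n" for i
  \<comment> \<open>Count 6 already belongs to the next period and is reached as T 1 of the value at
    count 0.\<close>
  proof (cases "cnt i = 6")
    case True then show ?thesis using L0[OF that] L06 by (simp add: L_def)
  next
    case False
    then have "cnt i < 6" using cnt_le[OF that] by simp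
    then show ?thesis using L0[OF that] T(2) by (simp add: L_def)
  qed
  moreover have "L (m + 6) = T 1 (L m)" for m
  proof -
    have d: "(m + 6) div 6 = 1 + m div 6" "(m + 6) mod 6 = m mod 6" by simp_all
    have "L (m + 6) = T (1 + m div 6) (L0 (nat (m mod 6)))" using d by (simp only: L_def)
    also have "\<dots> = T 1 (L m)" by (simp only: T(1) L_def)
    finally show ?thesis .
  qed
  moreover have "R (L m) (L (m + 1))" for m
  proof (cases "m mod 6 = 5")
    case True
    then have d: "(m + 1) div 6 = m div 6 + 1" "(m + 1) mod 6 = 0" by presburger+
    have "L (m + 1) = T (m div 6 + 1) (L0 0)" using d by (simp only: L_def nat_0)
    also have "\<dots> = T (m div 6) (L0 6)" by (simp only: T(1) L06)
    finally have "L (m + 1) = T (m div 6) (L0 (Suc 5))" by simp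
    moreover have "L m = T (m div 6) (L0 5)" using True by (simp add: L_def)
    ultimately show ?thesis using R stepL0[of 5] by simp
  next
    case False
    then have d: "(m + 1) div 6 = m div 6" "(m + 1) mod 6 = m mod 6 + 1" by presburger+
    have b: "m mod 6 < 5" "0 \<le> m mod 6" using False by presburger+
    have L1: "L (m + 1) = T (m div 6) (L0 (Suc (nat (m mod 6))))"
      unfolding L_def d using b by (simp add: Suc_nat_eq_nat_zadd1 add.commute)
    show ?thesis unfolding L1 L_def[of m]
    proof (intro R stepL0)
      show "nat (m mod 6) < 6" using b by linarith
    qed
  qed
  ultimately show ?thesis using that by blast
qed

text \<open>Undoes the normalisation. The indices 0 and n carry the same lattice: six steps give
  t^(-3), and \<open>wt\<close> has grown by 3.\<close>

definition tripod_lattice :: "int \<Rightarrow> nat \<Rightarrow> plane set" where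
  "tripod_lattice e i = tmul (wt i) ` tripod (int (cnt i) + e)"

lemma tripod_lattice_0: "tripod_lattice e 0 = tripod_lattice e n"
  using tripod_period[of e] by (simp add: tripod_lattice_def add.commute)

lemma tripod_lattice_prv: "i \<in> {1..n} \<Longrightarrow> tripod_lattice e (prv n i) = tripod_lattice e (i - 1)"
  using tripod_lattice_0 by (auto simp: prv_def)

end

lemma neighbour_flip: "neighbour A B \<Longrightarrow> o_submodule B \<Longrightarrow> neighbour (tmul 1 ` B) A"
  by (auto simp: neighbour_def o_submodule_tmul_image)

lemma neighbour_tripod: "neighbour (tripod m) (tripod (m + 1))"
proof (cases "even m")
  case True
  then have "(m + 1 + 1) div 2 = 1 + m div 2" by presburger
  then have "tripod (m + 1) = tmul (- (m div 2)) ` tmul (-1) ` leg ((m + 1) mod 6)"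
    using True by (simp add: tripod_def add.commute)
  moreover have "neighbour std_lattice (tmul (-1) ` leg ((m + 1) mod 6))"
    using neighbour_flip[OF neighbour_leg o_submodule_std_lattice, of "(m + 1) mod 6"]
      neighbour_tmul[of "-1" "tmul 1 ` std_lattice"] by simp
  ultimately show ?thesis using True by (simp only: tripod_def neighbour_tmul if_True)
next
  case False
  then show ?thesis using neighbour_leg by (simp add: tripod_def)
qed

lemma o_submodule_tripod: "o_submodule (tripod m)"
  using neighbour_tripod by (auto simp: neighbour_def)

lemma lattice2_std_lattice: "lattice2 std_lattice"
  unfolding std_lattice_eq_span2 lattice2_def by (intro exI conjI) (auto simp: det2_def)

lemma lattice2_tripod: "lattice2 (tripod m)"
proof (cases "even m")
  case True then show ?thesis by (simp add: tripod_def lattice2_tmul lattice2_std_lattice)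
next
  case False
  then have "even (m + 1)" by simp
  then have "lattice2 (tripod (m + 1))" by (simp add: tripod_def lattice2_tmul lattice2_std_lattice)
  then show ?thesis using neighbour_lattice_down neighbour_tripod by blast
qed

lemma tmul_std_lattice_subset: "0 \<le> m \<Longrightarrow> tmul m ` std_lattice \<subseteq> std_lattice"
  using o_submodule_tmul_nonneg[OF o_submodule_std_lattice] by auto

text \<open>The two bounds coincide at even positions and differ by one factor t at odd ones: every
  vertex of the tripod is at distance at most 1 from its centre.\<close>

lemma tripod_bounds:
  "tripod m \<subseteq> tmul (- ((m + 1) div 2)) ` std_lattice" "tmul (- (m div 2)) ` std_lattice \<subseteq> tripod m"
proof -
  have "tripod m \<subseteq> tmul (- ((m + 1) div 2)) ` std_lattice \<and> tmul (- (m div 2)) ` std_lattice \<subseteq> tripod m"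
  proof (cases "even m")
    case True
    then have "(m + 1) div 2 = m div 2" by presburger
    then show ?thesis using True by (simp add: tripod_def)
  next
    case False
    then have "(m + 1) div 2 = m div 2 + 1" by presburger
    then have *: "tmul (- (m div 2)) ` S = tmul (- ((m + 1) div 2)) ` tmul 1 ` S" for S by simp
    have "leg l \<subseteq> std_lattice" "tmul 1 ` std_lattice \<subseteq> leg l" for l
      using leg_between by blast+
    then show ?thesis using False unfolding * by (simp only: tripod_def tmul_image_subset_iff if_False)
  qed
  then show "tripod m \<subseteq> tmul (- ((m + 1) div 2)) ` std_lattice"
    "tmul (- (m div 2)) ` std_lattice \<subseteq> tripod m" by auto
qed

context root_vec
begin

lemma tripod_lattice_step_cases:
  assumes i: "i \<in> {1..n}"
  shows "a i = 2 \<Longrightarrow> tripod_lattice e i = tmul (eps k i) ` tripod_lattice e (prv n i)"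
    "a i = 0 \<Longrightarrow> tripod_lattice e (prv n i) = tmul (1 - eps k i) ` tripod_lattice e i"
    "a i = 1 \<Longrightarrow> neighbour (tmul (eps k i) ` tripod_lattice e (prv n i)) (tripod_lattice e i)"
proof -
  have *: "tmul (eps k i) ` tripod_lattice e (prv n i) =
      tmul (wt (i - 1) + eps k i) ` tripod (int (cnt (i - 1)) + e)"
    unfolding tripod_lattice_prv[OF i] by (simp add: tripod_lattice_def add.commute)
  show "tripod_lattice e i = tmul (eps k i) ` tripod_lattice e (prv n i)" if "a i = 2"
    unfolding * using that cnt_step[OF i] wt_step[OF i] by (simp add: tripod_lattice_def)
  show "tripod_lattice e (prv n i) = tmul (1 - eps k i) ` tripod_lattice e i" if "a i = 0"
    unfolding tripod_lattice_prv[OF i]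
    using that cnt_step[OF i] wt_step[OF i] by (simp add: tripod_lattice_def)
  show "neighbour (tmul (eps k i) ` tripod_lattice e (prv n i)) (tripod_lattice e i)" if "a i = 1"
    unfolding * using that cnt_step[OF i] wt_step[OF i] neighbour_tripod[of "int (cnt (i - 1)) + e"]
    by (simp add: tripod_lattice_def add_ac)
qed

lemma o_submodule_tripod_lattice: "o_submodule (tripod_lattice e i)"
  by (simp add: tripod_lattice_def o_submodule_tmul_image o_submodule_tripod)

lemma tripod_lattice_step:
  assumes i: "i \<in> {1..n}"
  shows "tmul (eps k i) ` tripod_lattice e (prv n i) \<subseteq> tripod_lattice e i"
    "tmul (1 - eps k i) ` tripod_lattice e i \<subseteq> tripod_lattice e (prv n i)"
proof -
  \<comment> \<open>After scaling by a power of t both inclusions say that the image of x lies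
    between t times the lattice and the lattice.\<close>
  have *: "tmul (1 - eps k i) ` A \<subseteq> B \<longleftrightarrow> tmul 1 ` A \<subseteq> tmul (eps k i) ` B" for A B
    using tmul_image_subset_iff[of "eps k i" "tmul (1 - eps k i) ` A" B] by simp
  have up: "tmul 1 ` S \<subseteq> S" if "o_submodule S" for S
    using o_submodule_tmul_nonneg[OF that] by auto
  consider "a i = 0" | "a i = 1" | "a i = 2" using a[OF i] by auto
  then have "tmul (eps k i) ` tripod_lattice e (prv n i) \<subseteq> tripod_lattice e i \<and>
    tmul 1 ` tripod_lattice e i \<subseteq> tmul (eps k i) ` tripod_lattice e (prv n i)"
  proof cases
    case 1
    then have "tmul (eps k i) ` tripod_lattice e (prv n i) = tmul 1 ` tripod_lattice e i"
      using tripod_lattice_step_cases(2)[OF i, of e] by simp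
    then show ?thesis using up[OF o_submodule_tripod_lattice] by simp
  next
    case 2
    then show ?thesis using tripod_lattice_step_cases(3)[OF i, of e] by (simp add: neighbour_def psubset_eq)
  next
    case 3
    then show ?thesis using tripod_lattice_step_cases(1)[OF i, of e] up[OF o_submodule_tripod_lattice[of e i]]
      by simp
  qed
  then show "tmul (eps k i) ` tripod_lattice e (prv n i) \<subseteq> tripod_lattice e i"
    "tmul (1 - eps k i) ` tripod_lattice e i \<subseteq> tripod_lattice e (prv n i)"
    unfolding * by auto
qed

end

section \<open>Modules attached to cyclic families of lattices\<close>

primrec x_exponent :: "nat \<Rightarrow> nat \<Rightarrow> nat \<Rightarrow> nat \<Rightarrow> int" where
  "x_exponent n k 0 i = 0"
| "x_exponent n k (Suc m) i = eps k (nxt n i) + x_exponent n k m (nxt n i)"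

primrec y_exponent :: "nat \<Rightarrow> nat \<Rightarrow> nat \<Rightarrow> nat \<Rightarrow> int" where
  "y_exponent n k 0 i = 0"
| "y_exponent n k (Suc m) i = 1 - eps k i + y_exponent n k m (prv n i)"

text \<open>A path acts on the constant representation by a power of t. The relation x^k = y^(n - k)
  becomes an equality of two exponents, which is evaluated at each vertex of both quivers.\<close>

lemma const_rep_path:
  assumes "(k, n) = (3, 9) \<or> (k, n) = (4, 8)" "i \<in> {1..n}"
  shows "xpow n (const_rep k) k i v = ypow n (const_rep k) (n - k) i v"
proof -
  have x: "xpow n (const_rep k) m i v = tmul (x_exponent n k m i) v" for m i v
    by (induction m arbitrary: i v) (simp_all add: add.commute)
  have y: "ypow n (const_rep k) m i v = tmul (y_exponent n k m i) v" for m i v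
    by (induction m arbitrary: i v) (simp_all add: add.commute)
  have "\<forall>i\<in>set [1..<10]. x_exponent 9 3 3 i = y_exponent 9 3 6 i" by code_simp
  moreover have "\<forall>i\<in>set [1..<9]. x_exponent 8 4 4 i = y_exponent 8 4 4 i" by code_simp
  ultimately have "x_exponent n k k i = y_exponent n k (n - k) i"
    using assms by (elim disjE) (simp_all add: atLeastLessThanSuc_atLeastAtMost[symmetric])
  then show ?thesis using x y by simp
qed

text \<open>The ambient set \<open>V\<close> is needed for modules whose elements are functions on \<open>nat\<close>: there the
  coordinate map to the plane is injective only on functions supported on \<open>{0, 1}\<close>.\<close>

lemma plane_embeddingI:
  fixes M :: "'v::ab_group_add brep" and \<phi> :: "'v \<Rightarrow> plane"
  assumes kn: "(k, n) = (3, 9) \<or> (k, n) = (4, 8)"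
    and "module (zscale M)"
    and sub: "\<And>i. i \<in> {1..n} \<Longrightarrow> vsp M i \<subseteq> V" "\<And>i. i \<in> {1..n} \<Longrightarrow> module.subspace (zscale M) (vsp M i)"
    and x: "\<And>i v. i \<in> {1..n} \<Longrightarrow> v \<in> vsp M (prv n i) \<Longrightarrow> xmap M i v \<in> vsp M i"
    and y: "\<And>i v. i \<in> {1..n} \<Longrightarrow> v \<in> vsp M i \<Longrightarrow> ymap M i v \<in> vsp M (prv n i)"
    and V: "\<And>u v. u \<in> V \<Longrightarrow> v \<in> V \<Longrightarrow> u + v \<in> V" "\<And>c v. v \<in> V \<Longrightarrow> zscale M c v \<in> V"
      "\<And>i v. v \<in> V \<Longrightarrow> xmap M i v \<in> V" "\<And>i v. v \<in> V \<Longrightarrow> ymap M i v \<in> V"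
    and \<phi>: "inj_on \<phi> V" "\<And>u v. \<phi> (u + v) = \<phi> u + \<phi> v" "\<And>c v. \<phi> (zscale M c v) = oscale c (\<phi> v)"
      "\<And>i v. \<phi> (xmap M i v) = tmul (eps k i) (\<phi> v)" "\<And>i v. \<phi> (ymap M i v) = tmul (1 - eps k i) (\<phi> v)"
  shows "plane_embedding k n M (\<lambda>i. \<phi>)"
proof -
  interpret Z: module "zscale M" by fact
  have n: "k < n" "1 \<le> k" using kn by auto
  have eqI: "u = v" if "u \<in> V" "v \<in> V" "\<phi> u = \<phi> v" for u v
    using \<phi>(1) that by (auto dest: inj_onD)
  have xp: "xpow n M m i v \<in> V \<and> \<phi> (xpow n M m i v) = xpow n (const_rep k) m i (\<phi> v)" if "v \<in> V" for m i v
    using that by (induction m arbitrary: i v) (auto simp: V \<phi>)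
  have yp: "ypow n M m i v \<in> V \<and> \<phi> (ypow n M m i v) = ypow n (const_rep k) m i (\<phi> v)" if "v \<in> V" for m i v
    using that by (induction m arbitrary: i v) (auto simp: V \<phi>)
  have "B_module k n M"
    unfolding B_module_def zlinear_on_def
  proof (intro conjI ballI allI)
    fix i assume i: "i \<in> {1..n}"
    have i': "prv n i \<in> {1..n}" by (rule prv_in[OF i])
    show "Z.subspace (vsp M i)" using sub i by blast
    show "xmap M i v \<in> vsp M i" if "v \<in> vsp M (prv n i)" for v using x i that by blast
    show "ymap M i v \<in> vsp M (prv n i)" if "v \<in> vsp M i" for v using y i that by blast
    show "xmap M i (u + v) = xmap M i u + xmap M i v"
      if "u \<in> vsp M (prv n i)" "v \<in> vsp M (prv n i)" for u v
      by (rule eqI; use sub(1)[OF i'] that in \<open>auto simp: V \<phi> tmul_add subset_iff\<close>)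
    show "ymap M i (u + v) = ymap M i u + ymap M i v"
      if "u \<in> vsp M i" "v \<in> vsp M i" for u v
      by (rule eqI; use sub(1)[OF i] that in \<open>auto simp: V \<phi> tmul_add subset_iff\<close>)
    show "xmap M i (zscale M c u) = zscale M c (xmap M i u)" if "u \<in> vsp M (prv n i)" for c u
      by (rule eqI; use sub(1)[OF i'] that in \<open>auto simp: V \<phi> tmul_oscale subset_iff\<close>)
    show "ymap M i (zscale M c u) = zscale M c (ymap M i u)" if "u \<in> vsp M i" for c u
      by (rule eqI; use sub(1)[OF i] that in \<open>auto simp: V \<phi> tmul_oscale subset_iff\<close>)
    fix v assume "v \<in> vsp M i"
    then have v: "v \<in> V" using sub(1)[OF i] by blast
    show "xmap M i (ymap M i v) = zscale M fps_X v"
      using v by (intro eqI) (auto simp: V \<phi> oscale_X)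
    show "ymap M (nxt n i) (xmap M (nxt n i) v) = zscale M fps_X v"
      using v by (intro eqI) (auto simp: V \<phi> oscale_X)
    show "xpow n M k i v = ypow n M (n - k) i v"
      using v xp yp const_rep_path[OF kn i] by (intro eqI) auto
  qed (rule Z.module_axioms)
  then show ?thesis
  proof (unfold_locales, goal_cases)
    case 4 then show ?case
      by (auto simp: brep_hom_def zlinear_on_def \<phi>)
  next
    case (5 i v)
    have "0 \<in> V" using V(2)[of v 0] sub(1) 5 by auto
    moreover have "\<phi> 0 = 0" using \<phi>(2)[of 0 0] by simp
    ultimately show ?case using eqI[of v 0] 5 sub(1) by auto
  qed (use n in auto)
qed

definition fps_vec :: "complex fps \<times> complex fps \<Rightarrow> plane" where
  "fps_vec v = Vec (fps_to_fls (fst v)) (fps_to_fls (snd v))"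

text \<open>A family of lattices realised on pairs of power series, the concrete carrier of the two
  modules. If A i lies inside \<open>std_lattice\<close>, then \<open>fps_vec\<close> identifies the
  carrier at i with A i.\<close>

definition fps_lattice_rep :: "nat \<Rightarrow> (nat \<Rightarrow> plane set) \<Rightarrow> (complex fps \<times> complex fps) brep" where
  "fps_lattice_rep k A = \<lparr> zscale = (\<lambda>c. map_prod ((*) c) ((*) c)), vsp = (\<lambda>i. fps_vec -` A i),
     xmap = (\<lambda>i. if i \<le> k then id else map_prod ((*) fps_X) ((*) fps_X)),
     ymap = (\<lambda>i. if i \<le> k then map_prod ((*) fps_X) ((*) fps_X) else id) \<rparr>"

lemma fps_vec_simps:
  "fps_vec (u + v) = fps_vec u + fps_vec v" "fps_vec 0 = 0"
  "fps_vec (map_prod ((*) c) ((*) c) v) = oscale c (fps_vec v)"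
  by (auto simp: fps_vec_def fls_times_fps_to_fls intro!: plane_eqI)

lemma inj_fps_vec: "inj fps_vec"
  by (auto simp: inj_def fps_vec_def)

lemma range_fps_vec: "range fps_vec = std_lattice"
proof
  show "std_lattice \<subseteq> range fps_vec"
  proof
    fix v assume "v \<in> std_lattice"
    then obtain c d where "v = oscale c unit1 + oscale d unit2" unfolding std_lattice_eq_span2 by (rule span2E)
    then have "v = fps_vec (c, d)" by (intro plane_eqI) (auto simp: fps_vec_def)
    then show "v \<in> range fps_vec" by blast
  qed
qed (auto simp: std_lattice_def fps_vec_def)

lemma module_fps_pair: "module (\<lambda>c :: complex fps. map_prod ((*) c) ((*) c))"
  by unfold_locales (auto simp: algebra_simps)

lemma fps_lattice_rep_embedding:
  assumes kn: "(k, n) = (3, 9) \<or> (k, n) = (4, 8)"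
    and A: "\<And>i. i \<in> {1..n} \<Longrightarrow> o_submodule (A i)"
    and step: "\<And>i. i \<in> {1..n} \<Longrightarrow> tmul (eps k i) ` A (prv n i) \<subseteq> A i"
      "\<And>i. i \<in> {1..n} \<Longrightarrow> tmul (1 - eps k i) ` A i \<subseteq> A (prv n i)"
  shows "plane_embedding k n (fps_lattice_rep k A) (\<lambda>i. fps_vec)"
proof -
  let ?M = "fps_lattice_rep k A"
  interpret Z: module "\<lambda>c :: complex fps. map_prod ((*) c) ((*) c)" by (rule module_fps_pair)
  have x: "fps_vec (xmap ?M i v) = tmul (eps k i) (fps_vec v)" for i v
    using fps_vec_simps(3)[of fps_X v] by (auto simp: fps_lattice_rep_def eps_def oscale_X)
  have y: "fps_vec (ymap ?M i v) = tmul (1 - eps k i) (fps_vec v)" for i v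
    using fps_vec_simps(3)[of fps_X v] by (auto simp: fps_lattice_rep_def eps_def oscale_X)
  show ?thesis
  proof (rule plane_embeddingI[OF kn, where V = UNIV])
    show "module (zscale ?M)" using module_fps_pair by (simp add: fps_lattice_rep_def)
    fix i assume i: "i \<in> {1..n}"
    show "module.subspace (zscale ?M) (vsp ?M i)"
      using A[OF i] by (auto simp: fps_lattice_rep_def Z.subspace_def fps_vec_simps o_submoduleD)
    show "xmap ?M i v \<in> vsp ?M i" if "v \<in> vsp ?M (prv n i)" for v
      using step(1)[OF i] that x[of i v] by (auto simp: fps_lattice_rep_def)
    show "ymap ?M i v \<in> vsp ?M (prv n i)" if "v \<in> vsp ?M i" for v
      using step(2)[OF i] that y[of i v] by (auto simp: fps_lattice_rep_def)
  qed (use inj_fps_vec x y in \<open>auto simp: fps_vec_simps fps_lattice_rep_def\<close>)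
qed

context root_vec
begin

definition tripod_rep :: "int \<Rightarrow> (complex fps \<times> complex fps) brep" where
  "tripod_rep e = fps_lattice_rep k (tripod_lattice e)"

lemma tripod_rep_embedding: "plane_embedding k n (tripod_rep e) (\<lambda>i. fps_vec)"
  unfolding tripod_rep_def
  by (rule fps_lattice_rep_embedding[OF kn o_submodule_tripod_lattice tripod_lattice_step])

text \<open>The position in the walk is at most 7, so the poles have order at most 4, while
  \<open>wt\<close> is at least 6.\<close>

lemma tripod_lattice_subset_std:
  assumes "i \<le> n" "e \<in> {0, 1}" shows "tripod_lattice e i \<subseteq> std_lattice"
proof -
  define m where "m = int (cnt i) + e"
  have "tripod_lattice e i \<subseteq> tmul (wt i) ` tmul (- ((m + 1) div 2)) ` std_lattice"
    unfolding tripod_lattice_def m_def by (intro image_mono tripod_bounds)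
  also have "\<dots> = tmul (wt i - (m + 1) div 2) ` std_lattice" by simp
  also have "\<dots> \<subseteq> std_lattice"
    using wt_ge[OF assms(1)] cnt_le[OF assms(1)] assms(2) by (intro tmul_std_lattice_subset) (auto simp: m_def)
  finally show ?thesis .
qed

lemma tripod_rep_image:
  assumes "i \<in> {1..n}" "e \<in> {0, 1}"
  shows "fps_vec ` vsp (tripod_rep e) i = tripod_lattice e i"
  using tripod_lattice_subset_std[of i e] assms range_fps_vec
  by (auto simp: tripod_rep_def fps_lattice_rep_def)

end

context plane_embedding
begin

lemma free_of_lattice2:
  assumes i: "i \<in> {1..n}" and "lattice2 (image i)"
  shows "free_of_rank (zscale M) (vsp M i) 2"
proof -
  obtain g h where gh: "det2 g h \<noteq> 0" "image i = span2 g h" using assms by (auto simp: lattice2_def)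
  then obtain b c where bc: "b \<in> vsp M i" "c \<in> vsp M i" "\<Phi> i b = g" "\<Phi> i c = h"
    using span2_base[of g h] span2_base[of h g] unfolding image_def by (metis imageE)
  have val: "\<Phi> i (zscale M \<alpha> b + zscale M \<beta> c) = oscale \<alpha> g + oscale \<beta> h" for \<alpha> \<beta>
    using bc \<Phi>_add[OF i scale_in[OF i bc(1)] scale_in[OF i bc(2)]] \<Phi>_scale[OF i] by simp
  have mem: "zscale M \<alpha> b + zscale M \<beta> c \<in> vsp M i" for \<alpha> \<beta>
    using bc by (intro add_in scale_in i)
  show ?thesis
  proof (rule free_of_rank_2I[OF Z.module_axioms])
    show "vsp M i = {zscale M \<alpha> b + zscale M \<beta> c |\<alpha> \<beta>. True}"
    proof (intro equalityI subsetI)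
      fix v assume v: "v \<in> vsp M i"
      then have "\<Phi> i v \<in> span2 g h" using gh unfolding image_def by blast
      then obtain \<alpha> \<beta> where "\<Phi> i v = oscale \<alpha> g + oscale \<beta> h" by (rule span2E)
      then have "v = zscale M \<alpha> b + zscale M \<beta> c" using \<Phi>_inj[OF i v mem] val by simp
      then show "v \<in> {zscale M \<alpha> b + zscale M \<beta> c |\<alpha> \<beta>. True}" by blast
    qed (use mem in auto)
    fix \<alpha> \<beta> assume "zscale M \<alpha> b + zscale M \<beta> c = 0"
    moreover have "\<Phi> i 0 = 0" using \<Phi>_scale[OF i zero_in[OF i], of 0] by simp
    ultimately have "oscale \<alpha> g + oscale \<beta> h = oscale 0 g + oscale 0 h" using val[of \<alpha> \<beta>] by simp
    then show "\<alpha> = 0 \<and> \<beta> = 0" by (rule det2_independent_o[OF gh(1)])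
  qed
qed

end

context root_vec
begin

lemma tripod_rep_rank:
  assumes "e \<in> {0, 1}"
  shows "CM k n (tripod_rep e)" "has_rank n (tripod_rep e) 2"
proof -
  interpret plane_embedding k n "tripod_rep e" "\<lambda>i. fps_vec" by (rule tripod_rep_embedding)
  have "lattice2 (image i)" if "i \<in> {1..n}" for i
    using tripod_rep_image[OF that assms] lattice2_tmul[OF lattice2_tripod]
    by (simp add: image_def tripod_lattice_def)
  then have "free_of_rank (zscale (tripod_rep e)) (vsp (tripod_rep e) i) 2" if "i \<in> {1..n}" for i
    using that free_of_lattice2 by blast
  then show "CM k n (tripod_rep e)" "has_rank n (tripod_rep e) 2"
    using B unfolding CM_def has_rank_def by blast+
qed

end

section \<open>Classification of the indecomposable modules\<close>

lemma (in plane_embedding) klinear_embedding: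
  assumes "klinear H" "bij H"
  shows "plane_embedding k n M (\<lambda>i v. H (\<Phi> i v))"
proof -
  have "H 0 = 0" using assms(1) by (metis add_cancel_left_left klinear_def)
  then have "v = 0" if "H v = 0" for v using assms(2) that by (metis bij_is_inj injD)
  then show ?thesis using plane_hom_klinear[OF assms(1) hom] kernel by unfold_locales auto
qed

context root_vec
begin

text \<open>Scaling the image at vertex i by t^(- wt i) makes the family constant along the arrows
  with entry 0 or 2, a step to a neighbour along those with entry 1, and multiplied by t^(-3) after
  a full turn: a \<open>lattice_walk\<close>. A common apartment would split the module, so only a
  tripod is left.\<close>

lemma indecomposable_image:
  assumes "plane_embedding k n M \<Phi>" and lat: "lattice2 (\<Phi> k ` vsp M k)"
    and surj2: "\<And>i. i \<in> {1..n} \<Longrightarrow> a i = 2 \<Longrightarrow> xmap M i ` vsp M (prv n i) = vsp M i"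
    and surj0: "\<And>i. i \<in> {1..n} \<Longrightarrow> a i = 0 \<Longrightarrow> ymap M i ` vsp M i = vsp M (prv n i)"
    and nonsurj: "\<And>i. i \<in> {1..n} \<Longrightarrow> a i = 1 \<Longrightarrow>
      xmap M i ` vsp M (prv n i) \<noteq> vsp M i \<and> ymap M i ` vsp M i \<noteq> vsp M (prv n i)"
    and ind: "indecomposable_brep n M"
  obtains e H where "e \<in> {0, 1}" "klinear H" "bij H"
    "\<And>i. i \<in> {1..n} \<Longrightarrow> H ` \<Phi> i ` vsp M i = tripod_lattice e i"
proof -
  interpret plane_embedding k n M \<Phi> by fact
  \<comment> \<open>Index 0 is vertex n seen at the start of the turn, hence with weight
    \<open>wt 0\<close> instead of \<open>wt n\<close>.\<close>
  define Z where "Z i = tmul (- wt i) ` image (if i = 0 then n else i)" for i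
  have Zi: "Z i = tmul (- wt i) ` image i" if "i \<in> {1..n}" for i using that by (auto simp: Z_def)
  have Zprv: "Z (i - 1) = tmul (- wt (i - 1)) ` image (prv n i)" if "i \<in> {1..n}" for i
    using that by (auto simp: Z_def prv_def)
  have imx: "\<Phi> i ` xmap M i ` vsp M (prv n i) = tmul (eps k i) ` image (prv n i)" if i: "i \<in> {1..n}" for i
    unfolding image_def image_image using \<Phi>_x[OF i] by (intro image_cong) auto
  have imy: "\<Phi> (prv n i) ` ymap M i ` vsp M i = tmul (1 - eps k i) ` image i" if i: "i \<in> {1..n}" for i
    unfolding image_def image_image using \<Phi>_y[OF i] by (intro image_cong) auto
  have inj: "inj_on (\<Phi> i) (vsp M i)" if "i \<in> {1..n}" for i
    using \<Phi>_inj[OF that] by (auto intro: inj_onI)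
  have const: "Z i = Z (i - 1)" if i: "i \<in> {1..n}" and ai: "a i \<noteq> 1" for i
  proof -
    consider "a i = 0" | "a i = 2" using a[OF i] ai by auto
    then show ?thesis
    proof cases
      case 1
      then have "image (prv n i) = tmul (1 - eps k i) ` image i"
        using surj0[OF i] imy[OF i] by (simp add: image_def)
      moreover have "- wt (i - 1) + (1 - eps k i) = - wt i" using wt_step[OF i] 1 by simp
      ultimately show ?thesis unfolding Zi[OF i] Zprv[OF i] by (simp only: tmul_image_tmul)
    next
      case 2
      then have "image i = tmul (eps k i) ` image (prv n i)"
        using surj2[OF i] imx[OF i] by (simp add: image_def)
      moreover have "- wt i + eps k i = - wt (i - 1)" using wt_step[OF i] 2 by simp
      ultimately show ?thesis unfolding Zi[OF i] Zprv[OF i] by (simp only: tmul_image_tmul)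
    qed
  qed
  have step: "neighbour (Z (i - 1)) (Z i)" if i: "i \<in> {1..n}" and ai: "a i = 1" for i
  proof -
    have i': "prv n i \<in> {1..n}" by (rule prv_in[OF i])
    have "tmul (eps k i) ` image (prv n i) \<noteq> image i"
    proof
      assume "tmul (eps k i) ` image (prv n i) = image i"
      then have "\<Phi> i ` xmap M i ` vsp M (prv n i) = \<Phi> i ` vsp M i" using imx[OF i] by (simp add: image_def)
      then have "xmap M i ` vsp M (prv n i) = vsp M i"
        using inj_on_image_eq_iff[OF inj[OF i]] x_in[OF i] by (metis image_subsetI order_refl)
      then show False using nonsurj[OF i ai] by simp
    qed
    moreover have "tmul (1 - eps k i) ` image i \<noteq> image (prv n i)"
    proof
      assume "tmul (1 - eps k i) ` image i = image (prv n i)"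
      then have "\<Phi> (prv n i) ` ymap M i ` vsp M i = \<Phi> (prv n i) ` vsp M (prv n i)"
        using imy[OF i] by (simp add: image_def)
      then have "ymap M i ` vsp M i = vsp M (prv n i)"
        using inj_on_image_eq_iff[OF inj[OF i']] y_in[OF i] by (metis image_subsetI order_refl)
      then show False using nonsurj[OF i ai] by simp
    qed
    \<comment> \<open>Neither arrow is surjective, so both inclusions tM \<subseteq> xM \<subseteq>
      M at vertex i are strict.\<close>
    then have "tmul 1 ` image i \<noteq> tmul (eps k i) ` image (prv n i)"
      using tmul_image_eq_iff[of "eps k i" "tmul (1 - eps k i) ` image i"] by simp
    moreover have "tmul 1 ` image i \<subseteq> tmul (eps k i) ` image (prv n i)"
      using image_step'[OF i] tmul_image_subset_iff[of "eps k i" "tmul (1 - eps k i) ` image i"] by simp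
    ultimately have "neighbour (tmul (eps k i) ` image (prv n i)) (image i)"
      using image_step[OF i] image_o_submodule[OF i'] by (auto simp: neighbour_def o_submodule_tmul_image)
    then have "neighbour (tmul (- wt i) ` tmul (eps k i) ` image (prv n i)) (tmul (- wt i) ` image i)"
      by (simp only: neighbour_tmul)
    moreover have "- wt i + eps k i = - wt (i - 1)" using wt_step[OF i] ai by simp
    ultimately show ?thesis unfolding Zi[OF i] Zprv[OF i] by (simp only: tmul_image_tmul)
  qed
  have turn: "Z n = tmul (-3) ` Z 0" using k_bounds by (simp add: Z_def algebra_simps)
  obtain L where L: "\<And>i. i \<le> n \<Longrightarrow> Z i = L (int (cnt i))" "\<And>m. L (m + 6) = tmul (-3) ` L m"
    "\<And>m. neighbour (L m) (L (m + 1))"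
  proof (rule periodic_sequence[where T = "\<lambda>q S. tmul (- 3 * q) ` S" and R = neighbour and Z = Z])
    fix L assume "\<And>i. i \<le> n \<Longrightarrow> Z i = L (int (cnt i))" "\<And>m. L (m + 6) = tmul (- 3 * 1) ` L m"
      "\<And>m. neighbour (L m) (L (m + 1))"
    then show thesis by (intro that[of L]) simp_all
  qed (use const step turn in \<open>simp_all add: algebra_simps\<close>)
  \<comment> \<open>The lattice property is known at vertex k and spreads along the chain in both
    directions; upwards it passes through tL (i + 1), which lies below L i.\<close>
  have latL: "lattice2 (L m)" for m
  proof (induction m rule: int_induct[where k = "int (cnt k)"])
    case base
    have "lattice2 (Z k)" using lat k_bounds by (simp add: Zi image_def lattice2_tmul)
    then show ?case using L(1)[of k] k_bounds by simp
  next
    case (step1 i)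
    have "o_submodule (L (i + 1))" using L(3)[of "i + 1"] by (auto simp: neighbour_def)
    then have "lattice2 (tmul 1 ` L (i + 1))"
      using neighbour_lattice_down[OF step1(2) neighbour_flip[OF L(3)]] by blast
    then show ?case using lattice2_tmul[of "tmul 1 ` L (i + 1)" "-1"] by simp
  next
    case (step2 i)
    then show ?case using neighbour_lattice_down L(3)[of "i - 1"] by simp
  qed
  interpret walk: lattice_walk L by unfold_locales (use L latL in auto)
  have im: "image i = tmul (wt i) ` L (int (cnt i))" if i: "i \<in> {1..n}" for i
    using Zi[OF i] L(1)[of i] i by (metis add.right_inverse atLeastAtMost_iff tmul_image_0 tmul_image_tmul)
  have "\<not> (\<exists>b c. det2 b c \<noteq> 0 \<and> (\<forall>m. adapted b c (L m)))"
    using adapted_not_indecomposable ind im adapted_tmul by metis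
  then obtain e H where e: "e \<in> {0, 1}" and H: "klinear H" "bij H" "\<And>m. H ` L m = tripod (m + e)"
    using walk.adapted_or_tripod by blast
  have "H ` \<Phi> i ` vsp M i = tripod_lattice e i" if i: "i \<in> {1..n}" for i
    using im[OF i] klinear_tmul_image[OF H(1)] H(3) by (simp add: image_def tripod_lattice_def)
  then show ?thesis using that e H by blast
qed

lemma indecomposable_isomorphic:
  assumes "B_module k n M" "has_rank n M 2" "indecomposable_brep n M"
    and "\<And>i. i \<in> {1..n} \<Longrightarrow> a i = 2 \<Longrightarrow> xmap M i ` vsp M (prv n i) = vsp M i"
    and "\<And>i. i \<in> {1..n} \<Longrightarrow> a i = 0 \<Longrightarrow> ymap M i ` vsp M i = vsp M (prv n i)"
    and "\<And>i. i \<in> {1..n} \<Longrightarrow> a i = 1 \<Longrightarrow>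
      xmap M i ` vsp M (prv n i) \<noteq> vsp M i \<and> ymap M i ` vsp M i \<noteq> vsp M (prv n i)"
  shows "\<exists>e\<in>{0, 1}. brep_isomorphic n M (tripod_rep e)"
proof -
  interpret B_mod k n M using assms(1) k_bounds by unfold_locales auto
  obtain \<Phi> where \<Phi>: "plane_embedding k n M \<Phi>" "\<Phi> k ` vsp M k = std_lattice"
    using rank_2_embedding[OF assms(2)] by blast
  show ?thesis
  proof (rule indecomposable_image[OF \<Phi>(1)])
    show "lattice2 (\<Phi> k ` vsp M k)" using \<Phi>(2) lattice2_std_lattice by simp
    show "indecomposable_brep n M" by fact
    fix e H assume e: "e \<in> {0, 1}" and H: "klinear H" "bij H"
      "\<And>i. i \<in> {1..n} \<Longrightarrow> H ` \<Phi> i ` vsp M i = tripod_lattice e i"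
    have "brep_isomorphic n M (tripod_rep e)"
    proof (rule plane_embedding_isomorphic)
      show "plane_embedding k n M (\<lambda>i v. H (\<Phi> i v))"
        by (rule plane_embedding.klinear_embedding[OF \<Phi>(1) H(1,2)])
      show "plane_embedding k n (tripod_rep e) (\<lambda>i. fps_vec)" by (rule tripod_rep_embedding)
      fix i assume i: "i \<in> {1..n}"
      show "(\<lambda>v. H (\<Phi> i v)) ` vsp M i = fps_vec ` vsp (tripod_rep e) i"
        using H(3)[OF i] tripod_rep_image[OF i e] by (simp add: image_image)
    qed
    then show ?thesis using e by blast
  qed (use assms in auto)
qed

section \<open>The tripod modules are indecomposable and not isomorphic\<close>

text \<open>Up to powers of t the chain has six terms. The residues are taken in 1, ..., 6 because
  these counts are attained at genuine vertices, while count 0 may occur only at index 0.\<close>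

lemma tripod_occurs:
  obtains i p where "i \<in> {1..n}" "tripod m = tmul p ` tripod_lattice e i"
proof -
  define c where "c = (m - e - 1) mod 6 + 1"
  have c: "1 \<le> c" "c \<le> 6" unfolding c_def by simp presburger
  have "1 \<le> nat c" "nat c \<le> 6" using c by auto
  then obtain i where i: "i \<in> {1..n}" "cnt i = nat c" by (rule cnt_surj)
  have m: "m = (c + e) + 6 * ((m - e - 1) div 6)" unfolding c_def by presburger
  have "tripod m = tmul (- 3 * ((m - e - 1) div 6)) ` tripod (c + e)"
    using tripod_period_mult[of "c + e"] m by metis
  also have "tripod (c + e) = tmul (- wt i) ` tripod_lattice e i"
    using i c by (simp add: tripod_lattice_def)
  finally show ?thesis using that[OF i(1)] by simp
qed

lemma tripod_rep_full: "\<exists>N. \<forall>v\<in>std_lattice. tmul N v \<in> tripod_lattice e k"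
proof -
  let ?m = "int (cnt k) + e"
  have "tmul (wt k) ` tmul (- (?m div 2)) ` std_lattice \<subseteq> tripod_lattice e k"
    unfolding tripod_lattice_def using tripod_bounds(2) by (simp only: tmul_image_subset_iff)
  then show ?thesis by (intro exI[of _ "wt k - ?m div 2"]) auto
qed

lemma tripod_hom_factors:
  assumes "e \<in> {0, 1}" "brep_hom n (tripod_rep e) (const_rep k) \<Psi>"
  obtains H where "klinear H"
    "\<And>i v. i \<in> {1..n} \<Longrightarrow> v \<in> vsp (tripod_rep e) i \<Longrightarrow> \<Psi> i v = H (fps_vec v)"
proof -
  interpret plane_embedding k n "tripod_rep e" "\<lambda>i. fps_vec" by (rule tripod_rep_embedding)
  obtain N where "\<forall>v\<in>std_lattice. tmul N v \<in> tripod_lattice e k" using tripod_rep_full by blast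
  then have "tmul N v \<in> image k" if "v \<in> std_lattice" for v
    using tripod_rep_image[of k e] assms(1) that k by (simp add: image_def)
  then show ?thesis using hom_factors[OF _ assms(2)] that by blast
qed

end

lemma klinear_expand: "klinear H \<Longrightarrow> H v = kscale (vx v) (H unit1) + kscale (vy v) (H unit2)"
proof -
  assume H: "klinear H"
  have "v = kscale (vx v) unit1 + kscale (vy v) unit2" by (intro plane_eqI) auto
  then have "H v = H (kscale (vx v) unit1 + kscale (vy v) unit2)" by simp
  then show ?thesis using H by (simp add: klinear_def)
qed

lemma integral_mult_nth_0:
  assumes "\<forall>j<0. x $$ j = 0" "\<forall>j<0. y $$ j = (0::complex)"
  shows "(x * y) $$ 0 = x $$ 0 * y $$ 0" "\<forall>j<0. (x * y) $$ j = 0"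
proof -
  obtain c where "x = fps_to_fls c" using assms(1) integral_fls_iff by blast
  then show "(x * y) $$ 0 = x $$ 0 * y $$ 0" "\<forall>j<0. (x * y) $$ j = 0"
    using fps_to_fls_mult_nth_nonpos[OF assms(2), of _ c] by auto
qed

text \<open>Three lines in \<open>\<complex>\<^sup>2\<close> are preserved only by scalars.\<close>

lemma tripod_endomorphism_scalar:
  assumes H: "klinear H" and pres: "\<And>m. H ` tripod m \<subseteq> tripod m"
  obtains s where "\<And>v. v \<in> std_lattice \<Longrightarrow> H v \<in> std_lattice \<and>
    vx (H v) $$ 0 = s * vx v $$ 0 \<and> vy (H v) $$ 0 = s * vy v $$ 0"
proof -
  have std: "H v \<in> std_lattice" if "v \<in> std_lattice" for v
    using pres[of 0] that by (auto simp: tripod_def)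
  have leg: "H v \<in> leg l" if "v \<in> leg l" "odd l" "l mod 6 = l" for v l
  proof -
    have "H ` tmul (- ((l + 1) div 2)) ` leg l \<subseteq> tmul (- ((l + 1) div 2)) ` leg l"
      using pres[of l] that by (simp add: tripod_def)
    then have "H ` leg l \<subseteq> leg l" unfolding klinear_tmul_image[OF H] by simp
    then show ?thesis using that by blast
  qed
  have u: "unit1 \<in> leg 1" "unit2 \<in> leg 3" "unit1 + unit2 \<in> leg 5"
    "unit1 \<in> std_lattice" "unit2 \<in> std_lattice"
    by (auto simp: leg_def std_lattice_def)
  \<comment> \<open>The constant terms of H form a 2 x 2 matrix: the first two legs make it
    diagonal, the third makes its diagonal entries equal.\<close>
  have h: "vy (H unit1) $$ 0 = 0" "vx (H unit2) $$ 0 = 0" "vx (H unit1) $$ 0 = vy (H unit2) $$ 0"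
  proof -
    have "H unit1 \<in> leg 1" "H unit2 \<in> leg 3" "H (unit1 + unit2) \<in> leg 5"
      using u leg by simp_all
    moreover have "H (unit1 + unit2) = H unit1 + H unit2" using H by (simp add: klinear_def)
    ultimately show "vy (H unit1) $$ 0 = 0" "vx (H unit2) $$ 0 = 0" "vx (H unit1) $$ 0 = vy (H unit2) $$ 0"
      by (simp_all add: leg_def)
  qed
  show ?thesis
  proof (rule that[of "vx (H unit1) $$ 0"], intro conjI)
    fix v assume v: "v \<in> std_lattice"
    then show "H v \<in> std_lattice" by (rule std)
    have i: "\<forall>j<0. vx v $$ j = 0" "\<forall>j<0. vy v $$ j = 0" using v by (auto simp: std_lattice_def)
    have i1: "\<forall>j<0. vx (H unit1) $$ j = 0" "\<forall>j<0. vy (H unit1) $$ j = 0"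
      "\<forall>j<0. vx (H unit2) $$ j = 0" "\<forall>j<0. vy (H unit2) $$ j = 0"
      using std[OF u(4)] std[OF u(5)] by (auto simp: std_lattice_def)
    show "vx (H v) $$ 0 = vx (H unit1) $$ 0 * vx v $$ 0"
      using klinear_expand[OF H, of v] integral_mult_nth_0(1)[OF i(1) i1(1)]
        integral_mult_nth_0(1)[OF i(2) i1(3)] h by simp
    show "vy (H v) $$ 0 = vx (H unit1) $$ 0 * vy v $$ 0"
      using klinear_expand[OF H, of v] integral_mult_nth_0(1)[OF i(1) i1(2)]
        integral_mult_nth_0(1)[OF i(2) i1(4)] h by simp
  qed
qed

text \<open>Large powers of t move w into \<open>std_lattice\<close>, very negative ones move it
  out; the transition is the wanted exponent.\<close>

lemma primitive_multiple:
  assumes "w \<noteq> 0" obtains p where "tmul p w \<in> std_lattice" "tmul p w \<notin> tmul 1 ` std_lattice"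
proof -
  obtain m0 where m0: "\<forall>m\<ge>m0. tmul m w \<in> std_lattice" using eventually_in_std_lattice by blast
  have nz: "vx w \<noteq> 0 \<or> vy w \<noteq> 0" using assms by (auto intro: plane_eqI)
  have "\<exists>p. tmul p w \<notin> std_lattice"
  proof -
    have "tmul (- fls_subdegree (vx w) - 1) w \<notin> std_lattice" if "vx w \<noteq> 0"
    proof
      assume "tmul (- fls_subdegree (vx w) - 1) w \<in> std_lattice"
      then have "vx (tmul (- fls_subdegree (vx w) - 1) w) $$ (-1) = 0" by (simp add: std_lattice_def)
      then show False using that by (simp add: tmul_sel)
    qed
    moreover have "tmul (- fls_subdegree (vy w) - 1) w \<notin> std_lattice" if "vy w \<noteq> 0"
    proof
      assume "tmul (- fls_subdegree (vy w) - 1) w \<in> std_lattice"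
      then have "vy (tmul (- fls_subdegree (vy w) - 1) w) $$ (-1) = 0" by (simp add: std_lattice_def)
      then show False using that by (simp add: tmul_sel)
    qed
    ultimately show ?thesis using nz by blast
  qed
  then obtain q where q: "tmul q w \<notin> std_lattice" by blast
  define r where "r = (LEAST r. tmul (q + int r) w \<in> std_lattice)"
  have "tmul (q + int (nat (m0 - q))) w \<in> std_lattice" using m0 by simp
  then have r: "tmul (q + int r) w \<in> std_lattice" unfolding r_def by (rule LeastI)
  have "r \<noteq> 0" using r q by (intro notI) simp
  then have "tmul (q + int (r - 1)) w \<notin> std_lattice"
    using not_less_Least[of "r - 1" "\<lambda>r. tmul (q + int r) w \<in> std_lattice"] by (simp add: r_def)
  then have "tmul (q + int r) w \<notin> tmul 1 ` std_lattice"
    using \<open>r \<noteq> 0\<close> by (simp add: mem_tmul_image algebra_simps)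
  then show ?thesis using that r by blast
qed

text \<open>A nonzero value of H, scaled to be primitive, would be a fixed vector, although H maps
  \<open>std_lattice\<close> into t \<open>std_lattice\<close>.\<close>

lemma idempotent_zero:
  assumes "klinear H" "\<And>v. H (H v) = H v" "\<And>v. v \<in> std_lattice \<Longrightarrow> H v \<in> tmul 1 ` std_lattice"
  shows "H v = 0"
proof (rule ccontr)
  assume "H v \<noteq> 0"
  then obtain p where p: "tmul p (H v) \<in> std_lattice" "tmul p (H v) \<notin> tmul 1 ` std_lattice"
    by (rule primitive_multiple)
  have "H (tmul p (H v)) = tmul p (H v)" by (simp add: klinear_tmul[OF assms(1)] assms(2))
  then show False using assms(3)[OF p(1)] p(2) by simp
qed

text \<open>Modulo t the map is a scalar s with s^2 = s. For s = 0 the map vanishes modulo t, for s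
  = 1 its complement does, and an idempotent that vanishes modulo t is zero.\<close>

lemma idempotent_trivial:
  assumes H: "klinear H" and idem: "\<And>v. H (H v) = H v" and pres: "\<And>m. H ` tripod m \<subseteq> tripod m"
  shows "(\<forall>v. H v = 0) \<or> (\<forall>v. H v = v)"
proof -
  obtain s where s: "\<And>v. v \<in> std_lattice \<Longrightarrow> H v \<in> std_lattice \<and>
    vx (H v) $$ 0 = s * vx v $$ 0 \<and> vy (H v) $$ 0 = s * vy v $$ 0"
    using tripod_endomorphism_scalar[OF H pres] by blast
  have u: "unit1 \<in> std_lattice" by (auto simp: std_lattice_def)
  have "vx (H (H unit1)) $$ 0 = s * s" using s[OF u] s[of "H unit1"] by simp
  then have "s * s = s" using idem s[OF u] by simp
  then consider "s = 0" | "s = 1" by auto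
  then show ?thesis
  proof cases
    case 1
    then have "H v \<in> tmul 1 ` std_lattice" if "v \<in> std_lattice" for v
      using s[OF that] by (simp add: std_lattice_tmul1)
    then show ?thesis using idempotent_zero[OF H idem] by blast
  next
    case 2
    define G where "G v = v - H v" for v
    have G: "klinear G" using H by (simp add: klinear_def G_def kscale.scale_right_diff_distrib)
    have Hd: "H (u - v) = H u - H v" for u v
      using H by (metis add_diff_cancel diff_add_cancel klinear_def)
    have "G (G v) = G v" for v by (simp add: G_def Hd idem)
    moreover have "G v \<in> tmul 1 ` std_lattice" if "v \<in> std_lattice" for v
      using s[OF that] 2 o_submoduleD(4)[OF o_submodule_std_lattice that, of "H v"]
      by (simp add: std_lattice_tmul1 G_def)
    ultimately have "G v = 0" for v using idempotent_zero[OF G] by blast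
    then show ?thesis by (simp add: G_def)
  qed
qed

context root_vec
begin

text \<open>A decomposition gives the projection onto S along T. As an endomorphism it comes from a
  K-linear idempotent preserving every lattice of the tripod, so it is 0 or the identity.\<close>

lemma tripod_rep_indecomposable:
  assumes e: "e \<in> {0, 1}"
  shows "indecomposable_brep n (tripod_rep e)"
proof -
  let ?M = "tripod_rep e"
  interpret plane_embedding k n ?M "\<lambda>i. fps_vec" by (rule tripod_rep_embedding)
  have kk: "k \<in> {1..n}" using k by auto
  obtain N where N: "\<forall>v\<in>std_lattice. tmul N v \<in> tripod_lattice e k" using tripod_rep_full by blast
  have "vsp ?M k \<noteq> {0}"
  proof
    assume "vsp ?M k = {0}"
    then have "tripod_lattice e k = {0}" using tripod_rep_image[OF kk e] by (simp add: fps_vec_simps)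
    then have "tmul N unit1 = 0" using N by (auto simp: std_lattice_def)
    then have "unit1 = 0" by simp
    then have "vx unit1 = vx 0" by simp
    then show False by simp
  qed
  moreover have "(\<forall>i\<in>{1..n}. S i = {0}) \<or> (\<forall>i\<in>{1..n}. T i = {0})"
    if S: "B_submodule n ?M S" and T: "B_submodule n ?M T"
      and dec: "\<forall>i\<in>{1..n}. vsp ?M i = {a + b |a b. a \<in> S i \<and> b \<in> T i} \<and> S i \<inter> T i = {0}" for S T
  proof -
    have subS: "Z.subspace (S i)" and subT: "Z.subspace (T i)" if "i \<in> {1..n}" for i
      using S T that by (auto simp: B_submodule_def)
    have inS: "S i \<subseteq> vsp ?M i" and inT: "T i \<subseteq> vsp ?M i" if "i \<in> {1..n}" for i
      using S T that by (auto simp: B_submodule_def)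
    have xS: "xmap ?M i u \<in> S i" if "i \<in> {1..n}" "u \<in> S (prv n i)" for i u
      using S that unfolding B_submodule_def by blast
    have xT: "xmap ?M i u \<in> T i" if "i \<in> {1..n}" "u \<in> T (prv n i)" for i u
      using T that unfolding B_submodule_def by blast
    have yS: "ymap ?M i u \<in> S (prv n i)" if "i \<in> {1..n}" "u \<in> S i" for i u
      using S that unfolding B_submodule_def by blast
    have yT: "ymap ?M i u \<in> T (prv n i)" if "i \<in> {1..n}" "u \<in> T i" for i u
      using T that unfolding B_submodule_def by blast
    \<comment> \<open>The component in S. It is unique because S and T meet in 0, and uniqueness
      makes it compatible with all operations.\<close>
    define \<pi> where "\<pi> i v = (SOME s. s \<in> S i \<and> v - s \<in> T i)" for i v
    have \<pi>: "\<pi> i v \<in> S i \<and> v - \<pi> i v \<in> T i" if i: "i \<in> {1..n}" and v: "v \<in> vsp ?M i" for i v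
    proof -
      have "v \<in> {a + b |a b. a \<in> S i \<and> b \<in> T i}" using conjunct1[OF bspec[OF dec i]] v by simp
      then obtain s t where "v = s + t" "s \<in> S i" "t \<in> T i" by blast
      then have "\<exists>s. s \<in> S i \<and> v - s \<in> T i" by (intro exI[of _ s]) simp
      then show ?thesis unfolding \<pi>_def by (rule someI_ex)
    qed
    have \<pi>_eq: "\<pi> i v = s" if i: "i \<in> {1..n}" and v: "v \<in> vsp ?M i" "s \<in> S i" "v - s \<in> T i" for i v s
    proof -
      have "\<pi> i v - s \<in> S i" using \<pi>[OF i v(1)] v(2) subS[OF i] by (blast intro: Z.subspace_diff)
      moreover have "(v - s) - (v - \<pi> i v) \<in> T i"
        using \<pi>[OF i v(1)] v(3) subT[OF i] by (blast intro: Z.subspace_diff)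
      ultimately have "\<pi> i v - s \<in> S i \<inter> T i" by simp
      then have "\<pi> i v - s = 0" using conjunct2[OF bspec[OF dec i]] by simp
      then show ?thesis by simp
    qed
    have hom\<pi>: "brep_hom n ?M (const_rep k) (\<lambda>i v. fps_vec (\<pi> i v))"
      unfolding brep_hom_def zlinear_on_def
    proof (intro ballI conjI allI)
      fix i assume i: "i \<in> {1..n}"
      have i': "prv n i \<in> {1..n}" by (rule prv_in[OF i])
      show "fps_vec (\<pi> i u) \<in> vsp (const_rep k) i" for u by simp
      show "fps_vec (\<pi> i (u + v)) = fps_vec (\<pi> i u) + fps_vec (\<pi> i v)"
        if u: "u \<in> vsp ?M i" and v: "v \<in> vsp ?M i" for u v
      proof -
        have "\<pi> i (u + v) = \<pi> i u + \<pi> i v"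
        proof (rule \<pi>_eq[OF i add_in[OF i u v]])
          show "\<pi> i u + \<pi> i v \<in> S i" using \<pi>[OF i] u v subS[OF i] by (blast intro: Z.subspace_add)
          have "(u - \<pi> i u) + (v - \<pi> i v) \<in> T i" using \<pi>[OF i] u v subT[OF i] by (blast intro: Z.subspace_add)
          then show "u + v - (\<pi> i u + \<pi> i v) \<in> T i" by (simp add: algebra_simps)
        qed
        then show ?thesis by (simp add: fps_vec_simps)
      qed
      show "fps_vec (\<pi> i (zscale ?M c u)) = zscale (const_rep k) c (fps_vec (\<pi> i u))"
        if u: "u \<in> vsp ?M i" for c u
      proof -
        have "\<pi> i (zscale ?M c u) = zscale ?M c (\<pi> i u)"
        proof (rule \<pi>_eq[OF i scale_in[OF i u]])
          show "zscale ?M c (\<pi> i u) \<in> S i" using \<pi>[OF i u] subS[OF i] by (blast intro: Z.subspace_scale)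
          have "zscale ?M c (u - \<pi> i u) \<in> T i" using \<pi>[OF i u] subT[OF i] by (blast intro: Z.subspace_scale)
          then show "zscale ?M c u - zscale ?M c (\<pi> i u) \<in> T i" by (simp add: Z.scale_right_diff_distrib)
        qed
        moreover have "\<pi> i u \<in> vsp ?M i" using \<pi>[OF i u] inS[OF i] by blast
        ultimately show ?thesis using \<Phi>_scale[OF i] by simp
      qed
      show "fps_vec (\<pi> i (xmap ?M i v)) = xmap (const_rep k) i (fps_vec (\<pi> (prv n i) v))"
        if v: "v \<in> vsp ?M (prv n i)" for v
      proof -
        have p: "\<pi> (prv n i) v \<in> S (prv n i)" "v - \<pi> (prv n i) v \<in> T (prv n i)" using \<pi>[OF i' v] by auto
        have pin: "\<pi> (prv n i) v \<in> vsp ?M (prv n i)" "v - \<pi> (prv n i) v \<in> vsp ?M (prv n i)"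
          using p inS[OF i'] inT[OF i'] by auto
        have "\<pi> i (xmap ?M i v) = xmap ?M i (\<pi> (prv n i) v)"
        proof (rule \<pi>_eq[OF i x_in[OF i v]])
          show "xmap ?M i (\<pi> (prv n i) v) \<in> S i" by (rule xS[OF i p(1)])
          have "xmap ?M i (v - \<pi> (prv n i) v) \<in> T i" by (rule xT[OF i p(2)])
          moreover have "xmap ?M i v = xmap ?M i (v - \<pi> (prv n i) v) + xmap ?M i (\<pi> (prv n i) v)"
            using x_add[OF i pin(2,1)] by simp
          ultimately show "xmap ?M i v - xmap ?M i (\<pi> (prv n i) v) \<in> T i" by simp
        qed
        then show ?thesis using \<Phi>_x[OF i pin(1)] by simp
      qed
      show "fps_vec (\<pi> (prv n i) (ymap ?M i v)) = ymap (const_rep k) i (fps_vec (\<pi> i v))"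
        if v: "v \<in> vsp ?M i" for v
      proof -
        have p: "\<pi> i v \<in> S i" "v - \<pi> i v \<in> T i" using \<pi>[OF i v] by auto
        have pin: "\<pi> i v \<in> vsp ?M i" "v - \<pi> i v \<in> vsp ?M i"
          using p inS[OF i] inT[OF i] by auto
        have "\<pi> (prv n i) (ymap ?M i v) = ymap ?M i (\<pi> i v)"
        proof (rule \<pi>_eq[OF i' y_in[OF i v]])
          show "ymap ?M i (\<pi> i v) \<in> S (prv n i)" by (rule yS[OF i p(1)])
          have "ymap ?M i (v - \<pi> i v) \<in> T (prv n i)" by (rule yT[OF i p(2)])
          moreover have "ymap ?M i v = ymap ?M i (v - \<pi> i v) + ymap ?M i (\<pi> i v)"
            using y_add[OF i pin(2,1)] by simp
          ultimately show "ymap ?M i v - ymap ?M i (\<pi> i v) \<in> T (prv n i)" by simp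
        qed
        then show ?thesis using \<Phi>_y[OF i pin(1)] by simp
      qed
    qed
    obtain H where H: "klinear H"
      "\<And>i v. i \<in> {1..n} \<Longrightarrow> v \<in> vsp ?M i \<Longrightarrow> fps_vec (\<pi> i v) = H (fps_vec v)"
      using tripod_hom_factors[OF e hom\<pi>] by blast
    have pres: "H ` tripod_lattice e i \<subseteq> tripod_lattice e i" if i: "i \<in> {1..n}" for i
      unfolding tripod_rep_image[OF i e, symmetric]
      using H(2)[OF i] \<pi>[OF i] inS[OF i] by (force simp: image_iff)
    \<comment> \<open>Idempotence is clear on the image at vertex k, and every vector of the plane
      over K gets there after scaling by a power of t.\<close>
    have idem: "H (H u) = H u" for u
    proof -
      obtain p where p: "tmul p u \<in> std_lattice" using eventually_in_std_lattice by blast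
      then have "tmul N (tmul p u) \<in> fps_vec ` vsp ?M k" using N tripod_rep_image[OF kk e] by blast
      then obtain v where v: "v \<in> vsp ?M k" "tmul (N + p) u = fps_vec v" by auto
      have pv: "\<pi> k v \<in> S k" "\<pi> k v \<in> vsp ?M k" using \<pi>[OF kk v(1)] inS[OF kk] by auto
      have "\<pi> k (\<pi> k v) = \<pi> k v"
        by (rule \<pi>_eq[OF kk pv(2,1)]) (simp add: Z.subspace_0[OF subT[OF kk]])
      then have "H (H (fps_vec v)) = H (fps_vec v)"
        using H(2)[OF kk v(1)] H(2)[OF kk pv(2)] by simp
      then show ?thesis unfolding v(2)[symmetric] by (simp add: klinear_tmul[OF H(1)])
    qed
    have "H ` tripod m \<subseteq> tripod m" for m
    proof -
      obtain i p where "i \<in> {1..n}" "tripod m = tmul p ` tripod_lattice e i" by (rule tripod_occurs)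
      then show ?thesis using pres[of i] by (simp only: klinear_tmul_image[OF H(1)] tmul_image_subset_iff)
    qed
    then consider "\<forall>v. H v = 0" | "\<forall>v. H v = v" using idempotent_trivial[OF H(1) idem] by blast
    then show ?thesis
    proof cases
      case 1
      have "s = 0" if i: "i \<in> {1..n}" and s: "s \<in> S i" for i s
      proof -
        have v: "s \<in> vsp ?M i" using inS[OF i] s by blast
        have "\<pi> i s = s" by (rule \<pi>_eq[OF i v s]) (simp add: Z.subspace_0[OF subT[OF i]])
        then have "fps_vec s = 0" using H(2)[OF i v] 1 by simp
        then show ?thesis using kernel[OF i v] by simp
      qed
      then show ?thesis using Z.subspace_0[OF subS] by blast
    next
      case 2
      have "t = 0" if i: "i \<in> {1..n}" and t: "t \<in> T i" for i t
      proof -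
        have v: "t \<in> vsp ?M i" using inT[OF i] t by blast
        have "\<pi> i t = 0" by (rule \<pi>_eq[OF i v]) (use t in \<open>simp_all add: Z.subspace_0[OF subS[OF i]]\<close>)
        then have "fps_vec t = 0" using H(2)[OF i v] 2 by (simp add: fps_vec_simps)
        then show ?thesis using kernel[OF i v] by simp
      qed
      then show ?thesis using Z.subspace_0[OF subT] by blast
    qed
  qed
  ultimately show ?thesis unfolding indecomposable_brep_def using kk by blast
qed

text \<open>An isomorphism would move the walk by one position and carry visits to the centre to
  visits to legs. But the centre positions 2 and 4 are homothetic, while the legs 3 and 5 are
  different vertices.\<close>

lemma tripod_rep_not_isomorphic: "\<not> brep_isomorphic n (tripod_rep 0) (tripod_rep 1)"
proof
  assume "brep_isomorphic n (tripod_rep 0) (tripod_rep 1)"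
  then obtain f where f: "brep_hom n (tripod_rep 0) (tripod_rep 1) f"
    "\<And>i. i \<in> {1..n} \<Longrightarrow> f i ` vsp (tripod_rep 0) i = vsp (tripod_rep 1) i"
    by (auto simp: brep_isomorphic_def brep_iso_def bij_betw_def)
  interpret M1: plane_embedding k n "tripod_rep 1" "\<lambda>i. fps_vec" by (rule tripod_rep_embedding)
  have "brep_hom n (tripod_rep 0) (const_rep k) (\<lambda>i v. fps_vec (f i v))"
    unfolding brep_hom_def zlinear_on_def
  proof (intro ballI conjI allI)
    fix i assume i: "i \<in> {1..n}"
    have i': "prv n i \<in> {1..n}" by (rule prv_in[OF i])
    have fin: "f i v \<in> vsp (tripod_rep 1) i" if "v \<in> vsp (tripod_rep 0) i" for v
      using f(2)[OF i] that by blast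
    have fin': "f (prv n i) v \<in> vsp (tripod_rep 1) (prv n i)" if "v \<in> vsp (tripod_rep 0) (prv n i)" for v
      using f(2)[OF i'] that by blast
    show "fps_vec (f i u) \<in> vsp (const_rep k) i" for u by simp
    show "fps_vec (f i (u + v)) = fps_vec (f i u) + fps_vec (f i v)"
      if "u \<in> vsp (tripod_rep 0) i" "v \<in> vsp (tripod_rep 0) i" for u v
      using f(1) i that by (simp add: brep_hom_def zlinear_on_def fps_vec_simps)
    show "fps_vec (f i (zscale (tripod_rep 0) c u)) = zscale (const_rep k) c (fps_vec (f i u))"
      if "u \<in> vsp (tripod_rep 0) i" for c u
      using f(1) i that M1.\<Phi>_scale[OF i fin[OF that]] by (simp add: brep_hom_def zlinear_on_def)
    show "fps_vec (f i (xmap (tripod_rep 0) i v)) = xmap (const_rep k) i (fps_vec (f (prv n i) v))"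
      if "v \<in> vsp (tripod_rep 0) (prv n i)" for v
      using f(1) i that M1.\<Phi>_x[OF i fin'[OF that]] by (simp add: brep_hom_def)
    show "fps_vec (f (prv n i) (ymap (tripod_rep 0) i v)) = ymap (const_rep k) i (fps_vec (f i v))"
      if "v \<in> vsp (tripod_rep 0) i" for v
      using f(1) i that M1.\<Phi>_y[OF i fin[OF that]] by (simp add: brep_hom_def)
  qed
  then obtain H where H: "klinear H"
    "\<And>i v. i \<in> {1..n} \<Longrightarrow> v \<in> vsp (tripod_rep 0) i \<Longrightarrow> fps_vec (f i v) = H (fps_vec v)"
    using tripod_hom_factors[of 0] by blast
  have "H ` tripod_lattice 0 i = tripod_lattice 1 i" if i: "i \<in> {1..n}" for i
  proof -
    have "tripod_lattice 0 i = fps_vec ` vsp (tripod_rep 0) i" using tripod_rep_image[OF i, of 0] by simp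
    then have "H ` tripod_lattice 0 i = (\<lambda>v. H (fps_vec v)) ` vsp (tripod_rep 0) i"
      by (simp only: image_image)
    also have "\<dots> = (\<lambda>v. fps_vec (f i v)) ` vsp (tripod_rep 0) i"
      using H(2)[OF i] by (intro image_cong) auto
    also have "\<dots> = fps_vec ` f i ` vsp (tripod_rep 0) i" by (simp add: image_image)
    also have "\<dots> = tripod_lattice 1 i" using f(2)[OF i] tripod_rep_image[OF i, of 1] by simp
    finally show ?thesis .
  qed
  then have "H ` tripod (int c) = tripod (int c + 1)" if c: "1 \<le> c" "c \<le> 6" for c
  proof -
    obtain i where "i \<in> {1..n}" "cnt i = c" using cnt_surj[OF c] by blast
    then have "H ` tmul (wt i) ` tripod (int c) = tmul (wt i) ` tripod (int c + 1)"
      using \<open>\<And>i. i \<in> {1..n} \<Longrightarrow> H ` tripod_lattice 0 i = tripod_lattice 1 i\<close>[of i]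
      by (simp add: tripod_lattice_def)
    then show ?thesis by (simp only: klinear_tmul_image[OF H(1)] tmul_image_eq_iff)
  qed
  from this[of 2] this[of 4] have "H ` tripod 2 = tripod 3" "H ` tripod 4 = tripod 5" by simp_all
  moreover have "tripod 4 = tmul (-1) ` tripod 2" by (simp add: tripod_def)
  ultimately have "tripod 5 = tmul (-1) ` tripod 3" by (simp add: klinear_tmul_image[OF H(1)])
  then have "leg 5 = leg 3" by (simp add: tripod_def)
  moreover have "unit2 \<in> leg 3" "unit2 \<notin> leg 5" by (auto simp: leg_def std_lattice_def)
  ultimately show False by simp
qed

end

section \<open>Filtrations\<close>

text \<open>On \<open>L_module I\<close> the arrow x is bijective for i in I and multiplication by t
  otherwise, and conversely for y. Surjectivity on both factors lifts to M. If it fails on exactly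
  one factor, a generator of that factor, taken in the submodule or lifted from the quotient, is not
  in the image.\<close>

lemma filtration_arrows:
  assumes "B_module k n M" "1 \<le> k" "k < n" "has_filtration k n M [I, J]" and i: "i \<in> {1..n}"
  shows "i \<in> I \<Longrightarrow> i \<in> J \<Longrightarrow> xmap M i ` vsp M (prv n i) = vsp M i"
    and "i \<notin> I \<Longrightarrow> i \<notin> J \<Longrightarrow> ymap M i ` vsp M i = vsp M (prv n i)"
    and "i \<in> I \<longleftrightarrow> i \<notin> J \<Longrightarrow>
      xmap M i ` vsp M (prv n i) \<noteq> vsp M i \<and> ymap M i ` vsp M i \<noteq> vsp M (prv n i)"
proof -
  interpret B_mod k n M using assms by unfold_locales auto
  have i': "prv n i \<in> {1..n}" by (rule prv_in[OF i])
  obtain f g where f: "brep_hom n M (L_module I) f" "\<forall>i\<in>{1..n}. f i ` vsp M i = UNIV"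
    and g: "brep_hom n (kernel_brep M f) (L_module J) g"
      "\<forall>i\<in>{1..n}. g i ` vsp (kernel_brep M f) i = UNIV"
    and zero: "\<forall>i\<in>{1..n}. vsp (kernel_brep (kernel_brep M f) g) i = {0}"
    using assms(4) by (auto simp: L_module_def)
  define N where "N i = {v \<in> vsp M i. f i v = 0}" for i
  have vN: "vsp (kernel_brep M f) i = N i" for i by (simp add: kernel_brep_def N_def)
  have f_add: "f j (u + v) = f j u + f j v" if "j \<in> {1..n}" "u \<in> vsp M j" "v \<in> vsp M j" for j u v
    using f(1) that by (auto simp: brep_hom_def zlinear_on_def)
  have f_diff: "f j (u - v) = f j u - f j v" if "j \<in> {1..n}" "u \<in> vsp M j" "v \<in> vsp M j" for j u v
    using f_add[OF that(1) diff_in[OF that] that(3)] by simp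
  have f_x: "f i (xmap M i v) = (if i \<in> I then f (prv n i) v else fps_X * f (prv n i) v)"
    if "v \<in> vsp M (prv n i)" for v
    using f(1) i that by (auto simp: brep_hom_def L_module_def)
  have f_y: "f (prv n i) (ymap M i v) = (if i \<in> I then fps_X * f i v else f i v)"
    if "v \<in> vsp M i" for v
    using f(1) i that by (auto simp: brep_hom_def L_module_def)
  have g_add: "g j (u + v) = g j u + g j v" if "j \<in> {1..n}" "u \<in> N j" "v \<in> N j" for j u v
    using g(1) that by (auto simp: brep_hom_def zlinear_on_def vN)
  have N_sub: "u - v \<in> N j" if "j \<in> {1..n}" "u \<in> N j" "v \<in> N j" for j u v
    using that f_diff[of j u v] diff_in[of j u v] by (auto simp: N_def)
  have g_diff: "g j (u - v) = g j u - g j v" if "j \<in> {1..n}" "u \<in> N j" "v \<in> N j" for j u v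
    using g_add[OF that(1) N_sub[OF that] that(3)] by simp
  have g_x: "g i (xmap M i v) = (if i \<in> J then g (prv n i) v else fps_X * g (prv n i) v)"
    if "v \<in> N (prv n i)" for v
    using g(1) i that by (auto simp: brep_hom_def L_module_def vN) (auto simp: kernel_brep_def)
  have g_y: "g (prv n i) (ymap M i v) = (if i \<in> J then fps_X * g i v else g i v)"
    if "v \<in> N i" for v
    using g(1) i that by (auto simp: brep_hom_def L_module_def vN) (auto simp: kernel_brep_def)
  have surj_f: "\<exists>v\<in>vsp M j. f j v = c" if "j \<in> {1..n}" for j c
    using f(2) that by (metis UNIV_I imageE)
  have surj_g: "\<exists>v\<in>N j. g j v = c" if "j \<in> {1..n}" for j c
    using g(2) that vN by (metis UNIV_I imageE)
  have ker: "v = 0" if "j \<in> {1..n}" "v \<in> N j" "g j v = 0" for j v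
  proof -
    have "v \<in> vsp (kernel_brep (kernel_brep M f) g) j" using that by (simp add: kernel_brep_def N_def)
    then show ?thesis using zero that(1) by blast
  qed
  have X1: "fps_X * c \<noteq> (1 :: complex fps)" for c
  proof
    assume "fps_X * c = 1"
    then have "(fps_X * c) $ 0 = 1 $ 0" by simp
    then show False by simp
  qed
  have xN: "xmap M i v \<in> N i" if "v \<in> N (prv n i)" for v
    using that f_x[of v] x_in[OF i] by (auto simp: N_def)
  have yN: "ymap M i v \<in> N (prv n i)" if "v \<in> N i" for v
    using that f_y[of v] y_in[OF i] by (auto simp: N_def)
  show "xmap M i ` vsp M (prv n i) = vsp M i" if IJ: "i \<in> I" "i \<in> J"
  proof
    show "xmap M i ` vsp M (prv n i) \<subseteq> vsp M i" using x_in[OF i] by blast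
    show "vsp M i \<subseteq> xmap M i ` vsp M (prv n i)"
    proof
      fix w assume w: "w \<in> vsp M i"
      \<comment> \<open>The class of w in the quotient is hit by v; the remainder lies in the
        kernel, where it is hit by u.\<close>
      obtain v where v: "v \<in> vsp M (prv n i)" "f (prv n i) v = f i w" using surj_f[OF i'] by blast
      have d: "w - xmap M i v \<in> N i"
        using w v f_diff[OF i w x_in[OF i v(1)]] f_x[OF v(1)] IJ diff_in[OF i w x_in[OF i v(1)]]
        by (simp add: N_def)
      obtain u where u: "u \<in> N (prv n i)" "g (prv n i) u = g i (w - xmap M i v)" using surj_g[OF i'] by blast
      have "g i (w - xmap M i v - xmap M i u) = g i (w - xmap M i v) - g i (xmap M i u)"
        by (rule g_diff[OF i d xN[OF u(1)]])
      also have "g i (xmap M i u) = g i (w - xmap M i v)" using g_x[OF u(1)] u(2) IJ by metis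
      finally have "w - xmap M i v - xmap M i u = 0" by (intro ker[OF i N_sub[OF i d xN[OF u(1)]]]) simp
      moreover have "u \<in> vsp M (prv n i)" using u by (simp add: N_def)
      ultimately have "w = xmap M i (v + u)" "v + u \<in> vsp M (prv n i)"
        using x_add[OF i v(1)] add_in[OF i' v(1)] by (simp_all add: algebra_simps)
      then show "w \<in> xmap M i ` vsp M (prv n i)" by blast
    qed
  qed
  show "ymap M i ` vsp M i = vsp M (prv n i)" if IJ: "i \<notin> I" "i \<notin> J"
  proof
    show "ymap M i ` vsp M i \<subseteq> vsp M (prv n i)" using y_in[OF i] by blast
    show "vsp M (prv n i) \<subseteq> ymap M i ` vsp M i"
    proof
      fix w assume w: "w \<in> vsp M (prv n i)"
      obtain v where v: "v \<in> vsp M i" "f i v = f (prv n i) w" using surj_f[OF i] by blast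
      have d: "w - ymap M i v \<in> N (prv n i)"
        using w v f_diff[OF i' w y_in[OF i v(1)]] f_y[OF v(1)] IJ diff_in[OF i' w y_in[OF i v(1)]]
        by (simp add: N_def)
      obtain u where u: "u \<in> N i" "g i u = g (prv n i) (w - ymap M i v)" using surj_g[OF i] by blast
      have "g (prv n i) (w - ymap M i v - ymap M i u) = g (prv n i) (w - ymap M i v) - g (prv n i) (ymap M i u)"
        by (rule g_diff[OF i' d yN[OF u(1)]])
      also have "g (prv n i) (ymap M i u) = g (prv n i) (w - ymap M i v)" using g_y[OF u(1)] u(2) IJ by metis
      finally have "w - ymap M i v - ymap M i u = 0" by (intro ker[OF i' N_sub[OF i' d yN[OF u(1)]]]) simp
      moreover have "u \<in> vsp M i" using u by (simp add: N_def)
      ultimately have "w = ymap M i (v + u)" "v + u \<in> vsp M i"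
        using y_add[OF i v(1)] add_in[OF i v(1)] by (simp_all add: algebra_simps)
      then show "w \<in> ymap M i ` vsp M i" by blast
    qed
  qed
  show "xmap M i ` vsp M (prv n i) \<noteq> vsp M i \<and> ymap M i ` vsp M i \<noteq> vsp M (prv n i)"
    if IJ: "i \<in> I \<longleftrightarrow> i \<notin> J"
  proof (cases "i \<in> I")
    case True
    obtain u where u: "u \<in> N i" "g i u = 1" using surj_g[OF i] by blast
    have "u \<notin> xmap M i ` vsp M (prv n i)"
    proof
      assume "u \<in> xmap M i ` vsp M (prv n i)"
      then obtain v where v: "v \<in> vsp M (prv n i)" "u = xmap M i v" by blast
      \<comment> \<open>On the quotient x acts as the identity, so a preimage of u lies in the
        submodule; there its value c would satisfy t c = 1.\<close>
      then have "v \<in> N (prv n i)" using u f_x[OF v(1)] True by (simp add: N_def)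
      then show False using g_x u v IJ True X1 by simp
    qed
    moreover obtain w where w: "w \<in> vsp M (prv n i)" "f (prv n i) w = 1" using surj_f[OF i'] by blast
    have "w \<notin> ymap M i ` vsp M i" using f_y w True X1 by force
    ultimately show ?thesis using u w by (auto simp: N_def)
  next
    case False
    obtain u where u: "u \<in> N (prv n i)" "g (prv n i) u = 1" using surj_g[OF i'] by blast
    have "u \<notin> ymap M i ` vsp M i"
    proof
      assume "u \<in> ymap M i ` vsp M i"
      then obtain v where v: "v \<in> vsp M i" "u = ymap M i v" by blast
      then have "v \<in> N i" using u f_y[OF v(1)] False by (simp add: N_def)
      then show False using g_y u v IJ False X1 by simp
    qed
    moreover obtain w where w: "w \<in> vsp M i" "f i w = 1" using surj_f[OF i] by blast
    have "w \<notin> xmap M i ` vsp M (prv n i)" using f_x w False X1 by force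
    ultimately show ?thesis using u w by (auto simp: N_def)
  qed
qed

section \<open>Exponent functions around the cycle and rank 1 modules\<close>

lemma bij_betw_prv: "bij_betw (prv n) {1..n} {1..n}"
  by (rule bij_betwI[where g = "nxt n"]) (auto simp: prv_def nxt_def)

text \<open>The jumps telescope around the cycle to the sum of the \<open>eps\<close>, which is n -
  k; since each is 0 or 1, exactly n - k of them are 1.\<close>

lemma card_jumps:
  fixes q :: "nat \<Rightarrow> int"
  assumes "k \<le> n" "\<And>i. i \<in> {1..n} \<Longrightarrow> q (prv n i) + eps k i - q i \<in> {0, 1}"
  shows "card {i \<in> {1..n}. q (prv n i) + eps k i = q i} = k"
proof -
  let ?I = "{i \<in> {1..n}. q (prv n i) + eps k i = q i}"
  have "(\<Sum>i=1..n. q (prv n i) + eps k i - q i) = (\<Sum>i=1..n. eps k i)"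
    using sum.reindex_bij_betw[OF bij_betw_prv, of q n] by (simp add: sum.distrib sum_subtractf)
  moreover have "(\<Sum>i=1..n. eps k i) = int n - int k"
  proof -
    have "(\<Sum>i=1..n. eps k i) = (\<Sum>i\<in>{k<..n}. 1)"
      unfolding eps_def by (rule sum.mono_neutral_cong_right) auto
    then show ?thesis using assms(1) by simp
  qed
  moreover have "(\<Sum>i=1..n. q (prv n i) + eps k i - q i) = (\<Sum>i\<in>{1..n} - ?I. 1)"
    using assms(2) by (intro sum.mono_neutral_cong_right) force+
  moreover have "(\<Sum>i\<in>{1..n} - ?I. 1) = int (card ({1..n} - ?I))"
    by (simp only: sum_constant mult_1_right)
  moreover have "card ({1..n} - ?I) = n - card ?I"
    by (subst card_Diff_subset) auto
  moreover have "?I \<subseteq> {1..n}" by auto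
  then have "card ?I \<le> card {1..n}" by (intro card_mono) simp_all
  then have "card ?I \<le> n" by (simp only: card_atLeastAtMost diff_Suc_1)
  ultimately show ?thesis using assms(1) by linarith
qed

text \<open>A functional whose values at vertex i form t^(q i) C[[t]] becomes a surjection onto a
  rank 1 module after division by t^(q i). There x is invertible exactly along the arrows at which q
  does not jump.\<close>

lemma rank_one_quotient:
  fixes M :: "'v::ab_group_add brep" and \<xi> :: "'v \<Rightarrow> complex fps" and q :: "nat \<Rightarrow> nat"
  assumes add: "\<And>i u v. i \<in> {1..n} \<Longrightarrow> u \<in> vsp M i \<Longrightarrow> v \<in> vsp M i \<Longrightarrow> \<xi> (u + v) = \<xi> u + \<xi> v"
    and scale: "\<And>i c v. i \<in> {1..n} \<Longrightarrow> v \<in> vsp M i \<Longrightarrow> \<xi> (zscale M c v) = c * \<xi> v"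
    and x: "\<And>i v. i \<in> {1..n} \<Longrightarrow> \<xi> (xmap M i v) = fps_X ^ nat (eps k i) * \<xi> v"
    and y: "\<And>i v. i \<in> {1..n} \<Longrightarrow> \<xi> (ymap M i v) = fps_X ^ nat (1 - eps k i) * \<xi> v"
    and image: "\<And>i. i \<in> {1..n} \<Longrightarrow> \<xi> ` vsp M i = range ((*) (fps_X ^ q i))"
    and jump: "\<And>i. i \<in> {1..n} \<Longrightarrow> int (q (prv n i)) + eps k i - int (q i) \<in> {0, 1}"
    and I: "I = {i \<in> {1..n}. int (q (prv n i)) + eps k i = int (q i)}"
  defines "f \<equiv> \<lambda>i v. fps_shift (q i) (\<xi> v)"
  shows "brep_hom n M (L_module I) f" "\<And>i. i \<in> {1..n} \<Longrightarrow> f i ` vsp M i = vsp (L_module I) i"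
    "\<And>i v. i \<in> {1..n} \<Longrightarrow> v \<in> vsp M i \<Longrightarrow> f i v = 0 \<longleftrightarrow> \<xi> v = 0"
proof -
  have div: "\<exists>c. \<xi> v = fps_X ^ q i * c" if "i \<in> {1..n}" "v \<in> vsp M i" for i v
    using image[OF that(1)] that(2) by blast
  have shift: "fps_shift m (fps_X ^ (m + l) * c) = fps_X ^ l * (c :: complex fps)" for m l c
    by (rule fps_ext) (auto simp: fps_X_power_mult_nth)
  have shift0: "fps_shift m (fps_X ^ m * c) = (c :: complex fps)" for m c
    using shift[of m 0 c] by simp
  show "f i ` vsp M i = vsp (L_module I) i" if i: "i \<in> {1..n}" for i
  proof -
    have "f i ` vsp M i = fps_shift (q i) ` \<xi> ` vsp M i" by (simp add: f_def image_image)
    also have "\<dots> = UNIV" unfolding image[OF i] by (simp add: image_image shift0)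
    finally show ?thesis by (simp add: L_module_def)
  qed
  show "f i v = 0 \<longleftrightarrow> \<xi> v = 0" if "i \<in> {1..n}" "v \<in> vsp M i" for i v
    using div[OF that] by (auto simp: f_def shift0)
  show "brep_hom n M (L_module I) f"
    unfolding brep_hom_def zlinear_on_def
  proof (intro ballI conjI allI)
    fix i assume i: "i \<in> {1..n}"
    have i': "prv n i \<in> {1..n}" by (rule prv_in[OF i])
    show "f i u \<in> vsp (L_module I) i" for u by (simp add: L_module_def)
    show "f i (u + v) = f i u + f i v" if "u \<in> vsp M i" "v \<in> vsp M i" for u v
      using add[OF i that] by (simp add: f_def fps_shift_add)
    show "f i (zscale M c u) = zscale (L_module I) c (f i u)" if u: "u \<in> vsp M i" for c u
    proof -
      obtain d where "\<xi> u = fps_X ^ q i * d" using div[OF i u] by blast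
      then show ?thesis using scale[OF i u] shift0[of "q i" "c * d"]
        by (simp add: f_def L_module_def shift0 mult.left_commute)
    qed
    show "f i (xmap M i v) = xmap (L_module I) i (f (prv n i) v)" if v: "v \<in> vsp M (prv n i)" for v
    proof -
      obtain d where d: "\<xi> v = fps_X ^ q (prv n i) * d" using div[OF i' v] by blast
      define l where "l = (if i \<in> I then 0 else 1 :: nat)"
      have "nat (eps k i) + q (prv n i) = q i + l"
        using jump[OF i] i by (auto simp: I l_def eps_def split: if_splits)
      then have "\<xi> (xmap M i v) = fps_X ^ (q i + l) * d"
        unfolding x[OF i] d by (metis mult.assoc power_add)
      then have "f i (xmap M i v) = fps_X ^ l * d" by (simp only: f_def shift)
      moreover have "f (prv n i) v = d" unfolding f_def d by (rule shift0)
      ultimately show ?thesis by (simp add: L_module_def l_def)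
    qed
    show "f (prv n i) (ymap M i v) = ymap (L_module I) i (f i v)" if v: "v \<in> vsp M i" for v
    proof -
      obtain d where d: "\<xi> v = fps_X ^ q i * d" using div[OF i v] by blast
      define l where "l = (if i \<in> I then 1 else 0 :: nat)"
      have "nat (1 - eps k i) + q i = q (prv n i) + l"
        using jump[OF i] i by (auto simp: I l_def eps_def split: if_splits)
      then have "\<xi> (ymap M i v) = fps_X ^ (q (prv n i) + l) * d"
        unfolding y[OF i] d by (metis mult.assoc power_add)
      then have "f (prv n i) (ymap M i v) = fps_X ^ l * d" by (simp only: f_def shift)
      moreover have "f i v = d" unfolding f_def d by (rule shift0)
      ultimately show ?thesis by (simp add: L_module_def l_def)
    qed
  qed
qed

text \<open>Exponents of the second coordinate of \<open>tripod m\<close> and of its intersection with the first axis.\<close>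

definition quot_exp :: "int \<Rightarrow> int" where
  "quot_exp m = (if even m then - (m div 2) else - ((m + 1) div 2) + (if m mod 6 = 1 then 1 else 0))"

definition sub_exp :: "int \<Rightarrow> int" where
  "sub_exp m = (if even m then - (m div 2) else - ((m + 1) div 2) + (if m mod 6 = 1 then 0 else 1))"

definition vanishes_below :: "int \<Rightarrow> complex fls \<Rightarrow> bool" where
  "vanishes_below p x \<longleftrightarrow> (\<forall>j<p. x $$ j = 0)"

lemma vanishes_below_shift: "vanishes_below p (fls_shift (- q) x) \<longleftrightarrow> vanishes_below (p - q) x"
proof
  assume *: "vanishes_below p (fls_shift (- q) x)"
  show "vanishes_below (p - q) x"
    unfolding vanishes_below_def
  proof (intro allI impI)
    fix j assume "j < p - q"
    then have "fls_shift (- q) x $$ (j + q) = 0"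
      using *[unfolded vanishes_below_def, rule_format, of "j + q"] by simp
    then show "x $$ j = 0" by simp
  qed
qed (auto simp: vanishes_below_def)

lemma std_lattice_iff: "v \<in> std_lattice \<longleftrightarrow> vanishes_below 0 (vx v) \<and> vanishes_below 0 (vy v)"
  by (auto simp: std_lattice_def vanishes_below_def)

lemma vanishes_below_1: "vanishes_below 1 x \<longleftrightarrow> vanishes_below 0 x \<and> x $$ 0 = 0"
proof -
  have "(j < 1) = (j < 0 \<or> j = 0)" for j :: int by auto
  then show ?thesis by (auto simp: vanishes_below_def)
qed

lemma leg_vy: "(\<exists>v\<in>leg l. vy v = y) \<longleftrightarrow> vanishes_below (if l = 1 then 1 else 0) y"
proof
  assume "vanishes_below (if l = 1 then 1 else 0) y"
  then show "\<exists>v\<in>leg l. vy v = y"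
    by (intro bexI[of _ "Vec (if l = 1 \<or> l = 3 then 0 else y) y"])
      (auto simp: leg_def std_lattice_iff vanishes_below_1 split: if_splits, auto simp: vanishes_below_def)
qed (auto simp: leg_def std_lattice_iff vanishes_below_1)

lemma leg_vx: "Vec x 0 \<in> leg l \<longleftrightarrow> vanishes_below (if l = 1 then 0 else 1) x"
  by (auto simp: leg_def std_lattice_iff vanishes_below_1) (auto simp: vanishes_below_def)

lemma tripod_vy: "(\<exists>v\<in>tripod m. vy v = y) \<longleftrightarrow> vanishes_below (quot_exp m) y"
proof -
  have sh: "(\<exists>v\<in>tmul p ` S. vy v = y) \<longleftrightarrow> (\<exists>v\<in>S. vy v = fls_shift p y)" for p S y
  proof
    assume "\<exists>v\<in>S. vy v = fls_shift p y"
    then show "\<exists>v\<in>tmul p ` S. vy v = y" by (force simp: tmul_sel)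
  qed (auto simp: tmul_sel)
  have std: "(\<exists>v\<in>std_lattice. vy v = y) \<longleftrightarrow> vanishes_below 0 y" for y
  proof
    assume "vanishes_below 0 y"
    then show "\<exists>v\<in>std_lattice. vy v = y"
      by (intro bexI[of _ "Vec 0 y"]) (auto simp: std_lattice_iff vanishes_below_def)
  qed (auto simp: std_lattice_iff)
  have v: "vanishes_below p (fls_shift q y) \<longleftrightarrow> vanishes_below (p + q) y" for p q y
    using vanishes_below_shift[of p "- q" y] by simp
  show ?thesis
  proof (cases "even m")
    case True
    then have t: "tripod m = tmul (- (m div 2)) ` std_lattice" "quot_exp m = - (m div 2)"
      by (simp_all add: tripod_def quot_exp_def)
    show ?thesis unfolding t sh std v by simp
  next
    case False
    then have t: "tripod m = tmul (- ((m + 1) div 2)) ` leg (m mod 6)"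
        "quot_exp m = - ((m + 1) div 2) + (if m mod 6 = 1 then 1 else 0)"
      by (simp_all add: tripod_def quot_exp_def)
    show ?thesis unfolding t sh leg_vy v by (simp add: add.commute)
  qed
qed

lemma tripod_vx: "Vec x 0 \<in> tripod m \<longleftrightarrow> vanishes_below (sub_exp m) x"
proof -
  have sh: "tmul p (Vec x 0) = Vec (fls_shift (- p) x) 0" for p
    by (rule plane_eqI) (simp_all add: tmul_sel)
  have std: "Vec x 0 \<in> std_lattice \<longleftrightarrow> vanishes_below 0 x" for x
    by (auto simp: std_lattice_iff vanishes_below_def)
  show ?thesis unfolding tripod_def sub_exp_def
    by (auto simp: mem_tmul_image sh std leg_vx vanishes_below_shift algebra_simps)
qed

text \<open>The sum is the order in t of the determinant of \<open>tripod m\<close>, which falls by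
  one with each step; it splits into the orders of the image and of the kernel of the second
  coordinate.\<close>

lemma quot_sub_exp: "quot_exp m + sub_exp m = - m"
proof -
  have "2 * (m div 2) = m" if "even m" using that by simp
  moreover have "2 * ((m + 1) div 2) = m + 1" "1 + 2 * (m div 2) = m" if "odd m" using that by presburger+
  ultimately show ?thesis by (auto simp: quot_exp_def sub_exp_def)
qed

lemma quot_exp_step: "quot_exp m - quot_exp (m + 1) \<in> {0, 1}" "sub_exp m - sub_exp (m + 1) \<in> {0, 1}"
proof -
  have "(m + 1 + 1) div 2 = m div 2 + 1" if "even m" using that by presburger
  then show "quot_exp m - quot_exp (m + 1) \<in> {0, 1}" "sub_exp m - sub_exp (m + 1) \<in> {0, 1}"
    by (auto simp: quot_exp_def sub_exp_def)
qed

lemma exp_period: "quot_exp (m + 6) = quot_exp m - 3" "sub_exp (m + 6) = sub_exp m - 3"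
proof -
  have "(m + 6) div 2 = m div 2 + 3" "(m + 6 + 1) div 2 = (m + 1) div 2 + 3" "(m + 6) mod 6 = m mod 6"
    by presburger+
  then show "quot_exp (m + 6) = quot_exp m - 3" "sub_exp (m + 6) = sub_exp m - 3"
    by (auto simp: quot_exp_def sub_exp_def)
qed

lemma exp_bounds: "- ((m + 1) div 2) \<le> quot_exp m" "- ((m + 1) div 2) \<le> sub_exp m"
  by (auto simp: quot_exp_def sub_exp_def)

lemma vanishes_below_fps: "vanishes_below (int q) (fps_to_fls c) \<longleftrightarrow> c \<in> range ((*) (fps_X ^ q))"
proof
  assume *: "vanishes_below (int q) (fps_to_fls c)"
  have "c = fps_X ^ q * fps_shift q c"
  proof (rule fps_ext)
    fix m
    show "c $ m = (fps_X ^ q * fps_shift q c) $ m"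
    proof (cases "m < q")
      case True
      then have "fps_to_fls c $$ int m = 0"
        using *[unfolded vanishes_below_def, rule_format, of "int m"] by simp
      then show ?thesis using True by (simp add: fps_X_power_mult_nth)
    qed (simp add: fps_X_power_mult_nth)
  qed
  then show "c \<in> range ((*) (fps_X ^ q))" by blast
qed (auto simp: vanishes_below_def fps_X_power_mult_nth)

context root_vec
begin

text \<open>Stated for any exponent function with steps 0 or 1 that drops by 3 per period, since it
  serves both the filtration and the profile. The period makes the arrow from n to 1 no
  exception.\<close>

lemma jump_exp:
  assumes E: "\<And>m. E m - E (m + 1) \<in> {0, 1}" "\<And>m. E (m + 6) = E m - 3" and i: "i \<in> {1..n}"
  shows "(wt (prv n i) + E (int (cnt (prv n i)) + e)) + eps k i - (wt i + E (int (cnt i) + e)) =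
    (if a i = 0 then 1 else if a i = 1 then E (int (cnt i) + e - 1) - E (int (cnt i) + e) else (0 :: int))"
proof -
  have "wt (prv n i) + E (int (cnt (prv n i)) + e) = wt (i - 1) + E (int (cnt (i - 1)) + e)"
    using i E(2)[of e] by (auto simp: prv_def add.commute)
  then show ?thesis using wt_step[OF i] cnt_step[OF i] by (auto simp: algebra_simps)
qed

text \<open>The second coordinate maps onto the top factor, and the intersection with the first axis
  is the bottom factor. This filtration computes the class of the module; it is not its
  profile.\<close>

lemma tripod_rep_filtration:
  assumes e: "e \<in> {0, 1}"
  obtains I J where "has_filtration k n (tripod_rep e) [I, J]"
    "\<And>j. j \<in> {1..n} \<Longrightarrow> a j = int (length (filter (\<lambda>I. j \<in> I) [I, J]))"
proof -
  let ?M = "tripod_rep e"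
  interpret plane_embedding k n ?M "\<lambda>i. fps_vec" by (rule tripod_rep_embedding)
  define P where "P E i = wt i + E (int (cnt i) + e)" for E :: "int \<Rightarrow> int" and i
  define q where "q i = nat (P quot_exp i)" for i
  define s where "s i = nat (P sub_exp i)" for i
  define I where "I = {i \<in> {1..n}. int (q (prv n i)) + eps k i = int (q i)}"
  define J where "J = {i \<in> {1..n}. int (s (prv n i)) + eps k i = int (s i)}"
  \<comment> \<open>All exponents are nonnegative, so the passage to natural numbers loses
    nothing.\<close>
  have pos: "int (q i) = P quot_exp i" "int (s i) = P sub_exp i" if "i \<in> {1..n}" for i
  proof -
    have "(int (cnt i) + e + 1) div 2 \<le> 4" using cnt_le[of i] e that by auto
    then show "int (q i) = P quot_exp i" "int (s i) = P sub_exp i"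
      using wt_ge[of i] exp_bounds[of "int (cnt i) + e"] that by (auto simp: P_def q_def s_def)
  qed
  have jq: "int (q (prv n i)) + eps k i - int (q i) =
      (if a i = 0 then 1 else if a i = 1 then quot_exp (int (cnt i) + e - 1) - quot_exp (int (cnt i) + e) else 0)"
    and js: "int (s (prv n i)) + eps k i - int (s i) =
      (if a i = 0 then 1 else if a i = 1 then sub_exp (int (cnt i) + e - 1) - sub_exp (int (cnt i) + e) else 0)"
    if i: "i \<in> {1..n}" for i
    unfolding pos[OF i] pos[OF prv_in[OF i]] P_def
    using jump_exp[of quot_exp i e, OF quot_exp_step(1) exp_period(1) i]
      jump_exp[of sub_exp i e, OF quot_exp_step(2) exp_period(2) i] by simp_all
  have jumpq: "int (q (prv n i)) + eps k i - int (q i) \<in> {0, 1}"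
    and jumps: "int (s (prv n i)) + eps k i - int (s i) \<in> {0, 1}" if i: "i \<in> {1..n}" for i
    unfolding jq[OF i] js[OF i]
    using quot_exp_step[of "int (cnt i) + e - 1"] by simp_all
  have kI: "k_subset k n I" "k_subset k n J"
    using card_jumps[of k n "\<lambda>i. int (q i)", OF _ jumpq] card_jumps[of k n "\<lambda>i. int (s i)", OF _ jumps] k
    by (auto simp: k_subset_def I_def J_def)
  have vM: "v \<in> vsp ?M i \<longleftrightarrow> fps_vec v \<in> tripod_lattice e i" for v i
    by (simp add: tripod_rep_def fps_lattice_rep_def)
  have ind: "tmul (- wt i) w \<in> tripod (int (cnt i) + e) \<longleftrightarrow> w \<in> tripod_lattice e i" for w i
    by (simp add: tripod_lattice_def mem_tmul_image)
  have im: "snd ` vsp ?M i = range ((*) (fps_X ^ q i))" if i: "i \<in> {1..n}" for i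
  proof -
    have "c \<in> snd ` vsp ?M i \<longleftrightarrow> vanishes_below (int (q i)) (fps_to_fls c)" for c
    proof -
      have "c \<in> snd ` vsp ?M i \<longleftrightarrow> (\<exists>w\<in>fps_vec ` vsp ?M i. vy w = fps_to_fls c)"
        by (force simp: fps_vec_def)
      also have "\<dots> \<longleftrightarrow> (\<exists>w\<in>tripod_lattice e i. vy w = fps_to_fls c)"
        unfolding tripod_rep_image[OF i e] ..
      also have "\<dots> \<longleftrightarrow> (\<exists>v\<in>tripod (int (cnt i) + e). vy v = fls_shift (wt i) (fps_to_fls c))"
      proof
        assume "\<exists>v\<in>tripod (int (cnt i) + e). vy v = fls_shift (wt i) (fps_to_fls c)"
        then show "\<exists>w\<in>tripod_lattice e i. vy w = fps_to_fls c"
          by (force simp: tripod_lattice_def tmul_sel)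
      next
        assume "\<exists>w\<in>tripod_lattice e i. vy w = fps_to_fls c"
        then obtain v where v: "v \<in> tripod (int (cnt i) + e)" "vy (tmul (wt i) v) = fps_to_fls c"
          by (auto simp: tripod_lattice_def)
        then have "vy v = fls_shift (wt i) (fps_to_fls c)" unfolding v(2)[symmetric] by (simp add: tmul_sel)
        then show "\<exists>v\<in>tripod (int (cnt i) + e). vy v = fls_shift (wt i) (fps_to_fls c)" using v(1) by blast
      qed
      also have "\<dots> \<longleftrightarrow> vanishes_below (int (q i)) (fps_to_fls c)"
        unfolding tripod_vy pos[OF i] P_def
        using vanishes_below_shift[of "quot_exp (int (cnt i) + e)" "- wt i" "fps_to_fls c"]
        by (simp add: add.commute)
      finally show ?thesis .
    qed
    then show ?thesis unfolding vanishes_below_fps by blast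
  qed
  have comp: "fst (zscale ?M c v) = c * fst v" "snd (zscale ?M c v) = c * snd v"
    "fst (xmap ?M i v) = fps_X ^ nat (eps k i) * fst v" "snd (xmap ?M i v) = fps_X ^ nat (eps k i) * snd v"
    "fst (ymap ?M i v) = fps_X ^ nat (1 - eps k i) * fst v" "snd (ymap ?M i v) = fps_X ^ nat (1 - eps k i) * snd v"
    for c v i
    by (auto simp: tripod_rep_def fps_lattice_rep_def eps_def)
  define f where "f i v = fps_shift (q i) (snd v)" for i and v :: "complex fps \<times> complex fps"
  have F: "brep_hom n ?M (L_module I) f" "\<And>i. i \<in> {1..n} \<Longrightarrow> f i ` vsp ?M i = vsp (L_module I) i"
    "\<And>i v. i \<in> {1..n} \<Longrightarrow> v \<in> vsp ?M i \<Longrightarrow> f i v = 0 \<longleftrightarrow> snd v = 0"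
    unfolding f_def by (rule rank_one_quotient[OF _ _ _ _ im jumpq I_def]; simp add: comp)+
  let ?N = "kernel_brep ?M f"
  have vN: "vsp ?N i = {v \<in> vsp ?M i. snd v = 0}" if "i \<in> {1..n}" for i
    using F(3)[OF that] by (auto simp: kernel_brep_def)
  have compN: "zscale ?N = zscale ?M" "xmap ?N = xmap ?M" "ymap ?N = ymap ?M" by (auto simp: kernel_brep_def)
  have imN: "fst ` vsp ?N i = range ((*) (fps_X ^ s i))" if i: "i \<in> {1..n}" for i
  proof -
    have "c \<in> fst ` vsp ?N i \<longleftrightarrow> vanishes_below (int (s i)) (fps_to_fls c)" for c
    proof -
      have "c \<in> fst ` vsp ?N i \<longleftrightarrow> (c, 0) \<in> vsp ?M i" unfolding vN[OF i] by force
      also have "\<dots> \<longleftrightarrow> Vec (fps_to_fls c) 0 \<in> tripod_lattice e i" unfolding vM by (simp add: fps_vec_def)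
      also have "\<dots> \<longleftrightarrow> tmul (- wt i) (Vec (fps_to_fls c) 0) \<in> tripod (int (cnt i) + e)" unfolding ind ..
      also have "tmul (- wt i) (Vec (fps_to_fls c) 0) = Vec (fls_shift (wt i) (fps_to_fls c)) 0"
        by (rule plane_eqI) (simp_all add: tmul_sel)
      also have "\<dots> \<in> tripod (int (cnt i) + e) \<longleftrightarrow> vanishes_below (int (s i)) (fps_to_fls c)"
        unfolding tripod_vx pos[OF i] P_def
        using vanishes_below_shift[of "sub_exp (int (cnt i) + e)" "- wt i" "fps_to_fls c"]
        by (simp add: add.commute)
      finally show ?thesis .
    qed
    then show ?thesis unfolding vanishes_below_fps by blast
  qed
  define g where "g i v = fps_shift (s i) (fst v)" for i and v :: "complex fps \<times> complex fps"
  have G: "brep_hom n ?N (L_module J) g" "\<And>i. i \<in> {1..n} \<Longrightarrow> g i ` vsp ?N i = vsp (L_module J) i"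
    "\<And>i v. i \<in> {1..n} \<Longrightarrow> v \<in> vsp ?N i \<Longrightarrow> g i v = 0 \<longleftrightarrow> fst v = 0"
    unfolding g_def by (rule rank_one_quotient[OF _ _ _ _ imN jumps J_def]; simp add: comp compN)+
  have zero: "vsp (kernel_brep ?N g) i = {0}" if i: "i \<in> {1..n}" for i
  proof -
    have "v = 0" if "v \<in> vsp (kernel_brep ?N g) i" for v
    proof -
      have "v \<in> vsp ?N i" "g i v = 0" using that by (auto simp: kernel_brep_def)
      then have "fst v = 0" "snd v = 0" using G(3)[OF i] vN[OF i] by auto
      then show ?thesis by (simp add: prod_eq_iff)
    qed
    moreover have "0 \<in> vsp ?N i" using vN[OF i] zero_in[OF i] by simp
    then have "0 \<in> vsp (kernel_brep ?N g) i" using G(3)[OF i] by (simp add: kernel_brep_def[of ?N])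
    ultimately show ?thesis by blast
  qed
  have "has_filtration k n ?M [I, J]"
    unfolding has_filtration.simps using kI F(1,2) G(1,2) zero by blast
  moreover have "a j = int (length (filter (\<lambda>I. j \<in> I) [I, J]))" if j: "j \<in> {1..n}" for j
  proof -
    \<comment> \<open>An arrow belongs to I or J when the corresponding exponent does not jump, and
      the two jumps add up to \<open>2 - a j\<close>.\<close>
    have "int (length (filter (\<lambda>I. j \<in> I) [I, J])) =
        (1 - (int (q (prv n j)) + eps k j - int (q j))) + (1 - (int (s (prv n j)) + eps k j - int (s j)))"
      using jumpq[OF j] jumps[OF j] j by (auto simp: I_def J_def)
    also have "\<dots> = a j"
      using a[OF j] quot_sub_exp[of "int (cnt j) + e"] quot_sub_exp[of "int (cnt j) + e - 1"]
      unfolding jq[OF j] js[OF j] by auto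
    finally show ?thesis by simp
  qed
  ultimately show ?thesis using that by blast
qed

end

section \<open>Real roots of degree two\<close>

definition cartan_form :: "nat \<Rightarrow> nat \<Rightarrow> (nat \<Rightarrow> int) \<Rightarrow> int" where
  "cartan_form k n r = (\<Sum>i=1..n. \<Sum>l=1..n. r i * J_cartan k n i l * r l)"

lemma J_cartan_sym: "J_cartan k n i l = J_cartan k n l i"
  by (auto simp: J_cartan_def J_adjacent_def)

lemma cartan_form_simple_root:
  assumes "i \<in> {1..n}" shows "cartan_form k n (simple_root i) = 2"
proof -
  have inner: "(\<Sum>l=1..n. simple_root i j * J_cartan k n j l * simple_root i l) = (if j = i then 2 else 0)" for j
  proof -
    have "(\<Sum>l=1..n. simple_root i j * J_cartan k n j l * simple_root i l) =
        (\<Sum>l=1..n. if l = i then (if j = i then 2 else 0) else 0)"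
      by (intro sum.cong) (auto simp: simple_root_def J_cartan_def)
    then show ?thesis using assms by simp
  qed
  show ?thesis unfolding cartan_form_def inner using assms by simp
qed

text \<open>With c the pairing of r and the simple root, which has square 2, subtracting c times the
  root changes the form by -2 c^2 + 2 c^2.\<close>

lemma cartan_form_reflection:
  assumes i: "i \<in> {1..n}"
  shows "cartan_form k n (simple_reflection k n i r) = cartan_form k n r"
proof -
  define c where "c = (\<Sum>l\<in>{1..n}. J_cartan k n i l * r l)"
  have ref: "simple_reflection k n i r j = r j - (if j = i then c else 0)" for j
    by (simp add: simple_reflection_def c_def simple_root_def)
  define s where "s j = (\<Sum>l=1..n. J_cartan k n j l * r l)" for j
  have inner: "(\<Sum>l=1..n. J_cartan k n j l * simple_reflection k n i r l) = s j - J_cartan k n j i * c" for j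
  proof -
    have "(\<Sum>l=1..n. J_cartan k n j l * simple_reflection k n i r l) =
        s j - (\<Sum>l=1..n. if l = i then J_cartan k n j i * c else 0)"
      unfolding ref s_def sum_subtractf[symmetric] by (intro sum.cong) (auto simp: algebra_simps)
    then show ?thesis using i by simp
  qed
  have form: "cartan_form k n u = (\<Sum>j=1..n. u j * (\<Sum>l=1..n. J_cartan k n j l * u l))" for u
    by (simp add: cartan_form_def sum_distrib_left mult.assoc)
  have "cartan_form k n (simple_reflection k n i r) =
      (\<Sum>j=1..n. (r j - (if j = i then c else 0)) * (s j - J_cartan k n j i * c))"
    unfolding form inner by (simp only: ref)
  also have "\<dots> = (\<Sum>j=1..n. r j * s j) - c * (\<Sum>j=1..n. J_cartan k n j i * r j) -
      (\<Sum>j=1..n. if j = i then c * (s i - J_cartan k n i i * c) else 0)"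
    unfolding sum_distrib_left sum_subtractf[symmetric]
    by (intro sum.cong) (auto simp: algebra_simps)
  also have "(\<Sum>j=1..n. J_cartan k n j i * r j) = c"
    unfolding c_def by (intro sum.cong refl) (simp only: J_cartan_sym[of k n i])
  also have "(\<Sum>j=1..n. if j = i then c * (s i - J_cartan k n i i * c) else 0) = c * (c - 2 * c)"
    using i by (simp add: s_def c_def J_cartan_def[of k n i i])
  also have "(\<Sum>j=1..n. r j * s j) - c * c - c * (c - 2 * c) = (\<Sum>j=1..n. r j * s j)"
    by (simp add: algebra_simps)
  also have "\<dots> = cartan_form k n r" unfolding form s_def ..
  finally show ?thesis .
qed

lemma real_root_form:
  assumes "real_root k n r"
  shows "cartan_form k n r = 2 \<and> (\<forall>j. j \<notin> {1..n} \<longrightarrow> r j = 0)"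
  using assms
proof induction
  case (simple i) then show ?case using cartan_form_simple_root by (auto simp: simple_root_def)
next
  case (reflect r i)
  then show ?case using cartan_form_reflection by (auto simp: simple_reflection_def simple_root_def)
qed

lemma root_vector_eq:
  assumes "j \<in> {1..n}"
  shows "root_vector k n r j = (if 2 \<le> j then r (j - 1) else 0) - (if j \<le> n - 1 then r j else 0) +
    (if j \<le> k then r n else 0)"
proof -
  have "(\<Sum>i\<in>{1..n-1}. r i * simple_root (i + 1) j) = (\<Sum>i\<in>{1..n-1}. if i = j - 1 then r i else 0)"
    using assms by (intro sum.cong) (auto simp: simple_root_def)
  also have "\<dots> = (if 2 \<le> j then r (j - 1) else 0)" using assms by (auto simp: sum.delta)
  finally have 1: "(\<Sum>i\<in>{1..n-1}. r i * simple_root (i + 1) j) = (if 2 \<le> j then r (j - 1) else 0)" .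
  have "(\<Sum>i\<in>{1..n-1}. r i * simple_root i j) = (\<Sum>i\<in>{1..n-1}. if i = j then r i else 0)"
    by (intro sum.cong) (auto simp: simple_root_def)
  then have 2: "(\<Sum>i\<in>{1..n-1}. r i * simple_root i j) = (if j \<le> n - 1 then r j else 0)"
    using assms by (auto simp: sum.delta)
  have "(\<Sum>i\<in>{1..k}. simple_root i j) = (\<Sum>i\<in>{1..k}. if i = j then 1 else 0)"
    by (intro sum.cong) (auto simp: simple_root_def)
  then have 3: "(\<Sum>i\<in>{1..k}. simple_root i j) = (if j \<le> k then 1 else 0)"
    using assms by (auto simp: sum.delta)
  show ?thesis unfolding root_vector_def right_diff_distrib sum_subtractf 1 2 3 by simp
qed

text \<open>The second identity is the equality of the quadratic form q with the Cartan form: by the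
  first one, \<open>(\<Sum>a\<^sub>i)\<^sup>2 / k\<^sup>2\<close> is \<open>(r n)\<^sup>2\<close>.
  For n = 9 and n = 8 both are polynomial identities checked by expansion.\<close>

lemma root_vector_sums:
  assumes "(k, n) = (3, 9) \<or> (k, n) = (4, 8)"
  shows "(\<Sum>j=1..n. root_vector k n r j) = int k * r n"
    "(\<Sum>j=1..n. (root_vector k n r j)\<^sup>2) = cartan_form k n r - (2 - int k) * (r n)\<^sup>2"
proof -
  have set9: "{1..9} = {1, 2, 3, 4, 5, 6, 7, 8, 9 :: nat}" and set8: "{1..8} = {1, 2, 3, 4, 5, 6, 7, 8 :: nat}"
    by auto
  have s9: "(\<Sum>j=1..9. F j) = F 1 + F 2 + F 3 + F 4 + F 5 + F 6 + F 7 + F 8 + F 9" for F :: "nat \<Rightarrow> int"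
    unfolding set9 by simp
  have s8: "(\<Sum>j=1..8. F j) = F 1 + F 2 + F 3 + F 4 + F 5 + F 6 + F 7 + F 8" for F :: "nat \<Rightarrow> int"
    unfolding set8 by simp
  have "(\<Sum>j=1..n. root_vector k n r j) = int k * r n \<and>
    (\<Sum>j=1..n. (root_vector k n r j)\<^sup>2) = cartan_form k n r - (2 - int k) * (r n)\<^sup>2"
    using assms
  proof
    assume "(k, n) = (3, 9)"
    then have kn: "k = 3" "n = 9" by auto
    show ?thesis unfolding kn cartan_form_def s9
      by (simp add: root_vector_eq J_cartan_def J_adjacent_def) (simp add: power2_eq_square algebra_simps)
  next
    assume "(k, n) = (4, 8)"
    then have kn: "k = 4" "n = 8" by auto
    show ?thesis unfolding kn cartan_form_def s8
      by (simp add: root_vector_eq J_cartan_def J_adjacent_def) (simp add: power2_eq_square algebra_simps)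
  qed
  then show "(\<Sum>j=1..n. root_vector k n r j) = int k * r n"
    "(\<Sum>j=1..n. (root_vector k n r j)\<^sup>2) = cartan_form k n r - (2 - int k) * (r n)\<^sup>2" by auto
qed

text \<open>The entries sum to 2k and their squares to 4k - 6. For (3,9) both numbers are 6, so the
  nonnegative integers a(a - 1) sum to 0; for (4,8) they are 8 and 10, so the squares of a - 1 sum
  to 2.\<close>

lemma degree_2_root_vec:
  assumes kn: "(k, n) = (3, 9) \<or> (k, n) = (4, 8)" and "real_root k n r" "root_degree n r = 2"
  shows "root_vec k n (root_vector k n r)"
proof -
  define a where "a = root_vector k n r"
  have rn: "r n = 2" using assms by (simp add: root_degree_def)
  have s1: "(\<Sum>j=1..n. a j) = 2 * int k" and s2: "(\<Sum>j=1..n. (a j)\<^sup>2) = 4 * int k - 6"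
    using root_vector_sums[OF kn, of r] real_root_form[OF assms(2)] rn by (auto simp: a_def)
  have range: "a j \<in> {0, 1, 2}" if j: "j \<in> {1..n}" for j
    using kn
  proof
    assume "(k, n) = (3, 9)"
    then have "(\<Sum>j=1..n. (a j)\<^sup>2 - a j) = 0" using s1 s2 by (simp add: sum_subtractf)
    moreover have "0 \<le> x\<^sup>2 - x" for x :: int
      using mult_nonneg_nonneg[of x "x - 1"] mult_nonpos_nonpos[of x "x - 1"]
      by (cases "x \<le> 0") (auto simp: power2_eq_square algebra_simps)
    ultimately have "(a j)\<^sup>2 - a j = 0" using j sum_nonneg_eq_0_iff[of "{1..n}" "\<lambda>j. (a j)\<^sup>2 - a j"] by simp
    then have "a j * (a j - 1) = 0" by (simp add: power2_eq_square algebra_simps)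
    then show ?thesis by auto
  next
    assume "(k, n) = (4, 8)"
    then have "(\<Sum>j=1..n. (a j - 1)\<^sup>2) = 2"
      using s1 s2 by (simp add: power2_diff sum_subtractf sum.distrib sum_distrib_left[symmetric])
    moreover have "(a j - 1)\<^sup>2 \<le> (\<Sum>j=1..n. (a j - 1)\<^sup>2)" using j by (intro member_le_sum) auto
    ultimately have "(a j - 1)\<^sup>2 < 2\<^sup>2" by simp
    then have "\<bar>a j - 1\<bar> < 2" using power2_less_imp_less[of "\<bar>a j - 1\<bar>" 2] by simp
    then show ?thesis by auto
  qed
  define N where "N v = int (card {j \<in> {1..n}. a j = v})" for v
  have count: "(\<Sum>j=1..n. f (a j)) = f 0 * N 0 + f 1 * N 1 + f 2 * N 2" for f :: "int \<Rightarrow> int"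
  proof -
    have "(\<Sum>j=1..n. f (a j)) = (\<Sum>j=1..n. (if a j = 0 then f 0 else 0) + (if a j = 1 then f 1 else 0) + (if a j = 2 then f 2 else 0))"
      using range by (intro sum.cong) auto
    also have "\<dots> = f 0 * N 0 + f 1 * N 1 + f 2 * N 2"
    proof -
      have "(\<Sum>j=1..n. if a j = v then c else 0) = c * N v" for v c
        unfolding N_def sum.inter_filter[symmetric, OF finite_atLeastAtMost] sum_constant by (simp only: mult.commute)
      then show ?thesis by (simp only: sum.distrib)
    qed
    finally show ?thesis .
  qed
  \<comment> \<open>The number, the sum and the sum of squares of the entries are three linear
    equations for the multiplicities of 0, 1 and 2.\<close>
  have "int n = N 0 + N 1 + N 2" "2 * int k = N 1 + 2 * N 2" "4 * int k - 6 = N 1 + 4 * N 2"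
    using count[of "\<lambda>_. 1"] count[of "\<lambda>x. x"] count[of "\<lambda>x. x\<^sup>2"] s1 s2 by simp_all
  then have "N 1 = 6" "N 0 = int (n - k - 3)" using kn by auto
  then have "card {j \<in> {1..n}. a j = 1} = 6" "card {j \<in> {1..n}. a j = 0} = n - k - 3"
    by (simp_all add: N_def)
  then show ?thesis using range kn unfolding a_def[symmetric] by unfold_locales auto
qed

section \<open>Rigidity\<close>

locale extension = B_mod k n M for k n :: nat and M :: "'v::ab_group_add brep" +
  fixes E :: "('v \<times> 'v) brep" and f :: "nat \<Rightarrow> 'v \<Rightarrow> 'v \<times> 'v" and g :: "nat \<Rightarrow> 'v \<times> 'v \<Rightarrow> 'v"
  assumes ext: "(E, f, g) \<in> extensions k n M M"
begin

sublocale E: B_mod k n E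
  using ext k by unfold_locales (auto simp: extensions_def)

lemma
  assumes "i \<in> {1..n}"
  shows f_in: "u \<in> vsp M i \<Longrightarrow> f i u \<in> vsp E i"
    and f_add: "u \<in> vsp M i \<Longrightarrow> v \<in> vsp M i \<Longrightarrow> f i (u + v) = f i u + f i v"
    and f_scale: "u \<in> vsp M i \<Longrightarrow> f i (zscale M c u) = zscale E c (f i u)"
    and f_x: "u \<in> vsp M (prv n i) \<Longrightarrow> f i (xmap M i u) = xmap E i (f (prv n i) u)"
    and f_y: "u \<in> vsp M i \<Longrightarrow> f (prv n i) (ymap M i u) = ymap E i (f i u)"
    and f_inj: "u \<in> vsp M i \<Longrightarrow> v \<in> vsp M i \<Longrightarrow> f i u = f i v \<Longrightarrow> u = v"
    and g_in: "e \<in> vsp E i \<Longrightarrow> g i e \<in> vsp M i"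
    and g_add: "d \<in> vsp E i \<Longrightarrow> e \<in> vsp E i \<Longrightarrow> g i (d + e) = g i d + g i e"
    and g_scale: "e \<in> vsp E i \<Longrightarrow> g i (zscale E c e) = zscale M c (g i e)"
    and g_x: "e \<in> vsp E (prv n i) \<Longrightarrow> g i (xmap E i e) = xmap M i (g (prv n i) e)"
    and g_y: "e \<in> vsp E i \<Longrightarrow> g (prv n i) (ymap E i e) = ymap M i (g i e)"
    and g_surj: "v \<in> vsp M i \<Longrightarrow> \<exists>e\<in>vsp E i. g i e = v"
    and exact: "e \<in> vsp E i \<Longrightarrow> g i e = 0 \<Longrightarrow> \<exists>u\<in>vsp M i. f i u = e"
    and gf: "u \<in> vsp M i \<Longrightarrow> g i (f i u) = 0"
proof -
  have F: "brep_hom n M E f" and G: "brep_hom n E M g" and inj: "inj_on (f i) (vsp M i)"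
    and im: "g i ` vsp E i = vsp M i" and ex: "f i ` vsp M i = {e \<in> vsp E i. g i e = 0}"
    using ext assms by (auto simp: extensions_def)
  show "u \<in> vsp M i \<Longrightarrow> f i u \<in> vsp E i" "u \<in> vsp M i \<Longrightarrow> v \<in> vsp M i \<Longrightarrow> f i (u + v) = f i u + f i v"
    "u \<in> vsp M i \<Longrightarrow> f i (zscale M c u) = zscale E c (f i u)"
    "u \<in> vsp M (prv n i) \<Longrightarrow> f i (xmap M i u) = xmap E i (f (prv n i) u)"
    "u \<in> vsp M i \<Longrightarrow> f (prv n i) (ymap M i u) = ymap E i (f i u)"
    using F assms by (auto simp: brep_hom_def zlinear_on_def)
  show "u \<in> vsp M i \<Longrightarrow> v \<in> vsp M i \<Longrightarrow> f i u = f i v \<Longrightarrow> u = v" using inj by (auto dest: inj_onD)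
  show "e \<in> vsp E i \<Longrightarrow> g i e \<in> vsp M i" "d \<in> vsp E i \<Longrightarrow> e \<in> vsp E i \<Longrightarrow> g i (d + e) = g i d + g i e"
    "e \<in> vsp E i \<Longrightarrow> g i (zscale E c e) = zscale M c (g i e)"
    "e \<in> vsp E (prv n i) \<Longrightarrow> g i (xmap E i e) = xmap M i (g (prv n i) e)"
    "e \<in> vsp E i \<Longrightarrow> g (prv n i) (ymap E i e) = ymap M i (g i e)"
    using G assms by (auto simp: brep_hom_def zlinear_on_def)
  show "v \<in> vsp M i \<Longrightarrow> \<exists>e\<in>vsp E i. g i e = v" using im by (metis imageE)
  show "e \<in> vsp E i \<Longrightarrow> g i e = 0 \<Longrightarrow> \<exists>u\<in>vsp M i. f i u = e"
  proof -
    assume "e \<in> vsp E i" "g i e = 0"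
    then have "e \<in> f i ` vsp M i" using ex by simp
    then show ?thesis by blast
  qed
  show "u \<in> vsp M i \<Longrightarrow> g i (f i u) = 0"
  proof -
    assume "u \<in> vsp M i"
    then have "f i u \<in> {e \<in> vsp E i. g i e = 0}" unfolding ex[symmetric] by blast
    then show ?thesis by blast
  qed
qed

lemma g_diff:
  assumes "i \<in> {1..n}" "d \<in> vsp E i" "e \<in> vsp E i" shows "g i (d - e) = g i d - g i e"
  using g_add[OF assms(1) E.diff_in[OF assms] assms(3)] by simp

end

locale split_extension = extension +
  fixes s :: "nat \<Rightarrow> 'a \<Rightarrow> 'a \<times> 'a"
  assumes s_hom: "brep_hom n M E s"
    and gs: "\<And>i v. i \<in> {1..n} \<Longrightarrow> v \<in> vsp M i \<Longrightarrow> g i (s i v) = v"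
begin

lemma
  assumes "i \<in> {1..n}"
  shows s_in: "u \<in> vsp M i \<Longrightarrow> s i u \<in> vsp E i"
    and s_add: "u \<in> vsp M i \<Longrightarrow> v \<in> vsp M i \<Longrightarrow> s i (u + v) = s i u + s i v"
    and s_scale: "u \<in> vsp M i \<Longrightarrow> s i (zscale M c u) = zscale E c (s i u)"
    and s_x: "u \<in> vsp M (prv n i) \<Longrightarrow> s i (xmap M i u) = xmap E i (s (prv n i) u)"
    and s_y: "u \<in> vsp M i \<Longrightarrow> s (prv n i) (ymap M i u) = ymap E i (s i u)"
  using s_hom assms by (auto simp: brep_hom_def zlinear_on_def)

text \<open>The retraction onto M belonging to the section s; the pair of r and g gives coordinates
  on E.\<close>

definition "r i e = (SOME u. u \<in> vsp M i \<and> e = f i u + s i (g i e))"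

lemma r:
  assumes i: "i \<in> {1..n}" and e: "e \<in> vsp E i"
  shows r_in: "r i e \<in> vsp M i" and decomp: "e = f i (r i e) + s i (g i e)"
proof -
  have se: "s i (g i e) \<in> vsp E i" by (rule s_in[OF i g_in[OF i e]])
  have "g i (e - s i (g i e)) = 0" using g_diff[OF i e se] gs[OF i g_in[OF i e]] by simp
  then obtain u where "u \<in> vsp M i" "f i u = e - s i (g i e)"
    using exact[OF i E.diff_in[OF i e se]] by blast
  then have "\<exists>u. u \<in> vsp M i \<and> e = f i u + s i (g i e)" by (intro exI[of _ u]) simp
  then have "r i e \<in> vsp M i \<and> e = f i (r i e) + s i (g i e)" unfolding r_def by (rule someI_ex)
  then show "r i e \<in> vsp M i" "e = f i (r i e) + s i (g i e)" by auto
qed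

lemma g_combine:
  assumes i: "i \<in> {1..n}" and uv: "u \<in> vsp M i" "v \<in> vsp M i"
  shows "f i u + s i v \<in> vsp E i" "g i (f i u + s i v) = v" "r i (f i u + s i v) = u"
proof -
  show e: "f i u + s i v \<in> vsp E i" by (intro E.add_in f_in s_in i uv)
  show gv: "g i (f i u + s i v) = v"
    using g_add[OF i f_in[OF i uv(1)] s_in[OF i uv(2)]] gf[OF i uv(1)] gs[OF i uv(2)] by simp
  have "f i (r i (f i u + s i v)) = f i u" using decomp[OF i e] gv by (metis add_right_cancel)
  then show "r i (f i u + s i v) = u" using f_inj[OF i r_in[OF i e] uv(1)] by simp
qed

end

text \<open>The sections identify both middle terms with the direct sum of two copies of M, and h is
  the resulting comparison.\<close>

lemma split_extensions_related:
  assumes "split_extension k n M E f g s" "split_extension k n M E' f' g' s'"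
  shows "((E, f, g), (E', f', g')) \<in> ext_rel k n M M"
proof -
  interpret A: split_extension k n M E f g s by fact
  interpret A': split_extension k n M E' f' g' s' by fact
  define h where "h i e = f' i (A.r i e) + s' i (g i e)" for i e
  define h' where "h' i e = f i (A'.r i e) + s i (g' i e)" for i e
  have h: "h i (f i u + s i v) = f' i u + s' i v" if "i \<in> {1..n}" "u \<in> vsp M i" "v \<in> vsp M i" for i u v
    using A.g_combine[OF that] by (simp add: h_def)
  have rep: "\<exists>u\<in>vsp M i. \<exists>v\<in>vsp M i. e = f i u + s i v" if "i \<in> {1..n}" "e \<in> vsp E i" for i e
    using A.r_in[OF that] A.decomp[OF that] A.g_in[OF that] by blast
  have "brep_hom n E E' h"
    unfolding brep_hom_def zlinear_on_def
  proof (intro ballI conjI allI)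
    fix i assume i: "i \<in> {1..n}"
    have i': "prv n i \<in> {1..n}" by (rule prv_in[OF i])
    show "h i e \<in> vsp E' i" if "e \<in> vsp E i" for e
      using rep[OF i that] h[OF i] A'.g_combine(1)[OF i] by auto
    show "h i (d + e) = h i d + h i e" if "d \<in> vsp E i" "e \<in> vsp E i" for d e
    proof -
      obtain u v where d: "d = f i u + s i v" and uv: "u \<in> vsp M i" "v \<in> vsp M i" using rep[OF i \<open>d \<in> _\<close>] by blast
      obtain u' v' where e: "e = f i u' + s i v'" and uv': "u' \<in> vsp M i" "v' \<in> vsp M i" using rep[OF i \<open>e \<in> _\<close>] by blast
      have "d + e = f i (u + u') + s i (v + v')"
        unfolding d e using A.f_add[OF i uv(1) uv'(1)] A.s_add[OF i uv(2) uv'(2)] by (simp add: algebra_simps)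
      then have "h i (d + e) = f' i (u + u') + s' i (v + v')"
        using h[OF i A.add_in[OF i uv(1) uv'(1)] A.add_in[OF i uv(2) uv'(2)]] by simp
      then show ?thesis
        unfolding d e h[OF i uv] h[OF i uv']
        using A'.f_add[OF i uv(1) uv'(1)] A'.s_add[OF i uv(2) uv'(2)] by (simp add: algebra_simps)
    qed
    show "h i (zscale E c e) = zscale E' c (h i e)" if "e \<in> vsp E i" for c e
    proof -
      obtain u v where e: "e = f i u + s i v" and uv: "u \<in> vsp M i" "v \<in> vsp M i" using rep[OF i \<open>e \<in> _\<close>] by blast
      have "zscale E c e = f i (zscale M c u) + s i (zscale M c v)"
        unfolding e using A.f_scale[OF i uv(1)] A.s_scale[OF i uv(2)] by (simp add: A.E.Z.scale_right_distrib)
      then have "h i (zscale E c e) = f' i (zscale M c u) + s' i (zscale M c v)"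
        using h[OF i A.scale_in[OF i uv(1)] A.scale_in[OF i uv(2)]] by simp
      then show ?thesis
        unfolding e h[OF i uv] using A'.f_scale[OF i uv(1)] A'.s_scale[OF i uv(2)]
        by (simp add: A'.E.Z.scale_right_distrib)
    qed
    show "h i (xmap E i e) = xmap E' i (h (prv n i) e)" if "e \<in> vsp E (prv n i)" for e
    proof -
      obtain u v where e: "e = f (prv n i) u + s (prv n i) v" and uv: "u \<in> vsp M (prv n i)" "v \<in> vsp M (prv n i)"
        using rep[OF i' \<open>e \<in> _\<close>] by blast
      have "xmap E i e = f i (xmap M i u) + s i (xmap M i v)"
        unfolding e A.f_x[OF i uv(1)] A.s_x[OF i uv(2)] by (rule A.E.x_add[OF i A.f_in[OF i' uv(1)] A.s_in[OF i' uv(2)]])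
      then have "h i (xmap E i e) = f' i (xmap M i u) + s' i (xmap M i v)"
        using h[OF i A.x_in[OF i uv(1)] A.x_in[OF i uv(2)]] by simp
      also have "\<dots> = xmap E' i (f' (prv n i) u + s' (prv n i) v)"
        unfolding A'.f_x[OF i uv(1)] A'.s_x[OF i uv(2)]
        by (rule A'.E.x_add[OF i A'.f_in[OF i' uv(1)] A'.s_in[OF i' uv(2)], symmetric])
      finally show ?thesis unfolding e h[OF i' uv] .
    qed
    show "h (prv n i) (ymap E i e) = ymap E' i (h i e)" if "e \<in> vsp E i" for e
    proof -
      obtain u v where e: "e = f i u + s i v" and uv: "u \<in> vsp M i" "v \<in> vsp M i"
        using rep[OF i \<open>e \<in> _\<close>] by blast
      have "ymap E i e = f (prv n i) (ymap M i u) + s (prv n i) (ymap M i v)"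
        unfolding e A.f_y[OF i uv(1)] A.s_y[OF i uv(2)] by (rule A.E.y_add[OF i A.f_in[OF i uv(1)] A.s_in[OF i uv(2)]])
      then have "h (prv n i) (ymap E i e) = f' (prv n i) (ymap M i u) + s' (prv n i) (ymap M i v)"
        using h[OF i' A.y_in[OF i uv(1)] A.y_in[OF i uv(2)]] by simp
      also have "\<dots> = ymap E' i (f' i u + s' i v)"
        unfolding A'.f_y[OF i uv(1)] A'.s_y[OF i uv(2)]
        by (rule A'.E.y_add[OF i A'.f_in[OF i uv(1)] A'.s_in[OF i uv(2)], symmetric])
      finally show ?thesis unfolding e h[OF i uv] .
    qed
  qed
  moreover have "bij_betw (h i) (vsp E i) (vsp E' i)" if i: "i \<in> {1..n}" for i
  proof (rule bij_betw_byWitness[where f' = "h' i"])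
    have h'_rep: "h' i (f' i u + s' i v) = f i u + s i v" if "u \<in> vsp M i" "v \<in> vsp M i" for u v
      using A'.g_combine[OF i that] by (simp add: h'_def)
    show "\<forall>e\<in>vsp E i. h' i (h i e) = e"
      using rep[OF i] h[OF i] h'_rep by force
    have rep': "\<exists>u\<in>vsp M i. \<exists>v\<in>vsp M i. e = f' i u + s' i v" if "e \<in> vsp E' i" for e
      using A'.r_in[OF i that] A'.decomp[OF i that] A'.g_in[OF i that] by blast
    show "\<forall>e\<in>vsp E' i. h i (h' i e) = e"
      using rep' h[OF i] h'_rep by force
    show "h i ` vsp E i \<subseteq> vsp E' i"
      using rep[OF i] h[OF i] A'.g_combine(1)[OF i] by force
    show "h' i ` vsp E' i \<subseteq> vsp E i"
      using rep' h'_rep A.g_combine(1)[OF i] by force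
  qed
  ultimately have "brep_iso n E E' h" by (simp add: brep_iso_def)
  moreover have "h i (f i v) = f' i v" if i: "i \<in> {1..n}" and v: "v \<in> vsp M i" for i v
  proof -
    have "s i 0 = 0" "s' i 0 = 0"
      using A.s_scale[OF i A.zero_in[OF i], of 0] A'.s_scale[OF i A.zero_in[OF i], of 0] by simp_all
    then show ?thesis using h[OF i v A.zero_in[OF i]] by simp
  qed
  moreover have "g' i (h i e) = g i e" if i: "i \<in> {1..n}" and e: "e \<in> vsp E i" for i e
    using A'.g_combine(2)[OF i A.r_in[OF i e] A.g_in[OF i e]] by (simp add: h_def)
  ultimately show ?thesis using A.ext A'.ext by (auto simp: ext_rel_def)
qed

context B_mod
begin

lemma direct_sum_extension:
  "(direct_sum M M, \<lambda>i v. (v, 0), \<lambda>i. snd) \<in> extensions k n M M"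
proof -
  let ?D = "direct_sum M M"
  have mod: "module (\<lambda>c. map_prod (zscale M c) (zscale M c))"
    by unfold_locales (auto simp: Z.scale_right_distrib Z.scale_left_distrib)
  then interpret D: module "\<lambda>c. map_prod (zscale M c) (zscale M c)" .
  have xp: "xpow n ?D m i v = (xpow n M m i (fst v), xpow n M m i (snd v))" for m i v
    by (induction m arbitrary: i v) (auto simp: direct_sum_def)
  have yp: "ypow n ?D m i v = (ypow n M m i (fst v), ypow n M m i (snd v))" for m i v
    by (induction m arbitrary: i v) (auto simp: direct_sum_def)
  have sub: "D.subspace (vsp M i \<times> vsp M i)" if "i \<in> {1..n}" for i
    using zero_in[OF that] add_in[OF that] scale_in[OF that] by (auto simp: D.subspace_def zero_prod_def)
  have yx': "ymap M (nxt n i) (xmap M (nxt n i) v) = zscale M fps_X v" if "i \<in> {1..n}" "v \<in> vsp M i" for i v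
    using yx[OF nxt_in[OF that(1)]] prv_nxt[OF that(1)] that(2) by simp
  have "B_module k n ?D"
    unfolding B_module_def
  proof (intro conjI ballI)
    show "module (zscale ?D)" using mod by (simp add: direct_sum_def)
    fix i assume i: "i \<in> {1..n}"
    show "module.subspace (zscale ?D) (vsp ?D i)" using sub[OF i] by (simp add: direct_sum_def)
    show "zlinear_on (zscale ?D) (vsp ?D (prv n i)) (zscale ?D) (vsp ?D i) (xmap ?D i)"
      using x_in[OF i] x_add[OF i] x_scale[OF i] by (auto simp: zlinear_on_def direct_sum_def)
    show "zlinear_on (zscale ?D) (vsp ?D i) (zscale ?D) (vsp ?D (prv n i)) (ymap ?D i)"
      using y_in[OF i] y_add[OF i] y_scale[OF i] by (auto simp: zlinear_on_def direct_sum_def)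
    fix v assume v: "v \<in> vsp ?D i"
    then have v': "fst v \<in> vsp M i" "snd v \<in> vsp M i" by (auto simp: direct_sum_def)
    show "xmap ?D i (ymap ?D i v) = zscale ?D fps_X v"
      using v' xy[OF i] by (auto simp: direct_sum_def prod_eq_iff)
    show "ymap ?D (nxt n i) (xmap ?D (nxt n i) v) = zscale ?D fps_X v"
      using v' yx'[OF i] by (auto simp: direct_sum_def prod_eq_iff)
    show "xpow n ?D k i v = ypow n ?D (n - k) i v"
      using v' path[OF i] by (simp add: xp yp)
  qed
  moreover have "i \<in> {1..n} \<Longrightarrow> xmap M i 0 = 0" for i
    using x_scale[of i 0 0] zero_in prv_in by simp
  moreover have "i \<in> {1..n} \<Longrightarrow> ymap M i 0 = 0" for i
    using y_scale[of i 0 0] zero_in by simp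
  ultimately show ?thesis
    using zero_in by (auto simp: extensions_def brep_hom_def zlinear_on_def direct_sum_def inj_on_def)
qed

text \<open>If every extension has a section, then all extensions are equivalent; since the direct
  sum is one of them, its class is the only one.\<close>

lemma rigidI:
  assumes "\<And>E f g. (E, f, g) \<in> extensions k n M M \<Longrightarrow>
    \<exists>s. brep_hom n M E s \<and> (\<forall>i\<in>{1..n}. \<forall>v\<in>vsp M i. g i (s i v) = v)"
  shows "rigid k n M"
proof -
  have rel: "(X, Y) \<in> ext_rel k n M M" if X: "X \<in> extensions k n M M" and Y: "Y \<in> extensions k n M M" for X Y
  proof -
    obtain E f g where x: "X = (E, f, g)" by (cases X)
    obtain E' f' g' where y: "Y = (E', f', g')" by (cases Y)
    obtain s where "brep_hom n M E s" "\<forall>i\<in>{1..n}. \<forall>v\<in>vsp M i. g i (s i v) = v" using assms X x by blast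
    then have "split_extension k n M E f g s" using X x by unfold_locales auto
    moreover obtain s' where "brep_hom n M E' s'" "\<forall>i\<in>{1..n}. \<forall>v\<in>vsp M i. g' i (s' i v) = v"
      using assms Y y by blast
    then have "split_extension k n M E' f' g' s'" using Y y by unfold_locales auto
    ultimately show ?thesis unfolding x y by (rule split_extensions_related)
  qed
  have "ext_rel k n M M `` {X} = extensions k n M M" if "X \<in> extensions k n M M" for X
  proof
    show "ext_rel k n M M `` {X} \<subseteq> extensions k n M M" by (auto simp: ext_rel_def)
    show "extensions k n M M \<subseteq> ext_rel k n M M `` {X}" using rel that by blast
  qed
  then show ?thesis using direct_sum_extension
    unfolding rigid_def Ext1_def Ext1_zero_def quotient_def by auto
qed

end

text \<open>The differences of the lifts \<open>p\<close>, \<open>q\<close>, \<open>s\<close> at the three visits to the centre lie, modulo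
  \<open>M\<^sub>2(\<complex>[[t]])\<close>, in the spans of the nilpotents attached to the three lines; these are linearly
  independent and the differences sum to zero, so all lifts agree.  The three lines then give three
  independent conditions on the constant matrix by which the lift must be corrected.\<close>

definition pair_submodule :: "(plane \<times> plane) set \<Rightarrow> bool" where
  "pair_submodule G \<longleftrightarrow> (\<forall>u v u' v'. (u, v) \<in> G \<longrightarrow> (u', v') \<in> G \<longrightarrow> (u + u', v + v') \<in> G) \<and>
    (\<forall>c u v. (u, v) \<in> G \<longrightarrow> (oscale c u, oscale c v) \<in> G)"

lemma pair_submoduleD:
  assumes "pair_submodule G"
  shows "(u, v) \<in> G \<Longrightarrow> (u', v') \<in> G \<Longrightarrow> (u + u', v + v') \<in> G"
    "(u, v) \<in> G \<Longrightarrow> (oscale c u, oscale c v) \<in> G"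
    "(u, v) \<in> G \<Longrightarrow> (u', v') \<in> G \<Longrightarrow> (u - u', v - v') \<in> G"
proof -
  show *: "(u, v) \<in> G \<Longrightarrow> (u', v') \<in> G \<Longrightarrow> (u + u', v + v') \<in> G" for u v u' v'
    using assms by (auto simp: pair_submodule_def)
  show **: "(u, v) \<in> G \<Longrightarrow> (oscale c u, oscale c v) \<in> G" for c u v
    using assms by (auto simp: pair_submodule_def)
  show "(u, v) \<in> G \<Longrightarrow> (u', v') \<in> G \<Longrightarrow> (u - u', v - v') \<in> G"
    using *[of u v "- u'" "- v'"] **[of u' v' "-1"] by simp
qed

lemma graph_span2:
  assumes "pair_submodule G" "klinear \<sigma>" "(\<sigma> g, g) \<in> G" "(\<sigma> h, h) \<in> G" "v \<in> span2 g h"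
  shows "(\<sigma> v, v) \<in> G"
proof -
  obtain a b where v: "v = oscale a g + oscale b h" using assms(5) by (rule span2E)
  have "\<sigma> v = oscale a (\<sigma> g) + oscale b (\<sigma> h)"
    using assms(2) by (simp add: v klinear_def oscale_def)
  then show ?thesis unfolding v using assms pair_submoduleD(1,2)[OF assms(1)] by simp
qed

text \<open>G m stands for an extension at position m of the chain, as pairs of a vector in the
  plane over K and the image in the quotient: \<open>ker\<close> and \<open>lift\<close> express
  exactness with \<open>tripod m\<close> at both ends, \<open>up\<close> and \<open>down\<close> are
  the arrows, \<open>period\<close> is the full turn. The graph of a single K-linear map has to lie
  in all of them.\<close>

lemma tripod_section:
  fixes G :: "int \<Rightarrow> (plane \<times> plane) set"
  assumes sub: "\<And>m. pair_submodule (G m)"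
    and ker: "\<And>m u. (u, 0) \<in> G m \<longleftrightarrow> u \<in> tripod m"
    and lift: "\<And>m v. v \<in> tripod m \<Longrightarrow> \<exists>u. (u, v) \<in> G m"
    and up: "\<And>m u v. (u, v) \<in> G m \<Longrightarrow> (u, v) \<in> G (m + 1)"
    and down: "\<And>m u v. (u, v) \<in> G (m + 1) \<Longrightarrow> (tmul 1 u, tmul 1 v) \<in> G m"
    and period: "\<And>m u v. (u, v) \<in> G (m + 6) \<longleftrightarrow> (tmul 3 u, tmul 3 v) \<in> G m"
  obtains \<sigma> where "klinear \<sigma>" "\<And>m v. v \<in> tripod m \<Longrightarrow> (\<sigma> v, v) \<in> G m"
proof -
  \<comment> \<open>Rescaling so that the three visits to the centre, \<open>C 0 0\<close>,
    \<open>C 1 2\<close> and \<open>C 2 4\<close>, all have kernel and quotient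
    \<open>std_lattice\<close>. The legs between them are \<open>C 1 1\<close>, \<open>C 2 3\<close>
    and \<open>C 3 5\<close>, and \<open>C 3 6\<close> is \<open>C 0 0\<close> again.\<close>
  define C where "C p m = {(u, v). (tmul (- p) u, tmul (- p) v) \<in> G m}" for p m
  have C_iff: "(u, v) \<in> C p m \<longleftrightarrow> (tmul (- p) u, tmul (- p) v) \<in> G m" for u v p m by (simp add: C_def)
  have subC: "pair_submodule (C p m)" for p m
    using pair_submoduleD(1,2)[OF sub[of m]] by (simp add: pair_submodule_def C_iff tmul_add tmul_oscale)
  note add = pair_submoduleD(1)[OF subC] and diff = pair_submoduleD(3)[OF subC]
  have kerC: "(u, 0) \<in> C p m \<longleftrightarrow> u \<in> tmul p ` tripod m" for u p m
    using ker[of "tmul (- p) u" m] by (simp add: C_iff mem_tmul_image)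
  have liftC: "\<exists>u. (u, v) \<in> C p m" if "v \<in> tmul p ` tripod m" for v p m
  proof -
    have "tmul (- p) v \<in> tripod m" using that by (simp add: mem_tmul_image)
    then obtain u where "(u, tmul (- p) v) \<in> G m" using lift by blast
    then have "(tmul p u, v) \<in> C p m" by (simp add: C_iff)
    then show ?thesis by blast
  qed
  have upC: "(u, v) \<in> C p m \<Longrightarrow> (u, v) \<in> C p (m + 1)" for u v p m using up by (simp add: C_iff)
  have downC: "(u, v) \<in> C p (m + 1) \<Longrightarrow> (u, v) \<in> C (p - 1) m" for u v p m
    using down[of "tmul (- p) u" "tmul (- p) v" m] by (simp add: C_iff)
  have shift: "(tmul 1 u, tmul 1 v) \<in> C (p + 1) m \<longleftrightarrow> (u, v) \<in> C p m" for u v p m by (simp add: C_iff)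
  have perC: "(u, v) \<in> C 3 6 \<longleftrightarrow> (u, v) \<in> C 0 0" for u v using period[of _ _ 0] by (simp add: C_iff)
  have t: "tripod 0 = std_lattice" "tmul 1 ` tripod 2 = std_lattice" "tmul 2 ` tripod 4 = std_lattice"
    "tmul 1 ` tripod 1 = leg 1" "tmul 2 ` tripod 3 = leg 3" "tmul 3 ` tripod 5 = leg 5"
    by (simp_all add: tripod_def)
  have k0: "(u, 0) \<in> C 0 0 \<longleftrightarrow> u \<in> std_lattice" and k2: "(u, 0) \<in> C 1 2 \<longleftrightarrow> u \<in> std_lattice"
    and k4: "(u, 0) \<in> C 2 4 \<longleftrightarrow> u \<in> std_lattice" and k1: "(u, 0) \<in> C 1 1 \<longleftrightarrow> u \<in> leg 1"
    and k3: "(u, 0) \<in> C 2 3 \<longleftrightarrow> u \<in> leg 3" and k5: "(u, 0) \<in> C 3 5 \<longleftrightarrow> u \<in> leg 5" for u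
    by (simp_all add: kerC t)
  have h1: "(u, v) \<in> C 1 1 \<Longrightarrow> (u, v) \<in> C 0 0" "(u, v) \<in> C 1 1 \<Longrightarrow> (u, v) \<in> C 1 2"
    and h3: "(u, v) \<in> C 2 3 \<Longrightarrow> (u, v) \<in> C 1 2" "(u, v) \<in> C 2 3 \<Longrightarrow> (u, v) \<in> C 2 4"
    and h5: "(u, v) \<in> C 3 5 \<Longrightarrow> (u, v) \<in> C 2 4" "(u, v) \<in> C 3 5 \<Longrightarrow> (u, v) \<in> C 0 0" for u v
    using downC[of u v 1 0] upC[of u v 1 1] downC[of u v 2 2] upC[of u v 2 3] downC[of u v 3 4]
      upC[of u v 3 5] perC[of u v] by simp_all
  have c1: "(u, v) \<in> C 0 0 \<Longrightarrow> (tmul 1 u, tmul 1 v) \<in> C 1 1" "(u, v) \<in> C 1 2 \<Longrightarrow> (tmul 1 u, tmul 1 v) \<in> C 1 1"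
    and c3: "(u, v) \<in> C 1 2 \<Longrightarrow> (tmul 1 u, tmul 1 v) \<in> C 2 3" "(u, v) \<in> C 2 4 \<Longrightarrow> (tmul 1 u, tmul 1 v) \<in> C 2 3"
    and c5: "(u, v) \<in> C 2 4 \<Longrightarrow> (tmul 1 u, tmul 1 v) \<in> C 3 5" "(u, v) \<in> C 0 0 \<Longrightarrow> (tmul 1 u, tmul 1 v) \<in> C 3 5" for u v
    using upC[of u v 0 0] downC[of u v 1 1] upC[of u v 1 2] downC[of u v 2 3] upC[of u v 2 4]
      downC[of u v 3 5] perC[of u v] shift[of u v 0 1] shift[of u v 1 3] shift[of u v 2 5] by simp_all
  have e: "unit1 \<in> std_lattice" "unit2 \<in> std_lattice" "unit1 \<in> leg 1" "unit2 \<in> leg 3" "unit1 + unit2 \<in> leg 5"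
    by (auto simp: leg_def std_lattice_def)
  have l: "\<exists>u. (u, v) \<in> C 0 0" "\<exists>u. (u, v) \<in> C 1 2" "\<exists>u. (u, v) \<in> C 2 4" if "v \<in> std_lattice" for v
    using liftC[of v 0 0] liftC[of v 1 2] liftC[of v 2 4] that by (simp_all add: t)
  obtain p1 where p1: "(p1, unit1) \<in> C 0 0" using l(1)[OF e(1)] by blast
  obtain p2 where p2: "(p2, unit2) \<in> C 0 0" using l(1)[OF e(2)] by blast
  note p = p1 p2
  obtain q1 where q1: "(q1, unit1) \<in> C 1 2" using l(2)[OF e(1)] by blast
  obtain q2 where q2: "(q2, unit2) \<in> C 1 2" using l(2)[OF e(2)] by blast
  note q = q1 q2
  obtain s1 where s1: "(s1, unit1) \<in> C 2 4" using l(3)[OF e(1)] by blast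
  obtain s2 where s2: "(s2, unit2) \<in> C 2 4" using l(3)[OF e(2)] by blast
  note s = s1 s2
  obtain r1 where r1: "(r1, unit1) \<in> C 1 1" using liftC[of unit1 1 1] e(3) unfolding t by blast
  obtain r3 where r3: "(r3, unit2) \<in> C 2 3" using liftC[of unit2 2 3] e(4) unfolding t by blast
  obtain r5 where r5: "(r5, unit1 + unit2) \<in> C 3 5" using liftC[of "unit1 + unit2" 3 5] e(5) unfolding t by blast
  note r = r1 r3 r5
  \<comment> \<open>Multiplied by t, lifts of v at adjacent visits both lift tv at the leg between
    them, so their difference lies in the kernel there.\<close>
  have leg_diff: "tmul 1 (u - u') \<in> leg 1" if "(u, v) \<in> C 0 0" "(u', v) \<in> C 1 2" for u u' v
    using diff[OF c1(1)[OF that(1)] c1(2)[OF that(2)]] k1 by (simp add: tmul_diff)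
  have leg_diff3: "tmul 1 (u - u') \<in> leg 3" if "(u, v) \<in> C 1 2" "(u', v) \<in> C 2 4" for u u' v
    using diff[OF c3(1)[OF that(1)] c3(2)[OF that(2)]] k3 by (simp add: tmul_diff)
  have leg_diff5: "tmul 1 (u - u') \<in> leg 5" if "(u, v) \<in> C 2 4" "(u', v) \<in> C 0 0" for u u' v
    using diff[OF c5(1)[OF that(1)] c5(2)[OF that(2)]] k5 by (simp add: tmul_diff)
  have std_iff: "x \<in> std_lattice" if "tmul 1 x \<in> std_lattice" "vx x $$ (-1) = 0" "vy x $$ (-1) = 0" for x
  proof -
    have "tmul 1 x \<in> tmul 1 ` std_lattice" unfolding std_lattice_tmul1 using that by (simp add: tmul_sel)
    then show ?thesis by (simp add: mem_tmul_image)
  qed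
  have coef: "vx x $$ (-1) = 0 \<and> vy x $$ (-1) = 0" if "x \<in> std_lattice" for x
    using that by (simp add: std_lattice_def)
  have legs: "tmul 1 x \<in> leg l \<Longrightarrow> tmul 1 x \<in> std_lattice" for x l by (simp add: leg_def)
  \<comment> \<open>Here \<open>unit1\<close> lies in the leg itself, and its lift \<open>r1\<close>
    there differs from both \<open>p1\<close> and \<open>q1\<close> by integral vectors.\<close>
  have pq1: "p1 - q1 \<in> std_lattice"
    using diff[OF p(1) h1(1)[OF r(1)]] diff[OF q(1) h1(2)[OF r(1)]] k0 k2
      o_submoduleD(4)[OF o_submodule_std_lattice, of "p1 - r1" "q1 - r1"] by simp
  have qs2: "q2 - s2 \<in> std_lattice"
    using diff[OF q(2) h3(1)[OF r(2)]] diff[OF s(2) h3(2)[OF r(2)]] k2 k4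
      o_submoduleD(4)[OF o_submodule_std_lattice, of "q2 - r3" "s2 - r3"] by simp
  \<comment> \<open>Polar parts: the second leg kills the first coordinate of
    \<open>q1 - s1\<close>, the third makes the two coordinates of \<open>s1 - p1\<close> equal, and
    since \<open>p1 - q1\<close> is integral the second coordinate of \<open>q1 - s1\<close>
    vanishes too. This is the independence of the three nilpotents, read in the first
    column.\<close>
  have qs1: "q1 - s1 \<in> std_lattice"
  proof (rule std_iff)
    have l3: "tmul 1 (q1 - s1) \<in> leg 3" by (rule leg_diff3[OF q(1) s(1)])
    have l5: "tmul 1 (s1 - p1) \<in> leg 5" by (rule leg_diff5[OF s(1) p(1)])
    show "tmul 1 (q1 - s1) \<in> std_lattice" using l3 by (rule legs)
    show x: "vx (q1 - s1) $$ (-1) = 0" using l3 by (simp add: leg_def tmul_sel)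
    have "vx (s1 - p1) $$ (-1) = vy (s1 - p1) $$ (-1)" using l5 by (simp add: leg_def tmul_sel)
    then show "vy (q1 - s1) $$ (-1) = 0" using x coef[OF pq1] by simp
  qed
  have pq2: "p2 - q2 \<in> std_lattice"
  proof (rule std_iff)
    have l1: "tmul 1 (p2 - q2) \<in> leg 1" by (rule leg_diff[OF p(2) q(2)])
    have l5: "tmul 1 (s2 - p2) \<in> leg 5" by (rule leg_diff5[OF s(2) p(2)])
    show "tmul 1 (p2 - q2) \<in> std_lattice" using l1 by (rule legs)
    show y: "vy (p2 - q2) $$ (-1) = 0" using l1 by (simp add: leg_def tmul_sel)
    have "vx (s2 - p2) $$ (-1) = vy (s2 - p2) $$ (-1)" using l5 by (simp add: leg_def tmul_sel)
    then show "vx (p2 - q2) $$ (-1) = 0" using y coef[OF qs2] by simp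
  qed
  have p2': "(p1, unit1) \<in> C 1 2" "(p2, unit2) \<in> C 1 2"
    using add[OF q(1), of "p1 - q1" 0] add[OF q(2), of "p2 - q2" 0] pq1 pq2 k2 by simp_all
  have p4': "(p1, unit1) \<in> C 2 4" "(p2, unit2) \<in> C 2 4"
    using add[OF s(1), of "p1 - s1" 0] add[OF s(2), of "p2 - s2" 0] k4
      o_submoduleD(2)[OF o_submodule_std_lattice pq1 qs1] o_submoduleD(2)[OF o_submodule_std_lattice pq2 qs2]
    by simp_all
  \<comment> \<open>Discrepancies between the lifts chosen at the legs and those at the centre. They
    are integral, and only their constant terms obstruct.\<close>
  define d1 where "d1 = r1 - p1"
  define d3 where "d3 = r3 - p2"
  define d5 where "d5 = r5 - (p1 + p2)"
  have d: "d1 \<in> std_lattice" "d3 \<in> std_lattice" "d5 \<in> std_lattice"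
    using diff[OF h1(1)[OF r(1)] p(1)] diff[OF h3(1)[OF r(2)] p2'(2)] diff[OF h5(2)[OF r(3)] add[OF p]] k0 k2
    by (simp_all add: d1_def d3_def d5_def)
  \<comment> \<open>Entries of the constant correction matrix. Each leg imposes one linear
    condition; the fourth entry is set to 0, which uses the freedom of adding scalar
    matrices.\<close>
  define c12 where "c12 = vx d3 $$ 0"
  define c21 where "c21 = vy d1 $$ 0"
  define c11 where "c11 = vx d5 $$ 0 - vy d5 $$ 0 - c12 + c21"
  define w1 where "w1 = Vec (fls_const c11) (fls_const c21)"
  define w2 where "w2 = Vec (fls_const c12) 0"
  have w: "w1 \<in> std_lattice" "w2 \<in> std_lattice" by (auto simp: w1_def w2_def std_lattice_def)
  define \<sigma> where "\<sigma> v = kscale (vx v) (p1 + w1) + kscale (vy v) (p2 + w2)" for v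
  have \<sigma>: "klinear \<sigma>"
    by (auto simp: klinear_def \<sigma>_def kscale.scale_left_distrib kscale.scale_right_distrib)
  have \<sigma>1: "\<sigma> unit1 = p1 + w1" and \<sigma>2: "\<sigma> unit2 = p2 + w2" by (simp_all add: \<sigma>_def)
  have \<sigma>3: "\<sigma> (unit1 + unit2) = p1 + p2 + (w1 + w2)" using \<sigma> \<sigma>1 \<sigma>2 by (simp add: klinear_def)
  have centre: "(\<sigma> unit1, unit1) \<in> C p m" "(\<sigma> unit2, unit2) \<in> C p m"
    if "(p, m) = (0, 0) \<or> (p, m) = (1, 2) \<or> (p, m) = (2, 4)" for p m
    using that p p2' p4' add[of p1 unit1 p m w1 0] add[of p2 unit2 p m w2 0] w k0 k2 k4 unfolding \<sigma>1 \<sigma>2 by auto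
  have diff_std: "\<And>u v. u \<in> std_lattice \<Longrightarrow> v \<in> std_lattice \<Longrightarrow> u - v \<in> std_lattice"
    by (rule o_submoduleD(4)[OF o_submodule_std_lattice])
  have l1: "(\<sigma> unit1, unit1) \<in> C 1 1"
  proof -
    have "w1 - d1 \<in> leg 1" using diff_std[OF w(1) d(1)] by (simp add: leg_def w1_def c21_def)
    then show ?thesis using add[OF r(1), of "w1 - d1" 0] k1 by (simp add: \<sigma>1 d1_def add.commute)
  qed
  have l3: "(\<sigma> unit2, unit2) \<in> C 2 3"
  proof -
    have "w2 - d3 \<in> leg 3" using diff_std[OF w(2) d(2)] by (simp add: leg_def w2_def c12_def)
    then show ?thesis using add[OF r(2), of "w2 - d3" 0] k3 by (simp add: \<sigma>2 d3_def add.commute)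
  qed
  have l5: "(\<sigma> (unit1 + unit2), unit1 + unit2) \<in> C 3 5"
  proof -
    have "w1 + w2 \<in> std_lattice" by (rule o_submoduleD(2)[OF o_submodule_std_lattice w])
    then have "w1 + w2 - d5 \<in> leg 5"
      using diff_std[OF _ d(3)] by (simp add: leg_def w1_def w2_def c11_def)
    then have "(w1 + w2 - d5, 0) \<in> C 3 5" using k5 by blast
    from add[OF r(3) this] have "(r5 + (w1 + w2 - d5), unit1 + unit2) \<in> C 3 5" by simp
    moreover have "r5 + (w1 + w2 - d5) = p1 + p2 + (w1 + w2)" by (simp add: d5_def)
    ultimately show ?thesis unfolding \<sigma>3 by (simp only:)
  qed
  have std: "(\<sigma> v, v) \<in> C p m" if "(p, m) = (0, 0) \<or> (p, m) = (1, 2) \<or> (p, m) = (2, 4)" "v \<in> std_lattice" for p m v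
    using graph_span2[OF subC \<sigma> centre[OF that(1)]] that(2) by (simp add: std_lattice_eq_span2)
  \<comment> \<open>The second generator of each leg is t times a vector of the centre, so its lift
    comes from an adjacent visit.\<close>
  have leg: "v \<in> leg 1 \<Longrightarrow> (\<sigma> v, v) \<in> C 1 1" "v \<in> leg 3 \<Longrightarrow> (\<sigma> v, v) \<in> C 2 3"
      "v \<in> leg 5 \<Longrightarrow> (\<sigma> v, v) \<in> C 3 5" for v
    using graph_span2[OF subC \<sigma> l1, of "tmul 1 unit2" v] graph_span2[OF subC \<sigma> l3, of "tmul 1 unit1" v]
      graph_span2[OF subC \<sigma> l5, of "tmul 1 unit2" v] c1(1)[OF centre(2)] c3(1)[OF centre(1)]
      c5(2)[OF centre(2)]
    unfolding leg_eq_span2 klinear_tmul[OF \<sigma>] by simp_all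
  have base: "(\<sigma> v, v) \<in> G m" if "m \<in> {0, 1, 2, 3, 4, 5}" "v \<in> tripod m" for m v
  proof -
    have *: "(\<sigma> v, v) \<in> G m \<longleftrightarrow> (\<sigma> (tmul p v), tmul p v) \<in> C p m" for p
      by (simp add: C_iff klinear_tmul[OF \<sigma>])
    have im: "tmul p v \<in> tmul p ` tripod m" for p using that(2) by blast
    show ?thesis using that(1)
    proof (elim insertE)
      assume "m = 0" then show ?thesis using *[of 0] im[of 0] t std by simp
    next
      assume "m = 1" then show ?thesis using *[of 1] im[of 1] t leg by simp
    next
      assume "m = 2" then show ?thesis using *[of 1] im[of 1] t std by simp
    next
      assume "m = 3" then show ?thesis using *[of 2] im[of 2] t leg by simp
    next
      assume "m = 4" then show ?thesis using *[of 2] im[of 2] t std by simp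
    next
      assume "m = 5" then show ?thesis using *[of 3] im[of 3] t leg by simp
    qed simp
  qed
  have per: "(u, v) \<in> G (m + 6 * q) \<longleftrightarrow> (tmul (3 * q) u, tmul (3 * q) v) \<in> G m" for u v m q
  proof (induction q arbitrary: u v rule: int_induct[where k = 0])
    case (step1 q)
    then show ?case using period[of u v "m + 6 * q"] by (simp add: algebra_simps)
  next
    case (step2 q)
    then show ?case using period[of "tmul (-3) u" "tmul (-3) v" "m + 6 * (q - 1)"] by (simp add: algebra_simps)
  qed simp
  have "(\<sigma> v, v) \<in> G m" if v: "v \<in> tripod m" for m v
  proof -
    define q where "q = m div 6"
    have m: "m = m mod 6 + 6 * q" by (simp add: q_def)
    have "v \<in> tmul (- 3 * q) ` tripod (m mod 6)" using v tripod_period_mult[of "m mod 6" q] m by simp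
    then have "tmul (3 * q) v \<in> tripod (m mod 6)" by (simp add: mem_tmul_image)
    moreover have "m mod 6 \<in> {0, 1, 2, 3, 4, 5}" by simp presburger
    ultimately have "(\<sigma> (tmul (3 * q) v), tmul (3 * q) v) \<in> G (m mod 6)" by (intro base)
    then have "(\<sigma> v, v) \<in> G (m mod 6 + 6 * q)" by (simp add: per klinear_tmul[OF \<sigma>])
    then show ?thesis using m by simp
  qed
  then show ?thesis using that \<sigma> by blast
qed

text \<open>M is free at vertex k, so the sequence splits there over C[[t]]; \<psi> is \<phi> on M
  and zero on chosen lifts of a basis.\<close>

lemma (in extension) extend_along_f:
  assumes "free_of_rank (zscale M) (vsp M k) 2" "zlinear_on (zscale M) (vsp M k) oscale UNIV \<phi>"
  obtains \<psi> where "zlinear_on (zscale E) (vsp E k) oscale UNIV \<psi>"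
    "\<And>u. u \<in> vsp M k \<Longrightarrow> \<psi> (f k u) = \<phi> u"
proof -
  have kk: "k \<in> {1..n}" using k by auto
  obtain b c where bc: "b \<in> vsp M k" "c \<in> vsp M k" "vsp M k = {zscale M \<alpha> b + zscale M \<beta> c |\<alpha> \<beta>. True}"
    and ind: "\<forall>\<alpha> \<beta>. zscale M \<alpha> b + zscale M \<beta> c = 0 \<longrightarrow> \<alpha> = 0 \<and> \<beta> = 0"
    using free_of_rank_2D[OF Z.module_axioms assms(1)] .
  have uniq: "\<alpha> = \<gamma> \<and> \<beta> = \<delta>" if "zscale M \<alpha> b + zscale M \<beta> c = zscale M \<gamma> b + zscale M \<delta> c" for \<alpha> \<beta> \<gamma> \<delta>
    using ind[rule_format, of "\<alpha> - \<gamma>" "\<beta> - \<delta>"] that by (simp add: Z.scale_left_diff_distrib algebra_simps)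
  obtain b' where b': "b' \<in> vsp E k" "g k b' = b" using g_surj[OF kk bc(1)] by blast
  obtain c' where c': "c' \<in> vsp E k" "g k c' = c" using g_surj[OF kk bc(2)] by blast
  define t where "t \<alpha> \<beta> = zscale E \<alpha> b' + zscale E \<beta> c'" for \<alpha> \<beta>
  have t_in: "t \<alpha> \<beta> \<in> vsp E k" for \<alpha> \<beta> unfolding t_def by (intro E.add_in E.scale_in kk b' c')
  have g_t: "g k (t \<alpha> \<beta>) = zscale M \<alpha> b + zscale M \<beta> c" for \<alpha> \<beta>
    unfolding t_def
    using g_add[OF kk E.scale_in[OF kk b'(1)] E.scale_in[OF kk c'(1)]] g_scale[OF kk b'(1)] g_scale[OF kk c'(1)] b' c'
    by simp
  have rep: "\<exists>u \<alpha> \<beta>. u \<in> vsp M k \<and> e = f k u + t \<alpha> \<beta>" if e: "e \<in> vsp E k" for e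
  proof -
    obtain \<alpha> \<beta> where ab: "g k e = zscale M \<alpha> b + zscale M \<beta> c" using g_in[OF kk e] bc(3) by auto
    have "g k (e - t \<alpha> \<beta>) = 0" using g_diff[OF kk e t_in] g_t ab by simp
    then obtain u where "u \<in> vsp M k" "f k u = e - t \<alpha> \<beta>" using exact[OF kk E.diff_in[OF kk e t_in]] by blast
    then have "u \<in> vsp M k \<and> e = f k u + t \<alpha> \<beta>" by simp
    then show ?thesis by blast
  qed
  have rep_uniq: "u = u'" if u: "u \<in> vsp M k" "u' \<in> vsp M k" "f k u + t \<alpha> \<beta> = f k u' + t \<gamma> \<delta>" for u u' \<alpha> \<beta> \<gamma> \<delta>
  proof -
    have "g k (f k u + t \<alpha> \<beta>) = g k (f k u' + t \<gamma> \<delta>)" using u(3) by simp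
    then have "zscale M \<alpha> b + zscale M \<beta> c = zscale M \<gamma> b + zscale M \<delta> c"
      using g_add[OF kk f_in[OF kk u(1)] t_in] g_add[OF kk f_in[OF kk u(2)] t_in] gf[OF kk u(1)] gf[OF kk u(2)] g_t
      by simp
    then have "\<alpha> = \<gamma> \<and> \<beta> = \<delta>" by (rule uniq)
    then show ?thesis using u f_inj[OF kk u(1,2)] by simp
  qed
  define \<psi> where "\<psi> e = \<phi> (SOME u. u \<in> vsp M k \<and> (\<exists>\<alpha> \<beta>. e = f k u + t \<alpha> \<beta>))" for e
  have \<psi>: "\<psi> (f k u + t \<alpha> \<beta>) = \<phi> u" if u: "u \<in> vsp M k" for u \<alpha> \<beta>
  proof -
    have "(SOME u'. u' \<in> vsp M k \<and> (\<exists>\<gamma> \<delta>. f k u + t \<alpha> \<beta> = f k u' + t \<gamma> \<delta>)) = u"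
      by (rule some_equality) (use u rep_uniq in blast)+
    then show ?thesis by (simp add: \<psi>_def)
  qed
  have \<phi>: "\<phi> (u + v) = \<phi> u + \<phi> v" "\<phi> (zscale M d u) = oscale d (\<phi> u)" if "u \<in> vsp M k" "v \<in> vsp M k" for u v d
    using assms(2) that by (auto simp: zlinear_on_def)
  have "zlinear_on (zscale E) (vsp E k) oscale UNIV \<psi>"
    unfolding zlinear_on_def
  proof (intro conjI ballI allI)
    fix d e assume "d \<in> vsp E k" "e \<in> vsp E k"
    then obtain u \<alpha> \<beta> v \<gamma> \<delta> where u: "u \<in> vsp M k" "d = f k u + t \<alpha> \<beta>" and v: "v \<in> vsp M k" "e = f k v + t \<gamma> \<delta>"
      using rep by meson
    have "d + e = f k (u + v) + t (\<alpha> + \<gamma>) (\<beta> + \<delta>)"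
      using f_add[OF kk u(1) v(1)] by (simp add: u(2) v(2) t_def E.Z.scale_left_distrib algebra_simps)
    then show "\<psi> (d + e) = \<psi> d + \<psi> e"
      using \<psi>[OF add_in[OF kk u(1) v(1)]] \<psi>[OF u(1)] \<psi>[OF v(1)] \<phi>(1)[OF u(1) v(1)] by (simp add: u(2) v(2))
  next
    fix d e assume "e \<in> vsp E k"
    then obtain u \<alpha> \<beta> where u: "u \<in> vsp M k" "e = f k u + t \<alpha> \<beta>" using rep by meson
    have "zscale E d e = f k (zscale M d u) + t (d * \<alpha>) (d * \<beta>)"
      using f_scale[OF kk u(1)] by (simp add: u(2) t_def E.Z.scale_right_distrib)
    then show "\<psi> (zscale E d e) = oscale d (\<psi> e)"
      using \<psi>[OF scale_in[OF kk u(1)]] \<psi>[OF u(1)] \<phi>(2)[OF u(1) u(1)] by (simp add: u(2))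
  qed simp
  moreover have "\<psi> (f k u) = \<phi> u" if "u \<in> vsp M k" for u
    using \<psi>[OF that, of 0 0] by (simp add: t_def)
  ultimately show ?thesis using that by blast
qed

definition tmul2 :: "int \<Rightarrow> plane \<times> plane \<Rightarrow> plane \<times> plane" where
  "tmul2 m = map_prod (tmul m) (tmul m)"

lemma tmul2_simps [simp]: "tmul2 p (tmul2 q x) = tmul2 (p + q) x" "tmul2 0 x = x" "tmul2 p (u, v) = (tmul p u, tmul p v)"
  by (auto simp: tmul2_def prod_eq_iff)

lemma tmul2_image [simp]: "tmul2 p ` tmul2 q ` S = tmul2 (p + q) ` S" "tmul2 0 ` S = S"
  by (auto simp: image_image)

lemma mem_tmul2_image: "x \<in> tmul2 p ` S \<longleftrightarrow> tmul2 (- p) x \<in> S"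
proof
  assume "tmul2 (- p) x \<in> S"
  then have "tmul2 p (tmul2 (- p) x) \<in> tmul2 p ` S" by blast
  then show "x \<in> tmul2 p ` S" by simp
qed auto

lemma pair_submodule_tmul2: "pair_submodule S \<Longrightarrow> pair_submodule (tmul2 p ` S)"
  by (auto simp: pair_submodule_def mem_tmul2_image tmul_add tmul_oscale)

context root_vec
begin

text \<open>The embedding of M extends along f to a map \<Psi> on E. Together with the image in the
  quotient it embeds E into a product of two planes over K. After the same scaling as for M the
  images form a chain as in \<open>tripod_section\<close>, and its linear section \<sigma> is pulled
  back to E.\<close>

lemma tripod_extension_splits:
  assumes e: "e \<in> {0, 1}" and ext: "(E, f, g) \<in> extensions k n (tripod_rep e) (tripod_rep e)"
  shows "\<exists>s. brep_hom n (tripod_rep e) E s \<and> (\<forall>i\<in>{1..n}. \<forall>v\<in>vsp (tripod_rep e) i. g i (s i v) = v)"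
proof -
  let ?M = "tripod_rep e"
  interpret P: plane_embedding k n ?M "\<lambda>i. fps_vec" by (rule tripod_rep_embedding)
  interpret X: extension k n ?M E f g by unfold_locales (rule ext)
  have kk: "k \<in> {1..n}" using P.k by auto
  have lin: "zlinear_on (zscale ?M) (vsp ?M k) oscale UNIV fps_vec"
    using P.hom kk by (auto simp: brep_hom_def)
  have free: "free_of_rank (zscale ?M) (vsp ?M k) 2" using tripod_rep_rank[OF e] kk by (auto simp: has_rank_def)
  obtain \<psi> where \<psi>: "zlinear_on (zscale E) (vsp E k) oscale UNIV \<psi>" "\<And>u. u \<in> vsp ?M k \<Longrightarrow> \<psi> (f k u) = fps_vec u"
    using X.extend_along_f[OF free lin] by blast
  obtain \<Psi> where \<Psi>: "brep_hom n E (const_rep k) \<Psi>" "\<And>v. v \<in> vsp E k \<Longrightarrow> \<Psi> k v = \<psi> v"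
    using X.E.extend_from_vertex[OF \<psi>(1)] by blast
  note \<Psi>D = plane_homD[OF \<Psi>(1)]
  have "brep_hom n ?M (const_rep k) (\<lambda>i u. \<Psi> i (f i u))"
    unfolding brep_hom_def zlinear_on_def
  proof (intro ballI conjI allI)
    fix i assume i: "i \<in> {1..n}"
    have i': "prv n i \<in> {1..n}" by (rule prv_in[OF i])
    show "\<Psi> i (f i u) \<in> vsp (const_rep k) i" for u by simp
    show "\<Psi> i (f i (u + v)) = \<Psi> i (f i u) + \<Psi> i (f i v)" if "u \<in> vsp ?M i" "v \<in> vsp ?M i" for u v
      using X.f_add[OF i that] \<Psi>D(1)[OF i] X.f_in[OF i] that by simp
    show "\<Psi> i (f i (zscale ?M c u)) = zscale (const_rep k) c (\<Psi> i (f i u))" if "u \<in> vsp ?M i" for c u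
      using X.f_scale[OF i that] \<Psi>D(2)[OF i] X.f_in[OF i] that by simp
    show "\<Psi> i (f i (xmap ?M i v)) = xmap (const_rep k) i (\<Psi> (prv n i) (f (prv n i) v))" if "v \<in> vsp ?M (prv n i)" for v
      using X.f_x[OF i that] \<Psi>D(3)[OF i] X.f_in[OF i'] that by simp
    show "\<Psi> (prv n i) (f (prv n i) (ymap ?M i v)) = ymap (const_rep k) i (\<Psi> i (f i v))" if "v \<in> vsp ?M i" for v
      using X.f_y[OF i that] \<Psi>D(4)[OF i] X.f_in[OF i] that by simp
  qed
  note comp_hom = this
  have \<Psi>f: "\<Psi> i (f i u) = fps_vec u" if i: "i \<in> {1..n}" "u \<in> vsp ?M i" for i u
  proof (rule P.homs_agree[OF comp_hom P.hom _ i])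
    fix v assume v: "v \<in> vsp ?M k"
    show "\<Psi> k (f k v) = fps_vec v" using \<Psi>(2)[OF X.f_in[OF kk v]] \<psi>(2)[OF v] by simp
  qed
  \<comment> \<open>Joint injectivity of \<Psi> and g: the kernel of g is M, where \<Psi> is the
    given embedding.\<close>
  have joint: "d = e'" if i: "i \<in> {1..n}" and de: "d \<in> vsp E i" "e' \<in> vsp E i" "\<Psi> i d = \<Psi> i e'" "g i d = g i e'" for i d e'
  proof -
    have diff: "d - e' \<in> vsp E i" by (rule X.E.diff_in[OF i de(1,2)])
    have "g i (d - e') = 0" using X.g_diff[OF i de(1,2)] de(4) by simp
    then obtain u where u: "u \<in> vsp ?M i" "f i u = d - e'" using X.exact[OF i diff] by blast
    have "\<Psi> i (d - e') + \<Psi> i e' = \<Psi> i d" using \<Psi>D(1)[OF i diff de(2)] by simp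
    then have "fps_vec u = 0" using \<Psi>f[OF i u(1)] u(2) de(3) by simp
    then have "u = 0" using P.kernel[OF i u(1)] by simp
    moreover have "f i 0 = 0" using X.f_scale[OF i P.zero_in[OF i], of 0] by simp
    ultimately show ?thesis using u by simp
  qed
  define F where "F i = (\<lambda>e'. (\<Psi> i e', fps_vec (g i e'))) ` vsp E i" for i
  have F_x: "(\<lambda>e'. (\<Psi> i e', fps_vec (g i e'))) ` xmap E i ` vsp E (prv n i) = tmul2 (eps k i) ` F (prv n i)"
    if i: "i \<in> {1..n}" for i
    unfolding F_def image_image
    using \<Psi>D(3)[OF i] X.g_x[OF i] P.\<Phi>_x[OF i] X.g_in[OF prv_in[OF i]] by (intro image_cong) auto
  have F_y: "(\<lambda>e'. (\<Psi> (prv n i) e', fps_vec (g (prv n i) e'))) ` ymap E i ` vsp E i = tmul2 (1 - eps k i) ` F i"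
    if i: "i \<in> {1..n}" for i
    unfolding F_def image_image
    using \<Psi>D(4)[OF i] X.g_y[OF i] P.\<Phi>_y[OF i] X.g_in[OF i] by (intro image_cong) auto
  have F_step: "tmul2 (eps k i) ` F (prv n i) \<subseteq> F i" "tmul2 (1 - eps k i) ` F i \<subseteq> F (prv n i)" if i: "i \<in> {1..n}" for i
    unfolding F_x[OF i, symmetric] F_y[OF i, symmetric] using X.E.x_in[OF i] X.E.y_in[OF i] by (auto simp: F_def)
  \<comment> \<open>Here x is onto on the submodule and on the quotient, hence on E, and the scaled
    chain makes no step at such an arrow.\<close>
  have F_2: "F i = tmul2 (eps k i) ` F (prv n i)" if i: "i \<in> {1..n}" and ai: "a i = 2" for i
  proof -
    have i': "prv n i \<in> {1..n}" by (rule prv_in[OF i])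
    have surj: "\<exists>v\<in>vsp ?M (prv n i). w = xmap ?M i v" if w: "w \<in> vsp ?M i" for w
    proof -
      have "fps_vec w \<in> tmul (eps k i) ` fps_vec ` vsp ?M (prv n i)"
        using tripod_lattice_step_cases(1)[OF i ai, of e] w unfolding tripod_rep_image[OF i e, symmetric]
          tripod_rep_image[OF i' e, symmetric] by blast
      then obtain v where v: "v \<in> vsp ?M (prv n i)" "fps_vec w = fps_vec (xmap ?M i v)"
        using P.\<Phi>_x[OF i] by auto
      then show ?thesis using P.\<Phi>_inj[OF i w P.x_in[OF i v(1)]] by blast
    qed
    have "xmap E i ` vsp E (prv n i) = vsp E i"
    proof
      show "vsp E i \<subseteq> xmap E i ` vsp E (prv n i)"
      proof
        fix e' assume e': "e' \<in> vsp E i"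
        obtain v where v: "v \<in> vsp ?M (prv n i)" "g i e' = xmap ?M i v" using surj[OF X.g_in[OF i e']] by blast
        obtain d where d: "d \<in> vsp E (prv n i)" "g (prv n i) d = v" using X.g_surj[OF i' v(1)] by blast
        have xd: "xmap E i d \<in> vsp E i" by (rule X.E.x_in[OF i d(1)])
        have "g i (e' - xmap E i d) = 0" using X.g_diff[OF i e' xd] X.g_x[OF i d(1)] d v by simp
        then obtain u where u: "u \<in> vsp ?M i" "f i u = e' - xmap E i d"
          using X.exact[OF i X.E.diff_in[OF i e' xd]] by blast
        obtain u' where u': "u' \<in> vsp ?M (prv n i)" "u = xmap ?M i u'" using surj[OF u(1)] by blast
        have "xmap E i (d + f (prv n i) u') = xmap E i d + f i u"
          using X.E.x_add[OF i d(1) X.f_in[OF i' u'(1)]] X.f_x[OF i u'(1)] u' by simp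
        then have "e' = xmap E i (d + f (prv n i) u')" using u(2) by simp
        then show "e' \<in> xmap E i ` vsp E (prv n i)" using X.E.add_in[OF i' d(1) X.f_in[OF i' u'(1)]] by blast
      qed
    qed (use X.E.x_in[OF i] in blast)
    then show ?thesis using F_x[OF i] by (simp add: F_def)
  qed
  have F_0: "F (prv n i) = tmul2 (1 - eps k i) ` F i" if i: "i \<in> {1..n}" and ai: "a i = 0" for i
  proof -
    have i': "prv n i \<in> {1..n}" by (rule prv_in[OF i])
    have surj: "\<exists>v\<in>vsp ?M i. w = ymap ?M i v" if w: "w \<in> vsp ?M (prv n i)" for w
    proof -
      have "fps_vec w \<in> tmul (1 - eps k i) ` fps_vec ` vsp ?M i"
        using tripod_lattice_step_cases(2)[OF i ai, of e] w unfolding tripod_rep_image[OF i e, symmetric]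
          tripod_rep_image[OF i' e, symmetric] by blast
      then obtain v where v: "v \<in> vsp ?M i" "fps_vec w = fps_vec (ymap ?M i v)"
        using P.\<Phi>_y[OF i] by auto
      then show ?thesis using P.\<Phi>_inj[OF i' w P.y_in[OF i v(1)]] by blast
    qed
    have "ymap E i ` vsp E i = vsp E (prv n i)"
    proof
      show "vsp E (prv n i) \<subseteq> ymap E i ` vsp E i"
      proof
        fix e' assume e': "e' \<in> vsp E (prv n i)"
        obtain v where v: "v \<in> vsp ?M i" "g (prv n i) e' = ymap ?M i v" using surj[OF X.g_in[OF i' e']] by blast
        obtain d where d: "d \<in> vsp E i" "g i d = v" using X.g_surj[OF i v(1)] by blast
        have yd: "ymap E i d \<in> vsp E (prv n i)" by (rule X.E.y_in[OF i d(1)])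
        have "g (prv n i) (e' - ymap E i d) = 0" using X.g_diff[OF i' e' yd] X.g_y[OF i d(1)] d v by simp
        then obtain u where u: "u \<in> vsp ?M (prv n i)" "f (prv n i) u = e' - ymap E i d"
          using X.exact[OF i' X.E.diff_in[OF i' e' yd]] by blast
        obtain u' where u': "u' \<in> vsp ?M i" "u = ymap ?M i u'" using surj[OF u(1)] by blast
        have "ymap E i (d + f i u') = ymap E i d + f (prv n i) u"
          using X.E.y_add[OF i d(1) X.f_in[OF i u'(1)]] X.f_y[OF i u'(1)] u' by simp
        then have "e' = ymap E i (d + f i u')" using u(2) by simp
        then show "e' \<in> ymap E i ` vsp E i" using X.E.add_in[OF i d(1) X.f_in[OF i u'(1)]] by blast
      qed
    qed (use X.E.y_in[OF i] in blast)
    then show ?thesis using F_y[OF i] by (simp add: F_def)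
  qed
  define Z where "Z i = tmul2 (- wt i) ` F (if i = 0 then n else i)" for i
  have Zi: "Z i = tmul2 (- wt i) ` F i" if "i \<in> {1..n}" for i using that by (auto simp: Z_def)
  have Zprv: "Z (i - 1) = tmul2 (- wt (i - 1)) ` F (prv n i)" if "i \<in> {1..n}" for i
    using that by (auto simp: Z_def prv_def)
  have const: "Z i = Z (i - 1)" if i: "i \<in> {1..n}" and ai: "a i \<noteq> 1" for i
  proof -
    consider "a i = 0" | "a i = 2" using a[OF i] ai by auto
    then show ?thesis
    proof cases
      case 1
      have "- wt (i - 1) + (1 - eps k i) = - wt i" using wt_step[OF i] 1 by simp
      then show ?thesis unfolding Zi[OF i] Zprv[OF i] F_0[OF i 1] by (simp only: tmul2_image)
    next
      case 2
      have "- wt i + eps k i = - wt (i - 1)" using wt_step[OF i] 2 by simp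
      then show ?thesis unfolding Zi[OF i] Zprv[OF i] F_2[OF i 2] by (simp only: tmul2_image)
    qed
  qed
  \<comment> \<open>Weak form of a step for the chain of pairs: the two inclusions that become
    \<open>up\<close> and \<open>down\<close>.\<close>
  define R where "R S S' \<longleftrightarrow> S \<subseteq> S' \<and> tmul2 1 ` S' \<subseteq> S" for S S' :: "(plane \<times> plane) set"
  have step: "R (Z (i - 1)) (Z i)" if i: "i \<in> {1..n}" and ai: "a i = 1" for i
  proof -
    have w: "- wt (i - 1) = - wt i + eps k i" using wt_step[OF i] ai by simp
    have "tmul2 (- wt i) ` tmul2 (eps k i) ` F (prv n i) \<subseteq> tmul2 (- wt i) ` F i"
      by (rule image_mono[OF F_step(1)[OF i]])
    moreover have "tmul2 (- wt (i - 1)) ` tmul2 (1 - eps k i) ` F i \<subseteq> tmul2 (- wt (i - 1)) ` F (prv n i)"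
      by (rule image_mono[OF F_step(2)[OF i]])
    moreover have "- wt (i - 1) + (1 - eps k i) = 1 + - wt i" using w by simp
    ultimately show ?thesis unfolding R_def Zi[OF i] Zprv[OF i] by (simp only: tmul2_image w)
  qed
  have turn: "Z n = tmul2 (-3) ` Z 0" using k_bounds by (simp add: Z_def algebra_simps)
  have R_shift: "R (tmul2 (- 3 * q) ` S) (tmul2 (- 3 * q) ` S')" if "R S S'" for q S S'
  proof -
    have "tmul2 (- 3 * q) ` tmul2 1 ` S' \<subseteq> tmul2 (- 3 * q) ` S" using that by (intro image_mono) (simp add: R_def)
    then show ?thesis using that by (auto simp: R_def add.commute image_mono)
  qed
  obtain L where L: "\<And>i. i \<le> n \<Longrightarrow> Z i = L (int (cnt i))" "\<And>m. L (m + 6) = tmul2 (-3) ` L m"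
    "\<And>m. R (L m) (L (m + 1))"
  proof (rule periodic_sequence[where T = "\<lambda>q S. tmul2 (- 3 * q) ` S" and R = R and Z = Z])
    fix L assume "\<And>i. i \<le> n \<Longrightarrow> Z i = L (int (cnt i))" "\<And>m. L (m + 6) = tmul2 (- 3 * 1) ` L m"
      "\<And>m. R (L m) (L (m + 1))"
    then show thesis by (intro that[of L]) simp_all
  next
    fix q S S' assume "R S S'" then show "R (tmul2 (- 3 * q) ` S) (tmul2 (- 3 * q) ` S')" by (rule R_shift)
  qed (use const step turn in \<open>simp_all add: algebra_simps\<close>)
  have L_mult: "L (m + 6 * q) = tmul2 (- 3 * q) ` L m" for m q
  proof (induction q rule: int_induct[where k = 0])
    case (step1 q)
    then show ?case using L(2)[of "m + 6 * q"] by (simp add: algebra_simps)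
  next
    case (step2 q)
    have "tmul2 3 ` L (m + 6 * q) = L (m + 6 * (q - 1))" using L(2)[of "m + 6 * (q - 1)"] by (simp add: algebra_simps)
    then show ?case using step2 by (simp add: algebra_simps)
  qed simp
  have occurs: "\<exists>i p. i \<in> {1..n} \<and> L m = tmul2 p ` F i \<and> tripod (m + e) = tmul p ` tripod_lattice e i" for m
  proof -
    \<comment> \<open>Representatives 1, ..., 6 again, since these counts occur at genuine
      vertices.\<close>
    define c where "c = (m - 1) mod 6 + 1"
    define q where "q = (m - 1) div 6"
    have c: "1 \<le> nat c" "nat c \<le> 6" "0 \<le> c" unfolding c_def by simp_all
    have m: "m = c + 6 * q" unfolding c_def q_def by simp
    obtain i where i: "i \<in> {1..n}" "cnt i = nat c" using cnt_surj[OF c(1,2)] by blast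
    have "L c = tmul2 (- wt i) ` F i" using L(1)[of i] Zi[OF i(1)] i c(3) by simp
    then have "L m = tmul2 (- 3 * q - wt i) ` F i" unfolding m L_mult by simp
    moreover have "tripod (m + e) = tmul (- 3 * q - wt i) ` tripod_lattice e i"
      using tripod_period_mult[of "c + e" q] i c(3) unfolding m by (simp add: tripod_lattice_def algebra_simps)
    ultimately show ?thesis using i(1) by blast
  qed
  have F_sub: "pair_submodule (F i)" if i: "i \<in> {1..n}" for i
    unfolding pair_submodule_def
  proof (intro conjI allI impI)
    fix u v u' v' assume "(u, v) \<in> F i" "(u', v') \<in> F i"
    then obtain d d' where d: "d \<in> vsp E i" "u = \<Psi> i d" "v = fps_vec (g i d)"
      and d': "d' \<in> vsp E i" "u' = \<Psi> i d'" "v' = fps_vec (g i d')" by (auto simp: F_def)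
    have "(u + u', v + v') = (\<Psi> i (d + d'), fps_vec (g i (d + d')))"
      using \<Psi>D(1)[OF i d(1) d'(1)] X.g_add[OF i d(1) d'(1)] by (simp add: d d' fps_vec_simps)
    then show "(u + u', v + v') \<in> F i" unfolding F_def using X.E.add_in[OF i d(1) d'(1)] by blast
  next
    fix c u v assume "(u, v) \<in> F i"
    then obtain d where d: "d \<in> vsp E i" "u = \<Psi> i d" "v = fps_vec (g i d)" by (auto simp: F_def)
    have "(oscale c u, oscale c v) = (\<Psi> i (zscale E c d), fps_vec (g i (zscale E c d)))"
      using \<Psi>D(2)[OF i d(1)] X.g_scale[OF i d(1)] P.\<Phi>_scale[OF i X.g_in[OF i d(1)]] by (simp add: d)
    then show "(oscale c u, oscale c v) \<in> F i" unfolding F_def using X.E.scale_in[OF i d(1)] by blast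
  qed
  have F_ker: "(u, 0) \<in> F i \<longleftrightarrow> u \<in> tripod_lattice e i" if i: "i \<in> {1..n}" for i u
  proof
    assume "(u, 0) \<in> F i"
    then obtain d where d: "d \<in> vsp E i" "u = \<Psi> i d" "fps_vec (g i d) = 0" by (auto simp: F_def)
    have "g i d = 0" using P.kernel[OF i X.g_in[OF i d(1)] d(3)] .
    then obtain w where w: "w \<in> vsp ?M i" "f i w = d" using X.exact[OF i d(1)] by blast
    then have "u = fps_vec w" using \<Psi>f[OF i w(1)] d by simp
    then show "u \<in> tripod_lattice e i" using w(1) tripod_rep_image[OF i e] by blast
  next
    assume "u \<in> tripod_lattice e i"
    then obtain w where w: "w \<in> vsp ?M i" "u = fps_vec w" using tripod_rep_image[OF i e] by blast
    have "(u, 0) = (\<Psi> i (f i w), fps_vec (g i (f i w)))"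
      using \<Psi>f[OF i w(1)] X.gf[OF i w(1)] w by (simp add: fps_vec_simps)
    then show "(u, 0) \<in> F i" unfolding F_def using X.f_in[OF i w(1)] by blast
  qed
  have F_lift: "\<exists>u. (u, v) \<in> F i" if i: "i \<in> {1..n}" and v: "v \<in> tripod_lattice e i" for i v
  proof -
    obtain w where w: "w \<in> vsp ?M i" "v = fps_vec w" using tripod_rep_image[OF i e] v by blast
    obtain d where "d \<in> vsp E i" "g i d = w" using X.g_surj[OF i w(1)] by blast
    then have "(\<Psi> i d, v) \<in> F i" using w by (auto simp: F_def)
    then show ?thesis by blast
  qed
  \<comment> \<open>The shift by e aligns the chain, which is indexed by counts, with the positions
    of \<open>tripod\<close>.\<close>
  define G where "G m = L (m - e)" for m
  obtain \<sigma> where \<sigma>: "klinear \<sigma>" "\<And>m v. v \<in> tripod m \<Longrightarrow> (\<sigma> v, v) \<in> G m"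
  proof (rule tripod_section[of G])
    fix m
    obtain i p where ip: "i \<in> {1..n}" "G m = tmul2 p ` F i" "tripod m = tmul p ` tripod_lattice e i"
      using occurs[of "m - e"] by (auto simp: G_def)
    show "pair_submodule (G m)" unfolding ip(2) by (rule pair_submodule_tmul2[OF F_sub[OF ip(1)]])
    show "(u, 0) \<in> G m \<longleftrightarrow> u \<in> tripod m" for u
      using F_ker[OF ip(1), of "tmul (- p) u"] by (simp add: ip(2,3) mem_tmul2_image mem_tmul_image)
    show "\<exists>u. (u, v) \<in> G m" if "v \<in> tripod m" for v
    proof -
      have "tmul (- p) v \<in> tripod_lattice e i" using that by (simp add: ip(3) mem_tmul_image)
      then obtain u where "(u, tmul (- p) v) \<in> F i" using F_lift[OF ip(1)] by blast
      then have "(tmul p u, v) \<in> G m" by (simp add: ip(2) mem_tmul2_image)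
      then show ?thesis by blast
    qed
    show "(u, v) \<in> G (m + 1)" if "(u, v) \<in> G m" for u v
      using L(3)[of "m - e"] that by (auto simp: R_def G_def algebra_simps)
    show "(tmul 1 u, tmul 1 v) \<in> G m" if "(u, v) \<in> G (m + 1)" for u v
    proof -
      have "tmul2 1 (u, v) \<in> L (m - e)"
        using L(3)[of "m - e"] that unfolding R_def G_def by (auto simp: algebra_simps)
      then show ?thesis by (simp add: G_def)
    qed
    show "(u, v) \<in> G (m + 6) \<longleftrightarrow> (tmul 3 u, tmul 3 v) \<in> G m" for u v
      using L(2)[of "m - e"] by (simp add: G_def mem_tmul2_image algebra_simps)
  next
    fix \<sigma> assume "klinear \<sigma>" "\<And>m v. v \<in> tripod m \<Longrightarrow> (\<sigma> v, v) \<in> G m"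
    then show thesis by (rule that)
  qed
  \<comment> \<open>The value at v is the unique element of E with coordinates \<sigma> v and v;
    uniqueness makes s a homomorphism.\<close>
  define s where "s i v = (SOME d. d \<in> vsp E i \<and> \<Psi> i d = \<sigma> (fps_vec v) \<and> g i d = v)" for i v
  have s: "s i v \<in> vsp E i" "\<Psi> i (s i v) = \<sigma> (fps_vec v)" "g i (s i v) = v"
    if i: "i \<in> {1..n}" and v: "v \<in> vsp ?M i" for i v
  proof -
    have "fps_vec v \<in> tripod_lattice e i" using v tripod_rep_image[OF i e] by blast
    then have "tmul (- wt i) (fps_vec v) \<in> tripod (int (cnt i) + e)" by (simp add: tripod_lattice_def mem_tmul_image)
    then have "(\<sigma> (tmul (- wt i) (fps_vec v)), tmul (- wt i) (fps_vec v)) \<in> L (int (cnt i))"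
      using \<sigma>(2) by (fastforce simp: G_def)
    moreover have "L (int (cnt i)) = tmul2 (- wt i) ` F i" using L(1)[of i] Zi[OF i] i by simp
    ultimately have "(\<sigma> (fps_vec v), fps_vec v) \<in> F i"
      by (simp add: mem_tmul2_image klinear_tmul[OF \<sigma>(1)])
    then obtain d where d: "d \<in> vsp E i" "\<Psi> i d = \<sigma> (fps_vec v)" "fps_vec (g i d) = fps_vec v" by (auto simp: F_def)
    then have "d \<in> vsp E i \<and> \<Psi> i d = \<sigma> (fps_vec v) \<and> g i d = v"
      using P.\<Phi>_inj[OF i X.g_in[OF i d(1)] v] by simp
    then have "s i v \<in> vsp E i \<and> \<Psi> i (s i v) = \<sigma> (fps_vec v) \<and> g i (s i v) = v" unfolding s_def by (rule someI)
    then show "s i v \<in> vsp E i" "\<Psi> i (s i v) = \<sigma> (fps_vec v)" "g i (s i v) = v" by auto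
  qed
  have \<sigma>_add: "\<sigma> (u + v) = \<sigma> u + \<sigma> v" and \<sigma>_o: "\<sigma> (oscale c u) = oscale c (\<sigma> u)" for u v c
    using \<sigma>(1) by (auto simp: klinear_def oscale_def)
  have "brep_hom n ?M E s"
    unfolding brep_hom_def zlinear_on_def
  proof (intro ballI conjI allI)
    fix i assume i: "i \<in> {1..n}"
    have i': "prv n i \<in> {1..n}" by (rule prv_in[OF i])
    show "s i u \<in> vsp E i" if "u \<in> vsp ?M i" for u by (rule s(1)[OF i that])
    show "s i (u + v) = s i u + s i v" if "u \<in> vsp ?M i" "v \<in> vsp ?M i" for u v
      by (rule joint[OF i])
        (use i that s[OF i] P.add_in[OF i that] X.E.add_in[OF i] \<Psi>D(1)[OF i] X.g_add[OF i] in
          \<open>simp_all add: fps_vec_simps \<sigma>_add\<close>)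
    show "s i (zscale ?M c u) = zscale E c (s i u)" if "u \<in> vsp ?M i" for c u
      by (rule joint[OF i])
        (use i that s[OF i] P.scale_in[OF i that] X.E.scale_in[OF i] \<Psi>D(2)[OF i] X.g_scale[OF i] P.\<Phi>_scale[OF i] in
          \<open>simp_all add: \<sigma>_o\<close>)
    show "s i (xmap ?M i v) = xmap E i (s (prv n i) v)" if "v \<in> vsp ?M (prv n i)" for v
      by (rule joint[OF i])
        (use i i' that s[OF i] s[OF i'] P.x_in[OF i that] X.E.x_in[OF i] \<Psi>D(3)[OF i] X.g_x[OF i] P.\<Phi>_x[OF i] in
          \<open>simp_all add: klinear_tmul[OF \<sigma>(1)]\<close>)
    show "s (prv n i) (ymap ?M i v) = ymap E i (s i v)" if "v \<in> vsp ?M i" for v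
      by (rule joint[OF i'])
        (use i i' that s[OF i] s[OF i'] P.y_in[OF i that] X.E.y_in[OF i] \<Psi>D(4)[OF i] X.g_y[OF i] P.\<Phi>_y[OF i] in
          \<open>simp_all add: klinear_tmul[OF \<sigma>(1)]\<close>)
  qed
  then show ?thesis using s(3) by blast
qed

lemma tripod_rep_rigid_indecomposable:
  assumes e: "e \<in> {0, 1}"
  shows "rigid_indecomposable k n 2 (tripod_rep e)"
proof -
  interpret plane_embedding k n "tripod_rep e" "\<lambda>i. fps_vec" by (rule tripod_rep_embedding)
  have "rigid k n (tripod_rep e)" by (rule rigidI) (rule tripod_extension_splits[OF e])
  then show ?thesis
    using tripod_rep_rank[OF e] tripod_rep_indecomposable[OF e] by (simp add: rigid_indecomposable_def)
qed

end

section \<open>Graded lattices and profiles\<close>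

global_interpretation cscale: vector_space cscale
  by unfold_locales (auto simp: cscale_def fun_eq_iff algebra_simps)

lemma delta_neq_0: "(\<lambda>c::nat. if c = i then 1 else 0 :: complex) \<noteq> 0"
proof
  assume "(\<lambda>c::nat. if c = i then 1 else 0 :: complex) = 0"
  from fun_cong[OF this, of i] show False by simp
qed

lemma coord_space_span:
  "coord_space 2 = cscale.span {(\<lambda>c. if c = 0 then 1 else 0), (\<lambda>c. if c = 1 then 1 else 0)}"
    (is "_ = cscale.span {?a, ?b}")
proof
  have ab: "?a \<noteq> ?b" by (auto dest: fun_cong[of _ _ 0])
  show "coord_space 2 \<subseteq> cscale.span {?a, ?b}"
  proof
    fix w :: "nat \<Rightarrow> complex" assume "w \<in> coord_space 2"
    then have "w = cscale (w 0) ?a + cscale (w 1) ?b"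
      by (auto simp: coord_space_def cscale_def fun_eq_iff)
    also have "\<dots> \<in> cscale.span {?a, ?b}"
      by (intro cscale.span_add cscale.span_scale cscale.span_base) auto
    finally show "w \<in> cscale.span {?a, ?b}" .
  qed
  have "cscale.subspace (coord_space 2)"
    by (auto simp: cscale.subspace_def coord_space_def cscale_def)
  then show "cscale.span {?a, ?b} \<subseteq> coord_space 2"
    by (intro cscale.span_minimal) (auto simp: coord_space_def)
qed

lemma coord_space_dim:
  assumes "cscale.subspace S" "S \<subseteq> coord_space 2"
  shows "cscale.dim S \<ge> 1 \<longleftrightarrow> S \<noteq> {0}" "cscale.dim S \<ge> 2 \<longleftrightarrow> S = coord_space 2"
proof -
  let ?a = "\<lambda>c::nat. if c = 0 then 1 else 0 :: complex" and ?b = "\<lambda>c::nat. if c = 1 then 1 else 0 :: complex"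
  have ab: "?a \<noteq> ?b" by (auto dest: fun_cong[of _ _ 0])
  have bound: "finite T \<and> card T \<le> 2" if "cscale.independent T" "T \<subseteq> coord_space 2" for T
    using cscale.independent_span_bound[of "{?a, ?b}" T] that ab unfolding coord_space_span by simp
  obtain B where B: "B \<subseteq> S" "cscale.independent B" "S \<subseteq> cscale.span B" "card B = cscale.dim S"
    by (rule cscale.basis_exists)
  have fB: "finite B" "card B \<le> 2" using bound[of B] B assms(2) by auto
  have span: "cscale.span B = S" using B assms(1) by (metis cscale.span_minimal subset_antisym)
  show "cscale.dim S \<ge> 1 \<longleftrightarrow> S \<noteq> {0}"
  proof
    assume "cscale.dim S \<ge> 1"
    then obtain w where "w \<in> B" using B(4) by (metis all_not_in_conv card.empty not_one_le_zero)
    moreover from this have "w \<noteq> 0" using B(2) cscale.dependent_zero by blast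
    ultimately show "S \<noteq> {0}" using B(1) by blast
  next
    assume "S \<noteq> {0}"
    then have "B \<noteq> {}" using span by auto
    then show "cscale.dim S \<ge> 1" using fB B(4) by (metis One_nat_def Suc_leI card_gt_0_iff)
  qed
  show "cscale.dim S \<ge> 2 \<longleftrightarrow> S = coord_space 2"
  proof
    assume dim: "cscale.dim S \<ge> 2"
    show "S = coord_space 2"
    proof (rule ccontr)
      assume "S \<noteq> coord_space 2"
      then obtain w where w: "w \<in> coord_space 2" "w \<notin> cscale.span B" using assms(2) span by blast
      then have "cscale.independent (insert w B)" "w \<notin> B"
        using B(2) by (auto simp: cscale.independent_insert intro: cscale.span_base)
      then have "card (insert w B) \<le> 2" using bound[of "insert w B"] w(1) B(1) assms(2) by blast
      then show False using \<open>w \<notin> B\<close> fB(1) dim B(4) by simp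
    qed
  next
    assume S: "S = coord_space 2"
    have ind: "cscale.independent {?a, ?b}"
    proof -
      have "?a \<notin> cscale.span {?b}"
      proof
        assume "?a \<in> cscale.span {?b}"
        then obtain k where "?a = cscale k ?b" by (auto simp: cscale.span_singleton)
        from fun_cong[OF this, of 0] show False by (simp add: cscale_def)
      qed
      moreover have "?b \<noteq> 0" by (rule delta_neq_0)
      then have "cscale.independent {?b}" by (simp add: cscale.dependent_single)
      ultimately show ?thesis using ab by (simp add: cscale.independent_insert)
    qed
    have "cscale.dim S = card {?a, ?b}"
      unfolding S coord_space_span using cscale.dim_span_eq_card_independent[OF ind] by simp
    then show "cscale.dim S \<ge> 2" using ab by simp
  qed
qed

section \<open>Homogeneous vectors and graded lattices\<close>

definition hvec :: "int \<Rightarrow> (nat \<Rightarrow> complex) \<Rightarrow> plane" where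
  "hvec m w = tmul m (Vec (fls_const (w 0)) (fls_const (w 1)))"

definition hcomp :: "int \<Rightarrow> plane \<Rightarrow> plane" where
  "hcomp m v = tmul m (Vec (fls_const (vx v $$ m)) (fls_const (vy v $$ m)))"

text \<open>Intrinsic form of being graded: for a module that lies between two multiples of
  \<open>std_lattice\<close>, it says that the module is the product of the t^m times its
  slices.\<close>

definition comp_closed :: "plane set \<Rightarrow> bool" where
  "comp_closed A \<longleftrightarrow> (\<forall>v\<in>A. \<forall>m. hcomp m v \<in> A)"

definition slice :: "plane set \<Rightarrow> int \<Rightarrow> (nat \<Rightarrow> complex) set" where
  "slice A m = {w \<in> coord_space 2. hvec m w \<in> A}"

definition fun_vec :: "(nat \<Rightarrow> complex fls) \<Rightarrow> plane" where
  "fun_vec v = Vec (v 0) (v 1)"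

definition planar :: "(nat \<Rightarrow> complex fls) set" where
  "planar = {v. \<forall>c\<ge>2. v c = 0}"

lemma hvec_nth: "vx (hvec m w) $$ j = (if j = m then w 0 else 0)" "vy (hvec m w) $$ j = (if j = m then w 1 else 0)"
  by (auto simp: hvec_def tmul_sel)

lemma comp_nth: "vx (hcomp m v) $$ j = (if j = m then vx v $$ m else 0)" "vy (hcomp m v) $$ j = (if j = m then vy v $$ m else 0)"
  by (auto simp: hcomp_def tmul_sel)

lemma plane_nth_eqI:
  assumes "\<And>j. vx u $$ j = vx v $$ j" "\<And>j. vy u $$ j = vy v $$ j" shows "u = v"
  by (intro plane_eqI fls_eqI) (use assms in auto)

lemma comp_hvec: "hcomp m v = hvec m (\<lambda>c. if c = 0 then vx v $$ m else if c = 1 then vy v $$ m else 0)"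
  by (simp add: hcomp_def hvec_def)

lemma comp_tmul: "hcomp m (tmul p v) = tmul p (hcomp (m - p) v)"
  by (rule plane_nth_eqI) (auto simp: hcomp_def tmul_sel)

lemma comp_closed_tmul: assumes "comp_closed A" shows "comp_closed (tmul p ` A)"
  using assms by (auto simp: comp_closed_def comp_tmul)

lemma tmul_std_lattice_iff:
  "v \<in> tmul q ` std_lattice \<longleftrightarrow> vanishes_below q (vx v) \<and> vanishes_below q (vy v)"
proof -
  have "vanishes_below 0 (fls_shift q x) \<longleftrightarrow> vanishes_below q x" for x
    using vanishes_below_shift[of 0 "- q" x] by simp
  then show ?thesis by (simp add: mem_tmul_image std_lattice_iff tmul_sel)
qed

lemma comp_closed_std_lattice: "comp_closed std_lattice"
  by (auto simp: comp_closed_def std_lattice_def comp_nth)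

lemma comp_closed_leg: "comp_closed (leg l)"
  by (auto simp: comp_closed_def leg_def std_lattice_def comp_nth)

lemma comp_closed_tripod: "comp_closed (tripod m)"
  by (simp add: tripod_def comp_closed_tmul comp_closed_std_lattice comp_closed_leg)

text \<open>All terms of v from degree K on lie in A anyway, so v differs from a finite sum of its
  components by an element of A.\<close>

lemma mem_of_comps:
  assumes A: "o_submodule A" and full: "tmul K ` std_lattice \<subseteq> A" and comps: "\<And>m. hcomp m v \<in> A"
  shows "v \<in> A"
proof -
  obtain q where q: "\<forall>m\<ge>q. tmul m v \<in> std_lattice" using eventually_in_std_lattice by blast
  \<comment> \<open>A degree below which v vanishes, taken at most K so that K - N counts the
    components to be added.\<close>
  define N where "N = min (- q) K"
  have "tmul (- N) v \<in> std_lattice" using q by (simp add: N_def)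
  then have v: "vanishes_below N (vx v)" "vanishes_below N (vy v)"
    using tmul_std_lattice_iff[of v N] by (simp_all add: mem_tmul_image)
  have "\<exists>s\<in>A. \<forall>j<N + int r. vx s $$ j = vx v $$ j \<and> vy s $$ j = vy v $$ j" for r
  proof -
    have "\<exists>s\<in>A. (\<forall>j<N + int r. vx s $$ j = vx v $$ j \<and> vy s $$ j = vy v $$ j) \<and>
        (\<forall>j\<ge>N + int r. vx s $$ j = 0 \<and> vy s $$ j = 0)"
    proof (induction r)
      case 0
      show ?case using o_submoduleD(1)[OF A] v by (intro bexI[of _ 0]) (auto simp: vanishes_below_def)
    next
      case (Suc r)
      then obtain s where s: "s \<in> A" "\<forall>j<N + int r. vx s $$ j = vx v $$ j \<and> vy s $$ j = vy v $$ j"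
        "\<forall>j\<ge>N + int r. vx s $$ j = 0 \<and> vy s $$ j = 0" by blast
      have "s + hcomp (N + int r) v \<in> A" by (rule o_submoduleD(2)[OF A s(1) comps])
      moreover have "vx (s + hcomp (N + int r) v) $$ j = vx v $$ j \<and> vy (s + hcomp (N + int r) v) $$ j = vy v $$ j"
        if "j < N + int (Suc r)" for j
      proof (cases "j = N + int r")
        case True then show ?thesis using s(3) by (simp add: comp_nth)
      next
        case False
        then have "j < N + int r" using that by simp
        then show ?thesis using s(2) by (simp add: comp_nth)
      qed
      moreover have "vx (s + hcomp (N + int r) v) $$ j = 0 \<and> vy (s + hcomp (N + int r) v) $$ j = 0"
        if "j \<ge> N + int (Suc r)" for j
        using s(3) that by (auto simp: comp_nth)
      ultimately show ?case by blast
    qed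
    then show ?thesis by blast
  qed
  from this[of "nat (K - N)"] obtain s where s: "s \<in> A" "\<forall>j<K. vx s $$ j = vx v $$ j \<and> vy s $$ j = vy v $$ j"
    by (auto simp: N_def)
  then have "v - s \<in> tmul K ` std_lattice" unfolding tmul_std_lattice_iff by (simp add: vanishes_below_def)
  then have "s + (v - s) \<in> A" using o_submoduleD(2)[OF A s(1)] full by blast
  then show ?thesis by simp
qed

lemma hvec_add: "hvec m (u + w) = hvec m u + hvec m w"
  by (rule plane_nth_eqI) (auto simp: hvec_nth)

lemma hvec_cscale: "hvec m (cscale c w) = oscale (fps_const c) (hvec m w)"
  by (rule plane_nth_eqI) (auto simp: hvec_nth cscale_def)

lemma hvec_0: "hvec m 0 = 0"
  by (rule plane_nth_eqI) (auto simp: hvec_nth)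

lemma slice_subspace:
  assumes "o_submodule A" shows "cscale.subspace (slice A m)" "slice A m \<subseteq> coord_space 2"
proof -
  show "cscale.subspace (slice A m)"
    unfolding cscale.subspace_def slice_def using o_submoduleD[OF assms]
    by (auto simp: hvec_add hvec_cscale hvec_0) (auto simp: coord_space_def cscale_def)
  show "slice A m \<subseteq> coord_space 2" by (auto simp: slice_def)
qed

text \<open>The lattice contains t^m w exactly for w in W m, since all its other coefficients are 0
  and lie in every subspace. So W can be recovered from the lattice.\<close>

lemma fun_vec_graded_lattice:
  assumes W: "graded_data 2 W"
  defines "A \<equiv> fun_vec ` graded_lattice 2 W"
  shows "comp_closed A" "slice A m = W m"
proof -
  have sub: "cscale.subspace (W m)" "W m \<subseteq> coord_space 2" for m
    using W by (auto simp: graded_data_def)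
  define hf where "hf m w = (\<lambda>c. fls_shift (- m) (fls_const (w c)))" for m and w :: "nat \<Rightarrow> complex"
  have hf: "fun_vec (hf m w) = hvec m w" for m w
    by (rule plane_nth_eqI) (auto simp: hf_def fun_vec_def hvec_nth)
  have hf_in: "hf m w \<in> graded_lattice 2 W" if w: "w \<in> W m" for m w
  proof -
    have "(\<lambda>c. hf m w c $$ j) \<in> W j" for j
    proof (cases "j = m")
      case True
      then have "(\<lambda>c. hf m w c $$ j) = w" by (simp add: hf_def)
      then show ?thesis using w True by simp
    next
      case False
      then have "(\<lambda>c. hf m w c $$ j) = 0" by (auto simp: hf_def fun_eq_iff)
      then show ?thesis using cscale.subspace_0[OF sub(1)] by simp
    qed
    moreover have "hf m w c = 0" if "c \<ge> 2" for c
      using w sub(2)[of m] that by (auto simp: hf_def coord_space_def)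
    ultimately show ?thesis by (simp add: graded_lattice_def)
  qed
  show "comp_closed A"
    unfolding comp_closed_def
  proof (intro ballI allI)
    fix u m assume "u \<in> A"
    then obtain v where v: "v \<in> graded_lattice 2 W" "u = fun_vec v" by (auto simp: A_def)
    have w: "(\<lambda>c. v c $$ m) \<in> W m" using v by (simp add: graded_lattice_def)
    have "hcomp m u = fun_vec (hf m (\<lambda>c. v c $$ m))"
      unfolding hf by (rule plane_nth_eqI) (auto simp: comp_nth hvec_nth v fun_vec_def)
    then show "hcomp m u \<in> A" using hf_in[OF w] by (simp add: A_def)
  qed
  show "slice A m = W m"
  proof
    show "W m \<subseteq> slice A m"
    proof
      fix w assume w: "w \<in> W m"
      have "fun_vec (hf m w) \<in> A" unfolding A_def using hf_in[OF w] by blast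
      then show "w \<in> slice A m" using w sub(2)[of m] unfolding hf by (auto simp: slice_def)
    qed
    show "slice A m \<subseteq> W m"
    proof
      fix w assume "w \<in> slice A m"
      then obtain v where w: "w \<in> coord_space 2" and v: "v \<in> graded_lattice 2 W" "hvec m w = fun_vec v"
        by (auto simp: slice_def A_def)
      have "v c $$ m = w c" for c
      proof -
        consider "c = 0" | "c = 1" | "c \<ge> 2" by linarith
        then show ?thesis
        proof cases
          case 1 then show ?thesis using arg_cong[OF v(2), of "\<lambda>u. vx u $$ m"] by (simp add: hvec_nth fun_vec_def)
        next
          case 2 then show ?thesis using arg_cong[OF v(2), of "\<lambda>u. vy u $$ m"] by (simp add: hvec_nth fun_vec_def)
        next
          case 3 then show ?thesis using v(1) w by (simp add: graded_lattice_def coord_space_def)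
        qed
      qed
      then have "w = (\<lambda>c. v c $$ m)" by auto
      then show "w \<in> W m" using v(1) by (simp add: graded_lattice_def)
    qed
  qed
qed

lemma slice_low:
  assumes "A \<subseteq> tmul q ` std_lattice" "m < q" "w \<in> slice A m" shows "w = 0"
proof
  fix c
  have h: "hvec m w \<in> tmul q ` std_lattice" "w \<in> coord_space 2" using assms by (auto simp: slice_def)
  then have "vx (hvec m w) $$ m = 0" "vy (hvec m w) $$ m = 0"
    using assms(2) by (simp_all only: tmul_std_lattice_iff vanishes_below_def)
  then have "w 0 = 0" "w 1 = 0" by (simp_all add: hvec_nth)
  moreover have "w c = 0" if "2 \<le> c" using h(2) that by (simp add: coord_space_def)
  moreover have "c = 0 \<or> c = 1 \<or> 2 \<le> c" by linarith
  ultimately show "w c = 0 c" by auto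
qed

lemma hvec_in_std: "q \<le> m \<Longrightarrow> hvec m w \<in> tmul q ` std_lattice"
  unfolding tmul_std_lattice_iff by (auto simp: vanishes_below_def hvec_nth)

lemma slice_high:
  assumes "tmul q ` std_lattice \<subseteq> A" "q \<le> m" shows "slice A m = coord_space 2"
  using hvec_in_std[OF assms(2)] assms(1) by (auto simp: slice_def)

text \<open>Converse passage: the bounds by multiples of \<open>std_lattice\<close> make the slices
  0 in low degrees and the whole plane in high ones, and \<open>mem_of_comps\<close> recovers the
  lattice from them.\<close>

lemma graded_data_slice:
  assumes A: "o_submodule A" "comp_closed A" and b: "tmul K ` std_lattice \<subseteq> A" "A \<subseteq> tmul q ` std_lattice"
  shows "graded_data 2 (slice A)" "graded_lattice 2 (slice A) = {v \<in> planar. fun_vec v \<in> A}"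
proof -
  have "slice A m \<subseteq> slice A (m + 1)" for m
  proof
    fix w assume "w \<in> slice A m"
    then have "w \<in> coord_space 2" "tmul 1 (hvec m w) \<in> A"
      using o_submodule_tmul_nonneg[OF A(1), of _ 1] by (auto simp: slice_def)
    moreover have "tmul 1 (hvec m w) = hvec (m + 1) w" by (simp add: hvec_def add.commute)
    ultimately show "w \<in> slice A (m + 1)" by (simp add: slice_def)
  qed
  moreover have "slice A m = {0}" if "m \<le> q - 1" for m
    using slice_low[OF b(2), of m] cscale.subspace_0[OF slice_subspace(1)[OF A(1)], of m] that by auto
  ultimately show "graded_data 2 (slice A)"
    unfolding graded_data_def using slice_subspace[OF A(1)] slice_high[OF b(1)]
    by (intro conjI allI exI[of _ "q - 1"] exI[of _ K] impI) simp_all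
  have hcomp: "hcomp m (fun_vec v) = hvec m (\<lambda>c. v c $$ m)" for v m
    by (rule plane_nth_eqI) (auto simp: comp_nth hvec_nth fun_vec_def)
  show "graded_lattice 2 (slice A) = {v \<in> planar. fun_vec v \<in> A}"
  proof (intro equalityI subsetI)
    fix v assume v: "v \<in> graded_lattice 2 (slice A)"
    then have "hcomp m (fun_vec v) \<in> A" for m unfolding hcomp by (simp add: graded_lattice_def slice_def)
    then have "fun_vec v \<in> A" by (rule mem_of_comps[OF A(1) b(1)])
    then show "v \<in> {v \<in> planar. fun_vec v \<in> A}" using v by (simp add: planar_def graded_lattice_def)
  next
    fix v assume v: "v \<in> {v \<in> planar. fun_vec v \<in> A}"
    then have "hvec m (\<lambda>c. v c $$ m) \<in> A" for m
      using A(2) unfolding hcomp[symmetric] by (simp add: comp_closed_def)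
    then show "v \<in> graded_lattice 2 (slice A)"
      using v by (simp add: planar_def graded_lattice_def slice_def coord_space_def)
  qed
qed

text \<open>The slices are 0 below degree q and the whole plane from degree q + h on. For h = 1 the
  module lies strictly between two adjacent multiples of \<open>std_lattice\<close>, so its slice in
  degree q is a line.\<close>

lemma profile_exponent_slice:
  assumes A: "o_submodule A" "comp_closed A" and h: "h = 0 \<or> h = 1"
    and b: "tmul (q + h) ` std_lattice \<subseteq> A" "A \<subseteq> tmul q ` std_lattice"
    and strict: "h = 1 \<Longrightarrow> A \<noteq> tmul q ` std_lattice \<and> A \<noteq> tmul (q + 1) ` std_lattice"
  shows "profile_exponent (slice A) 1 = q" "profile_exponent (slice A) 2 = q + h"
proof -
  note dim = coord_space_dim[OF slice_subspace[OF A(1)]]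
  have "slice A q \<noteq> {0}"
  proof (cases "h = 0")
    case True
    then have "slice A q = coord_space 2" using b by (intro slice_high) auto
    moreover have "(\<lambda>c. if c = 0 then 1 else 0) \<in> coord_space 2" by (simp add: coord_space_def)
    moreover have "(\<lambda>c::nat. if c = 0 then 1 else 0 :: complex) \<noteq> 0" by (rule delta_neq_0)
    ultimately show ?thesis by blast
  next
    case False
    then have "h = 1" using h by blast
    then obtain v where v: "v \<in> A" "v \<notin> tmul (q + 1) ` std_lattice" using strict b(1) by blast
    define w where "w = (\<lambda>c::nat. if c = 0 then vx v $$ q else if c = 1 then vy v $$ q else 0)"
    have "vanishes_below q (vx v)" "vanishes_below q (vy v)" using v b(2) tmul_std_lattice_iff by auto
    moreover have "\<not> (vanishes_below (q + 1) (vx v) \<and> vanishes_below (q + 1) (vy v))"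
      using v(2) unfolding tmul_std_lattice_iff .
    moreover have "j < q + 1 \<longleftrightarrow> j < q \<or> j = q" for j by auto
    ultimately have "vx v $$ q \<noteq> 0 \<or> vy v $$ q \<noteq> 0" by (auto simp: vanishes_below_def)
    then have "w \<noteq> 0" by (auto simp: w_def fun_eq_iff)
    moreover have "hcomp q v \<in> A" using A(2) v(1) by (simp add: comp_closed_def)
    then have "w \<in> slice A q" by (simp add: slice_def comp_hvec w_def coord_space_def)
    ultimately show ?thesis by blast
  qed
  moreover have "slice A m = {0}" if "m < q" for m
    using slice_low[OF b(2) that] cscale.subspace_0[OF slice_subspace(1)[OF A(1)], of m] by auto
  ultimately show "profile_exponent (slice A) 1 = q"
    unfolding profile_exponent_def dim(1) by (intro Least_equality) force+
  have "slice A (q + h) = coord_space 2" by (rule slice_high[OF b(1)]) simp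
  moreover have "q + h \<le> m" if full: "slice A m = coord_space 2" for m
  proof (rule ccontr)
    have e: "(\<lambda>c. if c = 0 then 1 else 0) \<in> coord_space 2" "(\<lambda>c. if c = 1 then 1 else 0) \<in> coord_space 2"
      by (simp_all add: coord_space_def)
    assume "\<not> q + h \<le> m"
    then consider "m < q" | "m = q" "h = 1" using h by force
    then show False
    proof cases
      case 1
      then have "(\<lambda>c::nat. if c = 0 then 1 else 0 :: complex) = 0" using slice_low[OF b(2)] full e(1) by blast
      then show False using delta_neq_0[of 0] by blast
    next
      case 2
      have "hvec q w \<in> A" if "w \<in> coord_space 2" for w
        using that full unfolding 2(1) slice_def by blast
      from this[OF e(1)] this[OF e(2)] have "tmul q unit1 \<in> A" "tmul q unit2 \<in> A"
        by (simp_all add: hvec_def)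
      then have "span2 (tmul q unit1) (tmul q unit2) \<subseteq> A" by (intro span2_least A)
      then have "tmul q ` std_lattice \<subseteq> A" by (simp add: std_lattice_eq_span2 tmul_span2)
      then show False using strict[OF 2(2)] b(2) by blast
    qed
  qed
  ultimately show "profile_exponent (slice A) 2 = q + h"
    unfolding profile_exponent_def dim(2) by (intro Least_equality) auto
qed

lemma fun_vec_simps:
  "fun_vec (u + v) = fun_vec u + fun_vec v"
  "fun_vec (zscale (lattice_brep k Ms) c v) = oscale c (fun_vec v)"
  "fun_vec (xmap (lattice_brep k Ms) i v) = tmul (eps k i) (fun_vec v)"
  "fun_vec (ymap (lattice_brep k Ms) i v) = tmul (1 - eps k i) (fun_vec v)"
proof -
  show "fun_vec (u + v) = fun_vec u + fun_vec v" by (rule plane_eqI) (simp_all add: fun_vec_def)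
  show "fun_vec (zscale (lattice_brep k Ms) c v) = oscale c (fun_vec v)"
    by (rule plane_eqI) (simp_all add: fun_vec_def lattice_brep_def)
  show "fun_vec (xmap (lattice_brep k Ms) i v) = tmul (eps k i) (fun_vec v)"
    "fun_vec (ymap (lattice_brep k Ms) i v) = tmul (1 - eps k i) (fun_vec v)"
    by (rule plane_eqI; simp add: fun_vec_def lattice_brep_def eps_def tmul_sel fls_X_times_conv_shift)+
qed

lemma inj_on_fun_vec: "inj_on fun_vec planar"
proof (rule inj_onI)
  fix u v assume uv: "u \<in> planar" "v \<in> planar" "fun_vec u = fun_vec v"
  show "u = v"
  proof
    fix c :: nat
    consider "c = 0" | "c = 1" | "c \<ge> 2" by linarith
    then show "u c = v c" using uv by cases (auto simp: fun_vec_def planar_def)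
  qed
qed

lemma fun_vec_planar: "fun_vec ` {v \<in> planar. fun_vec v \<in> A} = A"
proof
  show "A \<subseteq> fun_vec ` {v \<in> planar. fun_vec v \<in> A}"
  proof
    fix u assume u: "u \<in> A"
    define v where "v = (\<lambda>c::nat. if c = 0 then vx u else if c = 1 then vy u else 0)"
    have "fun_vec v = u" by (rule plane_eqI) (simp_all add: v_def fun_vec_def)
    moreover have "v \<in> planar" by (simp add: v_def planar_def)
    ultimately show "u \<in> fun_vec ` {v \<in> planar. fun_vec v \<in> A}" using u by force
  qed
qed auto

lemma module_lattice_brep: "module (zscale (lattice_brep k Ms))"
  by unfold_locales
    (auto simp: lattice_brep_def fun_eq_iff algebra_simps fls_times_fps_to_fls)

lemma lattice_brep_embedding:
  assumes kn: "(k, n) = (3, 9) \<or> (k, n) = (4, 8)"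
    and A: "\<And>i. i \<in> {1..n} \<Longrightarrow> o_submodule (A i)"
    and step: "\<And>i. i \<in> {1..n} \<Longrightarrow> tmul (eps k i) ` A (prv n i) \<subseteq> A i"
      "\<And>i. i \<in> {1..n} \<Longrightarrow> tmul (1 - eps k i) ` A i \<subseteq> A (prv n i)"
    and Ms: "\<And>i. i \<in> {1..n} \<Longrightarrow> Ms i = {v \<in> planar. fun_vec v \<in> A i}"
  shows "plane_embedding k n (lattice_brep k Ms) (\<lambda>i. fun_vec)"
proof -
  let ?N = "lattice_brep k Ms"
  interpret Z: module "zscale ?N" by (rule module_lattice_brep)
  have vsp: "vsp ?N i = Ms i" for i by (simp add: lattice_brep_def)
  have closed: "u + v \<in> planar" "zscale ?N c v \<in> planar" "xmap ?N i v \<in> planar" "ymap ?N i v \<in> planar"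
    if "u \<in> planar" "v \<in> planar" for u v c i
    using that by (auto simp: planar_def lattice_brep_def)
  have zero: "0 \<in> planar" "fun_vec 0 = 0" by (auto simp: planar_def fun_vec_def zero_plane_def)
  show ?thesis
  proof (rule plane_embeddingI[OF kn module_lattice_brep, where V = planar])
    fix i assume i: "i \<in> {1..n}"
    have i': "prv n i \<in> {1..n}" by (rule prv_in[OF i])
    show "vsp ?N i \<subseteq> planar" using Ms[OF i] by (auto simp: vsp)
    show "Z.subspace (vsp ?N i)"
      using o_submoduleD[OF A[OF i]] closed zero unfolding vsp Ms[OF i] Z.subspace_def
      by (auto simp: fun_vec_simps)
    show "xmap ?N i v \<in> vsp ?N i" if "v \<in> vsp ?N (prv n i)" for v
      using step(1)[OF i] closed(3)[of v v] that unfolding vsp Ms[OF i] Ms[OF i'] by (auto simp: fun_vec_simps)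
    show "ymap ?N i v \<in> vsp ?N (prv n i)" if "v \<in> vsp ?N i" for v
      using step(2)[OF i] closed(4)[of v v] that unfolding vsp Ms[OF i] Ms[OF i'] by (auto simp: fun_vec_simps)
  qed (use closed inj_on_fun_vec in \<open>auto simp: fun_vec_simps\<close>)
qed

section \<open>Lattices in a line and their jump sets\<close>

definition line_vec :: "int \<Rightarrow> complex fps \<Rightarrow> nat \<Rightarrow> complex fls" where
  "line_vec p c = (\<lambda>j. if j = 0 then fls_shift (- p) (fps_to_fls c) else 0)"

lemma line_lattice_eq: "line_lattice p = range (line_vec p)"
proof
  show "line_lattice p \<subseteq> range (line_vec p)"
  proof
    fix v assume v: "v \<in> line_lattice p"
    then have "\<forall>j<0. fls_shift p (v 0) $$ j = 0" by (simp add: line_lattice_def)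
    then obtain c where "fls_shift p (v 0) = fps_to_fls c" using integral_fls_iff by blast
    then have "v 0 = fls_shift (- p) (fps_to_fls c)" by (metis add.left_inverse fls_shift_0 fls_shift_fls_shift)
    then have "v = line_vec p c" using v by (auto simp: line_vec_def line_lattice_def)
    then show "v \<in> range (line_vec p)" by blast
  qed
qed (auto simp: line_lattice_def line_vec_def)

lemma line_vec_inj: "line_vec p c = line_vec p d \<longleftrightarrow> c = d"
proof
  assume "line_vec p c = line_vec p d"
  then have "line_vec p c 0 = line_vec p d 0" by simp
  then show "c = d" by (simp add: line_vec_def fls_shift_eq_iff)
qed simp

lemma line_vec_ops:
  "line_vec p c + line_vec p d = line_vec p (c + d)"
  "zscale (lattice_brep k Ms) b (line_vec p c) = line_vec p (b * c)"
  "xmap (lattice_brep k Ms) i (line_vec p c) = line_vec (p + eps k i) c"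
  "ymap (lattice_brep k Ms) i (line_vec p c) = line_vec (p + 1 - eps k i) c"
  by (auto simp: line_vec_def lattice_brep_def fun_eq_iff eps_def fls_X_times_conv_shift
      fls_times_fps_to_fls fls_shifted_times_simps)

lemma line_vec_X: "line_vec (p + 1) c = line_vec p (fps_X * c)"
  by (auto simp: line_vec_def fun_eq_iff fls_times_fps_to_fls fls_X_times_conv_shift algebra_simps)

lemma line_lattice_isomorphic:
  assumes jump: "\<And>i. i \<in> {1..n} \<Longrightarrow> p (prv n i) + eps k i - p i \<in> {0, 1}"
    and I: "I = {i \<in> {1..n}. p (prv n i) + eps k i = p i}"
  shows "brep_isomorphic n (lattice_brep k (\<lambda>i. line_lattice (p i))) (L_module I)"
proof -
  let ?N = "lattice_brep k (\<lambda>i. line_lattice (p i))"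
  define f where "f i v = (THE c. v = line_vec (p i) c)" for i v
  have f: "f i (line_vec (p i) c) = c" for i c by (simp add: f_def line_vec_inj)
  have vsp: "vsp ?N i = range (line_vec (p i))" for i by (simp add: lattice_brep_def line_lattice_eq)
  have x: "xmap ?N i (line_vec (p (prv n i)) c) = line_vec (p i) (if i \<in> I then c else fps_X * c)" if i: "i \<in> {1..n}" for i c
  proof (cases "i \<in> I")
    case True then show ?thesis by (simp add: line_vec_ops I)
  next
    case False
    then have "p (prv n i) + eps k i = p i + 1" using jump[OF i] i by (auto simp: I)
    then show ?thesis using False by (simp add: line_vec_ops line_vec_X)
  qed
  have y: "ymap ?N i (line_vec (p i) c) = line_vec (p (prv n i)) (if i \<in> I then fps_X * c else c)" if i: "i \<in> {1..n}" for i c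
  proof (cases "i \<in> I")
    case True
    then have e: "p i + 1 - eps k i = p (prv n i) + 1" by (simp add: I)
    show ?thesis unfolding line_vec_ops e line_vec_X using True by simp
  next
    case False
    then have "p i + 1 - eps k i = p (prv n i)" using jump[OF i] i by (auto simp: I)
    then show ?thesis using False by (simp add: line_vec_ops)
  qed
  have "brep_hom n ?N (L_module I) f"
    unfolding brep_hom_def zlinear_on_def vsp
    by (auto simp: x y f line_vec_ops(1,2) L_module_def)
  moreover have "bij_betw (f i) (vsp ?N i) (vsp (L_module I) i)" for i
    unfolding vsp by (rule bij_betwI[where g = "line_vec (p i)"]) (auto simp: f L_module_def)
  ultimately show ?thesis by (auto simp: brep_isomorphic_def brep_iso_def)
qed

text \<open>Surjectivity of x is an invariant: on the rank 1 module of I it holds exactly for i in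
  I, on the line lattices exactly when the exponent does not jump. So the isomorphism type
  determines the set.\<close>

lemma line_lattice_isomorphic_mem:
  assumes jump: "\<And>i. i \<in> {1..n} \<Longrightarrow> p (prv n i) + eps k i - p i \<in> {0, 1}"
    and iso: "brep_isomorphic n (lattice_brep k (\<lambda>i. line_lattice (p i))) (L_module I)" and i: "i \<in> {1..n}"
  shows "i \<in> I \<longleftrightarrow> p (prv n i) + eps k i = p i"
proof -
  let ?N = "lattice_brep k (\<lambda>i. line_lattice (p i))"
  have i': "prv n i \<in> {1..n}" by (rule prv_in[OF i])
  obtain f where f: "brep_hom n ?N (L_module I) f" "\<And>i. i \<in> {1..n} \<Longrightarrow> bij_betw (f i) (vsp ?N i) UNIV"
    using iso by (auto simp: brep_isomorphic_def brep_iso_def L_module_def)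
  have vsp: "vsp ?N i = range (line_vec (p i))" for i by (simp add: lattice_brep_def line_lattice_eq)
  have fx: "f i (xmap ?N i v) = (if i \<in> I then f (prv n i) v else fps_X * f (prv n i) v)" if "v \<in> vsp ?N (prv n i)" for v
    using f(1) i that by (auto simp: brep_hom_def L_module_def)
  have surj: "\<exists>v\<in>vsp ?N j. f j v = c" if "j \<in> {1..n}" for j c
    using f(2)[OF that] unfolding bij_betw_def by (metis UNIV_I imageE)
  show ?thesis
  proof
    assume iI: "i \<in> I"
    obtain v where v: "v \<in> vsp ?N (prv n i)" "f (prv n i) v = f i (line_vec (p i) 1)" using surj[OF i'] by blast
    obtain c where c: "v = line_vec (p (prv n i)) c" using v(1) by (auto simp: vsp)
    show "p (prv n i) + eps k i = p i"
    proof (rule ccontr)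
      assume "p (prv n i) + eps k i \<noteq> p i"
      then have "p (prv n i) + eps k i = p i + 1" using jump[OF i] by auto
      then have xv: "xmap ?N i v = line_vec (p i) (fps_X * c)" by (simp add: c line_vec_ops line_vec_X)
      have "f i (line_vec (p i) (fps_X * c)) = f i (line_vec (p i) 1)" using fx[OF v(1)] v(2) iI xv by simp
      moreover have "inj_on (f i) (range (line_vec (p i)))" using f(2)[OF i] by (simp add: bij_betw_def vsp)
      ultimately have "line_vec (p i) (fps_X * c) = line_vec (p i) 1" by (auto dest: inj_onD)
      then have "fps_X * c = 1" by (simp add: line_vec_inj)
      then have "(fps_X * c) $ 0 = 1 $ 0" by simp
      then show False by simp
    qed
  next
    assume eq: "p (prv n i) + eps k i = p i"
    show "i \<in> I"
    proof (rule ccontr)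
      assume iI: "i \<notin> I"
      obtain w where w: "w \<in> vsp ?N i" "f i w = 1" using surj[OF i] by blast
      obtain c where c: "w = line_vec (p i) c" using w(1) by (auto simp: vsp)
      have v: "line_vec (p (prv n i)) c \<in> vsp ?N (prv n i)" by (simp add: vsp)
      have "xmap ?N i (line_vec (p (prv n i)) c) = w" by (simp add: line_vec_ops eq c)
      then have "fps_X * f (prv n i) (line_vec (p (prv n i)) c) = 1" using fx[OF v] iI w(2) by simp
      then have "(fps_X * f (prv n i) (line_vec (p (prv n i)) c)) $ 0 = 1 $ 0" by simp
      then show False by simp
    qed
  qed
qed

section \<open>The position of graded lattices in the tree\<close>

lemma lattice2_full:
  assumes "lattice2 C" obtains K where "tmul K ` std_lattice \<subseteq> C"
proof -
  obtain g h where gh: "det2 g h \<noteq> 0" "C = span2 g h" using assms by (auto simp: lattice2_def)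
  obtain H where H: "klinear H" "bij H" "H g = unit1" "H h = unit2" using coordinate_map[OF gh(1)] .
  have HC: "H ` C = std_lattice" using klinear_span2[OF H(1)] H gh by (simp add: std_lattice_eq_span2)
  obtain K1 where K1: "\<forall>m\<ge>K1. tmul m (H unit1) \<in> std_lattice" using eventually_in_std_lattice by blast
  obtain K2 where K2: "\<forall>m\<ge>K2. tmul m (H unit2) \<in> std_lattice" using eventually_in_std_lattice by blast
  define K where "K = max K1 K2"
  have mem: "v \<in> C" if "H v \<in> std_lattice" for v
    using that HC bij_is_inj[OF H(2)] by (metis image_iff inj_eq)
  have "tmul K unit1 \<in> C" "tmul K unit2 \<in> C"
    using K1 K2 by (auto intro!: mem simp: klinear_tmul[OF H(1)] K_def)
  then have "span2 (tmul K unit1) (tmul K unit2) \<subseteq> C" by (intro span2_least lattice2_o_submodule assms)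
  then show ?thesis using that[of K] by (simp add: std_lattice_eq_span2 tmul_span2)
qed

text \<open>If all components of a vector lay in tC, so would the vector. A vector of N outside tC
  therefore has a component outside tC, and this component stays in N.\<close>

lemma homogeneous_primitive:
  assumes C: "lattice2 C" and N: "neighbour N C" "comp_closed N"
  obtains m w where "hvec m w \<in> N" "hvec m w \<notin> tmul 1 ` C"
proof -
  obtain v where v: "v \<in> N" "v \<notin> tmul 1 ` C" using N(1) by (auto simp: neighbour_def)
  have XC: "lattice2 (tmul 1 ` C)" by (rule lattice2_tmul[OF C])
  obtain K where "tmul K ` std_lattice \<subseteq> tmul 1 ` C" using lattice2_full[OF XC] .
  then have "\<not> (\<forall>m. hcomp m v \<in> tmul 1 ` C)" using mem_of_comps[OF lattice2_o_submodule[OF XC]] v(2) by blast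
  then obtain m where "hcomp m v \<notin> tmul 1 ` C" by blast
  moreover have "hcomp m v \<in> N" using N(2) v(1) by (simp add: comp_closed_def)
  ultimately show ?thesis using that by (metis comp_hvec)
qed

text \<open>The coefficient vectors form an invertible constant matrix, so over C[[t]] they span the
  same lattice as the standard basis, up to t^m.\<close>

lemma span2_same_degree:
  assumes "det2 (hvec m w) (hvec m w') \<noteq> 0"
  shows "span2 (hvec m w) (hvec m w') = tmul m ` std_lattice"
proof -
  let ?u = "hvec 0 w" and ?u' = "hvec 0 w'"
  define d where "d = w 0 * w' 1 - w 1 * w' 0"
  have hv: "hvec m v = tmul m (hvec 0 v)" for m v by (simp add: hvec_def)
  have "det2 ?u ?u' \<noteq> 0" using assms unfolding hv[of m w] hv[of m w'] by simp
  moreover have "det2 ?u ?u' = 0" if "d = 0"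
  proof -
    have "w 0 * w' 1 = w 1 * w' 0" using that by (simp add: d_def)
    then show ?thesis by (simp add: det2_def hvec_def)
  qed
  ultimately have d: "d \<noteq> 0" by blast
  have "span2 ?u ?u' = std_lattice"
  proof
    show "span2 ?u ?u' \<subseteq> std_lattice"
      by (intro span2_least o_submodule_std_lattice) (auto simp: std_lattice_def hvec_def)
    \<comment> \<open>The coefficients are the entries of the inverse matrix, with determinant
      d.\<close>
    have "unit1 = oscale (fps_const (w' 1 / d)) ?u + oscale (fps_const (- w 1 / d)) ?u'"
      "unit2 = oscale (fps_const (- w' 0 / d)) ?u + oscale (fps_const (w 0 / d)) ?u'"
      using d by (auto intro!: plane_nth_eqI simp: hvec_def d_def field_simps)
    then have "unit1 \<in> span2 ?u ?u'" "unit2 \<in> span2 ?u ?u'" using span2I by metis+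
    then show "std_lattice \<subseteq> span2 ?u ?u'"
      unfolding std_lattice_eq_span2 by (intro span2_least o_submodule_span2)
  qed
  then show ?thesis unfolding hv[of m w] hv[of m w'] tmul_span2[symmetric] by simp
qed

lemma oscale_hvec_nth:
  assumes "j \<le> m"
  shows "vx (oscale c (hvec m w)) $$ j = (if j = m then c $ 0 * w 0 else 0)"
    "vy (oscale c (hvec m w)) $$ j = (if j = m then c $ 0 * w 1 else 0)"
proof -
  have "oscale c (hvec m w) = tmul m (oscale c (Vec (fls_const (w 0)) (fls_const (w 1))))"
    by (simp add: hvec_def tmul_oscale)
  then show "vx (oscale c (hvec m w)) $$ j = (if j = m then c $ 0 * w 0 else 0)"
    "vy (oscale c (hvec m w)) $$ j = (if j = m then c $ 0 * w 1 else 0)"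
    using assms by (simp_all add: tmul_sel fps_to_fls_mult_nth_nonpos)
qed

text \<open>The graded lattices form a union of rays from a common origin; only the origin has three
  neighbours among them.\<close>

lemma three_graded_neighbours:
  assumes C: "lattice2 C" and N: "neighbour N1 C" "neighbour N2 C" "neighbour N3 C"
    and distinct: "N1 \<noteq> N2" "N1 \<noteq> N3" "N2 \<noteq> N3"
    and closed: "comp_closed N1" "comp_closed N2" "comp_closed N3"
  shows "\<exists>s. C = tmul s ` std_lattice"
proof -
  obtain m1 w1 where h1: "hvec m1 w1 \<in> N1" "hvec m1 w1 \<notin> tmul 1 ` C"
    using homogeneous_primitive[OF C N(1) closed(1)] .
  obtain m2 w2 where h2: "hvec m2 w2 \<in> N2" "hvec m2 w2 \<notin> tmul 1 ` C"
    using homogeneous_primitive[OF C N(2) closed(2)] .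
  obtain m3 w3 where h3: "hvec m3 w3 \<in> N3" "hvec m3 w3 \<notin> tmul 1 ` C"
    using homogeneous_primitive[OF C N(3) closed(3)] .
  note s12 = two_neighbours_span[OF C N(1,2) distinct(1) h1 h2]
  note s13 = two_neighbours_span[OF C N(1,3) distinct(2) h1 h3]
  note s23 = two_neighbours_span[OF C N(2,3) distinct(3) h2 h3]
  have nz: "w 0 \<noteq> 0 \<or> w 1 \<noteq> 0" if "hvec m w \<notin> tmul 1 ` C" for m w
  proof (rule ccontr)
    assume "\<not> (w 0 \<noteq> 0 \<or> w 1 \<noteq> 0)"
    then have "hvec m w = 0" by (intro plane_nth_eqI) (auto simp: hvec_nth)
    then show False
      using that o_submoduleD(1)[OF lattice2_o_submodule[OF lattice2_tmul[OF C, of 1]]] by simp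
  qed
  \<comment> \<open>Pairwise different degrees are excluded: the third vector is a combination of
    the first two with unit coefficients, so its component in the lower of their degrees is nonzero,
    although it is homogeneous of another degree. Two vectors of equal degree then identify
    C.\<close>
  have "m1 = m2 \<or> m1 = m3 \<or> m2 = m3"
  proof (rule ccontr)
    assume neq: "\<not> (m1 = m2 \<or> m1 = m3 \<or> m2 = m3)"
    have "hvec m3 w3 \<in> C" using h3 N(3) by (auto simp: neighbour_def)
    then obtain \<alpha> \<beta> where ab: "hvec m3 w3 = oscale \<alpha> (hvec m1 w1) + oscale \<beta> (hvec m2 w2)"
      unfolding s12(2) by (rule span2E)
    have N1: "N1 = span2 (hvec m1 w1) (tmul 1 (hvec m2 w2))"
      by (rule neighbour_basis_given[OF N(1) s12(2) h1(1)])
    have N2: "N2 = span2 (hvec m2 w2) (tmul 1 (hvec m1 w1))"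
      by (rule neighbour_basis_given[OF N(2) _ h2(1)]) (simp add: s12(2) span2_commute)
    have notin: "hvec m3 w3 \<notin> N1" "hvec m3 w3 \<notin> N2"
      using neighbour_eq_if_common_primitive[OF C] N h3 distinct by blast+
    have \<beta>: "\<beta> $ 0 \<noteq> 0"
    proof
      assume "\<beta> $ 0 = 0"
      then obtain \<gamma> where "\<beta> = fps_X * \<gamma>" using fps_X_dvd_of_nth_0 by blast
      then show False using notin(1) ab by (simp add: N1 oscale_X_mult span2I)
    qed
    have \<alpha>: "\<alpha> $ 0 \<noteq> 0"
    proof
      assume "\<alpha> $ 0 = 0"
      then obtain \<gamma> where "\<alpha> = fps_X * \<gamma>" using fps_X_dvd_of_nth_0 by blast
      then show False using notin(2) ab by (simp add: N2 oscale_X_mult span2I add.commute)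
    qed
    consider "m1 < m2" | "m2 < m1" using neq by linarith
    then show False
    proof cases
      case 1
      have "vx (hvec m3 w3) $$ m1 = \<alpha> $ 0 * w1 0" "vy (hvec m3 w3) $$ m1 = \<alpha> $ 0 * w1 1"
        using 1 unfolding ab by (simp_all add: oscale_hvec_nth del: oscale_sel)
      then show False using neq \<alpha> nz[OF h1(2)] by (auto simp: hvec_nth)
    next
      case 2
      have "vx (hvec m3 w3) $$ m2 = \<beta> $ 0 * w2 0" "vy (hvec m3 w3) $$ m2 = \<beta> $ 0 * w2 1"
        using 2 unfolding ab by (simp_all add: oscale_hvec_nth del: oscale_sel)
      then show False using neq \<beta> nz[OF h2(2)] by (auto simp: hvec_nth)
    qed
  qed
  then show ?thesis
    using s12 s13 s23 span2_same_degree by metis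
qed

text \<open>With \<open>hi_exp\<close> below, the two profile exponents of \<open>tripod m\<close>,
  which lies between t^hi and t^lo times \<open>std_lattice\<close>. They agree at the centre and
  differ by one at the legs.\<close>

definition lo_exp :: "int \<Rightarrow> int" where "lo_exp m = - ((m + 1) div 2)"

definition hi_exp :: "int \<Rightarrow> int" where "hi_exp m = - (m div 2)"

lemma lo_hi_step: "lo_exp m - lo_exp (m + 1) \<in> {0, 1}" "hi_exp m - hi_exp (m + 1) \<in> {0, 1}"
  by (simp_all add: lo_exp_def hi_exp_def) presburger+

lemma lo_hi_period: "lo_exp (m + 6) = lo_exp m - 3" "hi_exp (m + 6) = hi_exp m - 3"
  unfolding lo_exp_def hi_exp_def by presburger+

text \<open>Moving by one position exchanges the two exponents up to a constant, which does not
  affect jumps. This is why changing the parity e exchanges the two parts of the profile.\<close>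

lemma lo_hi_swap: "hi_exp (m + 1) = lo_exp m" "lo_exp (m + 1) = hi_exp m - 1"
  unfolding lo_exp_def hi_exp_def by presburger+

lemma klinear_o_submodule:
  assumes "klinear H" "o_submodule A" shows "o_submodule (H ` A)"
proof -
  have H: "H (u + v) = H u + H v" "H (oscale c v) = oscale c (H v)" for u v c
    using assms(1) by (auto simp: klinear_def oscale_def)
  have "H 0 = 0" using H(2)[of 0 0] by simp
  then have "0 \<in> H ` A" using o_submoduleD(1)[OF assms(2)] by force
  moreover have "u + v \<in> H ` A" if uv: "u \<in> H ` A" "v \<in> H ` A" for u v
  proof -
    obtain u' v' where "u = H u'" "v = H v'" "u' \<in> A" "v' \<in> A" using uv by blast
    then have "u + v = H (u' + v')" "u' + v' \<in> A" using H o_submoduleD(2)[OF assms(2)] by auto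
    then show ?thesis by blast
  qed
  moreover have "oscale c v \<in> H ` A" if v: "v \<in> H ` A" for c v
  proof -
    obtain v' where "v = H v'" "v' \<in> A" using v by blast
    then have "oscale c v = H (oscale c v')" "oscale c v' \<in> A" using H o_submoduleD(3)[OF assms(2)] by auto
    then show ?thesis by blast
  qed
  ultimately show ?thesis by (auto simp: o_submodule_def)
qed

lemma klinear_neighbour:
  assumes "klinear H" "inj H" "neighbour A B" shows "neighbour (H ` A) (H ` B)"
proof -
  have "tmul 1 ` H ` B = H ` tmul 1 ` B" by (simp only: klinear_tmul_image[OF assms(1)])
  then show ?thesis
    using assms(3) klinear_o_submodule[OF assms(1)] inj_image_subset_iff[OF assms(2)] inj_image_eq_iff[OF assms(2)]
    unfolding neighbour_def psubset_eq by simp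
qed

text \<open>The linear map G accounts for the choice of a graded realisation; s is the common shift
  up to which the profile exponents are determined.\<close>

lemma profile_exponent_tripod_image:
  assumes G: "klinear G" "inj G" "G ` std_lattice = tmul s ` std_lattice"
    and A: "A = tmul p ` G ` tripod m" "comp_closed A"
  shows "profile_exponent (slice A) 1 = p + lo_exp m + s" "profile_exponent (slice A) 2 = p + hi_exp m + s"
proof -
  define h where "h = hi_exp m - lo_exp m"
  have h: "h = 0 \<or> h = 1" unfolding h_def lo_exp_def hi_exp_def by presburger
  have std: "tmul (p + x + s) ` std_lattice = tmul p ` G ` tmul x ` std_lattice" for x
    unfolding klinear_tmul_image[OF G(1)] G(3) by (simp add: add_ac)
  have sub: "tmul p ` G ` S \<subseteq> tmul p ` G ` T \<longleftrightarrow> S \<subseteq> T" for S T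
    by (simp add: inj_image_subset_iff[OF G(2)])
  have eq: "tmul p ` G ` S = tmul p ` G ` T \<longleftrightarrow> S = T" for S T
    by (simp add: inj_image_eq_iff[OF G(2)])
  have b: "tmul (p + hi_exp m + s) ` std_lattice \<subseteq> A" "A \<subseteq> tmul (p + lo_exp m + s) ` std_lattice"
    unfolding A(1) std sub using tripod_bounds[of m] by (simp_all add: lo_exp_def hi_exp_def)
  have strict: "A \<noteq> tmul (p + lo_exp m + s) ` std_lattice \<and> A \<noteq> tmul (p + (lo_exp m + 1) + s) ` std_lattice"
    if "h = 1"
  proof -
    have odd: "odd m" using that unfolding h_def lo_exp_def hi_exp_def by presburger
    have "leg l \<noteq> std_lattice" "leg l \<noteq> tmul 1 ` std_lattice" for l using leg_between by blast+
    moreover have "tmul (lo_exp m + 1) ` std_lattice = tmul (lo_exp m) ` tmul 1 ` std_lattice" by simp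
    ultimately show ?thesis
      unfolding A(1) std eq using odd by (simp only: tripod_def lo_exp_def tmul_image_eq_iff if_False) simp
  qed
  have oA: "o_submodule A"
    unfolding A(1) by (intro o_submodule_tmul_image klinear_o_submodule G o_submodule_tripod)
  have hq: "p + lo_exp m + s + h = p + hi_exp m + s" by (simp add: h_def)
  show "profile_exponent (slice A) 1 = p + lo_exp m + s" "profile_exponent (slice A) 2 = p + hi_exp m + s"
    using profile_exponent_slice[OF oA A(2) h, of "p + lo_exp m + s"] b strict unfolding hq
    by (simp_all add: add_ac)
qed

text \<open>A vanishing determinant gives kernel vectors, read off from the two rows of the matrix
  with columns H \<open>unit1\<close> and H \<open>unit2\<close>; if both of them are zero, then H
  \<open>unit1\<close> = 0.\<close>

lemma klinear_injective_det:
  assumes H: "klinear H" and inj: "\<And>v. v \<in> std_lattice \<Longrightarrow> H v = 0 \<Longrightarrow> v = 0"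
  shows "det2 (H unit1) (H unit2) \<noteq> 0"
proof
  assume d: "det2 (H unit1) (H unit2) = 0"
  have inj': "v = 0" if "H v = 0" for v
  proof -
    obtain m where m: "\<forall>j\<ge>m. tmul j v \<in> std_lattice" using eventually_in_std_lattice by blast
    have "H (tmul m v) = 0" using that by (simp add: klinear_tmul[OF H])
    then have "tmul m v = 0" using inj m by blast
    then show ?thesis by simp
  qed
  let ?g = "H unit1" and ?h = "H unit2"
  have "H (Vec (vy ?h) (- vy ?g)) = 0" "H (Vec (vx ?h) (- vx ?g)) = 0"
    using d by (subst klinear_expand[OF H]; intro plane_eqI; simp add: det2_def algebra_simps)+
  then have "Vec (vy ?h) (- vy ?g) = 0" "Vec (vx ?h) (- vx ?g) = 0" using inj' by blast+
  then have "vy ?g = 0" "vx ?g = 0" by (simp_all add: zero_plane_def)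
  then have "?g = 0" by (intro plane_eqI) simp_all
  then have "unit1 = 0" by (rule inj')
  then show False by (simp add: zero_plane_def)
qed

context root_vec
begin

text \<open>The arrows along which the exponent \<open>wt i + E (cnt i + e)\<close> does not jump,
  i.e. the subset belonging to the rank 1 module with these exponents.\<close>

definition profile_set :: "(int \<Rightarrow> int) \<Rightarrow> int \<Rightarrow> nat set" where
  "profile_set E e = {i \<in> {1..n}. (wt (prv n i) + E (int (cnt (prv n i)) + e)) + eps k i = wt i + E (int (cnt i) + e)}"

lemma profile_jump:
  assumes "\<And>m. E m - E (m + 1) \<in> {0, 1}" "\<And>m. E (m + 6) = E m - 3" "i \<in> {1..n}"
  shows "(wt (prv n i) + E (int (cnt (prv n i)) + e)) + eps k i - (wt i + E (int (cnt i) + e)) \<in> {0, 1}"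
  unfolding jump_exp[where E = E, OF assms] using assms(1)[of "int (cnt i) + e - 1"] by simp

lemma profile_set_k_subset:
  assumes "\<And>m. E m - E (m + 1) \<in> {0, 1}" "\<And>m. E (m + 6) = E m - 3"
  shows "k_subset k n (profile_set E e)"
  using card_jumps[of k n "\<lambda>i. wt i + E (int (cnt i) + e)"] profile_jump[OF assms] k_bounds
  by (auto simp: k_subset_def profile_set_def)

lemma profile_set_swap:
  assumes "e \<in> {0, 1}"
  shows "profile_set lo_exp (1 - e) = profile_set hi_exp e" "profile_set hi_exp (1 - e) = profile_set lo_exp e"
proof -
  have shift: "profile_set E 1 = profile_set F 0" if "\<And>m. E (m + 1) = F m - d" for E F d
    using that by (auto simp: profile_set_def)
  have "profile_set lo_exp 1 = profile_set hi_exp 0" "profile_set hi_exp 1 = profile_set lo_exp 0"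
    by (rule shift[of _ _ 1], rule lo_hi_swap) (rule shift[of _ _ 0], simp add: lo_hi_swap)
  then show "profile_set lo_exp (1 - e) = profile_set hi_exp e" "profile_set hi_exp (1 - e) = profile_set lo_exp e"
    using assms by auto
qed

lemma comp_closed_tripod_lattice: "comp_closed (tripod_lattice e i)"
  by (simp add: tripod_lattice_def comp_closed_tmul comp_closed_tripod)

text \<open>The common shift s cancels in every jump, so the subset is the same for all s.\<close>

lemma profile_line_isomorphic:
  assumes "\<And>m. E m - E (m + 1) \<in> {0, 1}" "\<And>m. E (m + 6) = E m - 3"
    and p: "\<And>i. i \<in> {1..n} \<Longrightarrow> p i = wt i + E (int (cnt i) + e) + s"
  shows "brep_isomorphic n (lattice_brep k (\<lambda>i. line_lattice (p i))) (L_module (profile_set E e))"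
    "\<And>I. k_subset k n I \<Longrightarrow> brep_isomorphic n (lattice_brep k (\<lambda>i. line_lattice (p i))) (L_module I) \<Longrightarrow>
      I = profile_set E e"
proof -
  have jump: "p (prv n i) + eps k i - p i \<in> {0, 1}" if i: "i \<in> {1..n}" for i
  proof -
    have "p (prv n i) + eps k i - p i =
        (wt (prv n i) + E (int (cnt (prv n i)) + e)) + eps k i - (wt i + E (int (cnt i) + e))"
      using p[OF i] p[OF prv_in[OF i]] by simp
    then show ?thesis by (simp only: profile_jump[OF assms(1,2) i])
  qed
  have set: "profile_set E e = {i \<in> {1..n}. p (prv n i) + eps k i = p i}"
    unfolding profile_set_def using p prv_in by auto
  show "brep_isomorphic n (lattice_brep k (\<lambda>i. line_lattice (p i))) (L_module (profile_set E e))"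
    by (rule line_lattice_isomorphic[OF jump set])
  show "I = profile_set E e" if "k_subset k n I"
    "brep_isomorphic n (lattice_brep k (\<lambda>i. line_lattice (p i))) (L_module I)" for I
    using line_lattice_isomorphic_mem[OF jump that(2)] that(1) unfolding set k_subset_def by blast
qed

lemma tripod_lattice_std_bounds:
  "tmul (wt i + hi_exp (int (cnt i) + e)) ` std_lattice \<subseteq> tripod_lattice e i"
  "tripod_lattice e i \<subseteq> tmul (wt i + lo_exp (int (cnt i) + e)) ` std_lattice"
  using tripod_bounds[of "int (cnt i) + e"]
  unfolding tripod_lattice_def tmul_image_tmul[symmetric] tmul_image_subset_iff
  by (simp_all only: lo_exp_def hi_exp_def)

text \<open>The lattices of the tripod module are themselves graded, so their slices serve as W,
  with shift 0.\<close>

lemma tripod_rep_profile: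
  assumes e: "e \<in> {0, 1}"
  shows "has_profile k n (tripod_rep e) [profile_set lo_exp e, profile_set hi_exp e]"
proof -
  define W where "W i = slice (tripod_lattice e i)" for i
  let ?N = "lattice_brep k (\<lambda>i. graded_lattice 2 (W i))"
  have W: "graded_data 2 (W i)" "graded_lattice 2 (W i) = {v \<in> planar. fun_vec v \<in> tripod_lattice e i}" for i
    unfolding W_def
    using graded_data_slice[OF o_submodule_tripod_lattice comp_closed_tripod_lattice tripod_lattice_std_bounds]
    by auto
  have emb: "plane_embedding k n ?N (\<lambda>i. fun_vec)"
    by (rule lattice_brep_embedding[OF kn o_submodule_tripod_lattice tripod_lattice_step W(2)])
  interpret N: plane_embedding k n ?N "\<lambda>i. fun_vec" by (rule emb)
  have iso: "brep_isomorphic n (tripod_rep e) ?N"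
  proof (rule plane_embedding_isomorphic[OF tripod_rep_embedding emb])
    fix i assume "i \<in> {1..n}"
    then show "fps_vec ` vsp (tripod_rep e) i = fun_vec ` vsp ?N i"
      using tripod_rep_image[of i e] e by (simp add: lattice_brep_def W(2) fun_vec_planar)
  qed
  have exps: "profile_exponent (W i) 1 = wt i + lo_exp (int (cnt i) + e) + 0"
    "profile_exponent (W i) 2 = wt i + hi_exp (int (cnt i) + e) + 0" for i
  proof -
    have "klinear id" "inj (id :: plane \<Rightarrow> plane)" "id ` std_lattice = tmul 0 ` std_lattice"
      "tripod_lattice e i = tmul (wt i) ` id ` tripod (int (cnt i) + e)"
      by (simp_all add: klinear_def tripod_lattice_def)
    from profile_exponent_tripod_image[OF this comp_closed_tripod_lattice]
    show "profile_exponent (W i) 1 = wt i + lo_exp (int (cnt i) + e) + 0"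
      "profile_exponent (W i) 2 = wt i + hi_exp (int (cnt i) + e) + 0"
      unfolding W_def by simp_all
  qed
  have l1: "brep_isomorphic n (lattice_brep k (\<lambda>i. line_lattice (profile_exponent (W i) 1))) (L_module (profile_set lo_exp e))"
    by (rule profile_line_isomorphic(1)[OF lo_hi_step(1) lo_hi_period(1) exps(1)])
  have l2: "brep_isomorphic n (lattice_brep k (\<lambda>i. line_lattice (profile_exponent (W i) 2))) (L_module (profile_set hi_exp e))"
    by (rule profile_line_isomorphic(1)[OF lo_hi_step(2) lo_hi_period(2) exps(2)])
  have ks: "k_subset k n (profile_set lo_exp e)" "k_subset k n (profile_set hi_exp e)"
    using profile_set_k_subset lo_hi_step lo_hi_period by blast+
  have c: "c = 1 \<or> c = 2" if "c \<in> {1..2 :: nat}" for c using that by auto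
  have len: "length [profile_set lo_exp e, profile_set hi_exp e] = 2" by simp
  show ?thesis
    unfolding has_profile_def len
  proof (intro exI[of _ W] conjI ballI)
    fix c :: nat assume "c \<in> {1..2}"
    then consider "c = 1" | "c = 2" using c by blast
    then show "k_subset k n ([profile_set lo_exp e, profile_set hi_exp e] ! (c - 1))"
      "brep_isomorphic n (lattice_brep k (\<lambda>i. line_lattice (profile_exponent (W i) c)))
        (L_module ([profile_set lo_exp e, profile_set hi_exp e] ! (c - 1)))"
      using ks l1 l2 by (cases; simp)+
  qed (use W iso N.B in auto)
qed

text \<open>The profile comes with some graded realisation. By the classification its lattices are
  the images of a tripod under a linear map G. The three legs are distinct graded neighbours of the
  centre, which forces the centre to be t^s \<open>std_lattice\<close>; the exponents are then those
  of the tripod shifted by s.\<close>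

lemma profile_determined:
  fixes M :: "'v::ab_group_add brep"
  assumes M: "B_module k n M" "has_rank n M 2" "indecomposable_brep n M"
    and surj2: "\<And>i. i \<in> {1..n} \<Longrightarrow> a i = 2 \<Longrightarrow> xmap M i ` vsp M (prv n i) = vsp M i"
    and surj0: "\<And>i. i \<in> {1..n} \<Longrightarrow> a i = 0 \<Longrightarrow> ymap M i ` vsp M i = vsp M (prv n i)"
    and nonsurj: "\<And>i. i \<in> {1..n} \<Longrightarrow> a i = 1 \<Longrightarrow>
      xmap M i ` vsp M (prv n i) \<noteq> vsp M i \<and> ymap M i ` vsp M i \<noteq> vsp M (prv n i)"
    and prof: "has_profile k n M [I, J]"
  obtains e where "e \<in> {0, 1}" "I = profile_set lo_exp e" "J = profile_set hi_exp e"
proof -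
  interpret B_mod k n M using M(1) k_bounds by unfold_locales auto
  have kk: "k \<in> {1..n}" using k by auto
  have two: "Suc (Suc 0) = 2" by simp
  obtain W where W: "\<And>i. i \<in> {1..n} \<Longrightarrow> graded_data 2 (W i)"
    and iso: "brep_isomorphic n M (lattice_brep k (\<lambda>i. graded_lattice 2 (W i)))"
    and line: "\<And>c. c \<in> {1..2} \<Longrightarrow> k_subset k n ([I, J] ! (c - 1)) \<and> brep_isomorphic n
      (lattice_brep k (\<lambda>i. line_lattice (profile_exponent (W i) c))) (L_module ([I, J] ! (c - 1)))"
    using prof unfolding has_profile_def by (auto simp only: list.size two add_0 add_Suc plus_1_eq_Suc)
  let ?N = "lattice_brep k (\<lambda>i. graded_lattice 2 (W i))"
  have vN: "vsp ?N i = graded_lattice 2 (W i)" for i by (simp add: lattice_brep_def)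
  obtain h where h: "brep_hom n M ?N h" "\<And>i. i \<in> {1..n} \<Longrightarrow> bij_betw (h i) (vsp M i) (graded_lattice 2 (W i))"
    using iso by (auto simp: brep_isomorphic_def brep_iso_def vN)
  define \<Phi> where "\<Phi> i v = fun_vec (h i v)" for i v
  have \<Phi>_hom: "brep_hom n M (const_rep k) \<Phi>"
    using h(1) unfolding brep_hom_def zlinear_on_def \<Phi>_def by (auto simp: fun_vec_simps)
  have planar: "graded_lattice 2 (W i) \<subseteq> planar" for i by (auto simp: graded_lattice_def planar_def)
  have \<Phi>_ker: "v = 0" if i: "i \<in> {1..n}" and v: "v \<in> vsp M i" "\<Phi> i v = 0" for i v
  proof -
    have z: "0 \<in> vsp M i" by (rule zero_in[OF i])
    have "\<Phi> i 0 = 0" using plane_homD(2)[OF \<Phi>_hom i z, of 0] by simp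
    then have "fun_vec (h i v) = fun_vec (h i 0)" using v by (simp add: \<Phi>_def)
    moreover have "h i v \<in> planar" "h i 0 \<in> planar"
      using h(2)[OF i] v(1) z planar[of i] by (auto simp: bij_betw_def)
    ultimately have "h i v = h i 0" using inj_on_fun_vec by (auto dest: inj_onD)
    then show ?thesis using h(2)[OF i] v(1) z by (auto simp: bij_betw_def dest: inj_onD)
  qed
  interpret P: plane_embedding k n M \<Phi> using \<Phi>_hom \<Phi>_ker by unfold_locales auto
  define A where "A i = fun_vec ` graded_lattice 2 (W i)" for i
  have im: "\<Phi> i ` vsp M i = A i" if i: "i \<in> {1..n}" for i
  proof -
    have "\<Phi> i ` vsp M i = fun_vec ` h i ` vsp M i" by (simp add: \<Phi>_def image_image)
    then show ?thesis using h(2)[OF i] by (simp add: bij_betw_def A_def)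
  qed
  \<comment> \<open>The realisation is compared with the embedding \<open>\<Phi>0\<close> whose
    image at vertex k is \<open>std_lattice\<close>; the two differ by an injective linear
    map.\<close>
  have lat: "lattice2 (\<Phi> k ` vsp M k)"
  proof -
    obtain \<Phi>0 where \<Phi>0: "plane_embedding k n M \<Phi>0" "\<Phi>0 k ` vsp M k = std_lattice"
      using rank_2_embedding[OF M(2)] by blast
    interpret P0: plane_embedding k n M \<Phi>0 by (rule \<Phi>0(1))
    have "tmul 0 v \<in> P0.image k" if "v \<in> std_lattice" for v using \<Phi>0(2) that by (simp add: P0.image_def)
    then obtain H where H: "klinear H" "\<And>i v. i \<in> {1..n} \<Longrightarrow> v \<in> vsp M i \<Longrightarrow> \<Phi> i v = H (\<Phi>0 i v)"
      using P0.hom_factors[OF _ \<Phi>_hom] by blast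
    have "v = 0" if v: "v \<in> std_lattice" "H v = 0" for v
    proof -
      obtain u where u: "u \<in> vsp M k" "v = \<Phi>0 k u" using \<Phi>0(2) v(1) by blast
      then have "u = 0" using \<Phi>_ker[OF kk u(1)] H(2)[OF kk u(1)] v(2) by simp
      moreover have "\<Phi>0 k 0 = 0" using plane_homD(2)[OF P0.hom kk zero_in[OF kk], of 0] by simp
      ultimately show ?thesis using u by simp
    qed
    then have "det2 (H unit1) (H unit2) \<noteq> 0" by (rule klinear_injective_det[OF H(1)])
    moreover have "\<Phi> k ` vsp M k = H ` \<Phi>0 k ` vsp M k"
      unfolding image_image using H(2)[OF kk] by (intro image_cong) auto
    then have "\<Phi> k ` vsp M k = span2 (H unit1) (H unit2)"
      by (simp add: \<Phi>0(2) std_lattice_eq_span2 klinear_span2[OF H(1)])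
    ultimately show ?thesis by (auto simp: lattice2_def)
  qed
  show ?thesis
  proof (rule indecomposable_image[OF P.plane_embedding_axioms lat surj2 surj0 nonsurj M(3)])
    fix e H assume e: "e \<in> {0, 1}" and H: "klinear H" "bij H"
      and HA: "\<And>i. i \<in> {1..n} \<Longrightarrow> H ` \<Phi> i ` vsp M i = tripod_lattice e i"
    define G where "G = inv H"
    have HG: "H (G v) = v" and GH: "G (H v) = v" for v
      using H(2) by (simp_all add: G_def bij_inv_eq_iff bij_is_surj surj_f_inv_f bij_is_inj)
    have G: "klinear G"
      unfolding klinear_def
    proof (intro conjI allI)
      show "G (u + v) = G u + G v" for u v
        using H(1) GH[of "G u + G v"] by (simp add: klinear_def HG)
      show "G (kscale c v) = kscale c (G v)" for c v
        using H(1) GH[of "kscale c (G v)"] by (simp add: klinear_def HG)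
    qed
    have injG: "inj G" using HG by (metis injI)
    have GA: "A i = G ` tripod_lattice e i" if i: "i \<in> {1..n}" for i
      using HA[OF i] im[OF i] GH by (metis (no_types, lifting) image_cong image_ident image_image)
    have slice: "slice (A i) = W i" and closed: "comp_closed (A i)" if i: "i \<in> {1..n}" for i
      using fun_vec_graded_lattice[OF W[OF i]] by (auto simp: A_def)
    \<comment> \<open>Every term of the chain occurs at some vertex, so gradedness passes from the
      given lattices to the images of the whole chain.\<close>
    have tc: "comp_closed (G ` tripod m)" for m
    proof -
      obtain i p where ip: "i \<in> {1..n}" "tripod m = tmul p ` tripod_lattice e i" by (rule tripod_occurs)
      have "G ` tripod m = tmul p ` A i"
        unfolding ip(2) GA[OF ip(1)] by (rule klinear_tmul_image[OF G])
      then show ?thesis using comp_closed_tmul[OF closed[OF ip(1)]] by simp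
    qed
    have lc: "comp_closed (G ` leg l)" if "odd l" "l mod 6 = l" for l
    proof -
      have "leg l = tmul ((l + 1) div 2) ` tripod l" using that by (simp add: tripod_def)
      then have "G ` leg l = tmul ((l + 1) div 2) ` G ` tripod l" by (simp only: klinear_tmul_image[OF G])
      then show ?thesis using comp_closed_tmul[OF tc] by simp
    qed
    have "\<exists>s. G ` std_lattice = tmul s ` std_lattice"
    proof (rule three_graded_neighbours)
      have "G ` std_lattice = span2 (G unit1) (G unit2)" by (simp add: std_lattice_eq_span2 klinear_span2[OF G])
      moreover have "det2 (G unit1) (G unit2) \<noteq> 0"
      proof (rule klinear_injective_det[OF G])
        fix v assume "G v = 0"
        moreover have "H 0 = 0" using H(1) by (metis add_cancel_left_left klinear_def)
        ultimately show "v = 0" using HG[of v] by simp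
      qed
      ultimately show "lattice2 (G ` std_lattice)" by (auto simp: lattice2_def)
      show "neighbour (G ` leg 1) (G ` std_lattice)" "neighbour (G ` leg 3) (G ` std_lattice)"
        "neighbour (G ` leg 5) (G ` std_lattice)"
        by (intro klinear_neighbour G injG neighbour_leg)+
      have "unit1 \<in> leg 1" "unit1 \<notin> leg 3" "unit1 \<notin> leg 5" "unit2 \<in> leg 3" "unit2 \<notin> leg 5"
        by (simp_all add: leg_def std_lattice_def)
      then show "G ` leg 1 \<noteq> G ` leg 3" "G ` leg 1 \<noteq> G ` leg 5" "G ` leg 3 \<noteq> G ` leg 5"
        unfolding inj_image_eq_iff[OF injG] by metis+
    qed (use lc in simp_all)
    then obtain s where s: "G ` std_lattice = tmul s ` std_lattice" by blast
    have exps: "profile_exponent (W i) 1 = wt i + lo_exp (int (cnt i) + e) + s"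
      "profile_exponent (W i) 2 = wt i + hi_exp (int (cnt i) + e) + s" if i: "i \<in> {1..n}" for i
    proof -
      have "A i = tmul (wt i) ` G ` tripod (int (cnt i) + e)"
        unfolding GA[OF i] tripod_lattice_def by (rule klinear_tmul_image[OF G])
      from profile_exponent_tripod_image[OF G injG s this closed[OF i]]
      show "profile_exponent (W i) 1 = wt i + lo_exp (int (cnt i) + e) + s"
        "profile_exponent (W i) 2 = wt i + hi_exp (int (cnt i) + e) + s"
        unfolding slice[OF i] by auto
    qed
    have "I = profile_set lo_exp e"
      by (rule profile_line_isomorphic(2)[OF lo_hi_step(1) lo_hi_period(1) exps(1)]) (use line[of 1] in auto)
    moreover have "J = profile_set hi_exp e"
      by (rule profile_line_isomorphic(2)[OF lo_hi_step(2) lo_hi_period(2) exps(2)]) (use line[of 2] in auto)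
    ultimately show thesis using that[OF e] by blast
  qed
qed

end

section \<open>From root vectors to arrows, and the two modules of a root\<close>

lemma has_filtration_k_subset: "has_filtration k n M Is \<Longrightarrow> I \<in> set Is \<Longrightarrow> k_subset k n I"
  by (induction Is arbitrary: M) auto

lemma sum_filtration_counts:
  fixes n :: nat
  shows "(\<Sum>j=1..n. int (length (filter (\<lambda>I. j \<in> I) Is))) = (\<Sum>I\<leftarrow>Is. int (card (I \<inter> {1..n})))"
proof (induction Is)
  case (Cons I Is)
  have "(\<Sum>j=1..n. int (length (filter (\<lambda>I. j \<in> I) (I # Is)))) =
      (\<Sum>j=1..n. (if j \<in> I then 1 else 0) + int (length (filter (\<lambda>I. j \<in> I) Is)))"
    by (intro sum.cong) auto
  also have "\<dots> = (\<Sum>j=1..n. if j \<in> I then 1 else 0) + (\<Sum>I\<leftarrow>Is. int (card (I \<inter> {1..n})))"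
    using Cons by (simp add: sum.distrib)
  also have "(\<Sum>j=1..n. if j \<in> I then 1 else 0 :: int) = (\<Sum>j\<in>{1..n} \<inter> I. 1)"
    by (rule sum.inter_restrict[symmetric]) simp
  finally show ?case by (simp add: Int_commute)
qed simp

text \<open>Summing the entries shows that the filtration has exactly two factors: 2k equals k times
  its length. Each entry then counts how many of the two subsets contain the arrow.\<close>

lemma phi_arrows:
  assumes kn: "(k, n) = (3, 9) \<or> (k, n) = (4, 8)" and r: "root_degree n r = 2"
    and M: "B_module k n M" and phi: "phi_eq k n M r"
  defines "a \<equiv> root_vector k n r"
  shows "\<And>i. i \<in> {1..n} \<Longrightarrow> a i = 2 \<Longrightarrow> xmap M i ` vsp M (prv n i) = vsp M i"
    and "\<And>i. i \<in> {1..n} \<Longrightarrow> a i = 0 \<Longrightarrow> ymap M i ` vsp M i = vsp M (prv n i)"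
    and "\<And>i. i \<in> {1..n} \<Longrightarrow> a i = 1 \<Longrightarrow>
      xmap M i ` vsp M (prv n i) \<noteq> vsp M i \<and> ymap M i ` vsp M i \<noteq> vsp M (prv n i)"
proof -
  have kb: "1 \<le> k" "k < n" using kn by auto
  obtain Is where Is: "has_filtration k n M Is"
    "\<And>j. j \<in> {1..n} \<Longrightarrow> a j = int (length (filter (\<lambda>I. j \<in> I) Is))"
    using phi by (auto simp: phi_eq_def a_def)
  have card: "int (card (I \<inter> {1..n})) = int k" if "I \<in> set Is" for I
    using has_filtration_k_subset[OF Is(1) that] by (simp add: k_subset_def Int_absorb2)
  have "2 * int k = (\<Sum>j=1..n. a j)"
    using root_vector_sums(1)[OF kn, of r] r by (simp add: a_def root_degree_def)
  also have "\<dots> = (\<Sum>j=1..n. int (length (filter (\<lambda>I. j \<in> I) Is)))" using Is(2) by (intro sum.cong) auto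
  also have "\<dots> = (\<Sum>I\<leftarrow>Is. int (card (I \<inter> {1..n})))" by (rule sum_filtration_counts)
  also have "\<dots> = (\<Sum>I\<leftarrow>Is. int k)" using card by (intro arg_cong[where f = sum_list] map_cong) auto
  also have "\<dots> = int (length Is) * int k" by (simp add: sum_list_triv)
  finally have "length Is = 2" using kb by simp
  then obtain I J where IJ: "Is = [I, J]" by (auto simp: length_Suc_conv numeral_2_eq_2)
  have count: "a i = (if i \<in> I then 1 else 0) + (if i \<in> J then 1 else 0)" if "i \<in> {1..n}" for i
    using Is(2)[OF that] by (simp add: IJ)
  note arrows = filtration_arrows[OF M kb Is(1)[unfolded IJ]]
  show "xmap M i ` vsp M (prv n i) = vsp M i" if "i \<in> {1..n}" "a i = 2" for i
    using arrows(1)[OF that(1)] count[OF that(1)] that(2) by (auto split: if_splits)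
  show "ymap M i ` vsp M i = vsp M (prv n i)" if "i \<in> {1..n}" "a i = 0" for i
    using arrows(2)[OF that(1)] count[OF that(1)] that(2) by (auto split: if_splits)
  show "xmap M i ` vsp M (prv n i) \<noteq> vsp M i \<and> ymap M i ` vsp M i \<noteq> vsp M (prv n i)"
    if "i \<in> {1..n}" "a i = 1" for i
    using arrows(3)[OF that(1)] count[OF that(1)] that(2) by (auto split: if_splits)
qed

text \<open>The witnesses live on pairs of power series, while the modules to be classified may have
  any carrier type. That there are just two is expressed by requiring every such module to be
  isomorphic to one of the witnesses.\<close>

theorem theorem2:
  fixes k n :: nat
  assumes "(k, n) = (3, 9) \<or> (k, n) = (4, 8)"
  shows "(\<forall>r. real_root k n r \<and> root_degree n r = 2 \<longrightarrow>
           (\<exists>(M1 :: (complex fps \<times> complex fps) brep) (M2 :: (complex fps \<times> complex fps) brep).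
              rigid_indecomposable k n 2 M1 \<and> phi_eq k n M1 r \<and>
              rigid_indecomposable k n 2 M2 \<and> phi_eq k n M2 r \<and>
              \<not> brep_isomorphic n M1 M2 \<and>
              (\<forall>M :: 'v::ab_group_add brep.
                 rigid_indecomposable k n 2 M \<and> phi_eq k n M r \<longrightarrow>
                 brep_isomorphic n M M1 \<or> brep_isomorphic n M M2)))
       \<and> (\<forall>(M :: 'v brep) r I J.
           rigid_indecomposable k n 2 M \<and> phi_eq k n M r \<and>
           real_root k n r \<and> root_degree n r = 2 \<and> has_profile k n M [I, J] \<longrightarrow>
           (\<exists>N :: (complex fps \<times> complex fps) brep.
              rigid_indecomposable k n 2 N \<and> has_profile k n N [J, I]))"
proof (intro conjI allI impI)
  fix r assume r: "real_root k n r \<and> root_degree n r = 2"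
  interpret root_vec k n "root_vector k n r" using degree_2_root_vec[OF assms] r by blast
  have phi: "phi_eq k n (tripod_rep e) r" if e: "e \<in> {0, 1}" for e
  proof (rule tripod_rep_filtration[OF e])
    fix I J assume "has_filtration k n (tripod_rep e) [I, J]"
      "\<And>j. j \<in> {1..n} \<Longrightarrow> root_vector k n r j = int (length (filter (\<lambda>I. j \<in> I) [I, J]))"
    then show ?thesis using real_root_form r unfolding phi_eq_def by blast
  qed
  have uniq: "brep_isomorphic n M (tripod_rep 0) \<or> brep_isomorphic n M (tripod_rep 1)"
    if M: "rigid_indecomposable k n 2 M \<and> phi_eq k n M r" for M :: "'v brep"
  proof -
    have B: "B_module k n M" "has_rank n M 2" "indecomposable_brep n M"
      using M by (auto simp: rigid_indecomposable_def CM_def)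
    have "\<exists>e\<in>{0, 1}. brep_isomorphic n M (tripod_rep e)"
      by (rule indecomposable_isomorphic[OF B])
        (use phi_arrows[OF assms _ B(1), of r] r M in blast)+
    then show ?thesis by auto
  qed
  show "\<exists>(M1 :: (complex fps \<times> complex fps) brep) (M2 :: (complex fps \<times> complex fps) brep).
      rigid_indecomposable k n 2 M1 \<and> phi_eq k n M1 r \<and>
      rigid_indecomposable k n 2 M2 \<and> phi_eq k n M2 r \<and> \<not> brep_isomorphic n M1 M2 \<and>
      (\<forall>M :: 'v brep. rigid_indecomposable k n 2 M \<and> phi_eq k n M r \<longrightarrow>
        brep_isomorphic n M M1 \<or> brep_isomorphic n M M2)"
    by (rule exI[of _ "tripod_rep 0"], rule exI[of _ "tripod_rep 1"])
      (use tripod_rep_rigid_indecomposable[of 0] tripod_rep_rigid_indecomposable[of 1] phi[of 0] phi[of 1]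
        tripod_rep_not_isomorphic uniq in auto)
next
  fix M :: "'v brep" and r I J
  assume M: "rigid_indecomposable k n 2 M \<and> phi_eq k n M r \<and>
    real_root k n r \<and> root_degree n r = 2 \<and> has_profile k n M [I, J]"
  interpret root_vec k n "root_vector k n r" using degree_2_root_vec[OF assms] M by blast
  have B: "B_module k n M" "has_rank n M 2" "indecomposable_brep n M"
    using M by (auto simp: rigid_indecomposable_def CM_def)
  have r: "root_degree n r = 2" "phi_eq k n M r" and prof: "has_profile k n M [I, J]" using M by auto
  obtain e where e: "e \<in> {0, 1}" "I = profile_set lo_exp e" "J = profile_set hi_exp e"
    using profile_determined[OF B phi_arrows[OF assms r(1) B(1) r(2)] prof] by blast
  \<comment> \<open>The tripod module of the other parity belongs to the same root and has the two
    parts of the profile exchanged.\<close>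
  have e': "1 - e \<in> {0, 1}" using e(1) by auto
  show "\<exists>N :: (complex fps \<times> complex fps) brep. rigid_indecomposable k n 2 N \<and> has_profile k n N [J, I]"
    using tripod_rep_rigid_indecomposable[OF e'] tripod_rep_profile[OF e'] profile_set_swap[OF e(1)] e(2,3)
    by metis
qed

end
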